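(* Let $X=\mathbb C^n$ and let $\varOmega\Subset T^*X$ (conically) be an open conic subset. For any $P(t;z,\zeta,\eta),Q(t;z,\zeta,\eta)\in\widehat{\mathfrak S}(\varOmega;S)$ set $$Q\circ P(t;z,\zeta,\eta)=e^{t\langle\partial_{\zeta'},\partial_{z'}\rangle}Q(t;z,\zeta',\eta)\,P(t;z',\zeta,\eta)\Big|_{z'=z,\ \zeta'=\zeta}=e^{t\langle\partial_{\zeta'},\partial_{z'}\rangle}Q(t;z,\zeta+\zeta',\eta)\,P(t;z+z',\zeta,\eta)\Big|_{z'=0,\ \zeta'=0}.$$ (1) $Q\circ P\in\widehat{\mathfrak S}(\varOmega;S)$. Moreover, if either $P$ or $Q$ is an element of $\widehat{\mathfrak N}(\varOmega;S)$, then $Q\circ P\in\widehat{\mathfrak N}(\varOmega;S)$. (2) $R\circ(Q\circ P)=(R\circ Q)\circ P$ holds (for $P,Q,R\in\widehat{\mathfrak S}(\varOmega;S)$). (3) Let $\varPhi(w)=z$ be a holomorphic coordinate transformation. Then $$\varPhi^*Q\circ\varPhi^*P(t;w,\lambda,\eta)-\varPhi^*(Q\circ P)(t;w,\lambda,\eta)\in\widehat{\mathfrak N}_{(w;\lambda)}.$$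
   Context: $\|z\|=\max_i|z_i|$. $V\Subset U$ conically means that $V$ is generated by a relatively compact subset of $U$ (contained in $\mathbb R_{>0}K$ with $K\subset U$ compact). For an open conic $\varOmega$ and $\rho\ge0$, $\varOmega_\rho$ is the closure of $\bigcup_{(z;\zeta)\in\varOmega}\{(z+z';\zeta+\zeta');\ \|z'\|\le\rho,\ \|\zeta'\|\le\rho\|\zeta\|\}$; $d_\rho=d(1-\rho)$; $S=\{\eta\in\mathbb C;\ 0<|\eta|<r,\ |\arg\eta|<\theta/4\}$ with $r,\theta\in]0,\frac12[$; for $U\subset S$, $(\varOmega_\rho*U)[md_\rho]=\{(z;\zeta,\eta)\in\varOmega_\rho\times U;\ \|\eta\zeta\|\ge md_\rho\}$. Functions on these sets are understood to be holomorphic on neighborhoods; $t$ is an indeterminate. $\widehat{\mathfrak N}(\varOmega;S)$: formal series $P=\sum_{\nu\ge0}t^\nu P_\nu(z,\zeta,\eta)$ such that for some $d>0$, $\rho\in]0,1[$ each $P_\nu$ is holomorphic on $(\varOmega_\rho*S)[(\nu+1)d_\rho]$ and there is $A\in]0,1[$ such that for every $Z\Subset S$, $h>0$ there is $C_{h,Z}>0$ with $|\sum_{\nu=0}^{m-1}P_\nu|\le C_{h,Z}A^me^{h\|\zeta\|}$ for all $m\in\mathbb N$ on $(\varOmega_\rho*Z)[md_\rho]$. $\widehat{\mathfrak S}(\varOmega;S)$: formal series $P=\sum t^\nu P_\nu$ such that for some $d>0$, $\rho\in]0,1[$ each $P_\nu$ is holomorphic on $(\varOmega_\rho*S)[(\nu+1)d_\rho]$;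 there is $A\in]0,1[$ such that for every $Z\Subset S$, $h>0$ there is $C_{h,Z}>0$ with $|P_\nu|\le C_{h,Z}A^\nu e^{h\|\zeta\|}$ for all $\nu\ge0$ on $(\varOmega_\rho*Z)[(\nu+1)d_\rho]$; and $\partial_\eta P\in\widehat{\mathfrak N}(\varOmega;S)$. Coordinate transformation: with cotangent coordinates $(z;\zeta)$, $(w;\lambda)$ near $\operatorname{Cl}\varOmega$ and $z=\varPhi(w)$, $J^*_\varPhi(z',z)$ is a holomorphic $n\times n$ matrix, for $z'$ near $z$, with $\varPhi^{-1}(z')-\varPhi^{-1}(z)=J^*_\varPhi(z',z)(z'-z)$, and $$\varPhi^*P(t;w,\lambda,\eta)=e^{t\langle\partial_{\zeta'},\partial_{z'}\rangle}P\bigl(t;\varPhi(w),\zeta'+{}^{\mathsf t}\!J^*_\varPhi(\varPhi(w)+z',\varPhi(w))\lambda,\eta\bigr)\Big|_{z'=0,\ \zeta'=0}.$$ $\widehat{\mathfrak N}_{(w;\lambda)}$ is the inductive limit of $\widehat{\mathfrak N}(\varOmega';S)$ (in the coordinates $(w;\lambda)$) over open conic neighborhoods $\varOmega'$ of the point $(w;\lambda)$ and $r,\theta\to0$. *)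

theory Defs
  imports "HOL-Analysis.Analysis"
begin

section \<open>Holomorphic maps between finite-dimensional complex vector spaces\<close>

text \<open>
  The library has no complex scalar multiplication on \<open>complex ^ 'n\<close> and on products of such
  spaces in a form that serves all of them at once; this class provides it.
\<close>

class complex_space = real_normed_vector +
  fixes scaleC :: "complex \<Rightarrow> 'a \<Rightarrow> 'a" (infixr "*\<^sub>C" 75)
  assumes scaleC_add_right: "c *\<^sub>C (x + y) = c *\<^sub>C x + c *\<^sub>C y"
    and scaleC_add_left: "(c + d) *\<^sub>C x = c *\<^sub>C x + d *\<^sub>C x"
    and scaleC_scaleC: "c *\<^sub>C d *\<^sub>C x = (c * d) *\<^sub>C x"
    and scaleC_of_real: "complex_of_real a *\<^sub>C x = a *\<^sub>R x"

instantiation complex :: complex_space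
begin
definition scaleC_complex_def: "c *\<^sub>C (x::complex) = c * x"
instance
  by standard (auto simp: scaleC_complex_def algebra_simps scaleR_conv_of_real)
end

instantiation vec :: (complex_space, finite) complex_space
begin
definition scaleC_vec_def: "c *\<^sub>C (x :: 'a ^ 'b) = (\<chi> i. c *\<^sub>C (x $ i))"
instance
  by standard
    (auto simp: scaleC_vec_def vec_eq_iff scaleC_add_right scaleC_add_left scaleC_scaleC
      scaleC_of_real)
end

instantiation prod :: (complex_space, complex_space) complex_space
begin
definition scaleC_prod_def: "c *\<^sub>C (x :: 'a \<times> 'b) = (c *\<^sub>C fst x, c *\<^sub>C snd x)"
instance
  by standard
    (auto simp: scaleC_prod_def prod_eq_iff scaleC_add_right scaleC_add_left scaleC_scaleC
      scaleC_of_real)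
end

definition holo_on :: "('a::complex_space \<Rightarrow> 'b::complex_space) \<Rightarrow> 'a set \<Rightarrow> bool"
  where "holo_on f U \<longleftrightarrow>
    (\<forall>x\<in>U. \<exists>f'. (f has_derivative f') (at x) \<and> (\<forall>c v. f' (c *\<^sub>C v) = c *\<^sub>C f' v))"

definition holo_near :: "('a::complex_space \<Rightarrow> 'b::complex_space) \<Rightarrow> 'a set \<Rightarrow> bool"
  where "holo_near f A \<longleftrightarrow> (\<exists>U. open U \<and> A \<subseteq> U \<and> holo_on f U)"


section \<open>Conic sets and sectors\<close>

text \<open>Points of \<open>T\<^sup>*X\<close> for \<open>X = \<complex>\<^sup>n\<close> are pairs \<open>(z, \<zeta>)\<close>; the zero section is included.\<close>

definition maxnorm :: "complex ^ 'n \<Rightarrow> real"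
  where "maxnorm z = Max (range (\<lambda>i. cmod (z $ i)))"

definition fibre_conic :: "((complex ^ 'n) \<times> (complex ^ 'n)) set \<Rightarrow> bool"
  where "fibre_conic \<Omega> \<longleftrightarrow> (\<forall>z \<zeta> c. (z, \<zeta>) \<in> \<Omega> \<and> c > 0 \<longrightarrow> (z, c *\<^sub>R \<zeta>) \<in> \<Omega>)"

definition conically_relcompact ::
    "((complex ^ 'n) \<times> (complex ^ 'n)) set \<Rightarrow> ((complex ^ 'n) \<times> (complex ^ 'n)) set \<Rightarrow> bool"
  where "conically_relcompact V U \<longleftrightarrow>
    (\<exists>K. compact K \<and> K \<subseteq> U \<and> V \<subseteq> {(z, c *\<^sub>R \<zeta>) | z \<zeta> c. c > 0 \<and> (z, \<zeta>) \<in> K})"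

definition admissible :: "((complex ^ 'n) \<times> (complex ^ 'n)) set \<Rightarrow> bool"
  where "admissible \<Omega> \<longleftrightarrow> open \<Omega> \<and> fibre_conic \<Omega> \<and> conically_relcompact \<Omega> UNIV"

definition enlarge ::
    "((complex ^ 'n) \<times> (complex ^ 'n)) set \<Rightarrow> real \<Rightarrow> ((complex ^ 'n) \<times> (complex ^ 'n)) set"
  where "enlarge \<Omega> \<rho> = closure (\<Union>(z, \<zeta>)\<in>\<Omega>.
    {(z + z', \<zeta> + \<zeta>') | z' \<zeta>'. maxnorm z' \<le> \<rho> \<and> maxnorm \<zeta>' \<le> \<rho> * maxnorm \<zeta>})"

definition sector :: "real \<Rightarrow> real \<Rightarrow> complex set"
  where "sector r \<theta> = {\<eta>. 0 < cmod \<eta> \<and> cmod \<eta> < r \<and> \<bar>Arg \<eta>\<bar> < \<theta> / 4}"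

definition relcompact :: "complex set \<Rightarrow> complex set \<Rightarrow> bool"
  where "relcompact Z S \<longleftrightarrow> compact (closure Z) \<and> closure Z \<subseteq> S"

text \<open>\<open>cdom \<Omega> \<rho> U c\<close> is the set \<open>(\<Omega>\<^sub>\<rho> * U)[c]\<close>.\<close>

definition cdom ::
    "((complex ^ 'n) \<times> (complex ^ 'n)) set \<Rightarrow> real \<Rightarrow> complex set \<Rightarrow> real
      \<Rightarrow> ((complex ^ 'n) \<times> (complex ^ 'n) \<times> complex) set"
  where "cdom \<Omega> \<rho> U c =
    {(z, \<zeta>, \<eta>). (z, \<zeta>) \<in> enlarge \<Omega> \<rho> \<and> \<eta> \<in> U \<and> maxnorm (\<eta> *\<^sub>C \<zeta>) \<ge> c}"


section \<open>Formal series\<close>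

text \<open>
  A formal series \<open>\<Sum>\<^sub>\<nu> t\<^sup>\<nu> P\<^sub>\<nu>(z, \<zeta>, \<eta>)\<close> is a function into the formal power series in \<open>t\<close>.
  As a HOL function it is total, but only the values of the coefficient \<open>P\<^sub>\<nu>\<close> near
  \<open>(\<Omega>\<^sub>\<rho> * S)[(\<nu> + 1) d\<^sub>\<rho>]\<close> are meaningful.
\<close>

type_synonym 'n series = "complex ^ 'n \<Rightarrow> complex ^ 'n \<Rightarrow> complex \<Rightarrow> complex fps"

definition holo_series ::
    "((complex ^ 'n) \<times> (complex ^ 'n)) set \<Rightarrow> complex set \<Rightarrow> real \<Rightarrow> real \<Rightarrow> 'n series \<Rightarrow> bool"
  where "holo_series \<Omega> S d \<rho> P \<longleftrightarrow>
    (\<forall>\<nu>. holo_near (\<lambda>(z, \<zeta>, \<eta>). fps_nth (P z \<zeta> \<eta>) \<nu>)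
      (cdom \<Omega> \<rho> S ((real \<nu> + 1) * (d * (1 - \<rho>)))))"

definition N_hat ::
    "((complex ^ 'n) \<times> (complex ^ 'n)) set \<Rightarrow> complex set \<Rightarrow> 'n series set"
  where "N_hat \<Omega> S = {P. \<exists>d>0. \<exists>\<rho>\<in>{0<..<1}. holo_series \<Omega> S d \<rho> P \<and>
    (\<exists>A\<in>{0<..<1}. \<forall>Z h. relcompact Z S \<and> h > 0 \<longrightarrow> (\<exists>C>0. \<forall>m::nat.
      \<forall>(z, \<zeta>, \<eta>) \<in> cdom \<Omega> \<rho> Z (real m * (d * (1 - \<rho>))).
        cmod (\<Sum>\<nu><m. fps_nth (P z \<zeta> \<eta>) \<nu>) \<le> C * A ^ m * exp (h * maxnorm \<zeta>)))}"

definition d_eta :: "'n series \<Rightarrow> 'n series"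
  where "d_eta P z \<zeta> \<eta> = Abs_fps (\<lambda>\<nu>. deriv (\<lambda>\<eta>. fps_nth (P z \<zeta> \<eta>) \<nu>) \<eta>)"

definition S_hat ::
    "((complex ^ 'n) \<times> (complex ^ 'n)) set \<Rightarrow> complex set \<Rightarrow> 'n series set"
  where "S_hat \<Omega> S = {P. (\<exists>d>0. \<exists>\<rho>\<in>{0<..<1}. holo_series \<Omega> S d \<rho> P \<and>
    (\<exists>A\<in>{0<..<1}. \<forall>Z h. relcompact Z S \<and> h > 0 \<longrightarrow> (\<exists>C>0. \<forall>\<nu>.
      \<forall>(z, \<zeta>, \<eta>) \<in> cdom \<Omega> \<rho> Z ((real \<nu> + 1) * (d * (1 - \<rho>))).
        cmod (fps_nth (P z \<zeta> \<eta>) \<nu>) \<le> C * A ^ \<nu> * exp (h * maxnorm \<zeta>))))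
    \<and> d_eta P \<in> N_hat \<Omega> S}"

text \<open>
  Equality of formal series over \<open>\<Omega>\<close> and \<open>S\<close>: the coefficients agree as functions on
  neighborhoods of their domains, for some \<open>d\<close> and \<open>\<rho>\<close>.
\<close>

definition series_eq ::
    "((complex ^ 'n) \<times> (complex ^ 'n)) set \<Rightarrow> complex set \<Rightarrow> 'n series \<Rightarrow> 'n series \<Rightarrow> bool"
  where "series_eq \<Omega> S P Q \<longleftrightarrow> (\<exists>d>0. \<exists>\<rho>\<in>{0<..<1}.
    holo_series \<Omega> S d \<rho> P \<and> holo_series \<Omega> S d \<rho> Q \<and>
    (\<forall>\<nu>. \<forall>x \<in> cdom \<Omega> \<rho> S ((real \<nu> + 1) * (d * (1 - \<rho>))).
      \<forall>\<^sub>F (z, \<zeta>, \<eta>) in nhds x. fps_nth (P z \<zeta> \<eta>) \<nu> = fps_nth (Q z \<zeta> \<eta>) \<nu>))"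

text \<open>
  \<open>P \<in> N_hat_at p\<close> means that \<open>P\<close> defines an element of the inductive limit of the spaces
  \<open>N_hat \<Omega>' (sector r \<theta>)\<close> over the open conic neighborhoods \<open>\<Omega>'\<close> of \<open>p\<close> and \<open>r, \<theta> \<rightarrow> 0\<close>.
\<close>

definition N_hat_at :: "(complex ^ 'n) \<times> (complex ^ 'n) \<Rightarrow> 'n series set"
  where "N_hat_at p = {P. \<exists>\<Omega>' r \<theta>. admissible \<Omega>' \<and> p \<in> \<Omega>' \<and>
    r \<in> {0<..<1/2} \<and> \<theta> \<in> {0<..<1/2} \<and> P \<in> N_hat \<Omega>' (sector r \<theta>)}"


section \<open>The operator \<open>exp (t \<langle>\<partial>\<^sub>\<zeta>, \<partial>\<^sub>z\<rangle>)\<close> and composition\<close>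

definition dzeta_dz ::
    "(complex ^ 'n \<Rightarrow> complex ^ 'n \<Rightarrow> complex) \<Rightarrow> complex ^ 'n \<Rightarrow> complex ^ 'n \<Rightarrow> complex"
  where "dzeta_dz f z \<zeta> =
    (\<Sum>i\<in>UNIV. deriv (\<lambda>a. deriv (\<lambda>b. f (z + axis i b) (\<zeta> + axis i a)) 0) 0)"

definition exp_t ::
    "(complex ^ 'n \<Rightarrow> complex ^ 'n \<Rightarrow> complex fps) \<Rightarrow> complex ^ 'n \<Rightarrow> complex ^ 'n \<Rightarrow> complex fps"
  where "exp_t F z \<zeta> = Abs_fps (\<lambda>\<nu>. \<Sum>k\<le>\<nu>.
    (dzeta_dz ^^ k) (\<lambda>z \<zeta>. fps_nth (F z \<zeta>) (\<nu> - k)) z \<zeta> / fact k)"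

definition series_comp :: "('n::finite) series \<Rightarrow> 'n series \<Rightarrow> 'n series" (infixr "\<odot>" 55)
  where "(Q \<odot> P) z \<zeta> \<eta> = exp_t (\<lambda>z' \<zeta>'. Q z \<zeta>' \<eta> * P z' \<zeta> \<eta>) z \<zeta>"

lemma exp_t_translate:
  "exp_t (\<lambda>z' \<zeta>'. F (z + z') (\<zeta> + \<zeta>')) 0 0 = exp_t F z \<zeta>"
proof -
  have shift: "(dzeta_dz ^^ k) (\<lambda>z' \<zeta>'. f (z + z') (\<zeta> + \<zeta>')) =
      (\<lambda>z' \<zeta>'. (dzeta_dz ^^ k) f (z + z') (\<zeta> + \<zeta>'))" for k f
    by (induction k) (auto simp: dzeta_dz_def fun_eq_iff add.assoc)
  have "(dzeta_dz ^^ k) (\<lambda>z' \<zeta>'. fps_nth (F (z + z') (\<zeta> + \<zeta>')) m) 0 0 =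
      (dzeta_dz ^^ k) (\<lambda>z \<zeta>. fps_nth (F z \<zeta>) m) z \<zeta>" for k m
    by (simp add: shift[of k "\<lambda>z \<zeta>. fps_nth (F z \<zeta>) m"])
  then show ?thesis
    by (simp add: exp_t_def)
qed

lemma series_comp_alt:
  "(Q \<odot> P) z \<zeta> \<eta> = exp_t (\<lambda>z' \<zeta>'. Q z (\<zeta> + \<zeta>') \<eta> * P (z + z') \<zeta> \<eta>) 0 0"
  using exp_t_translate[of "\<lambda>z' \<zeta>'. Q z \<zeta>' \<eta> * P z' \<zeta> \<eta>" z \<zeta>] by (simp add: series_comp_def)


section \<open>Coordinate transformations\<close>

definition coordinate_transformation ::
    "(complex ^ 'n \<Rightarrow> complex ^ 'n) \<Rightarrow> (complex ^ 'n) set \<Rightarrow> (complex ^ 'n) set \<Rightarrow> bool"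
  where "coordinate_transformation \<Phi> W V \<longleftrightarrow> open W \<and> open V \<and> bij_betw \<Phi> W V \<and>
    holo_on \<Phi> W \<and> holo_on (inv_into W \<Phi>) V"

text \<open>\<open>J z' z\<close> is only required to be holomorphic near the diagonal, and it is not unique.\<close>

definition is_Jstar ::
    "(complex ^ 'n \<Rightarrow> complex ^ 'n) \<Rightarrow> (complex ^ 'n) set \<Rightarrow> (complex ^ 'n) set
      \<Rightarrow> (complex ^ 'n \<Rightarrow> complex ^ 'n \<Rightarrow> complex ^ 'n ^ 'n) \<Rightarrow> bool"
  where "is_Jstar \<Phi> W V J \<longleftrightarrow> (\<exists>D. open D \<and> D \<subseteq> V \<times> V \<and> (\<forall>z\<in>V. (z, z) \<in> D) \<and>
    holo_on (\<lambda>(z', z). J z' z) D \<and>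
    (\<forall>(z', z)\<in>D. inv_into W \<Phi> z' - inv_into W \<Phi> z = J z' z *v (z' - z)))"

text \<open>The new cotangent coordinate is called \<open>\<mu>\<close>, as \<open>\<lambda>\<close> is not available as a variable.\<close>

definition pullback ::
    "(complex ^ 'n \<Rightarrow> complex ^ 'n) \<Rightarrow> (complex ^ 'n \<Rightarrow> complex ^ 'n \<Rightarrow> complex ^ 'n ^ 'n)
      \<Rightarrow> 'n series \<Rightarrow> 'n series"
  where "pullback \<Phi> J P w \<mu> \<eta> =
    exp_t (\<lambda>z' \<zeta>'. P (\<Phi> w) (\<zeta>' + transpose (J (\<Phi> w + z') (\<Phi> w)) *v \<mu>) \<eta>) 0 0"

end

theory Submission
  imports Defs "HOL-Complex_Analysis.Cauchy_Integral_Formula"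
begin

text \<open>
  Up to order \<open>\<nu>\<close> in \<open>t\<close> the composition is the star product
  \<open>F \<star> G = \<Sum>\<^sub>k t\<^sup>k/k! B\<^sub>k(F, G)\<close> with \<open>B\<^sub>k(F, G) = \<Sum> \<partial>\<^sub>\<zeta>\<^sub>i\<^sub>1 \<dots> \<partial>\<^sub>\<zeta>\<^sub>i\<^sub>k F \<cdot> \<partial>\<^sub>z\<^sub>i\<^sub>1 \<dots> \<partial>\<^sub>z\<^sub>i\<^sub>k G\<close>.
  By Cauchy's inequality the \<open>k\<close>-th term gains \<open>k\<^sup>2\<^sup>k/(k! \<parallel>\<zeta>\<parallel>\<^sup>k)\<close> up to a factor \<open>c\<^sup>k\<close>, and
  \<open>\<parallel>\<zeta>\<parallel> \<ge> \<nu> d\<^sub>\<rho> \<ge> k d\<^sub>\<rho>\<close> turns this into a geometric factor as small as desired, once \<open>\<rho>\<close> is halved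
  and \<open>d\<close> is enlarged. Associativity is an identity of bidifferential operators.

  In (3) the difference vanishes identically, so no estimate is needed. With \<open>J\<^sup>*\<close> abbreviated to
  \<open>J\<close>, the pullback satisfies \<open>\<Phi>\<^sup>*(\<zeta>\<^sub>i \<circ> P) = \<Sum>\<^sub>j J\<^sub>j\<^sub>i \<mu>\<^sub>j \<circ> \<Phi>\<^sup>*P\<close>. Writing
  \<open>Q = Q(z, \<zeta>0, \<eta>) + \<Sum>\<^sub>i (\<zeta>\<^sub>i - \<zeta>0\<^sub>i) Q\<^sub>i\<close> by Hadamard's lemma, with \<open>\<zeta>0\<close> the value of the new covector at
  the point considered, this relation and associativity express the coefficients of \<open>t\<^sup>m\<close> of both
  \<open>\<Phi>\<^sup>*Q \<circ> \<Phi>\<^sup>*P\<close> and \<open>\<Phi>\<^sup>*(Q \<circ> P)\<close> by the same formula in those of \<open>t\<^sup>m\<^sup>-\<^sup>1\<close>.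
\<close>

section \<open>Directional derivatives of holomorphic functions\<close>

text \<open>In (3), the relation for \<zeta>_i comes from the defining property of \<open>J\<close>.
  Write g for the inverse of \<Phi> and \<sigma> for the covector transpose J(z + z', z) \<mu>.
  Pairing the property with \<mu> gives <z', \<sigma>> = <\<mu>, g(z + z') - g(z)>. Differentiating
  along a motion of z that keeps z + z' fixed expresses \<sigma>_i as its value at z' = 0 plus terms
  with a factor z'_j, and the exponential turns a factor z'_j at the origin into t d/d\<zeta>'_j.
  This holds for every choice of \<open>J\<close>. In (1), the condition on the \<eta>-derivative
  reproduces itself: d/d\<eta> is a derivation of the composition, and in each of the two resulting
  terms one factor is null, so the estimate for null symbols covers it. Each coefficient of the
  exponential involves finitely many derivatives at one point. Associativity and (3) are therefore
  local identities, and what remains is to compare domains; in (3) this needs a bound of ||\<mu>||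
  by a multiple of ||\<sigma>||. Throughout, d enters only through D = d(1 - \<rho>), and D and
  \<rho> are varied independently.\<close>

no_notation fps_nth (infixl "$" 75)

lemma scaleC_zero_left [simp]: "0 *\<^sub>C (x::'a::complex_space) = 0"
  using scaleC_of_real[of 0 x] by simp

lemma scaleC_zero_right [simp]: "c *\<^sub>C (0::'a::complex_space) = 0"
  using scaleC_add_right[of c "0::'a" 0] by simp

lemma scaleC_eq_scaleR: "c *\<^sub>C (x::'a::complex_space) = Re c *\<^sub>R x + Im c *\<^sub>R (\<i> *\<^sub>C x)"
proof -
  have "c *\<^sub>C x = (of_real (Re c) + of_real (Im c) * \<i>) *\<^sub>C x"
    using complex_eq[of c] by (simp add: mult.commute)
  then show ?thesis
    by (simp add: scaleC_add_left scaleC_of_real flip: scaleC_scaleC)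
qed

text \<open>The class ties \<open>scaleC\<close> to the norm only for real scalars, but for fixed
  \<open>x\<close> the previous formula involves just the two vectors \<open>x\<close> and
  \<open>\<i> *\<^sub>C x\<close>.\<close>

lemma bounded_linear_scaleC_left: "bounded_linear (\<lambda>c. c *\<^sub>C (x::'a::complex_space))"
proof -
  have "bounded_linear (\<lambda>c. Re c *\<^sub>R x + Im c *\<^sub>R (\<i> *\<^sub>C x))"
    by (intro bounded_linear_add bounded_linear_compose[OF bounded_linear_scaleR_left]
      bounded_linear_Re bounded_linear_Im)
  then show ?thesis
    by (subst scaleC_eq_scaleR)
qed

lemma has_derivative_scaleC_line:
  "((\<lambda>c. (x::'a::complex_space) + c *\<^sub>C v) has_derivative (\<lambda>c. c *\<^sub>C v)) (at c0)"
  by (rule has_derivative_eq_rhs)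
    (auto intro!: derivative_eq_intros bounded_linear.has_derivative[OF bounded_linear_scaleC_left])

lemma continuous_on_scaleC_left [continuous_intros]:
  "continuous_on S f \<Longrightarrow> continuous_on S (\<lambda>s. f s *\<^sub>C (x::'a::complex_space))"
  using bounded_linear.continuous_on[OF bounded_linear_scaleC_left] .

text \<open>Restriction to a complex line, as in \<open>dzeta_dz\<close>, so it is defined for every
  function. Where \<open>f\<close> is holomorphic it is the Frechet derivative applied to
  \<open>v\<close>, hence linear in \<open>v\<close>.\<close>

definition cderiv :: "'a::complex_space \<Rightarrow> ('a \<Rightarrow> complex) \<Rightarrow> 'a \<Rightarrow> complex"
  where "cderiv v f x = deriv (\<lambda>c. f (x + c *\<^sub>C v)) 0"

lemma holo_on_subset: "holo_on f U \<Longrightarrow> V \<subseteq> U \<Longrightarrow> holo_on f V"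
  by (auto simp: holo_on_def)

lemma has_field_derivative_along_line:
  fixes f :: "'a::complex_space \<Rightarrow> complex"
  assumes "(f has_derivative f') (at (x + c0 *\<^sub>C v))" and "\<And>c v. f' (c *\<^sub>C v) = c *\<^sub>C f' v"
  shows "((\<lambda>c. f (x + c *\<^sub>C v)) has_field_derivative f' v) (at c0)"
proof -
  have "((\<lambda>c. f (x + c *\<^sub>C v)) has_derivative (\<lambda>c. f' (c *\<^sub>C v))) (at c0)"
    using has_derivative_compose[OF has_derivative_scaleC_line assms(1)] .
  then show ?thesis
    by (simp add: has_field_derivative_def assms(2) scaleC_complex_def mult.commute[of _ "f' v"])
qed

lemma cderiv_eqI:
  fixes f :: "'a::complex_space \<Rightarrow> complex"
  assumes "(f has_derivative f') (at x)" and "\<And>c v. f' (c *\<^sub>C v) = c *\<^sub>C f' v"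
  shows "cderiv v f x = f' v"
  using has_field_derivative_along_line[of f f' x 0 v] assms
  by (simp add: cderiv_def DERIV_imp_deriv)

lemma holo_on_has_derivative:
  fixes f :: "'a::complex_space \<Rightarrow> complex"
  assumes "holo_on f U" "x \<in> U"
  shows "(f has_derivative (\<lambda>v. cderiv v f x)) (at x)"
proof -
  obtain f' where f': "(f has_derivative f') (at x)" "\<And>c v. f' (c *\<^sub>C v) = c *\<^sub>C f' v"
    using assms unfolding holo_on_def by blast
  then have "(\<lambda>v. cderiv v f x) = f'"
    using cderiv_eqI by blast
  with f' show ?thesis by simp
qed

lemma cderiv_scaleC:
  fixes f :: "'a::complex_space \<Rightarrow> complex"
  assumes "holo_on f U" "x \<in> U"
  shows "cderiv (c *\<^sub>C v) f x = c * cderiv v f x"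
  using assms cderiv_eqI[of f _ x] unfolding holo_on_def by (metis scaleC_complex_def)

lemma cderiv_add_direction:
  fixes f :: "'a::complex_space \<Rightarrow> complex"
  assumes "holo_on f U" "x \<in> U"
  shows "cderiv (v + w) f x = cderiv v f x + cderiv w f x"
  using linear_add[OF has_derivative_linear[OF holo_on_has_derivative[OF assms]]] .

lemma cderiv_sum_direction:
  fixes f :: "'a::complex_space \<Rightarrow> complex"
  assumes "holo_on f U" "x \<in> U"
  shows "cderiv (sum v I) f x = (\<Sum>i\<in>I. cderiv (v i) f x)"
  using linear_sum[OF has_derivative_linear[OF holo_on_has_derivative[OF assms]]] .

lemma holo_onI:
  fixes f :: "'a::complex_space \<Rightarrow> complex"
  assumes "\<And>x. x \<in> U \<Longrightarrow> \<exists>f'. (f has_derivative f') (at x) \<and> (\<forall>c v. f' (c *\<^sub>C v) = c * f' v)"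
  shows "holo_on f U"
  using assms by (auto simp: holo_on_def scaleC_complex_def)

lemma holo_on_imp_continuous_on: "holo_on f U \<Longrightarrow> continuous_on U f"
  by (meson continuous_at_imp_continuous_on has_derivative_continuous holo_on_def)

lemma cderiv_along_line:
  fixes f :: "'a::complex_space \<Rightarrow> complex"
  assumes "holo_on f U" "x + c *\<^sub>C v \<in> U"
  shows "((\<lambda>c. f (x + c *\<^sub>C v)) has_field_derivative cderiv v f (x + c *\<^sub>C v)) (at c)"
  using has_field_derivative_along_line[OF holo_on_has_derivative[OF assms]] cderiv_scaleC[OF assms]
  by (simp add: scaleC_complex_def)

lemma cderiv_cong_open:
  assumes "open U" "x \<in> U" "\<And>y. y \<in> U \<Longrightarrow> f y = g y"
  shows "cderiv v f x = cderiv v g x"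
proof -
  have "open ((\<lambda>c. x + c *\<^sub>C v) -` U)"
    using assms(1) by (intro open_vimage) (auto intro!: continuous_intros)
  then have "eventually (\<lambda>c. c \<in> (\<lambda>c. x + c *\<^sub>C v) -` U) (nhds 0)"
    using assms(2) by (intro eventually_nhds_in_open) auto
  then have "eventually (\<lambda>c. f (x + c *\<^sub>C v) = g (x + c *\<^sub>C v)) (nhds 0)"
    by eventually_elim (use assms in auto)
  then show ?thesis
    unfolding cderiv_def by (intro deriv_cong_ev) auto
qed

lemma holo_on_cong:
  assumes "open U" "\<And>x. x \<in> U \<Longrightarrow> f x = g x" "holo_on f U"
  shows "holo_on g U"
  unfolding holo_on_def
proof
  fix x assume x: "x \<in> U"
  then obtain f' where f': "(f has_derivative f') (at x)" "\<forall>c v. f' (c *\<^sub>C v) = c *\<^sub>C f' v"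
    using assms(3) unfolding holo_on_def by blast
  have "(g has_derivative f') (at x)"
    using has_derivative_transform_within_open[OF f'(1) assms(1) x] assms(2) by auto
  with f'(2) show "\<exists>f'. (g has_derivative f') (at x) \<and> (\<forall>c v. f' (c *\<^sub>C v) = c *\<^sub>C f' v)"
    by blast
qed

lemma holo_on_compose:
  assumes "holo_on f U" "holo_on g V" "\<And>x. x \<in> U \<Longrightarrow> f x \<in> V"
  shows "holo_on (\<lambda>x. g (f x)) U"
  unfolding holo_on_def
proof
  fix x assume x: "x \<in> U"
  obtain f' where f': "(f has_derivative f') (at x)" "\<forall>c v. f' (c *\<^sub>C v) = c *\<^sub>C f' v"
    using assms(1) x unfolding holo_on_def by blast
  obtain g' where g': "(g has_derivative g') (at (f x))" "\<forall>c v. g' (c *\<^sub>C v) = c *\<^sub>C g' v"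
    using assms(2,3) x unfolding holo_on_def by blast
  have "((\<lambda>x. g (f x)) has_derivative (\<lambda>v. g' (f' v))) (at x)"
    using has_derivative_compose[OF f'(1) g'(1)] .
  then show "\<exists>f'. ((\<lambda>x. g (f x)) has_derivative f') (at x) \<and> (\<forall>c v. f' (c *\<^sub>C v) = c *\<^sub>C f' v)"
    using f'(2) g'(2) by (intro exI[of _ "\<lambda>v. g' (f' v)"]) auto
qed

lemma cderiv_compose:
  assumes "holo_on f U" "holo_on g V" "x \<in> U" "f x \<in> V"
    and "(f has_derivative f') (at x)"
  shows "cderiv v (\<lambda>x. g (f x)) x = cderiv (f' v) g (f x)"
proof -
  obtain f'' where f'': "(f has_derivative f'') (at x)" "\<forall>c v. f'' (c *\<^sub>C v) = c *\<^sub>C f'' v"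
    using assms(1,3) unfolding holo_on_def by blast
  have [simp]: "f' = f''"
    using has_derivative_unique[OF assms(5) f''(1)] .
  have "((\<lambda>x. g (f x)) has_derivative (\<lambda>v. cderiv (f' v) g (f x))) (at x)"
    using has_derivative_compose[OF assms(5) holo_on_has_derivative[OF assms(2,4)]] .
  then show ?thesis
    by (rule cderiv_eqI) (use f'' cderiv_scaleC[OF assms(2,4)] in \<open>auto simp: scaleC_complex_def\<close>)
qed

lemma holo_on_const [simp, intro]: "holo_on (\<lambda>x. c) U"
  unfolding holo_on_def
  by (auto intro!: exI[of _ "\<lambda>x. 0"])

section \<open>Cauchy's formula on complex lines\<close>

definition circ :: "real \<Rightarrow> real \<Rightarrow> complex"
  where "circ r s = of_real r * exp (2 * of_real pi * \<i> * of_real s)"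

lemma norm_circ [simp]: "r > 0 \<Longrightarrow> cmod (circ r s) = r"
  by (simp add: circ_def norm_mult)

lemma circ_nonzero [simp]: "r > 0 \<Longrightarrow> circ r s \<noteq> 0"
  by (simp add: circ_def)

lemma continuous_on_circ [continuous_intros]:
  "continuous_on S f \<Longrightarrow> continuous_on S (\<lambda>x. circ r (f x))"
  unfolding circ_def by (intro continuous_intros)

text \<open>Cauchy's formula on the line through \<open>x\<close> in direction \<open>v\<close>. It
  replaces a derivative by an integral of \<open>f\<close> over a compact parameter interval,
  through which continuity and holomorphy pass from \<open>f\<close> to its derivatives.\<close>

lemma Cauchy_cderiv:
  fixes f :: "'a::complex_space \<Rightarrow> complex"
  assumes "holo_on f U" "r > 0" "\<And>c. cmod c \<le> r \<Longrightarrow> x + c *\<^sub>C v \<in> U"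
  shows "cderiv v f x =
    integral {0..1} (\<lambda>s. f (x + circ r s *\<^sub>C v) / circ r s)"
proof -
  define g where "g = (\<lambda>c. f (x + c *\<^sub>C v))"
  have g: "(g has_field_derivative cderiv v f (x + c *\<^sub>C v)) (at c)" if "cmod c \<le> r" for c
    unfolding g_def using cderiv_along_line[OF assms(1) assms(3)[OF that]] .
  have c1: "continuous_on (cball 0 r) g"
    by (rule continuous_at_imp_continuous_on) (auto intro!: DERIV_isCont[OF g])
  have c2: "g holomorphic_on ball 0 r"
    unfolding holomorphic_on_open[OF open_ball]
    by (intro ballI exI, rule g) simp
  have "(g has_field_derivative (1 / (2 * of_real pi * \<i>) *
      contour_integral (circlepath 0 r) (\<lambda>u. g u / (u - 0)^2))) (at 0)"
    by (rule Cauchy_derivative_integral_circlepath(2)[OF c1 c2]) (use assms in auto)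
  then have "cderiv v f x = 1 / (2 * of_real pi * \<i>) *
      contour_integral (circlepath 0 r) (\<lambda>u. g u / (u - 0)^2)"
    using g[of 0] assms(2) by (auto intro: DERIV_unique)
  also have "contour_integral (circlepath 0 r) (\<lambda>u. g u / (u - 0)^2) =
      integral {0..1} (\<lambda>s. (2 * of_real pi * \<i>) * (g (circ r s) / circ r s))"
    unfolding contour_integral_integral
  proof (intro integral_cong)
    fix s :: real
    have 1: "circlepath 0 r s = circ r s"
      by (simp add: circlepath circ_def)
    have 2: "vector_derivative (circlepath 0 r) (at s) = 2 * of_real pi * \<i> * circ r s"
      by (simp add: vector_derivative_circlepath circ_def)
    show "g (circlepath 0 r s) / (circlepath 0 r s - 0)\<^sup>2 * vector_derivative (circlepath 0 r) (at s) =
        2 * of_real pi * \<i> * (g (circ r s) / circ r s)"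
      unfolding 1 2 using assms(2) by (simp add: power2_eq_square)
  qed
  finally show ?thesis
    unfolding integral_mult_right by (simp add: g_def)
qed

lemma holo_on_integral:
  fixes F :: "'a::{complex_space,euclidean_space} \<Rightarrow> real \<Rightarrow> complex"
  assumes U: "open U" and F: "\<And>s. s \<in> {0..1} \<Longrightarrow> holo_on (\<lambda>x. F x s) U"
    and cF: "continuous_on (U \<times> {0..1}) (\<lambda>(x, s). F x s)"
    and cD: "\<And>v. continuous_on (U \<times> {0..1}) (\<lambda>(x, s). cderiv v (\<lambda>x. F x s) x)"
  shows "holo_on (\<lambda>x. integral {0..1} (F x)) U"
    and "\<And>x v. x \<in> U \<Longrightarrow> cderiv v (\<lambda>x. integral {0..1} (F x)) x =
      integral {0..1} (\<lambda>s. cderiv v (\<lambda>x. F x s) x)"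
proof -
  \<comment> \<open>The Leibniz rule asks for a derivative that is continuous as a bounded linear
    map; in finite dimension it is enough to check this on basis directions, which is what
    \<open>cD\<close> provides.\<close>
  define F' where "F' x s = Blinfun (\<lambda>v. cderiv v (\<lambda>x. F x s) x)" for x s
  have bl: "bounded_linear (\<lambda>v. cderiv v (\<lambda>x. F x s) x)" if "x \<in> U" "s \<in> {0..1}" for x s
    using has_derivative_bounded_linear[OF holo_on_has_derivative[OF F[OF that(2)] that(1)]] .
  have F'_app: "blinfun_apply (F' x s) v = cderiv v (\<lambda>x. F x s) x" if "x \<in> U" "s \<in> {0..1}" for x s v
    unfolding F'_def using bounded_linear_Blinfun_apply[OF bl[OF that]] by simp
  have contF': "continuous_on (U \<times> {0..1}) (\<lambda>(x, s). F' x s)"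
  proof (rule continuous_on_blinfun_componentwise)
    fix i :: 'a
    show "continuous_on (U \<times> {0..1}) (\<lambda>x. blinfun_apply (case x of (x, s) \<Rightarrow> F' x s) i)"
      by (rule continuous_on_eq[OF cD[of i]]) (auto simp: F'_app)
  qed
  have *: "((\<lambda>x. integral {0..1} (F x)) has_derivative
      (\<lambda>v. integral {0..1} (\<lambda>s. cderiv v (\<lambda>x. F x s) x0))) (at x0)" if x0: "x0 \<in> U" for x0
  proof -
    obtain e where e: "e > 0" "ball x0 e \<subseteq> U"
      using U x0 open_contains_ball by blast
    have int: "(F' x0) integrable_on cbox 0 1"
    proof (intro integrable_continuous)
      have "continuous_on ({0..1}::real set) (\<lambda>s. (\<lambda>(x, s). F' x s) (x0, s))"
        by (rule continuous_on_compose2[OF contF']) (auto intro!: continuous_intros simp: x0)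
      then show "continuous_on (cbox 0 1) (F' x0)" by simp
    qed
    have deriv: "((\<lambda>x. integral (cbox 0 1) (F x)) has_derivative blinfun_apply (integral (cbox 0 1) (F' x0)))
        (at x0 within ball x0 e)"
    proof (rule leibniz_rule)
      fix x s assume "x \<in> ball x0 e" "s \<in> cbox 0 (1::real)"
      then have xs: "x \<in> U" "s \<in> {0..1}" using e by auto
      have "((\<lambda>x. F x s) has_derivative blinfun_apply (F' x s)) (at x)"
        using holo_on_has_derivative[OF F[OF xs(2)] xs(1)] F'_app[OF xs]
        by (metis (no_types, lifting) ext)
      then show "((\<lambda>x. F x s) has_derivative blinfun_apply (F' x s)) (at x within ball x0 e)"
        by (rule has_derivative_at_withinI)
    next
      fix x assume "x \<in> ball x0 e"
      then have x: "x \<in> U" using e by auto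
      have "continuous_on ({0..1}::real set) (\<lambda>s. (\<lambda>(x, s). F x s) (x, s))"
        by (rule continuous_on_compose2[OF cF]) (auto intro!: continuous_intros simp: x)
      then show "F x integrable_on cbox 0 1"
        by (intro integrable_continuous) simp
    next
      show "continuous_on (ball x0 e \<times> cbox 0 1) (\<lambda>(x, t). F' x t)"
        by (rule continuous_on_subset[OF contF']) (use e in auto)
    qed (use e in auto)
    have eq: "blinfun_apply (integral (cbox 0 1) (F' x0)) =
        (\<lambda>v. integral {0..1} (\<lambda>s. cderiv v (\<lambda>x. F x s) x0))"
    proof
      fix v
      have "blinfun_apply (integral (cbox 0 1) (F' x0)) v = integral (cbox 0 1) (\<lambda>s. blinfun_apply (F' x0 s) v)"
        by (rule blinfun_apply_integral[OF int])
      also have "\<dots> = integral {0..1} (\<lambda>s. cderiv v (\<lambda>x. F x s) x0)"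
        by (simp only: cbox_interval) (intro integral_cong, simp add: F'_app x0)
      finally show "blinfun_apply (integral (cbox 0 1) (F' x0)) v =
        integral {0..1} (\<lambda>s. cderiv v (\<lambda>x. F x s) x0)" .
    qed
    have "at x0 within ball x0 e = at x0"
      using e by (intro at_within_open) auto
    then show ?thesis
      using deriv unfolding cbox_interval eq[unfolded cbox_interval] by simp
  qed
  have lin: "integral {0..1} (\<lambda>s. cderiv (c *\<^sub>C v) (\<lambda>x. F x s) x) =
      c *\<^sub>C integral {0..1} (\<lambda>s. cderiv v (\<lambda>x. F x s) x)" if "x \<in> U" for c v x
  proof -
    have "integral {0..1} (\<lambda>s. cderiv (c *\<^sub>C v) (\<lambda>x. F x s) x) =
        integral {0..1} (\<lambda>s. c * cderiv v (\<lambda>x. F x s) x)"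
      by (intro integral_cong cderiv_scaleC[OF F that])
    then show ?thesis by (simp add: scaleC_complex_def)
  qed
  show "holo_on (\<lambda>x. integral {0..1} (F x)) U"
  proof (rule holo_onI)
    fix x assume x: "x \<in> U"
    define f' where "f' v = integral {0..1} (\<lambda>s. cderiv v (\<lambda>x. F x s) x)" for v
    have "((\<lambda>x. integral {0..1} (F x)) has_derivative f') (at x)"
      using *[OF x] by (simp add: f'_def[abs_def])
    moreover have "f' (c *\<^sub>C v) = c * f' v" for c v
      unfolding f'_def lin[OF x] scaleC_complex_def ..
    ultimately show "\<exists>f'. ((\<lambda>x. integral {0..1} (F x)) has_derivative f') (at x) \<and>
        (\<forall>c v. f' (c *\<^sub>C v) = c * f' v)"
      by blast
  qed
  show "\<And>x v. x \<in> U \<Longrightarrow> cderiv v (\<lambda>x. integral {0..1} (F x)) x =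
      integral {0..1} (\<lambda>s. cderiv v (\<lambda>x. F x s) x)"
    using cderiv_eqI[OF * lin] by simp
qed

lemma small_disc_in_ball:
  fixes v :: "'a::complex_space"
  assumes "e > 0"
  obtains r where "r > 0" "\<And>c. cmod c \<le> r \<Longrightarrow> norm (c *\<^sub>C v) < e"
proof -
  obtain K where K: "K > 0" "\<And>c. norm (c *\<^sub>C v) \<le> cmod c * K"
    using bounded_linear.pos_bounded[OF bounded_linear_scaleC_left[of v]] by blast
  have "norm (c *\<^sub>C v) < e" if "cmod c \<le> e / (2 * K)" for c
  proof -
    have "norm (c *\<^sub>C v) \<le> e / (2 * K) * K"
      using K(2)[of c] that K(1) by (meson mult_right_mono order_trans less_imp_le)
    also have "\<dots> = e / 2" using K by simp
    finally show ?thesis using assms by simp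
  qed
  with K assms show ?thesis by (intro that[of "e / (2 * K)"]) auto
qed

text \<open>Near a point one radius serves all centres, so the derivative is an integral of
  \<open>f\<close> over circles that move continuously.\<close>

lemma continuous_on_cderiv:
  fixes f :: "'a::{complex_space,euclidean_space} \<Rightarrow> complex"
  assumes "open U" "holo_on f U"
  shows "continuous_on U (cderiv v f)"
proof (rule continuous_at_imp_continuous_on, rule ballI)
  fix x0 assume "x0 \<in> U"
  then obtain e where e: "e > 0" "ball x0 e \<subseteq> U"
    using assms(1) open_contains_ball by blast
  obtain r where r: "r > 0" "\<And>c. cmod c \<le> r \<Longrightarrow> norm (c *\<^sub>C v) < e / 2"
    using small_disc_in_ball[of "e / 2" v] e by auto
  have inU: "x + c *\<^sub>C v \<in> U" if "x \<in> ball x0 (e / 2)" "cmod c \<le> r" for x c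
  proof -
    have "dist x0 (x + c *\<^sub>C v) \<le> dist x0 x + norm (c *\<^sub>C v)"
      using norm_triangle_ineq4[of "x0 - x" "c *\<^sub>C v"] by (simp add: dist_norm algebra_simps)
    then have "x + c *\<^sub>C v \<in> ball x0 e" using that r(2)[of c] by (simp add: dist_commute)
    then show ?thesis using e by blast
  qed
  let ?F = "\<lambda>x s. f (x + circ r s *\<^sub>C v) / circ r s"
  have "continuous_on (ball x0 (e / 2)) (\<lambda>x. integral (cbox 0 1) (?F x))"
  proof (rule integral_continuous_on_param)
    show "continuous_on (ball x0 (e / 2) \<times> cbox 0 1) (\<lambda>(x, s). ?F x s)"
      unfolding case_prod_beta
      by (intro continuous_intros continuous_on_compose2[OF holo_on_imp_continuous_on[OF assms(2)]])
        (use inU r(1) in auto)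
  qed
  then have "continuous_on (ball x0 (e / 2)) (cderiv v f)"
    by (rule continuous_on_eq) (use Cauchy_cderiv[OF assms(2) r(1) inU] in auto)
  then show "isCont (cderiv v f) x0"
    using e by (simp add: continuous_on_eq_continuous_at)
qed

text \<open>Differentiates Cauchy's formula for \<open>cderiv w f\<close> under the integral sign.
  The integrand is a translate of \<open>f\<close>, so only first derivatives of \<open>f\<close>
  occur and no regularity of \<open>cderiv w f\<close> has to be known beforehand.\<close>

lemma cderiv_local:
  fixes f :: "'a::{complex_space,euclidean_space} \<Rightarrow> complex"
  assumes U: "open U" and f: "holo_on f U"
    and e: "e > 0" "ball x0 (2 * e) \<subseteq> U" and r: "r > 0" "\<And>c. cmod c \<le> r \<Longrightarrow> norm (c *\<^sub>C w) < e"
  shows "holo_on (cderiv w f) (ball x0 e) \<and> (\<forall>v. cderiv v (cderiv w f) x0 =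
      integral {0..1} (\<lambda>s. cderiv v f (x0 + circ r s *\<^sub>C w) / circ r s))"
proof -
  have inU: "x + c *\<^sub>C w \<in> U" if "x \<in> ball x0 e" "cmod c \<le> r" for x c
  proof -
    have "dist x0 (x + c *\<^sub>C w) \<le> dist x0 x + norm (c *\<^sub>C w)"
      using norm_triangle_ineq4[of "x0 - x" "c *\<^sub>C w"] by (simp add: dist_norm algebra_simps)
    then have "x + c *\<^sub>C w \<in> ball x0 (2 * e)" using that r(2)[of c] by (simp add: dist_commute)
    then show ?thesis using e by blast
  qed
  define F where "F x s = f (x + circ r s *\<^sub>C w) / circ r s"
    for x and s :: real
  have "(F has_derivative
      (\<lambda>v. cderiv v f (x + circ r s *\<^sub>C w) / circ r s)) (at x)"
    if "F = (\<lambda>x. f (x + circ r s *\<^sub>C w) / circ r s)"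
      "x \<in> ball x0 e" for x and s :: real and F
  proof -
    have "x + circ r s *\<^sub>C w \<in> U"
      using that r(1) by (intro inU) auto
    note d = holo_on_has_derivative[OF f this]
    have "((\<lambda>x. x + circ r s *\<^sub>C w) has_derivative (\<lambda>v. v)) (at x)"
      by (auto intro!: derivative_eq_intros)
    from has_derivative_compose[OF this d] show ?thesis
      unfolding that(1) divide_inverse by (rule has_derivative_mult_left)
  qed
  then have F_deriv: "((\<lambda>x. F x s) has_derivative
      (\<lambda>v. cderiv v f (x + circ r s *\<^sub>C w) / circ r s)) (at x)"
    if "x \<in> ball x0 e" for x s using that unfolding F_def by blast
  have lin: "cderiv (c *\<^sub>C v) f (x + circ r s *\<^sub>C w) / circ r s =
    c * (cderiv v f (x + circ r s *\<^sub>C w) / circ r s)"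
    if "x \<in> ball x0 e" for x and s :: real and c v
    using cderiv_scaleC[OF f inU[OF that]] r(1) by simp
  have F_holo: "holo_on (\<lambda>x. F x s) (ball x0 e)" for s
    by (rule holo_onI) (use F_deriv lin in blast)
  have F_cderiv: "cderiv v (\<lambda>x. F x s) x =
      cderiv v f (x + circ r s *\<^sub>C w) / circ r s"
    if "x \<in> ball x0 e" for x s v
    by (rule cderiv_eqI[OF F_deriv[OF that]]) (use lin[OF that] in \<open>auto simp: scaleC_complex_def\<close>)
  have cF: "continuous_on (ball x0 e \<times> {0..1}) (\<lambda>(x, s). F x s)"
    unfolding case_prod_beta F_def
    by (intro continuous_intros continuous_on_compose2[OF holo_on_imp_continuous_on[OF f]])
      (use inU r(1) in auto)
  have cD: "continuous_on (ball x0 e \<times> {0..1}) (\<lambda>(x, s). cderiv v (\<lambda>x. F x s) x)" for v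
  proof -
    have "continuous_on (ball x0 e \<times> {0..1}) (\<lambda>(x, s).
        cderiv v f (x + circ r s *\<^sub>C w) / circ r s)"
      unfolding case_prod_beta
      by (intro continuous_intros continuous_on_compose2[OF continuous_on_cderiv[OF U f]])
        (use inU r(1) in auto)
    then show ?thesis
      by (rule continuous_on_eq) (auto simp: F_cderiv)
  qed
  note I = holo_on_integral[OF open_ball F_holo cF cD]
  have eq: "integral {0..1} (F x) = cderiv w f x" if "x \<in> ball x0 e" for x
    using Cauchy_cderiv[OF f r(1) inU[OF that]] by (simp add: F_def[abs_def])
  have h: "holo_on (cderiv w f) (ball x0 e)"
    by (rule holo_on_cong[OF open_ball eq I(1)])
  have "cderiv v (cderiv w f) x0 = integral {0..1} (\<lambda>s. cderiv v (\<lambda>x. F x s) x0)" for v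
    using cderiv_cong_open[OF open_ball, of x0 x0 e "cderiv w f" "\<lambda>x. integral {0..1} (F x)" v]
      eq I(2)[of x0 v] e by auto
  then show ?thesis using h e by (auto simp: F_cderiv)
qed

lemma cderiv_nbhd:
  fixes x0 w :: "'a::complex_space"
  assumes "open U" "x0 \<in> U"
  obtains e r where "e > 0" "ball x0 (2 * e) \<subseteq> U" "r > 0" "\<And>c. cmod c \<le> r \<Longrightarrow> norm (c *\<^sub>C w) < e"
proof -
  obtain e where e: "e > 0" "ball x0 e \<subseteq> U" using assms open_contains_ball by blast
  moreover obtain r where "r > 0" "\<And>c. cmod c \<le> r \<Longrightarrow> norm (c *\<^sub>C w) < e / 2"
    using small_disc_in_ball[of "e / 2" w] e by auto
  ultimately show ?thesis by (intro that[of "e / 2" r]) auto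
qed

lemma holo_on_cderiv:
  fixes f :: "'a::{complex_space,euclidean_space} \<Rightarrow> complex"
  assumes U: "open U" and f: "holo_on f U"
  shows "holo_on (cderiv w f) U"
  unfolding holo_on_def
proof
  fix x0 assume "x0 \<in> U"
  then obtain e r where er: "e > 0" "ball x0 (2 * e) \<subseteq> U" "r > 0"
      "\<And>c. cmod c \<le> r \<Longrightarrow> norm (c *\<^sub>C w) < e" using cderiv_nbhd[OF U] by metis
  with cderiv_local[OF U f, of e x0 r w] have "holo_on (cderiv w f) (ball x0 e)" by blast
  then show "\<exists>f'. (cderiv w f has_derivative f') (at x0) \<and> (\<forall>c v. f' (c *\<^sub>C v) = c *\<^sub>C f' v)"
    using er(1) by (auto simp: holo_on_def)
qed

text \<open>Both sides are the same Cauchy integral of \<open>cderiv v f\<close> in direction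
  \<open>w\<close>: one by differentiation under the integral, the other by Cauchy's formula for
  \<open>cderiv v f\<close>.\<close>

lemma cderiv_commute:
  fixes f :: "'a::{complex_space,euclidean_space} \<Rightarrow> complex"
  assumes U: "open U" and f: "holo_on f U" and x: "x \<in> U"
  shows "cderiv v (cderiv w f) x = cderiv w (cderiv v f) x"
proof -
  obtain e r where er: "e > 0" "ball x (2 * e) \<subseteq> U" "r > 0"
      "\<And>c. cmod c \<le> r \<Longrightarrow> norm (c *\<^sub>C w) < e" using cderiv_nbhd[OF U x] by metis
  have "x + c *\<^sub>C w \<in> U" if "cmod c \<le> r" for c
  proof -
    have "x + c *\<^sub>C w \<in> ball x (2 * e)" using er(1) er(4)[OF that] by (simp add: dist_norm)
    then show ?thesis using er(2) by blast
  qed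
  from Cauchy_cderiv[OF holo_on_cderiv[OF U f] er(3) this] cderiv_local[OF U f er(1,2,3), of w] er(4)
  show ?thesis by auto
qed

lemma holo_on_by_derivative:
  fixes f :: "'a::complex_space \<Rightarrow> complex"
  assumes "\<And>x. x \<in> U \<Longrightarrow> (f has_derivative f' x) (at x)"
    and "\<And>x c v. x \<in> U \<Longrightarrow> f' x (c *\<^sub>C v) = c * f' x v"
  shows "holo_on f U" and "\<And>x v. x \<in> U \<Longrightarrow> cderiv v f x = f' x v"
proof -
  show "holo_on f U"
  proof (rule holo_onI)
    fix x assume x: "x \<in> U"
    have "(f has_derivative f' x) (at x) \<and> (\<forall>c v. f' x (c *\<^sub>C v) = c * f' x v)"
      using assms(1)[OF x] assms(2)[OF x] by blast
    then show "\<exists>f'. (f has_derivative f') (at x) \<and> (\<forall>c v. f' (c *\<^sub>C v) = c * f' v)"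
      by (rule exI[of _ "f' x"])
  qed
  show "\<And>x v. x \<in> U \<Longrightarrow> cderiv v f x = f' x v"
    using cderiv_eqI assms by (metis scaleC_complex_def)
qed

section \<open>Calculus rules for scalar and vector-valued holomorphic functions\<close>

lemma
  fixes f g :: "'a::complex_space \<Rightarrow> complex"
  assumes f: "holo_on f U" and g: "holo_on g U"
  shows holo_on_add: "holo_on (\<lambda>x. f x + g x) U"
    and cderiv_add: "\<And>x v. x \<in> U \<Longrightarrow> cderiv v (\<lambda>x. f x + g x) x = cderiv v f x + cderiv v g x"
    and holo_on_mult: "holo_on (\<lambda>x. f x * g x) U"
    and cderiv_mult: "\<And>x v. x \<in> U \<Longrightarrow> cderiv v (\<lambda>x. f x * g x) x = cderiv v f x * g x + f x * cderiv v g x"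
proof -
  have d1: "((\<lambda>x. f x + g x) has_derivative (\<lambda>v. cderiv v f x + cderiv v g x)) (at x)" if "x \<in> U" for x
    using that by (intro has_derivative_add holo_on_has_derivative[OF f] holo_on_has_derivative[OF g])
  have l1: "cderiv (c *\<^sub>C v) f x + cderiv (c *\<^sub>C v) g x = c * (cderiv v f x + cderiv v g x)"
    if "x \<in> U" for x c v
    using that by (simp add: cderiv_scaleC[OF f] cderiv_scaleC[OF g] distrib_left)
  show "holo_on (\<lambda>x. f x + g x) U"
    by (rule holo_on_by_derivative(1)[OF d1 l1])
  show "\<And>x v. x \<in> U \<Longrightarrow> cderiv v (\<lambda>x. f x + g x) x = cderiv v f x + cderiv v g x"
    by (rule holo_on_by_derivative(2)[OF d1 l1])
  have d2: "((\<lambda>x. f x * g x) has_derivative (\<lambda>v. f x * cderiv v g x + cderiv v f x * g x)) (at x)"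
    if "x \<in> U" for x
    using that by (intro has_derivative_mult holo_on_has_derivative[OF f] holo_on_has_derivative[OF g])
  have l2: "f x * cderiv (c *\<^sub>C v) g x + cderiv (c *\<^sub>C v) f x * g x =
      c * (f x * cderiv v g x + cderiv v f x * g x)" if "x \<in> U" for x c v
    using that by (simp add: cderiv_scaleC[OF f] cderiv_scaleC[OF g] algebra_simps)
  show "holo_on (\<lambda>x. f x * g x) U"
    by (rule holo_on_by_derivative(1)[OF d2 l2])
  show "\<And>x v. x \<in> U \<Longrightarrow> cderiv v (\<lambda>x. f x * g x) x = cderiv v f x * g x + f x * cderiv v g x"
    by (subst holo_on_by_derivative(2)[OF d2 l2]) simp_all
qed

lemma cderiv_const [simp]: "cderiv v (\<lambda>x. c) x = 0"
  by (simp add: cderiv_def)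

lemma
  fixes f :: "'i \<Rightarrow> 'a::complex_space \<Rightarrow> complex"
  assumes f: "\<And>i. i \<in> I \<Longrightarrow> holo_on (f i) U"
  shows holo_on_sum: "holo_on (\<lambda>x. \<Sum>i\<in>I. f i x) U"
    and cderiv_sum: "\<And>x v. x \<in> U \<Longrightarrow> cderiv v (\<lambda>x. \<Sum>i\<in>I. f i x) x = (\<Sum>i\<in>I. cderiv v (f i) x)"
proof -
  have "holo_on (\<lambda>x. \<Sum>i\<in>I. f i x) U \<and>
      (\<forall>x v. x \<in> U \<longrightarrow> cderiv v (\<lambda>x. \<Sum>i\<in>I. f i x) x = (\<Sum>i\<in>I. cderiv v (f i) x))"
    using f
  proof (induction I rule: infinite_finite_induct)
    case (insert i I)
    then have i: "holo_on (f i) U" and I: "holo_on (\<lambda>x. \<Sum>i\<in>I. f i x) U"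
      and D: "\<And>x v. x \<in> U \<Longrightarrow> cderiv v (\<lambda>x. \<Sum>i\<in>I. f i x) x = (\<Sum>i\<in>I. cderiv v (f i) x)"
      by auto
    show ?case
      using insert(1,2) holo_on_add[OF i I] cderiv_add[OF i I] D by simp
  qed auto
  then show "holo_on (\<lambda>x. \<Sum>i\<in>I. f i x) U"
    and "\<And>x v. x \<in> U \<Longrightarrow> cderiv v (\<lambda>x. \<Sum>i\<in>I. f i x) x = (\<Sum>i\<in>I. cderiv v (f i) x)"
    by auto
qed

lemma holo_on_minus: "holo_on f U \<Longrightarrow> holo_on (\<lambda>x. - f x :: complex) U"
  using holo_on_mult[OF holo_on_const, of f U "-1"] by simp

lemma holo_on_diff: "holo_on f U \<Longrightarrow> holo_on g U \<Longrightarrow> holo_on (\<lambda>x. f x - g x :: complex) U"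
  using holo_on_add[OF _ holo_on_minus, of f U g] by simp

lemma holo_on_linear:
  assumes "bounded_linear f" "\<And>c x. f (c *\<^sub>C x) = c *\<^sub>C f x"
  shows "holo_on f U"
  unfolding holo_on_def using bounded_linear_imp_has_derivative[OF assms(1)] assms(2) by blast

lemma holo_on_Pair:
  assumes "holo_on f U" "holo_on g U"
  shows "holo_on (\<lambda>x. (f x, g x)) U"
  unfolding holo_on_def
proof
  fix x assume x: "x \<in> U"
  obtain f' where f': "(f has_derivative f') (at x)" "\<forall>c v. f' (c *\<^sub>C v) = c *\<^sub>C f' v"
    using assms(1) x unfolding holo_on_def by blast
  obtain g' where g': "(g has_derivative g') (at x)" "\<forall>c v. g' (c *\<^sub>C v) = c *\<^sub>C g' v"
    using assms(2) x unfolding holo_on_def by blast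
  have "((\<lambda>x. (f x, g x)) has_derivative (\<lambda>v. (f' v, g' v))) (at x)"
    using has_derivative_Pair[OF f'(1) g'(1)] .
  then show "\<exists>f'. ((\<lambda>x. (f x, g x)) has_derivative f') (at x) \<and> (\<forall>c v. f' (c *\<^sub>C v) = c *\<^sub>C f' v)"
    using f'(2) g'(2) by (intro exI[of _ "\<lambda>v. (f' v, g' v)"]) (simp add: scaleC_prod_def)
qed

lemma has_derivative_vec_lambda:
  fixes f :: "'a::real_normed_vector \<Rightarrow> ('b::real_normed_vector) ^ 'n"
  assumes "\<And>i. ((\<lambda>x. f x $ i) has_derivative (\<lambda>v. f' v $ i)) (at x)"
  shows "(f has_derivative f') (at x)"
proof -
  have bl: "bounded_linear (\<lambda>v. f' v $ i)" for i
    using has_derivative_bounded_linear[OF assms] .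
  have lim: "((\<lambda>y. (f y $ i - f x $ i - f' (y - x) $ i) /\<^sub>R norm (y - x)) \<longlongrightarrow> 0) (at x)" for i
    using assms[of i] by (simp add: has_derivative_at_within)
  have "((\<lambda>y. (f y - f x - f' (y - x)) /\<^sub>R norm (y - x)) \<longlongrightarrow> 0) (at x)"
    by (rule vec_tendstoI) (use lim in simp)
  moreover have "bounded_linear f'"
  proof -
    have "linear f'"
      by (rule linearI) (auto simp: vec_eq_iff linear_add[OF bounded_linear.linear[OF bl]]
          linear_cmul[OF bounded_linear.linear[OF bl]])
    moreover have "\<exists>K. \<forall>v. norm (f' v) \<le> norm v * K"
    proof -
      obtain K where K: "\<And>i v. norm (f' v $ i) \<le> norm v * K i"
        using bounded_linear.bounded[OF bl] by metis
      have "norm (f' v) \<le> norm v * (\<Sum>i\<in>UNIV. K i)" for v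
      proof -
        have "norm (f' v) \<le> (\<Sum>i\<in>UNIV. norm (f' v $ i))"
          unfolding norm_vec_def by (rule L2_set_le_sum) auto
        also have "\<dots> \<le> norm v * (\<Sum>i\<in>UNIV. K i)"
          unfolding sum_distrib_left by (intro sum_mono K)
        finally show ?thesis .
      qed
      then show ?thesis by blast
    qed
    ultimately show ?thesis
      by (simp add: bounded_linear_def bounded_linear_axioms_def)
  qed
  ultimately show ?thesis
    by (simp add: has_derivative_at_within)
qed

lemma holo_on_vec:
  fixes f :: "'a::complex_space \<Rightarrow> ('b::complex_space) ^ 'n"
  assumes "\<And>i. holo_on (\<lambda>x. f x $ i) U"
  shows "holo_on f U"
  unfolding holo_on_def
proof
  fix x assume x: "x \<in> U"
  have "\<exists>f'. \<forall>i. ((\<lambda>x. f x $ i) has_derivative f' i) (at x) \<and> (\<forall>c v. f' i (c *\<^sub>C v) = c *\<^sub>C f' i v)"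
    using assms x unfolding holo_on_def by (intro choice) blast
  then obtain f' where f': "\<And>i. ((\<lambda>x. f x $ i) has_derivative f' i) (at x)"
      "\<And>i c v. f' i (c *\<^sub>C v) = c *\<^sub>C f' i v" by blast
  have "(f has_derivative (\<lambda>v. \<chi> i. f' i v)) (at x)"
    by (rule has_derivative_vec_lambda) (use f' in simp)
  then show "\<exists>f'. (f has_derivative f') (at x) \<and> (\<forall>c v. f' (c *\<^sub>C v) = c *\<^sub>C f' v)"
    using f' by (intro exI[of _ "\<lambda>v. \<chi> i. f' i v"]) (simp add: scaleC_vec_def vec_eq_iff)
qed

lemma holo_on_fst: "holo_on f U \<Longrightarrow> holo_on (\<lambda>x. fst (f x)) U"
  by (rule holo_on_compose[where V = UNIV])
    (auto intro: holo_on_linear[OF bounded_linear_fst] simp: scaleC_prod_def)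

lemma holo_on_snd: "holo_on f U \<Longrightarrow> holo_on (\<lambda>x. snd (f x)) U"
  by (rule holo_on_compose[where V = UNIV])
    (auto intro: holo_on_linear[OF bounded_linear_snd] simp: scaleC_prod_def)

lemma holo_on_vec_nth: "holo_on f U \<Longrightarrow> holo_on (\<lambda>x. f x $ i) U"
  by (rule holo_on_compose[where V = UNIV])
    (auto intro: holo_on_linear[OF bounded_linear_vec_nth] simp: scaleC_vec_def)

lemma holo_on_id: "holo_on (\<lambda>x. x) U"
  by (rule holo_on_linear) (auto intro: bounded_linear_ident)

lemma holo_on_vec_add:
  fixes f g :: "'a::complex_space \<Rightarrow> complex ^ 'n"
  shows "holo_on f U \<Longrightarrow> holo_on g U \<Longrightarrow> holo_on (\<lambda>x. f x + g x) U"
  by (rule holo_on_vec) (auto intro!: holo_on_add holo_on_vec_nth)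

lemmas holo_on_intros = holo_on_add holo_on_mult holo_on_sum holo_on_minus holo_on_diff holo_on_Pair
  holo_on_fst holo_on_snd holo_on_vec_nth holo_on_id holo_on_vec_add

section \<open>Functions with values in formal power series\<close>

definition holo_fps :: "'a::complex_space set \<Rightarrow> ('a \<Rightarrow> complex fps) \<Rightarrow> bool"
  where "holo_fps U F \<longleftrightarrow> (\<forall>m. holo_on (\<lambda>x. fps_nth (F x) m) U)"

definition cderiv_fps :: "'a::complex_space \<Rightarrow> ('a \<Rightarrow> complex fps) \<Rightarrow> 'a \<Rightarrow> complex fps"
  where "cderiv_fps v F x = Abs_fps (\<lambda>m. cderiv v (\<lambda>x. fps_nth (F x) m) x)"

lemma fps_nth_cderiv_fps [simp]: "fps_nth (cderiv_fps v F x) m = cderiv v (\<lambda>x. fps_nth (F x) m) x"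
  by (simp add: cderiv_fps_def)

lemma holo_fpsD: "holo_fps U F \<Longrightarrow> holo_on (\<lambda>x. fps_nth (F x) m) U"
  by (simp add: holo_fps_def)

lemma holo_fps_subset: "holo_fps U F \<Longrightarrow> V \<subseteq> U \<Longrightarrow> holo_fps V F"
  by (auto simp: holo_fps_def intro: holo_on_subset)

lemma holo_fps_const [simp, intro]: "holo_fps U (\<lambda>x. c)"
  by (simp add: holo_fps_def)

lemma holo_fps_add: "holo_fps U F \<Longrightarrow> holo_fps U G \<Longrightarrow> holo_fps U (\<lambda>x. F x + G x)"
  by (simp add: holo_fps_def holo_on_add)

lemma holo_fps_mult: "holo_fps U F \<Longrightarrow> holo_fps U G \<Longrightarrow> holo_fps U (\<lambda>x. F x * G x)"
  by (simp add: holo_fps_def fps_mult_nth holo_on_sum holo_on_mult)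

lemma holo_fps_sum: "(\<And>i. i \<in> I \<Longrightarrow> holo_fps U (F i)) \<Longrightarrow> holo_fps U (\<lambda>x. \<Sum>i\<in>I. F i x)"
  by (simp add: holo_fps_def fps_sum_nth holo_on_sum)

lemma holo_fps_scalar: "holo_on f U \<Longrightarrow> holo_fps U (\<lambda>x. fps_const (f x))"
  unfolding holo_fps_def
proof
  fix m assume "holo_on f U"
  then show "holo_on (\<lambda>x. fps_nth (fps_const (f x)) m) U"
    by (cases "m = 0") auto
qed

lemma holo_fps_cderiv_fps:
  fixes F :: "'a::{complex_space,euclidean_space} \<Rightarrow> complex fps"
  shows "open U \<Longrightarrow> holo_fps U F \<Longrightarrow> holo_fps U (cderiv_fps v F)"
  by (simp add: holo_fps_def holo_on_cderiv)

lemma cderiv_fps_cong: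
  "open U \<Longrightarrow> x \<in> U \<Longrightarrow> (\<And>y. y \<in> U \<Longrightarrow> F y = G y) \<Longrightarrow> cderiv_fps v F x = cderiv_fps v G x"
  by (rule fps_ext, unfold fps_nth_cderiv_fps, rule cderiv_cong_open) auto

lemma cderiv_fps_const [simp]: "cderiv_fps v (\<lambda>x. c) x = 0"
  by (rule fps_ext) simp

lemma cderiv_fps_add:
  assumes "holo_fps U F" "holo_fps U G" "x \<in> U"
  shows "cderiv_fps v (\<lambda>x. F x + G x) x = cderiv_fps v F x + cderiv_fps v G x"
  by (rule fps_ext) (simp add: cderiv_add[OF holo_fpsD[OF assms(1)] holo_fpsD[OF assms(2)] assms(3)])

lemma cderiv_fps_mult:
  assumes "holo_fps U F" "holo_fps U G" "x \<in> U"
  shows "cderiv_fps v (\<lambda>x. F x * G x) x = cderiv_fps v F x * G x + F x * cderiv_fps v G x"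
proof (rule fps_ext)
  fix m
  have h: "holo_on (\<lambda>x. fps_nth (F x) i * fps_nth (G x) (m - i)) U" for i
    using assms(1,2) by (simp add: holo_fps_def holo_on_mult)
  show "fps_nth (cderiv_fps v (\<lambda>x. F x * G x) x) m =
      fps_nth (cderiv_fps v F x * G x + F x * cderiv_fps v G x) m"
    by (simp add: fps_mult_nth cderiv_sum[OF h assms(3)] sum.distrib
        cderiv_mult[OF holo_fpsD[OF assms(1)] holo_fpsD[OF assms(2)] assms(3)])
qed

lemma cderiv_fps_mult_const:
  assumes "holo_fps U F" "x \<in> U"
  shows "cderiv_fps v (\<lambda>x. c * F x) x = c * cderiv_fps v F x"
  using cderiv_fps_mult[OF holo_fps_const assms, of v c] by simp

lemma cderiv_fps_sum:
  assumes "\<And>i. i \<in> I \<Longrightarrow> holo_fps U (F i)" "x \<in> U"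
  shows "cderiv_fps v (\<lambda>x. \<Sum>i\<in>I. F i x) x = (\<Sum>i\<in>I. cderiv_fps v (F i) x)"
  by (rule fps_ext) (simp add: fps_sum_nth cderiv_sum[OF holo_fpsD[OF assms(1)] assms(2)])

lemma cderiv_fps_commute:
  fixes F :: "'a::{complex_space,euclidean_space} \<Rightarrow> complex fps"
  assumes "open U" "holo_fps U F" "x \<in> U"
  shows "cderiv_fps v (cderiv_fps w F) x = cderiv_fps w (cderiv_fps v F) x"
  by (rule fps_ext) (simp add: cderiv_fps_def[abs_def] cderiv_commute[OF assms(1) holo_fpsD[OF assms(2)] assms(3)])

lemma cderiv_fps_scalar: "cderiv_fps v (\<lambda>x. fps_const (f x)) x = fps_const (cderiv v f x)"
proof (rule fps_ext)
  fix m
  show "fps_nth (cderiv_fps v (\<lambda>x. fps_const (f x)) x) m = fps_nth (fps_const (cderiv v f x)) m"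
    by (cases "m = 0") auto
qed

section \<open>The bidifferential operators of the composition\<close>

type_synonym 'n point = "(complex ^ 'n) \<times> (complex ^ 'n) \<times> complex"

definition dir_z :: "'n \<Rightarrow> 'n::finite point"
  where "dir_z i = (axis i 1, 0, 0)"

definition dir_zeta :: "'n \<Rightarrow> 'n::finite point"
  where "dir_zeta i = (0, axis i 1, 0)"

text \<open>The operator B_k with its two factors at independent points \<open>x\<close> and
  \<open>y\<close>, so that each factor can be differentiated separately; the composition lives on
  the diagonal \<open>x = y\<close>. The recursion runs over ordered index tuples, hence a single k!
  in \<open>bidiff_exp\<close> instead of multi-index factorials.\<close>

fun bidiff :: "nat \<Rightarrow> ('n::finite point \<Rightarrow> complex fps) \<Rightarrow> ('n point \<Rightarrow> complex fps)
    \<Rightarrow> 'n point \<Rightarrow> 'n point \<Rightarrow> complex fps" where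
  "bidiff 0 F G x y = F x * G y"
| "bidiff (Suc k) F G x y =
    (\<Sum>i\<in>UNIV. bidiff k (cderiv_fps (dir_zeta i) F) (cderiv_fps (dir_z i) G) x y)"

lemma bidiff_cong:
  assumes "open U" "\<And>x. x \<in> U \<Longrightarrow> F x = F' x" "\<And>x. x \<in> U \<Longrightarrow> G x = G' x" "x \<in> U" "y \<in> U"
  shows "bidiff k F G x y = bidiff k F' G' x y"
  using assms(2,3)
proof (induction k arbitrary: F G F' G')
  case 0
  then show ?case using assms(4,5) by simp
next
  case (Suc k)
  show ?case
    unfolding bidiff.simps
    by (intro sum.cong refl Suc.IH; rule cderiv_fps_cong[OF assms(1)]; use Suc.prems in auto)
qed

lemma bidiff_add_left:
  assumes "open U" "holo_fps U F" "holo_fps U F'" "x \<in> U" "y \<in> U"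
  shows "bidiff k (\<lambda>x. F x + F' x) G x y = bidiff k F G x y + bidiff k F' G x y"
  using assms(2,3)
proof (induction k arbitrary: F F' G)
  case 0
  then show ?case by (simp add: distrib_right)
next
  case (Suc k)
  have "bidiff k (cderiv_fps v (\<lambda>x. F x + F' x)) H x y =
      bidiff k (cderiv_fps v F) H x y + bidiff k (cderiv_fps v F') H x y" for v H
  proof -
    have "bidiff k (cderiv_fps v (\<lambda>x. F x + F' x)) H x y =
        bidiff k (\<lambda>x. cderiv_fps v F x + cderiv_fps v F' x) H x y"
      by (rule bidiff_cong[OF assms(1) _ refl assms(4,5)]) (rule cderiv_fps_add[OF Suc.prems])
    also have "\<dots> = bidiff k (cderiv_fps v F) H x y + bidiff k (cderiv_fps v F') H x y"
      by (rule Suc.IH) (intro holo_fps_cderiv_fps assms(1) Suc.prems)+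
    finally show ?thesis .
  qed
  then show ?case by (simp add: sum.distrib)
qed

lemma bidiff_add_right:
  assumes "open U" "holo_fps U G" "holo_fps U G'" "x \<in> U" "y \<in> U"
  shows "bidiff k F (\<lambda>x. G x + G' x) x y = bidiff k F G x y + bidiff k F G' x y"
  using assms(2,3)
proof (induction k arbitrary: F G G')
  case 0
  then show ?case by (simp add: distrib_left)
next
  case (Suc k)
  have "bidiff k H (cderiv_fps v (\<lambda>x. G x + G' x)) x y =
      bidiff k H (cderiv_fps v G) x y + bidiff k H (cderiv_fps v G') x y" for v H
  proof -
    have "bidiff k H (cderiv_fps v (\<lambda>x. G x + G' x)) x y =
        bidiff k H (\<lambda>x. cderiv_fps v G x + cderiv_fps v G' x) x y"
      by (rule bidiff_cong[OF assms(1) refl _ assms(4,5)]) (rule cderiv_fps_add[OF Suc.prems])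
    also have "\<dots> = bidiff k H (cderiv_fps v G) x y + bidiff k H (cderiv_fps v G') x y"
      by (rule Suc.IH) (intro holo_fps_cderiv_fps assms(1) Suc.prems)+
    finally show ?thesis .
  qed
  then show ?case by (simp add: sum.distrib)
qed

text \<open>Only \<zeta>-derivatives fall on the left factor, so a factor that is free of \<zeta>
  commutes with all of them.\<close>

lemma bidiff_mult_left:
  assumes "open U" "holo_fps U C" "holo_fps U F" "x \<in> U" "y \<in> U"
    and "\<And>i x. x \<in> U \<Longrightarrow> cderiv_fps (dir_zeta i) C x = 0"
  shows "bidiff k (\<lambda>x. C x * F x) G x y = C x * bidiff k F G x y"
  using assms(3)
proof (induction k arbitrary: F G)
  case 0
  then show ?case by simp
next
  case (Suc k)
  have "bidiff k (cderiv_fps (dir_zeta i) (\<lambda>x. C x * F x)) H x y =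
      C x * bidiff k (cderiv_fps (dir_zeta i) F) H x y" for i H
  proof -
    have "bidiff k (cderiv_fps (dir_zeta i) (\<lambda>x. C x * F x)) H x y =
        bidiff k (\<lambda>x. C x * cderiv_fps (dir_zeta i) F x) H x y"
      by (rule bidiff_cong[OF assms(1) _ refl assms(4,5)])
        (simp add: cderiv_fps_mult[OF assms(2) Suc.prems] assms(6))
    also have "\<dots> = C x * bidiff k (cderiv_fps (dir_zeta i) F) H x y"
      by (rule Suc.IH) (intro holo_fps_cderiv_fps assms(1) Suc.prems)
    finally show ?thesis .
  qed
  then show ?case by (simp add: sum_distrib_left)
qed

lemma bidiff_mult_const_right:
  assumes "open U" "holo_fps U G" "x \<in> U" "y \<in> U"
  shows "bidiff k F (\<lambda>x. c * G x) x y = c * bidiff k F G x y"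
  using assms(2)
proof (induction k arbitrary: F G)
  case 0
  then show ?case by simp
next
  case (Suc k)
  have "bidiff k H (cderiv_fps v (\<lambda>x. c * G x)) x y = c * bidiff k H (cderiv_fps v G) x y" for v H
  proof -
    have "bidiff k H (cderiv_fps v (\<lambda>x. c * G x)) x y = bidiff k H (\<lambda>x. c * cderiv_fps v G x) x y"
      by (rule bidiff_cong[OF assms(1) refl _ assms(3,4)]) (rule cderiv_fps_mult_const[OF Suc.prems])
    also have "\<dots> = c * bidiff k H (cderiv_fps v G) x y"
      by (rule Suc.IH) (intro holo_fps_cderiv_fps assms(1) Suc.prems)
    finally show ?thesis .
  qed
  then show ?case by (simp add: sum_distrib_left)
qed

lemma bidiff_mult_const_left:
  assumes "open U" "holo_fps U F" "x \<in> U" "y \<in> U"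
  shows "bidiff k (\<lambda>x. c * F x) G x y = c * bidiff k F G x y"
  by (rule bidiff_mult_left[OF assms(1) _ assms(2,3,4)]) auto

lemma bidiff_zero_right [simp]: "bidiff k F (\<lambda>x. 0) x y = 0"
proof (induction k arbitrary: F)
  case (Suc k)
  have "cderiv_fps v (\<lambda>x. 0) = (\<lambda>x. 0)" for v :: "'a point" by (rule ext) simp
  then show ?case by (simp add: Suc)
qed simp

lemma bidiff_zero_left [simp]: "bidiff k (\<lambda>x. 0) G x y = 0"
proof (induction k arbitrary: G)
  case (Suc k)
  have "cderiv_fps v (\<lambda>x. 0) = (\<lambda>x. 0)" for v :: "'a point" by (rule ext) simp
  then show ?case by (simp add: Suc)
qed simp

lemma bidiff_sum_right:
  assumes "open U" "\<And>i. i \<in> I \<Longrightarrow> holo_fps U (G i)" "x \<in> U" "y \<in> U"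
  shows "bidiff k F (\<lambda>x. \<Sum>i\<in>I. G i x) x y = (\<Sum>i\<in>I. bidiff k F (G i) x y)"
  using assms(2)
proof (induction I rule: infinite_finite_induct)
  case (insert i I)
  have "bidiff k F (\<lambda>x. G i x + (\<Sum>i\<in>I. G i x)) x y =
      bidiff k F (G i) x y + bidiff k F (\<lambda>x. \<Sum>i\<in>I. G i x) x y"
    by (rule bidiff_add_right[OF assms(1) _ _ assms(3,4)])
      (use insert.prems in \<open>auto intro!: holo_fps_sum\<close>)
  with insert show ?case by simp
qed auto

lemma bidiff_sum_left:
  assumes "open U" "\<And>i. i \<in> I \<Longrightarrow> holo_fps U (F i)" "x \<in> U" "y \<in> U"
  shows "bidiff k (\<lambda>x. \<Sum>i\<in>I. F i x) G x y = (\<Sum>i\<in>I. bidiff k (F i) G x y)"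
  using assms(2)
proof (induction I rule: infinite_finite_induct)
  case (insert i I)
  have "bidiff k (\<lambda>x. F i x + (\<Sum>i\<in>I. F i x)) G x y =
      bidiff k (F i) G x y + bidiff k (\<lambda>x. \<Sum>i\<in>I. F i x) G x y"
    by (rule bidiff_add_left[OF assms(1) _ _ assms(3,4)])
      (use insert.prems in \<open>auto intro!: holo_fps_sum\<close>)
  with insert show ?case by simp
qed auto

text \<open>Taking the evaluation points as maps \<open>a\<close> and \<open>b\<close> covers in one
  statement the cases of one point fixed and of the diagonal.\<close>

lemma holo_fps_bidiff:
  fixes a b :: "'b::complex_space \<Rightarrow> 'n::finite point"
  assumes "open U" "holo_fps U F" "holo_fps U G"
    and "holo_on a V" "holo_on b V" "\<And>p. p \<in> V \<Longrightarrow> a p \<in> U" "\<And>p. p \<in> V \<Longrightarrow> b p \<in> U"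
  shows "holo_fps V (\<lambda>p. bidiff k F G (a p) (b p))"
  using assms(2,3)
proof (induction k arbitrary: F G)
  case 0
  have "holo_fps V (\<lambda>p. F (a p))"
    unfolding holo_fps_def by (intro allI holo_on_compose[OF assms(4) holo_fpsD[OF 0(1)]] assms(6))
  moreover have "holo_fps V (\<lambda>p. G (b p))"
    unfolding holo_fps_def by (intro allI holo_on_compose[OF assms(5) holo_fpsD[OF 0(2)]] assms(7))
  ultimately show ?case by (simp add: holo_fps_mult)
next
  case (Suc k)
  show ?case
    unfolding bidiff.simps
    by (intro holo_fps_sum Suc.IH holo_fps_cderiv_fps assms(1) Suc.prems)
qed

lemma cderiv_fps_bidiff:
  assumes "open U" "holo_fps U F" "holo_fps U G" "x \<in> U" "y \<in> U"
  shows "cderiv_fps v (\<lambda>x. bidiff k F G x y) x = bidiff k (cderiv_fps v F) G x y"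
    and "cderiv_fps v (\<lambda>y. bidiff k F G x y) y = bidiff k F (cderiv_fps v G) x y"
proof -
  have "(\<forall>x\<in>U. \<forall>y\<in>U. cderiv_fps v (\<lambda>x. bidiff k F G x y) x = bidiff k (cderiv_fps v F) G x y)
    \<and> (\<forall>x\<in>U. \<forall>y\<in>U. cderiv_fps v (\<lambda>y. bidiff k F G x y) y = bidiff k F (cderiv_fps v G) x y)"
    using assms(2,3)
  proof (induction k arbitrary: F G)
    case 0
    have "cderiv_fps v (\<lambda>x. F x * c) x = cderiv_fps v F x * c" if "x \<in> U" for x c
      using cderiv_fps_mult_const[OF 0(1) that, of v c] by (simp add: mult.commute)
    then show ?case
      using cderiv_fps_mult_const[OF 0(2)] by simp
  next
    case (Suc k)
    note h = holo_fps_cderiv_fps[OF assms(1)]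
    note hF = h[OF Suc.prems(1)] and hG = h[OF Suc.prems(2)]
    have cF: "cderiv_fps v (cderiv_fps w F) x = cderiv_fps w (cderiv_fps v F) x" if "x \<in> U" for x w
      using cderiv_fps_commute[OF assms(1) Suc.prems(1) that] .
    have cG: "cderiv_fps v (cderiv_fps w G) x = cderiv_fps w (cderiv_fps v G) x" if "x \<in> U" for x w
      using cderiv_fps_commute[OF assms(1) Suc.prems(2) that] .
    show ?case
    proof (intro conjI ballI)
      fix x y assume xy: "x \<in> U" "y \<in> U"
      have "cderiv_fps v (\<lambda>x. bidiff (Suc k) F G x y) x =
          (\<Sum>i\<in>UNIV. cderiv_fps v (\<lambda>x. bidiff k (cderiv_fps (dir_zeta i) F) (cderiv_fps (dir_z i) G) x y) x)"
        unfolding bidiff.simps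
        by (rule cderiv_fps_sum[OF _ xy(1)], rule holo_fps_bidiff[OF assms(1) hF hG holo_on_id holo_on_const])
          (use xy in auto)
      also have "\<dots> = bidiff (Suc k) (cderiv_fps v F) G x y"
        unfolding bidiff.simps
      proof (intro sum.cong refl)
        fix i
        show "cderiv_fps v (\<lambda>x. bidiff k (cderiv_fps (dir_zeta i) F) (cderiv_fps (dir_z i) G) x y) x =
          bidiff k (cderiv_fps (dir_zeta i) (cderiv_fps v F)) (cderiv_fps (dir_z i) G) x y"
          using Suc.IH[OF hF[of "dir_zeta i"] hG[of "dir_z i"]] xy
          by (simp add: bidiff_cong[OF assms(1) cF refl xy, where G = "cderiv_fps (dir_z i) G"])
      qed
      finally show "cderiv_fps v (\<lambda>x. bidiff (Suc k) F G x y) x = bidiff (Suc k) (cderiv_fps v F) G x y" .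
    next
      fix x y assume xy: "x \<in> U" "y \<in> U"
      have "cderiv_fps v (\<lambda>y. bidiff (Suc k) F G x y) y =
          (\<Sum>i\<in>UNIV. cderiv_fps v (\<lambda>y. bidiff k (cderiv_fps (dir_zeta i) F) (cderiv_fps (dir_z i) G) x y) y)"
        unfolding bidiff.simps
        by (rule cderiv_fps_sum[OF _ xy(2)], rule holo_fps_bidiff[OF assms(1) hF hG holo_on_const holo_on_id])
          (use xy in auto)
      also have "\<dots> = bidiff (Suc k) F (cderiv_fps v G) x y"
        unfolding bidiff.simps
      proof (intro sum.cong refl)
        fix i
        show "cderiv_fps v (\<lambda>y. bidiff k (cderiv_fps (dir_zeta i) F) (cderiv_fps (dir_z i) G) x y) y =
          bidiff k (cderiv_fps (dir_zeta i) F) (cderiv_fps (dir_z i) (cderiv_fps v G)) x y"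
          using Suc.IH[OF hF[of "dir_zeta i"] hG[of "dir_z i"]] xy
          by (simp add: bidiff_cong[OF assms(1) refl cG xy, where F = "cderiv_fps (dir_zeta i) F"])
      qed
      finally show "cderiv_fps v (\<lambda>y. bidiff (Suc k) F G x y) y = bidiff (Suc k) F (cderiv_fps v G) x y" .
    qed
  qed
  then show "cderiv_fps v (\<lambda>x. bidiff k F G x y) x = bidiff k (cderiv_fps v F) G x y"
    and "cderiv_fps v (\<lambda>y. bidiff k F G x y) y = bidiff k F (cderiv_fps v G) x y"
    using assms(4,5) by auto
qed

text \<open>Leibniz rule: derivatives with constant coefficients commute with those inside B_k, so a
  derivative of the restriction to the diagonal splits over the two factors.\<close>

lemma cderiv_fps_bidiff_diag:
  assumes "open U" "holo_fps U F" "holo_fps U G" "x \<in> U"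
  shows "cderiv_fps v (\<lambda>x. bidiff k F G x x) x =
    bidiff k (cderiv_fps v F) G x x + bidiff k F (cderiv_fps v G) x x"
  using assms(2,3)
proof (induction k arbitrary: F G)
  case 0
  then show ?case using cderiv_fps_mult[OF 0 assms(4)] by simp
next
  case (Suc k)
  note h = holo_fps_cderiv_fps[OF assms(1)]
  note hF = h[OF Suc.prems(1)] and hG = h[OF Suc.prems(2)]
  have "cderiv_fps v (\<lambda>x. bidiff (Suc k) F G x x) x =
      (\<Sum>i\<in>UNIV. cderiv_fps v (\<lambda>x. bidiff k (cderiv_fps (dir_zeta i) F) (cderiv_fps (dir_z i) G) x x) x)"
    unfolding bidiff.simps
    by (rule cderiv_fps_sum[OF _ assms(4)], rule holo_fps_bidiff[OF assms(1) hF hG holo_on_id holo_on_id]) auto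
  also have "\<dots> = (\<Sum>i\<in>UNIV.
      bidiff k (cderiv_fps (dir_zeta i) (cderiv_fps v F)) (cderiv_fps (dir_z i) G) x x +
      bidiff k (cderiv_fps (dir_zeta i) F) (cderiv_fps (dir_z i) (cderiv_fps v G)) x x)"
  proof (intro sum.cong refl)
    fix i
    show "cderiv_fps v (\<lambda>x. bidiff k (cderiv_fps (dir_zeta i) F) (cderiv_fps (dir_z i) G) x x) x =
      bidiff k (cderiv_fps (dir_zeta i) (cderiv_fps v F)) (cderiv_fps (dir_z i) G) x x +
      bidiff k (cderiv_fps (dir_zeta i) F) (cderiv_fps (dir_z i) (cderiv_fps v G)) x x"
      unfolding Suc.IH[OF hF hG]
      by (intro arg_cong2[of _ _ _ _ "(+)"] bidiff_cong[OF assms(1) _ _ assms(4,4)] refl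
          cderiv_fps_commute[OF assms(1)] Suc.prems)
  qed
  finally show ?case by (simp add: sum.distrib)
qed

text \<open>The derivatives act on each power of t separately and the product never moves a
  coefficient to a lower order. This is what permits truncation.\<close>

lemma fps_nth_bidiff_cong:
  assumes "open U" "\<And>x j. x \<in> U \<Longrightarrow> j \<le> m \<Longrightarrow> fps_nth (F x) j = fps_nth (F' x) j"
    "\<And>x j. x \<in> U \<Longrightarrow> j \<le> m \<Longrightarrow> fps_nth (G x) j = fps_nth (G' x) j" "x \<in> U" "y \<in> U" "j \<le> m"
  shows "fps_nth (bidiff k F G x y) j = fps_nth (bidiff k F' G' x y) j"
  using assms(2,3)
proof (induction k arbitrary: F G F' G')
  case 0
  then show ?case using assms(4,5,6) by (auto simp: fps_mult_nth intro!: sum.cong)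
next
  case (Suc k)
  show ?case
    unfolding bidiff.simps fps_sum_nth
    by (intro sum.cong refl Suc.IH; unfold fps_nth_cderiv_fps;
        rule cderiv_cong_open[OF assms(1)]; use Suc.prems in auto)
qed

section \<open>The star product\<close>

definition bidiff_exp :: "nat \<Rightarrow> ('n::finite point \<Rightarrow> complex fps) \<Rightarrow> ('n point \<Rightarrow> complex fps)
    \<Rightarrow> 'n point \<Rightarrow> complex fps"
  where "bidiff_exp k F G x = fps_const (1 / fact k) * bidiff k F G x x"

text \<open>The composition without \<open>exp_t\<close>, as an operation on functions of a point,
  which is the form suited to algebra. \<open>series_comp_eq_star\<close> identifies the two where
  both factors are holomorphic.\<close>

definition star :: "('n::finite point \<Rightarrow> complex fps) \<Rightarrow> ('n point \<Rightarrow> complex fps)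
    \<Rightarrow> 'n point \<Rightarrow> complex fps"
  where "star F G x = Abs_fps (\<lambda>\<nu>. \<Sum>k\<le>\<nu>. fps_nth (bidiff_exp k F G x) (\<nu> - k))"

lemma bidiff_exp_0 [simp]: "bidiff_exp 0 F G x = F x * G x"
  by (simp add: bidiff_exp_def)

text \<open>Coefficient form of t d/dt exp(tB) = tB exp(tB), with B the pairing of
  \<zeta>-derivatives on the left with z-derivatives on the right.\<close>

lemma bidiff_exp_Suc:
  "of_nat (Suc k) * bidiff_exp (Suc k) F G x =
    (\<Sum>i\<in>UNIV. bidiff_exp k (cderiv_fps (dir_zeta i) F) (cderiv_fps (dir_z i) G) x)"
proof -
  have "(of_nat (Suc k) :: complex fps) * fps_const (1 / fact (Suc k)) = fps_const (1 / fact k)"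
    by (simp add: fps_of_nat[symmetric] field_simps del: of_nat_Suc)
  then show ?thesis
    unfolding bidiff_exp_def by (simp add: sum_distrib_left mult.assoc[symmetric] del: of_nat_Suc)
qed

lemma holo_fps_bidiff_exp:
  "open U \<Longrightarrow> holo_fps U F \<Longrightarrow> holo_fps U G \<Longrightarrow> holo_fps U (bidiff_exp k F G)"
  unfolding bidiff_exp_def[abs_def]
  by (intro holo_fps_mult holo_fps_const holo_fps_bidiff[where U = U] holo_on_id) auto

lemma holo_fps_star:
  assumes "open U" "holo_fps U F" "holo_fps U G"
  shows "holo_fps U (star F G)"
  unfolding holo_fps_def star_def fps_nth_Abs_fps
  by (intro allI holo_on_sum holo_fpsD holo_fps_bidiff_exp assms)

lemma bidiff_exp_cong:
  assumes "open U" "\<And>x. x \<in> U \<Longrightarrow> F x = F' x" "\<And>x. x \<in> U \<Longrightarrow> G x = G' x" "x \<in> U"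
  shows "bidiff_exp k F G x = bidiff_exp k F' G' x"
  unfolding bidiff_exp_def using bidiff_cong[OF assms assms(4)] by simp

lemma star_cong:
  assumes "open U" "\<And>x. x \<in> U \<Longrightarrow> F x = F' x" "\<And>x. x \<in> U \<Longrightarrow> G x = G' x" "x \<in> U"
  shows "star F G x = star F' G' x"
  unfolding star_def using bidiff_exp_cong[OF assms] by simp

lemma fps_nth_bidiff_exp_cong:
  assumes "open U" "\<And>x j. x \<in> U \<Longrightarrow> j \<le> m \<Longrightarrow> fps_nth (F x) j = fps_nth (F' x) j"
    "\<And>x j. x \<in> U \<Longrightarrow> j \<le> m \<Longrightarrow> fps_nth (G x) j = fps_nth (G' x) j" "x \<in> U" "j \<le> m"
  shows "fps_nth (bidiff_exp k F G x) j = fps_nth (bidiff_exp k F' G' x) j"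
  unfolding bidiff_exp_def using fps_nth_bidiff_cong[OF assms(1-4,4,5)] by simp

lemma cderiv_fps_bidiff_exp:
  assumes "open U" "holo_fps U F" "holo_fps U G" "x \<in> U"
  shows "cderiv_fps v (bidiff_exp k F G) x =
    bidiff_exp k (cderiv_fps v F) G x + bidiff_exp k F (cderiv_fps v G) x"
proof -
  have "holo_fps U (\<lambda>x. bidiff k F G x x)"
    by (rule holo_fps_bidiff[OF assms(1-3) holo_on_id holo_on_id])
  from cderiv_fps_mult_const[OF this assms(4), of v "fps_const (1 / fact k)"] show ?thesis
    unfolding bidiff_exp_def[abs_def] using cderiv_fps_bidiff_diag[OF assms] by (simp add: distrib_left)
qed

lemma bidiff_exp_add_left:
  assumes "open U" "holo_fps U F" "holo_fps U F'" "x \<in> U"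
  shows "bidiff_exp k (\<lambda>x. F x + F' x) G x = bidiff_exp k F G x + bidiff_exp k F' G x"
  unfolding bidiff_exp_def using bidiff_add_left[OF assms assms(4)] by (simp add: distrib_left)

lemma bidiff_exp_add_right:
  assumes "open U" "holo_fps U G" "holo_fps U G'" "x \<in> U"
  shows "bidiff_exp k F (\<lambda>x. G x + G' x) x = bidiff_exp k F G x + bidiff_exp k F G' x"
  unfolding bidiff_exp_def using bidiff_add_right[OF assms assms(4)] by (simp add: distrib_left)

lemma bidiff_exp_sum_left:
  assumes "open U" "\<And>i. i \<in> I \<Longrightarrow> holo_fps U (F i)" "x \<in> U"
  shows "bidiff_exp k (\<lambda>x. \<Sum>i\<in>I. F i x) G x = (\<Sum>i\<in>I. bidiff_exp k (F i) G x)"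
  unfolding bidiff_exp_def by (subst bidiff_sum_left[OF assms assms(3)]) (auto simp: sum_distrib_left)

lemma bidiff_exp_sum_right:
  assumes "open U" "\<And>i. i \<in> I \<Longrightarrow> holo_fps U (G i)" "x \<in> U"
  shows "bidiff_exp k F (\<lambda>x. \<Sum>i\<in>I. G i x) x = (\<Sum>i\<in>I. bidiff_exp k F (G i) x)"
  unfolding bidiff_exp_def by (subst bidiff_sum_right[OF assms assms(3)]) (auto simp: sum_distrib_left)

lemma bidiff_exp_mult_const_left:
  assumes "open U" "holo_fps U F" "x \<in> U"
  shows "bidiff_exp k (\<lambda>x. c * F x) G x = c * bidiff_exp k F G x"
  unfolding bidiff_exp_def using bidiff_mult_const_left[OF assms assms(3)] by (simp add: ac_simps)

lemma bidiff_exp_mult_const_right: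
  assumes "open U" "holo_fps U G" "x \<in> U"
  shows "bidiff_exp k F (\<lambda>x. c * G x) x = c * bidiff_exp k F G x"
  unfolding bidiff_exp_def using bidiff_mult_const_right[OF assms assms(3)] by (simp add: ac_simps)

lemma fps_nth_mult_cong:
  fixes c :: "complex fps"
  assumes "\<And>j. j \<le> m \<Longrightarrow> fps_nth a j = fps_nth b j"
  shows "fps_nth (c * a) m = fps_nth (c * b) m"
  unfolding fps_mult_nth by (rule sum.cong) (auto simp: assms)

text \<open>Terms with k > m are divisible by t^k and do not reach order m; allowing any larger
  bound \<open>M\<close> lets several orders share one finite sum.\<close>

lemma fps_nth_star:
  assumes "m \<le> M"
  shows "fps_nth (star F G x) m = fps_nth (\<Sum>k\<le>M. fps_X ^ k * bidiff_exp k F G x) m"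
proof -
  have "(\<Sum>k\<le>M. if m < k then 0 else fps_nth (bidiff_exp k F G x) (m - k)) =
      (\<Sum>k\<le>m. fps_nth (bidiff_exp k F G x) (m - k))"
    using assms by (intro sum.mono_neutral_cong_right) auto
  then show ?thesis
    by (simp add: star_def fps_sum_nth fps_X_power_mult_nth)
qed

lemma star_add_left:
  assumes "open U" "holo_fps U F" "holo_fps U F'" "x \<in> U"
  shows "star (\<lambda>x. F x + F' x) G x = star F G x + star F' G x"
  by (rule fps_ext) (simp add: star_def bidiff_exp_add_left[OF assms] sum.distrib)

lemma star_mult_left:
  assumes "open U" "holo_fps U C" "holo_fps U F" "x \<in> U"
    and "\<And>i x. x \<in> U \<Longrightarrow> cderiv_fps (dir_zeta i) C x = 0"
  shows "star (\<lambda>x. C x * F x) G x = C x * star F G x"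
proof (rule fps_ext)
  fix m
  have "bidiff_exp k (\<lambda>x. C x * F x) G x = C x * bidiff_exp k F G x" for k
    unfolding bidiff_exp_def using bidiff_mult_left[OF assms(1-4,4,5)] by (simp add: ac_simps)
  then have "fps_nth (star (\<lambda>x. C x * F x) G x) m =
      fps_nth (C x * (\<Sum>k\<le>m. fps_X ^ k * bidiff_exp k F G x)) m"
    by (simp add: fps_nth_star[OF order_refl] sum_distrib_left ac_simps)
  also have "\<dots> = fps_nth (C x * star F G x) m"
    by (rule fps_nth_mult_cong) (simp add: fps_nth_star)
  finally show "fps_nth (star (\<lambda>x. C x * F x) G x) m = fps_nth (C x * star F G x) m" .
qed

text \<open>Write C as C times 1 and take C out of the left factor; the constant 1 is a left
  unit.\<close>

lemma star_const_left:
  assumes "open U" "holo_fps U C" "holo_fps U G" "x \<in> U"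
    and "\<And>i x. x \<in> U \<Longrightarrow> cderiv_fps (dir_zeta i) C x = 0"
  shows "star C G x = C x * G x"
proof -
  have bd: "bidiff k (\<lambda>x. 1) G x x = (if k = 0 then G x else 0)" for k
  proof (cases k)
    case (Suc l)
    have "cderiv_fps v (\<lambda>x. 1 :: complex fps) = (\<lambda>x. 0)" for v :: "'a point" by (rule ext) simp
    then show ?thesis using Suc by simp
  qed simp
  have "star (\<lambda>x. C x * 1) G x = C x * star (\<lambda>x. 1) G x"
    by (rule star_mult_left[OF assms(1,2) _ assms(4,5)]) auto
  also have "star (\<lambda>x. 1) G x = G x"
    by (rule fps_ext) (simp add: star_def bidiff_exp_def bd if_distrib[of fps_nth]
      if_distrib[of "\<lambda>f. f _"] if_distrib[of "\<lambda>f. _ * f"] sum.delta cong: if_cong)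
  finally show ?thesis by simp
qed

lemma cderiv_linear:
  assumes "bounded_linear f" "\<And>c x. f (c *\<^sub>C x) = c *\<^sub>C f x"
  shows "cderiv v f x = f v"
  by (rule cderiv_eqI[OF bounded_linear_imp_has_derivative[OF assms(1)] assms(2)])

lemma cderiv_zeta_coord: "cderiv v (\<lambda>x::'n::finite point. fst (snd x) $ i) x = fst (snd v) $ i"
  by (rule cderiv_linear)
    (simp_all add: scaleC_prod_def scaleC_vec_def scaleC_complex_def bounded_linear_compose[OF
      bounded_linear_vec_nth bounded_linear_compose[OF bounded_linear_fst bounded_linear_snd]])

text \<open>The left factor is linear in \<zeta>, so all terms beyond the first order
  vanish.\<close>

lemma star_zeta:
  assumes "open U" "holo_fps U G" "x \<in> U"
  shows "star (\<lambda>x. fps_const (fst (snd x) $ i)) G x =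
    fps_const (fst (snd x) $ i) * G x + fps_X * cderiv_fps (dir_z i) G x"
proof -
  let ?Z = "\<lambda>x::'a point. fps_const (fst (snd x) $ i)"
  have D: "cderiv_fps (dir_zeta j) ?Z = (\<lambda>x. fps_const (axis j 1 $ i))" for j
    by (rule ext) (simp add: cderiv_fps_scalar cderiv_zeta_coord dir_zeta_def)
  have D2: "cderiv_fps v (\<lambda>x::'a point. c) = (\<lambda>x. 0)" for v and c :: "complex fps"
    by (rule ext) simp
  have b1: "bidiff_exp (Suc 0) ?Z G x = cderiv_fps (dir_z i) G x"
  proof -
    have "bidiff_exp (Suc 0) ?Z G x = (\<Sum>j\<in>UNIV. fps_const (axis j 1 $ i) * cderiv_fps (dir_z j) G x)"
      by (simp add: bidiff_exp_def D)
    also have "\<dots> = (\<Sum>j\<in>UNIV. if j = i then cderiv_fps (dir_z j) G x else 0)"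
      by (intro sum.cong) (auto simp: axis_def)
    finally show ?thesis by simp
  qed
  have b2: "bidiff_exp (Suc (Suc k)) ?Z G x = 0" for k
    by (simp add: bidiff_exp_def D D2)
  show ?thesis
  proof (rule fps_ext)
    fix m
    \<comment> \<open>The bound m + 1 rather than m guarantees that the terms k = 0 and k = 1 are
      both present even for m = 0.\<close>
    have "fps_nth (star ?Z G x) m = fps_nth (\<Sum>k<Suc (Suc m). fps_X ^ k * bidiff_exp k ?Z G x) m"
      unfolding lessThan_Suc_atMost by (rule fps_nth_star) simp
    also have "(\<Sum>k<Suc (Suc m). fps_X ^ k * bidiff_exp k ?Z G x) =
        ?Z x * G x + fps_X * cderiv_fps (dir_z i) G x"
      by (simp add: sum.lessThan_Suc_shift b1 b2 del: sum.lessThan_Suc)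
    finally show "fps_nth (star ?Z G x) m = fps_nth (?Z x * G x + fps_X * cderiv_fps (dir_z i) G x) m" .
  qed
qed

text \<open>Groups the terms by the total order N = k + l, the form in which the associativity
  identity is proved.\<close>

lemma fps_nth_double_sum:
  fixes a :: "nat \<Rightarrow> nat \<Rightarrow> complex fps"
  shows "fps_nth (\<Sum>k\<le>m. \<Sum>l\<le>m. fps_X ^ (k + l) * a k l) m =
    (\<Sum>N\<le>m. fps_nth (\<Sum>k\<le>N. a k (N - k)) (m - N))"
proof -
  have "fps_nth (\<Sum>k\<le>m. \<Sum>l\<le>m. fps_X ^ (k + l) * a k l) m =
      (\<Sum>(k, l)\<in>{..m} \<times> {..m}. if m < k + l then 0 else fps_nth (a k l) (m - (k + l)))"
    unfolding sum.cartesian_product fps_sum_nth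
    by (intro sum.cong refl) (auto simp: fps_X_power_mult_nth)
  also have "\<dots> = (\<Sum>(k, l)\<in>{(k, l). k + l \<le> m}. fps_nth (a k l) (m - (k + l)))"
    by (intro sum.mono_neutral_cong_right) (auto split: if_splits)
  also have "\<dots> = (\<Sum>N\<le>m. \<Sum>k\<le>N. fps_nth (a k (N - k)) (m - (k + (N - k))))"
    by (rule sum.triangle_reindex_eq)
  also have "\<dots> = (\<Sum>N\<le>m. fps_nth (\<Sum>k\<le>N. a k (N - k)) (m - N))"
    by (simp add: fps_sum_nth)
  finally show ?thesis .
qed

text \<open>
  The Euler operator \<open>t d/dt\<close> multiplies the part of order \<open>N\<close> by \<open>N\<close> and, since the bidifferential
  operator is a derivation in each factor, reduces the order by one.
\<close>

lemma bidiff_exp_assoc: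
  assumes U: "open U" and "holo_fps U F" "holo_fps U G" "holo_fps U H" and x: "x \<in> U"
  shows "(\<Sum>k\<le>N. bidiff_exp k F (bidiff_exp (N - k) G H) x) =
    (\<Sum>k\<le>N. bidiff_exp k (bidiff_exp (N - k) F G) H x)"
  using assms(2-4)
proof (induction N arbitrary: F G H)
  case 0
  then show ?case by (simp add: bidiff_exp_def mult.assoc)
next
  case (Suc N)
  note hol = holo_fps_bidiff_exp[OF U] holo_fps_cderiv_fps[OF U] Suc.prems
  define L where "L F G H = (\<Sum>k\<le>N. bidiff_exp k F (bidiff_exp (N - k) G H) x)" for F G H
  define R where "R F G H = (\<Sum>k\<le>N. bidiff_exp k (bidiff_exp (N - k) F G) H x)" for F G H
  let ?dz = "\<lambda>i. cderiv_fps (dir_z i)" and ?dzeta = "\<lambda>i. cderiv_fps (dir_zeta i)"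
  \<comment> \<open>The weight N + 1 is distributed as k plus N + 1 - k; each part cancels against
    one of the two factorials and lowers one of the two operators by an order.\<close>
  have split: "of_nat (Suc N) * (\<Sum>k\<le>Suc N. a k (Suc N - k)) =
      (\<Sum>k\<le>N. of_nat (Suc k) * a (Suc k) (N - k)) + (\<Sum>k\<le>N. of_nat (Suc (N - k)) * a k (Suc (N - k)))"
    for a :: "nat \<Rightarrow> nat \<Rightarrow> complex fps"
  proof -
    have "of_nat (Suc N) * (\<Sum>k\<le>Suc N. a k (Suc N - k)) =
        (\<Sum>k\<le>Suc N. of_nat k * a k (Suc N - k)) + (\<Sum>k\<le>Suc N. of_nat (Suc N - k) * a k (Suc N - k))"
      unfolding sum_distrib_left sum.distrib[symmetric]
      by (intro sum.cong refl) (auto simp: of_nat_diff algebra_simps)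
    also have "(\<Sum>k\<le>Suc N. of_nat k * a k (Suc N - k)) = (\<Sum>k\<le>N. of_nat (Suc k) * a (Suc k) (N - k))"
      by (subst sum.atMost_Suc_shift) simp
    also have "(\<Sum>k\<le>Suc N. of_nat (Suc N - k) * a k (Suc N - k)) =
        (\<Sum>k\<le>N. of_nat (Suc (N - k)) * a k (Suc (N - k)))"
      by (simp add: Suc_diff_le add_diff_eq)
    finally show ?thesis .
  qed
  \<comment> \<open>Three sums arise, one for each pair of factors joined by a derivative: F with G,
    F with H, G with H. The other bracketing produces the same three.\<close>
  have "of_nat (Suc N) * (\<Sum>k\<le>Suc N. bidiff_exp k F (bidiff_exp (Suc N - k) G H) x) =
      (\<Sum>i\<in>UNIV. L (?dzeta i F) (?dz i G) H) + (\<Sum>i\<in>UNIV. L (?dzeta i F) G (?dz i H)) +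
      (\<Sum>i\<in>UNIV. L F (?dzeta i G) (?dz i H))"
  proof -
    have "of_nat (Suc k) * bidiff_exp (Suc k) F (bidiff_exp (N - k) G H) x =
        (\<Sum>i\<in>UNIV. bidiff_exp k (?dzeta i F) (bidiff_exp (N - k) (?dz i G) H) x) +
        (\<Sum>i\<in>UNIV. bidiff_exp k (?dzeta i F) (bidiff_exp (N - k) G (?dz i H)) x)" for k
    proof -
      have "bidiff_exp k (?dzeta i F) (?dz i (bidiff_exp (N - k) G H)) x =
          bidiff_exp k (?dzeta i F) (bidiff_exp (N - k) (?dz i G) H) x +
          bidiff_exp k (?dzeta i F) (bidiff_exp (N - k) G (?dz i H)) x" for i
        by (subst bidiff_exp_add_right[OF U _ _ x, symmetric])
          (auto intro!: hol bidiff_exp_cong[OF U _ _ x] cderiv_fps_bidiff_exp[OF U])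
      then show ?thesis by (simp only: bidiff_exp_Suc sum.distrib)
    qed
    moreover have "of_nat (Suc (N - k)) * bidiff_exp k F (bidiff_exp (Suc (N - k)) G H) x =
        (\<Sum>i\<in>UNIV. bidiff_exp k F (bidiff_exp (N - k) (?dzeta i G) (?dz i H)) x)" for k
      by (subst bidiff_exp_mult_const_right[OF U _ x, symmetric], intro hol,
          subst bidiff_exp_sum_right[OF U _ x, symmetric], intro hol)
        (simp only: bidiff_exp_Suc)
    ultimately show ?thesis
      unfolding split[of "\<lambda>k l. bidiff_exp k F (bidiff_exp l G H) x"] L_def
      by (simp only: sum.distrib sum.swap[of _ "UNIV" "{..N}"])
  qed
  moreover have "of_nat (Suc N) * (\<Sum>k\<le>Suc N. bidiff_exp k (bidiff_exp (Suc N - k) F G) H x) =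
      (\<Sum>i\<in>UNIV. R (?dzeta i F) (?dz i G) H) + (\<Sum>i\<in>UNIV. R (?dzeta i F) G (?dz i H)) +
      (\<Sum>i\<in>UNIV. R F (?dzeta i G) (?dz i H))"
  proof -
    have "of_nat (Suc k) * bidiff_exp (Suc k) (bidiff_exp (N - k) F G) H x =
        (\<Sum>i\<in>UNIV. bidiff_exp k (bidiff_exp (N - k) (?dzeta i F) G) (?dz i H) x) +
        (\<Sum>i\<in>UNIV. bidiff_exp k (bidiff_exp (N - k) F (?dzeta i G)) (?dz i H) x)" for k
    proof -
      have "bidiff_exp k (?dzeta i (bidiff_exp (N - k) F G)) (?dz i H) x =
          bidiff_exp k (bidiff_exp (N - k) (?dzeta i F) G) (?dz i H) x +
          bidiff_exp k (bidiff_exp (N - k) F (?dzeta i G)) (?dz i H) x" for i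
        by (subst bidiff_exp_add_left[OF U _ _ x, symmetric])
          (auto intro!: hol bidiff_exp_cong[OF U _ _ x] cderiv_fps_bidiff_exp[OF U])
      then show ?thesis by (simp only: bidiff_exp_Suc sum.distrib)
    qed
    moreover have "of_nat (Suc (N - k)) * bidiff_exp k (bidiff_exp (Suc (N - k)) F G) H x =
        (\<Sum>i\<in>UNIV. bidiff_exp k (bidiff_exp (N - k) (?dzeta i F) (?dz i G)) H x)" for k
      by (subst bidiff_exp_mult_const_left[OF U _ x, symmetric], intro hol,
          subst bidiff_exp_sum_left[OF U _ x, symmetric], intro hol)
        (simp only: bidiff_exp_Suc)
    ultimately show ?thesis
      unfolding split[of "\<lambda>k l. bidiff_exp k (bidiff_exp l F G) H x"] R_def
      by (simp only: sum.distrib sum.swap[of _ "UNIV" "{..N}"] add.commute add.left_commute)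
  qed
  moreover have "L F' G' H' = R F' G' H'" if "holo_fps U F'" "holo_fps U G'" "holo_fps U H'" for F' G' H'
    unfolding L_def R_def by (rule Suc.IH[OF that])
  ultimately have "of_nat (Suc N) * (\<Sum>k\<le>Suc N. bidiff_exp k F (bidiff_exp (Suc N - k) G H) x) =
      of_nat (Suc N) * (\<Sum>k\<le>Suc N. bidiff_exp k (bidiff_exp (Suc N - k) F G) H x)"
    by (simp only: hol)
  then show ?case
    by (simp only: mult_cancel_left of_nat_eq_0_iff) simp
qed

text \<open>At a fixed order of t both sides are finite sums, which split by total order N; for each
  N the bidifferential identity applies.\<close>

theorem star_assoc:
  assumes U: "open U" and hF: "holo_fps U F" and hG: "holo_fps U G" and hH: "holo_fps U H" and x: "x \<in> U"
  shows "star F (star G H) x = star (star F G) H x"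
proof (rule fps_ext)
  fix m
  have hol: "holo_fps U (\<lambda>x. fps_X ^ l * bidiff_exp l F G x)" if "holo_fps U F" "holo_fps U G" for l F G
    using that by (intro holo_fps_mult holo_fps_const holo_fps_bidiff_exp U)
  have "fps_nth (star F (star G H) x) m = fps_nth (\<Sum>k\<le>m. \<Sum>l\<le>m.
      fps_X ^ (k + l) * bidiff_exp k F (bidiff_exp l G H) x) m"
  proof -
    have "bidiff_exp k F (\<lambda>x. \<Sum>l\<le>m. fps_X ^ l * bidiff_exp l G H x) x =
        (\<Sum>l\<le>m. fps_X ^ l * bidiff_exp k F (bidiff_exp l G H) x)" for k
      by (subst bidiff_exp_sum_right[OF U _ x])
        (auto intro!: hol hG hH sum.cong bidiff_exp_mult_const_right[OF U _ x] holo_fps_bidiff_exp U)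
    then have "fps_nth (bidiff_exp k F (star G H) x) j =
        fps_nth (\<Sum>l\<le>m. fps_X ^ l * bidiff_exp k F (bidiff_exp l G H) x) j" if "j \<le> m" for k j
      using fps_nth_bidiff_exp_cong[OF U refl _ x that, where G = "star G H"
          and G' = "\<lambda>x. \<Sum>l\<le>m. fps_X ^ l * bidiff_exp l G H x"] fps_nth_star[of _ m G H]
      by simp
    then have "fps_nth (fps_X ^ k * bidiff_exp k F (star G H) x) m =
        fps_nth (fps_X ^ k * (\<Sum>l\<le>m. fps_X ^ l * bidiff_exp k F (bidiff_exp l G H) x)) m" for k
      by (rule fps_nth_mult_cong)
    then show ?thesis
      unfolding fps_nth_star[OF order_refl] fps_sum_nth
      by (simp add: sum_distrib_left power_add mult.assoc fps_sum_nth)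
  qed
  moreover have "fps_nth (star (star F G) H x) m = fps_nth (\<Sum>k\<le>m. \<Sum>l\<le>m.
      fps_X ^ (k + l) * bidiff_exp k (bidiff_exp l F G) H x) m"
  proof -
    have "bidiff_exp k (\<lambda>x. \<Sum>l\<le>m. fps_X ^ l * bidiff_exp l F G x) H x =
        (\<Sum>l\<le>m. fps_X ^ l * bidiff_exp k (bidiff_exp l F G) H x)" for k
      by (subst bidiff_exp_sum_left[OF U _ x])
        (auto intro!: hol hG hF sum.cong bidiff_exp_mult_const_left[OF U _ x] holo_fps_bidiff_exp U)
    then have "fps_nth (bidiff_exp k (star F G) H x) j =
        fps_nth (\<Sum>l\<le>m. fps_X ^ l * bidiff_exp k (bidiff_exp l F G) H x) j" if "j \<le> m" for k j
      using fps_nth_bidiff_exp_cong[OF U _ refl x that, where F = "star F G"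
          and F' = "\<lambda>x. \<Sum>l\<le>m. fps_X ^ l * bidiff_exp l F G x"] fps_nth_star[of _ m F G]
      by simp
    then have "fps_nth (fps_X ^ k * bidiff_exp k (star F G) H x) m =
        fps_nth (fps_X ^ k * (\<Sum>l\<le>m. fps_X ^ l * bidiff_exp k (bidiff_exp l F G) H x)) m" for k
      by (rule fps_nth_mult_cong)
    then show ?thesis
      unfolding fps_nth_star[OF order_refl] fps_sum_nth
      by (simp add: sum_distrib_left power_add mult.assoc fps_sum_nth)
  qed
  ultimately show "fps_nth (star F (star G H) x) m = fps_nth (star (star F G) H x) m"
    unfolding fps_nth_double_sum using bidiff_exp_assoc[OF assms] by simp
qed

section \<open>From \<open>exp_t\<close> to the star product\<close>

definition lap :: "('p::complex_space \<times> (complex ^ 'n) \<times> (complex ^ 'n::finite) \<Rightarrow> complex fps)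
    \<Rightarrow> 'p \<times> (complex ^ 'n) \<times> (complex ^ 'n) \<Rightarrow> complex fps"
  where "lap G y = (\<Sum>i\<in>UNIV. cderiv_fps (0, 0, axis i 1) (cderiv_fps (0, axis i 1, 0) G) y)"

lemma scaleC_axis: "c *\<^sub>C axis i 1 = (axis i c :: complex ^ 'n)"
  by (simp add: scaleC_vec_def scaleC_complex_def axis_def vec_eq_iff)

text \<open>\<open>lap\<close> is \<open>dzeta_dz\<close> in the last two variables for functions
  that also depend on a parameter \<open>p\<close>. In the composition and in the pullback the
  parameter holds the outer variables, so that these can be differentiated as well.\<close>

lemma dzeta_dz_funpow:
  fixes G :: "'p::complex_space \<times> (complex ^ 'n) \<times> (complex ^ 'n::finite) \<Rightarrow> complex fps"
  shows "(dzeta_dz ^^ k) (\<lambda>z \<zeta>. fps_nth (G (p, z, \<zeta>)) m) = (\<lambda>z \<zeta>. fps_nth ((lap ^^ k) G (p, z, \<zeta>)) m)"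
proof (induction k)
  case (Suc k)
  have "dzeta_dz (\<lambda>z \<zeta>. fps_nth (H (p, z, \<zeta>)) m) z \<zeta> = fps_nth (lap H (p, z, \<zeta>)) m"
    for H :: "'p \<times> (complex ^ 'n) \<times> (complex ^ 'n) \<Rightarrow> complex fps" and z \<zeta>
    by (simp add: dzeta_dz_def lap_def fps_sum_nth cderiv_def scaleC_prod_def scaleC_axis)
  then show ?case by (simp add: Suc)
qed simp

lemma fps_nth_exp_t:
  fixes G :: "'p::complex_space \<times> (complex ^ 'n) \<times> (complex ^ 'n::finite) \<Rightarrow> complex fps"
  shows "fps_nth (exp_t (\<lambda>z \<zeta>. G (p, z, \<zeta>)) z \<zeta>) m =
    (\<Sum>k\<le>m. fps_nth ((lap ^^ k) G (p, z, \<zeta>)) (m - k) / fact k)"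
  by (simp add: exp_t_def dzeta_dz_funpow)

lemma lap_cong:
  fixes G :: "'p::complex_space \<times> (complex ^ 'n) \<times> (complex ^ 'n::finite) \<Rightarrow> complex fps"
  assumes "open V" "y \<in> V" "\<And>y. y \<in> V \<Longrightarrow> G y = H y"
  shows "lap G y = lap H y"
  unfolding lap_def
  by (intro sum.cong refl cderiv_fps_cong[OF assms(1,2)] cderiv_fps_cong[OF assms(1)] assms(3))

definition pt_series :: "'n series \<Rightarrow> 'n::finite point \<Rightarrow> complex fps"
  where "pt_series P x = P (fst x) (fst (snd x)) (snd (snd x))"

lemma pt_series_simp [simp]: "pt_series P (z, \<zeta>, \<eta>) = P z \<zeta> \<eta>"
  by (simp add: pt_series_def)

text \<open>In the composition the left factor depends on \<zeta>' alone and the right factor on z'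
  alone, up to the parameter, so every application of \<open>lap\<close> puts one derivative on
  each. The maps \<open>a\<close> and \<open>b\<close> give the two evaluation points.\<close>

lemma lap_product:
  fixes F G :: "'n::finite point \<Rightarrow> complex fps"
    and a b :: "'n point \<times> (complex ^ 'n) \<times> (complex ^ 'n) \<Rightarrow> 'n point"
  assumes U: "open U" "holo_fps U F" "holo_fps U G"
    and a: "a = (\<lambda>(p, z', \<zeta>'). (fst p, \<zeta>', snd (snd p)))" and b: "b = (\<lambda>(p, z', \<zeta>'). (z', snd p))"
    and y: "a y \<in> U" "b y \<in> U"
  shows "(lap ^^ k) (\<lambda>y. F (a y) * G (b y)) y = bidiff k F G (a y) (b y)"
  using y
proof (induction k arbitrary: y)
  case (Suc k)
  define V where "V = a -` U \<inter> b -` U"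
  have V: "open V"
    unfolding V_def a b case_prod_beta
    by (intro open_Int open_vimage U(1) continuous_intros)
  have yV: "y \<in> V" using Suc.prems by (simp add: V_def)
  have da: "cderiv_fps (0, 0, axis i 1) (\<lambda>y. bidiff k F H (a y) (b y)) y =
      cderiv_fps (dir_zeta i) (\<lambda>x. bidiff k F H x (b y)) (a y)" for y i H
  proof (rule fps_ext)
    obtain p1 p2 p3 z' \<zeta>' where "y = ((p1, p2, p3), z', \<zeta>')" by (metis surj_pair)
    then show "fps_nth (cderiv_fps (0, 0, axis i 1) (\<lambda>y. bidiff k F H (a y) (b y)) y) m =
        fps_nth (cderiv_fps (dir_zeta i) (\<lambda>x. bidiff k F H x (b y)) (a y)) m" for m
      by (simp add: cderiv_def a b scaleC_prod_def dir_zeta_def zero_prod_def)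
  qed
  have db: "cderiv_fps (0, axis i 1, 0) (\<lambda>y. bidiff k F H (a y) (b y)) y =
      cderiv_fps (dir_z i) (\<lambda>x. bidiff k F H (a y) x) (b y)" for y i H
  proof (rule fps_ext)
    obtain p1 p2 p3 z' \<zeta>' where "y = ((p1, p2, p3), z', \<zeta>')" by (metis surj_pair)
    then show "fps_nth (cderiv_fps (0, axis i 1, 0) (\<lambda>y. bidiff k F H (a y) (b y)) y) m =
        fps_nth (cderiv_fps (dir_z i) (\<lambda>x. bidiff k F H (a y) x) (b y)) m" for m
      by (simp add: cderiv_def a b scaleC_prod_def dir_z_def zero_prod_def)
  qed
  have "(lap ^^ Suc k) (\<lambda>y. F (a y) * G (b y)) y = lap (\<lambda>y. bidiff k F G (a y) (b y)) y"
    unfolding funpow.simps comp_apply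
    by (rule lap_cong[OF V yV]) (use Suc.IH in \<open>auto simp: V_def\<close>)
  also have "\<dots> = bidiff (Suc k) F G (a y) (b y)"
    unfolding lap_def bidiff.simps
  proof (intro sum.cong refl)
    fix i
    have "cderiv_fps (0, 0, axis i 1) (cderiv_fps (0, axis i 1, 0) (\<lambda>y. bidiff k F G (a y) (b y))) y =
        cderiv_fps (0, 0, axis i 1) (\<lambda>y. bidiff k F (cderiv_fps (dir_z i) G) (a y) (b y)) y"
      by (rule cderiv_fps_cong[OF V yV], unfold db, rule cderiv_fps_bidiff(2)[OF U]) (auto simp: V_def)
    also have "\<dots> = bidiff k (cderiv_fps (dir_zeta i) F) (cderiv_fps (dir_z i) G) (a y) (b y)"
      unfolding da
      by (rule cderiv_fps_bidiff(1)[OF U(1,2) holo_fps_cderiv_fps[OF U(1,3)] Suc.prems])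
    finally show "cderiv_fps (0, 0, axis i 1) (cderiv_fps (0, axis i 1, 0)
        (\<lambda>y. bidiff k F G (a y) (b y))) y =
      bidiff k (cderiv_fps (dir_zeta i) F) (cderiv_fps (dir_z i) G) (a y) (b y)" .
  qed
  finally show ?case .
qed simp

lemma series_comp_eq_star:
  assumes U: "open U" "holo_fps U (pt_series Q)" "holo_fps U (pt_series P)" and x: "x \<in> U"
  shows "pt_series (Q \<odot> P) x = star (pt_series Q) (pt_series P) x"
proof (rule fps_ext)
  fix m
  obtain z \<zeta> \<eta> where xe: "x = (z, \<zeta>, \<eta>)" using prod_cases3 by blast
  define a b :: "'a point \<times> (complex ^ 'a) \<times> (complex ^ 'a) \<Rightarrow> 'a point"
    where "a = (\<lambda>(p, z', \<zeta>'). (fst p, \<zeta>', snd (snd p)))" and "b = (\<lambda>(p, z', \<zeta>'). (z', snd p))"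
  let ?G = "\<lambda>y. pt_series Q (a y) * pt_series P (b y)"
  have "pt_series (Q \<odot> P) x = exp_t (\<lambda>z' \<zeta>'. ?G (x, z', \<zeta>')) z \<zeta>"
    by (simp add: xe series_comp_def a_def b_def)
  moreover have "(lap ^^ k) ?G (x, z, \<zeta>) = bidiff k (pt_series Q) (pt_series P) x x" for k
    using lap_product[OF U a_def b_def, of "(x, z, \<zeta>)" k] x by (simp add: a_def b_def xe)
  ultimately show "fps_nth (pt_series (Q \<odot> P) x) m = fps_nth (star (pt_series Q) (pt_series P) x) m"
    by (simp add: fps_nth_exp_t[of ?G] star_def bidiff_exp_def)
qed

text \<open>Coefficients beyond order N do not enter, so they may be replaced by 0, which is
  holomorphic everywhere.\<close>

lemma series_comp_cutoff:
  assumes "m \<le> N"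
  shows "fps_nth ((Q \<odot> P) z \<zeta> \<eta>) m =
    fps_nth (((\<lambda>z \<zeta> \<eta>. fps_cutoff (Suc N) (Q z \<zeta> \<eta>)) \<odot> (\<lambda>z \<zeta> \<eta>. fps_cutoff (Suc N) (P z \<zeta> \<eta>))) z \<zeta> \<eta>) m"
proof -
  have "fps_nth (f * g) (m - k) = fps_nth (fps_cutoff (Suc N) f * fps_cutoff (Suc N) g) (m - k)"
    for f g :: "complex fps" and k
    unfolding fps_mult_nth by (rule sum.cong) (use assms in auto)
  then show ?thesis
    by (simp add: series_comp_def exp_t_def)
qed

lemma fps_nth_star_cong:
  assumes "open U" "\<And>x j. x \<in> U \<Longrightarrow> j \<le> m \<Longrightarrow> fps_nth (F x) j = fps_nth (F' x) j"
    "\<And>x j. x \<in> U \<Longrightarrow> j \<le> m \<Longrightarrow> fps_nth (G x) j = fps_nth (G' x) j" "x \<in> U" "j \<le> m"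
  shows "fps_nth (star F G x) j = fps_nth (star F' G' x) j"
  unfolding star_def fps_nth_Abs_fps
  by (intro sum.cong refl fps_nth_bidiff_exp_cong[OF assms(1-4)]) (use assms(5) in auto)

text \<open>
  The domain of the coefficient of \<open>t\<^sup>\<nu>\<close> shrinks as \<open>\<nu>\<close> grows. So identities are proved for series all
  of whose coefficients are holomorphic on one open set, and transferred up to a given order.
\<close>

lemma fps_nth_series_comp:
  assumes U: "open U" "holo_fps U F" "holo_fps U G" and x: "x \<in> U" and "m \<le> N"
    and Q: "\<And>x j. x \<in> U \<Longrightarrow> j \<le> N \<Longrightarrow> fps_nth (pt_series Q x) j = fps_nth (F x) j"
    and P: "\<And>x j. x \<in> U \<Longrightarrow> j \<le> N \<Longrightarrow> fps_nth (pt_series P x) j = fps_nth (G x) j"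
  shows "fps_nth (pt_series (Q \<odot> P) x) m = fps_nth (star F G x) m"
proof -
  define c :: "'a series \<Rightarrow> 'a series" where "c P = (\<lambda>z \<zeta> \<eta>. fps_cutoff (Suc N) (P z \<zeta> \<eta>))" for P
  have c_eq: "pt_series (c P) x = fps_cutoff (Suc N) (pt_series P x)" for P x
    by (simp add: c_def pt_series_def)
  have hol: "holo_fps U (pt_series (c P))" if "holo_fps U F"
    "\<And>x j. x \<in> U \<Longrightarrow> j \<le> N \<Longrightarrow> fps_nth (pt_series P x) j = fps_nth (F x) j" for P F
    unfolding holo_fps_def
  proof
    fix j
    show "holo_on (\<lambda>x. fps_nth (pt_series (c P) x) j) U"
    proof (cases "j \<le> N")
      case True
      show ?thesis
        by (rule holo_on_cong[OF U(1) _ holo_fpsD[OF that(1), of j]]) (use that(2) True in \<open>auto simp: c_eq\<close>)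
    qed (simp add: c_eq)
  qed
  have "fps_nth (pt_series (Q \<odot> P) x) m = fps_nth (pt_series (c Q \<odot> c P) x) m"
    unfolding c_def pt_series_def by (rule series_comp_cutoff[OF \<open>m \<le> N\<close>])
  also have "\<dots> = fps_nth (star (pt_series (c Q)) (pt_series (c P)) x) m"
    by (simp add: series_comp_eq_star[OF U(1) hol[OF U(2) Q] hol[OF U(3) P] x])
  also have "\<dots> = fps_nth (star F G x) m"
    by (rule fps_nth_star_cong[OF U(1) _ _ x \<open>m \<le> N\<close>]) (auto simp: c_eq Q P)
  finally show ?thesis .
qed

section \<open>Neighborhoods on which the coefficients are holomorphic\<close>

lemma cdom_antimono: "c' \<le> c \<Longrightarrow> cdom \<Omega> \<rho> S c \<subseteq> cdom \<Omega> \<rho> S c'"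
  by (auto simp: cdom_def)

text \<open>\<open>D\<close> stands for d(1 - \<rho>), so that it can be changed independently of
  \<rho>.\<close>

definition holo_coeffs :: "((complex ^ 'n) \<times> (complex ^ 'n)) set \<Rightarrow> complex set \<Rightarrow> real \<Rightarrow> real
    \<Rightarrow> 'n::finite series \<Rightarrow> bool"
  where "holo_coeffs \<Omega> S D \<rho> P \<longleftrightarrow>
    (\<forall>\<nu>. holo_near (\<lambda>x. fps_nth (pt_series P x) \<nu>) (cdom \<Omega> \<rho> S ((real \<nu> + 1) * D)))"

lemma holo_series_eq: "holo_series \<Omega> S d \<rho> P = holo_coeffs \<Omega> S (d * (1 - \<rho>)) \<rho> P"
  by (simp add: holo_series_def holo_coeffs_def pt_series_def split_def)

text \<open>The domain of order \<nu> lies in the domains of all lower orders, so the intersection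
  of their finitely many neighborhoods is still a neighborhood of it.\<close>

lemma holo_coeffs_common_domain:
  assumes "holo_coeffs \<Omega> S D \<rho> P" "D > 0"
  obtains U where "open U" "cdom \<Omega> \<rho> S ((real \<nu> + 1) * D) \<subseteq> U"
    "\<And>j. j \<le> \<nu> \<Longrightarrow> holo_on (\<lambda>x. fps_nth (pt_series P x) j) U"
proof -
  obtain V where V: "\<And>j. open (V j)" "\<And>j. cdom \<Omega> \<rho> S ((real j + 1) * D) \<subseteq> V j"
      "\<And>j. holo_on (\<lambda>x. fps_nth (pt_series P x) j) (V j)"
    using assms(1) unfolding holo_coeffs_def holo_near_def by metis
  show ?thesis
  proof (rule that[of "\<Inter>j\<le>\<nu>. V j"])
    show "open (\<Inter>j\<le>\<nu>. V j)" using V(1) by (intro open_INT) auto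
    have "cdom \<Omega> \<rho> S ((real \<nu> + 1) * D) \<subseteq> V j" if "j \<le> \<nu>" for j
      by (rule order_trans[OF cdom_antimono V(2)]) (use that assms(2) in auto)
    then show "cdom \<Omega> \<rho> S ((real \<nu> + 1) * D) \<subseteq> (\<Inter>j\<le>\<nu>. V j)" by blast
    show "holo_on (\<lambda>x. fps_nth (pt_series P x) j) (\<Inter>j\<le>\<nu>. V j)" if "j \<le> \<nu>" for j
      by (rule holo_on_subset[OF V(3)]) (use that in auto)
  qed
qed

lemma holo_fps_cutoff:
  assumes "\<And>j. j \<le> \<nu> \<Longrightarrow> holo_on (\<lambda>x. fps_nth (F x) j) U"
  shows "holo_fps U (\<lambda>x. fps_cutoff (Suc \<nu>) (F x))"
  unfolding holo_fps_def
proof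
  fix j
  show "holo_on (\<lambda>x. fps_nth (fps_cutoff (Suc \<nu>) (F x)) j) U"
    by (cases "j \<le> \<nu>") (use assms in auto)
qed

text \<open>Differentiation is local and order \<nu> uses only orders up to \<nu>, so holomorphy
  survives with the same \<open>D\<close> and \<rho>; constants are lost only in the
  estimates.\<close>

lemma holo_coeffs_comp:
  assumes P: "holo_coeffs \<Omega> S D \<rho> P" and Q: "holo_coeffs \<Omega> S D \<rho> Q" and "D > 0"
  shows "holo_coeffs \<Omega> S D \<rho> (Q \<odot> P)"
  unfolding holo_coeffs_def
proof
  fix \<nu> :: nat
  obtain U where U: "open U" "cdom \<Omega> \<rho> S ((real \<nu> + 1) * D) \<subseteq> U"
    "\<And>j. j \<le> \<nu> \<Longrightarrow> holo_on (\<lambda>x. fps_nth (pt_series P x) j) U"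
    using holo_coeffs_common_domain[OF P \<open>D > 0\<close>] by blast
  obtain V where V: "open V" "cdom \<Omega> \<rho> S ((real \<nu> + 1) * D) \<subseteq> V"
    "\<And>j. j \<le> \<nu> \<Longrightarrow> holo_on (\<lambda>x. fps_nth (pt_series Q x) j) V"
    using holo_coeffs_common_domain[OF Q \<open>D > 0\<close>] by blast
  let ?P = "\<lambda>x. fps_cutoff (Suc \<nu>) (pt_series P x)" and ?Q = "\<lambda>x. fps_cutoff (Suc \<nu>) (pt_series Q x)"
  have UV: "open (U \<inter> V)" using U(1) V(1) by auto
  have hP: "holo_fps (U \<inter> V) ?P"
    by (rule holo_fps_cutoff, rule holo_on_subset[OF U(3)]) auto
  have hQ: "holo_fps (U \<inter> V) ?Q"
    by (rule holo_fps_cutoff, rule holo_on_subset[OF V(3)]) auto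
  have eq: "fps_nth (star ?Q ?P x) \<nu> = fps_nth (pt_series (Q \<odot> P) x) \<nu>" if "x \<in> U \<inter> V" for x
    by (rule fps_nth_series_comp[OF UV hQ hP that order_refl, symmetric]) auto
  have "holo_on (\<lambda>x. fps_nth (pt_series (Q \<odot> P) x) \<nu>) (U \<inter> V)"
    by (rule holo_on_cong[OF UV eq holo_fpsD[OF holo_fps_star[OF UV hQ hP]]])
  then show "holo_near (\<lambda>x. fps_nth (pt_series (Q \<odot> P) x) \<nu>) (cdom \<Omega> \<rho> S ((real \<nu> + 1) * D))"
    unfolding holo_near_def using UV U(2) V(2) by blast
qed

lemma holo_coeffs_common_domain3:
  assumes P: "holo_coeffs \<Omega> S D \<rho> P" and Q: "holo_coeffs \<Omega> S D \<rho> Q" and R: "holo_coeffs \<Omega> S D \<rho> R"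
    and "D > 0"
  obtains U where "open U" "cdom \<Omega> \<rho> S ((real \<nu> + 1) * D) \<subseteq> U"
    "holo_fps U (\<lambda>x. fps_cutoff (Suc \<nu>) (pt_series P x))"
    "holo_fps U (\<lambda>x. fps_cutoff (Suc \<nu>) (pt_series Q x))"
    "holo_fps U (\<lambda>x. fps_cutoff (Suc \<nu>) (pt_series R x))"
proof -
  have "\<exists>U. open U \<and> cdom \<Omega> \<rho> S ((real \<nu> + 1) * D) \<subseteq> U \<and>
      holo_fps U (\<lambda>x. fps_cutoff (Suc \<nu>) (pt_series P x))" if P: "holo_coeffs \<Omega> S D \<rho> P" for P
  proof -
    obtain U where U: "open U" "cdom \<Omega> \<rho> S ((real \<nu> + 1) * D) \<subseteq> U"
        "\<And>j. j \<le> \<nu> \<Longrightarrow> holo_on (\<lambda>x. fps_nth (pt_series P x) j) U"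
      using holo_coeffs_common_domain[OF P \<open>D > 0\<close>] by blast
    with holo_fps_cutoff[OF U(3)] show ?thesis by blast
  qed
  note ex = this
  obtain U1 U2 U3 where U: "open U1" "cdom \<Omega> \<rho> S ((real \<nu> + 1) * D) \<subseteq> U1"
      "holo_fps U1 (\<lambda>x. fps_cutoff (Suc \<nu>) (pt_series P x))"
      "open U2" "cdom \<Omega> \<rho> S ((real \<nu> + 1) * D) \<subseteq> U2"
      "holo_fps U2 (\<lambda>x. fps_cutoff (Suc \<nu>) (pt_series Q x))"
      "open U3" "cdom \<Omega> \<rho> S ((real \<nu> + 1) * D) \<subseteq> U3"
      "holo_fps U3 (\<lambda>x. fps_cutoff (Suc \<nu>) (pt_series R x))"
    using ex[OF P] ex[OF Q] ex[OF R] by metis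
  show ?thesis
  proof (rule that[of "U1 \<inter> U2 \<inter> U3"])
    show "open (U1 \<inter> U2 \<inter> U3)" using U by auto
  qed (use U in \<open>auto intro: holo_fps_subset\<close>)
qed

lemma series_comp_assoc:
  assumes P: "holo_coeffs \<Omega> S D \<rho> P" and Q: "holo_coeffs \<Omega> S D \<rho> Q" and R: "holo_coeffs \<Omega> S D \<rho> R"
    and "D > 0"
  obtains U where "open U" "cdom \<Omega> \<rho> S ((real \<nu> + 1) * D) \<subseteq> U"
    "\<And>x. x \<in> U \<Longrightarrow> fps_nth (pt_series (R \<odot> Q \<odot> P) x) \<nu> = fps_nth (pt_series ((R \<odot> Q) \<odot> P) x) \<nu>"
proof -
  obtain U where U: "open U" "cdom \<Omega> \<rho> S ((real \<nu> + 1) * D) \<subseteq> U"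
    and h: "holo_fps U (\<lambda>x. fps_cutoff (Suc \<nu>) (pt_series P x))"
    "holo_fps U (\<lambda>x. fps_cutoff (Suc \<nu>) (pt_series Q x))"
    "holo_fps U (\<lambda>x. fps_cutoff (Suc \<nu>) (pt_series R x))"
    using holo_coeffs_common_domain3[OF P Q R \<open>D > 0\<close>] by blast
  show ?thesis
  proof (rule that[OF U])
    fix x assume x: "x \<in> U"
    have "fps_nth (pt_series (R \<odot> Q \<odot> P) x) \<nu> = fps_nth (star (\<lambda>x. fps_cutoff (Suc \<nu>) (pt_series R x))
        (star (\<lambda>x. fps_cutoff (Suc \<nu>) (pt_series Q x)) (\<lambda>x. fps_cutoff (Suc \<nu>) (pt_series P x))) x) \<nu>"
      by (rule fps_nth_series_comp[OF U(1) h(3) holo_fps_star[OF U(1) h(2,1)] x order_refl],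
          simp, rule fps_nth_series_comp[OF U(1) h(2,1)]) auto
    also have "\<dots> = fps_nth (star (star (\<lambda>x. fps_cutoff (Suc \<nu>) (pt_series R x))
        (\<lambda>x. fps_cutoff (Suc \<nu>) (pt_series Q x))) (\<lambda>x. fps_cutoff (Suc \<nu>) (pt_series P x)) x) \<nu>"
      by (simp only: star_assoc[OF U(1) h(3,2,1) x])
    also have "\<dots> = fps_nth (pt_series ((R \<odot> Q) \<odot> P) x) \<nu>"
      by (rule fps_nth_series_comp[OF U(1) holo_fps_star[OF U(1) h(3,2)] h(1) x order_refl, symmetric],
          rule fps_nth_series_comp[OF U(1) h(3,2)]) auto
    finally show "fps_nth (pt_series (R \<odot> Q \<odot> P) x) \<nu> = fps_nth (pt_series ((R \<odot> Q) \<odot> P) x) \<nu>" .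
  qed
qed

section \<open>Estimates\<close>

lemma maxnorm_ge: "cmod (z $ i) \<le> maxnorm z"
  unfolding maxnorm_def by (intro Max_ge) auto

lemma maxnorm_le_iff: "maxnorm z \<le> c \<longleftrightarrow> (\<forall>i. cmod (z $ i) \<le> c)"
  unfolding maxnorm_def by (subst Max_le_iff) auto

lemma maxnorm_nonneg [simp]: "0 \<le> maxnorm z"
  using order_trans[OF norm_ge_zero maxnorm_ge] .

lemma maxnorm_zero [simp]: "maxnorm 0 = 0"
  using maxnorm_le_iff[of 0 0] maxnorm_nonneg[of 0] by (intro antisym) auto

lemma maxnorm_triangle: "maxnorm (z + w) \<le> maxnorm z + maxnorm w"
  unfolding maxnorm_le_iff
proof
  fix i
  show "cmod ((z + w) $ i) \<le> maxnorm z + maxnorm w"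
    using norm_triangle_ineq[of "z $ i" "w $ i"] maxnorm_ge[of z i] maxnorm_ge[of w i] by simp
qed

lemma maxnorm_scaleC: "maxnorm (c *\<^sub>C z) = cmod c * maxnorm z"
proof (rule antisym)
  show "maxnorm (c *\<^sub>C z) \<le> cmod c * maxnorm z"
    unfolding maxnorm_le_iff
    by (auto simp: scaleC_vec_def scaleC_complex_def norm_mult intro!: mult_left_mono maxnorm_ge)
  have "Max (range (\<lambda>i. cmod (z $ i))) \<in> range (\<lambda>i. cmod (z $ i))" by (rule Max_in) auto
  then obtain i where "maxnorm z = cmod (z $ i)"
    unfolding maxnorm_def by blast
  then show "cmod c * maxnorm z \<le> maxnorm (c *\<^sub>C z)"
    using maxnorm_ge[of "c *\<^sub>C z" i] by (simp add: scaleC_vec_def scaleC_complex_def norm_mult)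
qed

lemma maxnorm_axis [simp]: "maxnorm (axis i c) = cmod c"
proof (rule antisym)
  show "maxnorm (axis i c) \<le> cmod c" unfolding maxnorm_le_iff by (auto simp: axis_def)
  show "cmod c \<le> maxnorm (axis i c)" using maxnorm_ge[of "axis i c" i] by (simp add: axis_def)
qed

lemma maxnorm_uminus [simp]: "maxnorm (- z) = maxnorm z"
  by (simp add: maxnorm_def)

section \<open>Cauchy estimates for the bidifferential operators\<close>

lemma cderiv_bound:
  fixes f :: "'a::complex_space \<Rightarrow> complex"
  assumes "holo_on f U" "r > 0" "\<And>c. cmod c \<le> r \<Longrightarrow> x + c *\<^sub>C v \<in> U"
    and "\<And>c. cmod c \<le> r \<Longrightarrow> cmod (f (x + c *\<^sub>C v)) \<le> M"
  shows "cmod (cderiv v f x) \<le> M / r"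
proof -
  define g where "g = (\<lambda>c. f (x + c *\<^sub>C v))"
  have g: "(g has_field_derivative cderiv v f (x + c *\<^sub>C v)) (at c)" if "cmod c \<le> r" for c
    unfolding g_def using cderiv_along_line[OF assms(1) assms(3)[OF that]] .
  have c1: "continuous_on (cball 0 r) g"
    by (rule continuous_at_imp_continuous_on) (auto intro!: DERIV_isCont[OF g])
  have c2: "g holomorphic_on ball 0 r"
    unfolding holomorphic_on_open[OF open_ball]
    by (intro ballI exI, rule g) simp
  have "cmod ((deriv ^^ 1) g 0) \<le> fact 1 * M / r ^ 1"
    by (rule Cauchy_inequality[OF c2 c1 assms(2)]) (use assms(4) in \<open>auto simp: g_def\<close>)
  then show ?thesis by (simp add: g_def cderiv_def)
qed

fun scalar_bidiff :: "nat \<Rightarrow> ('n::finite point \<Rightarrow> complex) \<Rightarrow> ('n point \<Rightarrow> complex)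
    \<Rightarrow> 'n point \<Rightarrow> 'n point \<Rightarrow> complex" where
  "scalar_bidiff 0 f g x y = f x * g y"
| "scalar_bidiff (Suc k) f g x y =
    (\<Sum>i\<in>UNIV. scalar_bidiff k (cderiv (dir_zeta i) f) (cderiv (dir_z i) g) x y)"

lemma fps_nth_bidiff:
  "fps_nth (bidiff k F G x y) m =
    (\<Sum>i\<le>m. scalar_bidiff k (\<lambda>x. fps_nth (F x) i) (\<lambda>x. fps_nth (G x) (m - i)) x y)"
proof (induction k arbitrary: F G)
  case 0
  then show ?case by (simp add: fps_mult_nth atMost_atLeast0)
next
  case (Suc k)
  then show ?case
    by (simp add: fps_sum_nth) (rule sum.swap)
qed

text \<open>Regarding scalars as constant series transfers the bilinearity of \<open>bidiff\<close>
  to \<open>scalar_bidiff\<close>.\<close>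

lemma bidiff_scalar:
  "bidiff k (\<lambda>x. fps_const (f x)) (\<lambda>x. fps_const (g x)) x y = fps_const (scalar_bidiff k f g x y)"
proof (induction k arbitrary: f g)
  case (Suc k)
  have D: "cderiv_fps v (\<lambda>x. fps_const (f x)) = (\<lambda>x. fps_const (cderiv v f x))"
    for f and v :: "'a point"
    by (rule ext) (rule cderiv_fps_scalar)
  show ?case
    by (rule fps_ext) (simp add: D Suc fps_sum_nth)
qed simp

lemma fps_const_sum: "fps_const (\<Sum>i\<in>I. f i) = (\<Sum>i\<in>I. fps_const (f i))"
  by (rule fps_ext) (simp add: fps_sum_nth)

lemma scalar_bidiff_sum_right:
  assumes "open U" "\<And>i. i \<in> I \<Longrightarrow> holo_on (g i) U" "x \<in> U"
  shows "scalar_bidiff k f (\<lambda>x. \<Sum>i\<in>I. g i x) x x = (\<Sum>i\<in>I. scalar_bidiff k f (g i) x x)"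
proof -
  have "bidiff k (\<lambda>x. fps_const (f x)) (\<lambda>x. \<Sum>i\<in>I. fps_const (g i x)) x x =
      (\<Sum>i\<in>I. bidiff k (\<lambda>x. fps_const (f x)) (\<lambda>x. fps_const (g i x)) x x)"
    by (rule bidiff_sum_right[OF assms(1) _ assms(3,3)]) (intro holo_fps_scalar assms(2))
  then show ?thesis
    unfolding fps_const_sum[symmetric] bidiff_scalar by simp
qed

lemma scalar_bidiff_sum_left:
  assumes "open U" "\<And>i. i \<in> I \<Longrightarrow> holo_on (f i) U" "x \<in> U"
  shows "scalar_bidiff k (\<lambda>x. \<Sum>i\<in>I. f i x) g x x = (\<Sum>i\<in>I. scalar_bidiff k (f i) g x x)"
proof -
  have "bidiff k (\<lambda>x. \<Sum>i\<in>I. fps_const (f i x)) (\<lambda>x. fps_const (g x)) x x =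
      (\<Sum>i\<in>I. bidiff k (\<lambda>x. fps_const (f i x)) (\<lambda>x. fps_const (g x)) x x)"
    by (rule bidiff_sum_left[OF assms(1) _ assms(3,3)]) (intro holo_fps_scalar assms(2))
  then show ?thesis
    unfolding fps_const_sum[symmetric] bidiff_scalar by simp
qed

text \<open>The k derivatives on each factor are estimated one at a time, each spending a disc of
  radius e1 (in \<zeta>) or e2 (in z) out of the total radius k e1 or k e2. The power of
  \<open>CARD('n)\<close> counts the index tuples.\<close>

lemma scalar_bidiff_bound:
  fixes f g :: "'n::finite point \<Rightarrow> complex"
  assumes "open U" "open V" "holo_on f U" "holo_on g V" "e1 > 0" "e2 > 0"
    and "\<And>\<zeta>'. maxnorm \<zeta>' \<le> real k * e1 \<Longrightarrow> x + (0, \<zeta>', 0) \<in> U \<and> cmod (f (x + (0, \<zeta>', 0))) \<le> M1"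
    and "\<And>z'. maxnorm z' \<le> real k * e2 \<Longrightarrow> y + (z', 0, 0) \<in> V \<and> cmod (g (y + (z', 0, 0))) \<le> M2"
  shows "cmod (scalar_bidiff k f g x y) \<le> (real CARD('n) / (e1 * e2)) ^ k * (M1 * M2)"
  using assms(3,4,7,8)
proof (induction k arbitrary: f g M1 M2)
  case 0
  have "cmod (f x) \<le> M1" "cmod (g y) \<le> M2"
    using 0(3)[of 0] 0(4)[of 0] by (auto simp: zero_prod_def[symmetric])
  then have "cmod (f x) * cmod (g y) \<le> M1 * M2"
    by (intro mult_mono) (auto intro: order_trans[OF norm_ge_zero])
  then show ?case by (simp add: norm_mult)
next
  case (Suc k)
  have f: "x + (0, \<zeta>', 0) \<in> U \<and> cmod (cderiv (dir_zeta i) f (x + (0, \<zeta>', 0))) \<le> M1 / e1"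
    if "maxnorm \<zeta>' \<le> real k * e1" for \<zeta>' i
  proof -
    have "maxnorm (\<zeta>' + axis i c) \<le> real (Suc k) * e1" if "cmod c \<le> e1" for c
      using maxnorm_triangle[of \<zeta>' "axis i c"] that \<open>maxnorm \<zeta>' \<le> real k * e1\<close>
      by (simp add: algebra_simps)
    moreover have "x + (0, \<zeta>', 0) + c *\<^sub>C dir_zeta i = x + (0, \<zeta>' + axis i c, 0)" for c
      by (simp add: dir_zeta_def scaleC_prod_def scaleC_axis add.assoc)
    ultimately have *: "x + (0, \<zeta>', 0) + c *\<^sub>C dir_zeta i \<in> U \<and>
        cmod (f (x + (0, \<zeta>', 0) + c *\<^sub>C dir_zeta i)) \<le> M1" if "cmod c \<le> e1" for c
      using Suc.prems(3) that by metis
    show ?thesis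
      using cderiv_bound[OF Suc.prems(1) assms(5), of "x + (0, \<zeta>', 0)" "dir_zeta i" M1] * *[of 0] assms(5)
      by auto
  qed
  have g: "y + (z', 0, 0) \<in> V \<and> cmod (cderiv (dir_z i) g (y + (z', 0, 0))) \<le> M2 / e2"
    if "maxnorm z' \<le> real k * e2" for z' i
  proof -
    have "maxnorm (z' + axis i c) \<le> real (Suc k) * e2" if "cmod c \<le> e2" for c
      using maxnorm_triangle[of z' "axis i c"] that \<open>maxnorm z' \<le> real k * e2\<close>
      by (simp add: algebra_simps)
    moreover have "y + (z', 0, 0) + c *\<^sub>C dir_z i = y + (z' + axis i c, 0, 0)" for c
      by (simp add: dir_z_def scaleC_prod_def scaleC_axis add.assoc)
    ultimately have *: "y + (z', 0, 0) + c *\<^sub>C dir_z i \<in> V \<and>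
        cmod (g (y + (z', 0, 0) + c *\<^sub>C dir_z i)) \<le> M2" if "cmod c \<le> e2" for c
      using Suc.prems(4) that by metis
    show ?thesis
      using cderiv_bound[OF Suc.prems(2) assms(6), of "y + (z', 0, 0)" "dir_z i" M2] * *[of 0] assms(6)
      by auto
  qed
  have "cmod (scalar_bidiff (Suc k) f g x y) \<le>
      (\<Sum>i\<in>(UNIV::'n set). (real CARD('n) / (e1 * e2)) ^ k * (M1 / e1 * (M2 / e2)))"
    unfolding scalar_bidiff.simps
    by (rule sum_norm_le, rule Suc.IH[OF holo_on_cderiv[OF assms(1) Suc.prems(1)]
          holo_on_cderiv[OF assms(2) Suc.prems(2)] f g])
  also have "\<dots> = (real CARD('n) / (e1 * e2)) ^ Suc k * (M1 * M2)"
    using assms(5,6) by (simp add: field_simps)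
  finally show ?case .
qed

text \<open>k^k / k! is one term of the series of exp k, and e \<le> 3.\<close>

lemma power_self_le_fact: "real k ^ k \<le> 3 ^ k * fact k"
proof -
  note E = exp_converges[of "real k"]
  have "(\<Sum>n\<in>{k}. real k ^ n /\<^sub>R fact n) \<le> (\<Sum>n. real k ^ n /\<^sub>R fact n)"
    by (rule sum_le_suminf[OF sums_summable[OF E]]) auto
  then have "real k ^ k / fact k \<le> exp (real k)"
    unfolding sums_unique[OF E, symmetric] by (simp add: divide_inverse mult.commute)
  also have "\<dots> \<le> 3 ^ k"
    using exp_le by (simp add: exp_of_nat_mult[of k 1, simplified] power_mono)
  finally show ?thesis by (simp add: divide_le_eq)
qed

text \<open>Cauchy estimates in polydiscs of radii \<open>\<epsilon> / k\<close> and \<open>\<epsilon> \<parallel>\<zeta>\<parallel> / k\<close> suffice, as \<open>k\<^sup>k \<le> 3\<^sup>k k!\<close>.\<close>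

lemma scalar_bidiff_fact_bound:
  fixes f g :: "'n::finite point \<Rightarrow> complex"
  assumes "open U" "open V" "holo_on f U" "holo_on g V" "\<epsilon> > 0" "A > 0" "D > 0"
    and D: "D \<ge> 3 * real CARD('n) / (\<epsilon>\<^sup>2 * A)" and L: "L \<ge> real k * D"
    and f: "\<And>\<zeta>'. maxnorm \<zeta>' \<le> \<epsilon> * L \<Longrightarrow> x + (0, \<zeta>', 0) \<in> U \<and> cmod (f (x + (0, \<zeta>', 0))) \<le> M1"
    and g: "\<And>z'. maxnorm z' \<le> \<epsilon> \<Longrightarrow> x + (z', 0, 0) \<in> V \<and> cmod (g (x + (z', 0, 0))) \<le> M2"
  shows "cmod (scalar_bidiff k f g x x / fact k) \<le> A ^ k * (M1 * M2)"
\<comment> \<open>The radii \<epsilon> / k and \<epsilon> L / k used below need k > 0.\<close>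
proof (cases "k = 0")
  case True
  have "0 \<le> L" using L assms(7) True by simp
  then have "cmod (f x) \<le> M1" "cmod (g x) \<le> M2"
    using f[of 0] g[of 0] assms(5) by (auto simp: zero_prod_def[symmetric])
  then have "cmod (f x) * cmod (g x) \<le> M1 * M2"
    by (intro mult_mono) (auto intro: order_trans[OF norm_ge_zero])
  then show ?thesis using True by (simp add: norm_mult)
next
  case False
  then have k: "real k > 0" by simp
  then have Lpos: "L > 0" using L assms(7) by (meson less_le_trans mult_pos_pos)
  have M: "M1 \<ge> 0" "M2 \<ge> 0"
    using f[of 0] g[of 0] assms(5) Lpos by (auto intro: order_trans[OF norm_ge_zero])
  define N where "N = real CARD('n)"
  have "cmod (scalar_bidiff k f g x x) \<le> (N / ((\<epsilon> * L / k) * (\<epsilon> / k))) ^ k * (M1 * M2)"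
    unfolding N_def
    by (rule scalar_bidiff_bound[OF assms(1-4)]) (use k Lpos assms(5) f g in auto)
  also have "N / ((\<epsilon> * L / k) * (\<epsilon> / k)) = N / (\<epsilon>\<^sup>2 * L) * real k * real k"
    using k by (simp add: power2_eq_square field_simps)
  also have "(N / (\<epsilon>\<^sup>2 * L) * real k * real k) ^ k = (N * real k / (\<epsilon>\<^sup>2 * L)) ^ k * real k ^ k"
    by (simp add: power_mult_distrib[symmetric])
  also have "(N * real k / (\<epsilon>\<^sup>2 * L)) ^ k * real k ^ k \<le> (N * real k / (\<epsilon>\<^sup>2 * L)) ^ k * (3 ^ k * fact k)"
    using Lpos by (intro mult_left_mono power_self_le_fact zero_le_power) (auto simp: N_def)
  also have "\<dots> = (3 * N * real k / (\<epsilon>\<^sup>2 * L)) ^ k * fact k"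
    by (simp add: power_mult_distrib[symmetric] mult_ac)
  also have "(3 * N * real k / (\<epsilon>\<^sup>2 * L)) ^ k * fact k \<le> A ^ k * fact k"
  proof (intro mult_right_mono power_mono)
    \<comment> \<open>The threshold on D enters here: with L \<ge> k D the base 3 N k /
      (\<epsilon>^2 L) is at most 3 N / (\<epsilon>^2 D) \<le> A.\<close>
    have "3 * N \<le> D * (\<epsilon>\<^sup>2 * A)"
      using D assms(5,6) by (simp add: N_def divide_le_eq)
    then have "3 * N * real k \<le> (D * (\<epsilon>\<^sup>2 * A)) * real k" by (simp add: mult_right_mono)
    also have "\<dots> \<le> A * (\<epsilon>\<^sup>2 * L)"
      using mult_left_mono[OF L, of "\<epsilon>\<^sup>2 * A"] assms(5,6) by (simp add: mult_ac)
    finally show "3 * N * real k / (\<epsilon>\<^sup>2 * L) \<le> A"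
      using Lpos assms(5) by (simp add: divide_le_eq)
  qed (use Lpos in \<open>auto simp: N_def\<close>)
  finally have "cmod (scalar_bidiff k f g x x) \<le> A ^ k * fact k * (M1 * M2)"
    using M by (simp add: mult_right_mono)
  then show ?thesis
    by (simp add: norm_divide divide_le_eq mult_ac)
qed

text \<open>The estimate of the composition at order m has at most (m + 1)^2 terms; enlarging the
  ratio from A to B pays for them.\<close>

lemma poly_times_power_bound:
  fixes A B :: real
  assumes "0 < A" "A < B"
  obtains K where "K > 0" "\<And>m. (real m + 1)\<^sup>2 * A ^ m \<le> K * B ^ m"
proof -
  \<comment> \<open>The square root gives each of the two factors m + 1 its own decaying power
    q^m.\<close>
  define q where "q = sqrt (A / B)"
  have q: "0 < q" "q < 1" "q\<^sup>2 = A / B"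
    using assms by (auto simp: q_def)
  have "Bseq (\<lambda>m. of_nat m * q ^ m)"
    using powser_times_n_limit_0[of q] q by (intro convergent_imp_Bseq convergentI) auto
  then obtain K where K: "K > 0" "\<And>m. norm (of_nat m * q ^ m) \<le> K"
    unfolding Bseq_def by auto
  have "(real m + 1)\<^sup>2 * A ^ m \<le> (K + 1)\<^sup>2 * B ^ m" for m
  proof -
    have "(real m + 1) * q ^ m \<le> K + 1"
      using K(2)[of m] q power_le_one[of q m] by (simp add: distrib_right)
    then have "((real m + 1) * q ^ m)\<^sup>2 \<le> (K + 1)\<^sup>2"
      using q by (intro power_mono) auto
    then have "(real m + 1)\<^sup>2 * (A / B) ^ m \<le> (K + 1)\<^sup>2"
      using q(3) by (simp add: power_mult_distrib power_commutes flip: power_mult q(3)) (simp add: mult.commute)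
    then show ?thesis
      using assms by (simp add: power_divide field_simps)
  qed
  with K(1) show ?thesis by (intro that[of "(K + 1)\<^sup>2"]) auto
qed

section \<open>Shifting points inside the enlarged domains\<close>

lemma maxnorm_scaleR: "maxnorm (c *\<^sub>R z) = \<bar>c\<bar> * maxnorm z"
  using maxnorm_scaleC[of "of_real c" z] by (simp add: scaleC_of_real)

lemma maxnorm_le_norm: "maxnorm z \<le> norm z"
  unfolding maxnorm_le_iff using Finite_Cartesian_Product.norm_nth_le by blast

lemma continuous_on_maxnorm [continuous_intros]:
  fixes f :: "'a::topological_space \<Rightarrow> complex ^ 'n::finite"
  assumes "continuous_on S f"
  shows "continuous_on S (\<lambda>x. maxnorm (f x))"
proof (rule continuous_on_compose2[OF _ assms subset_UNIV])
  have "1-lipschitz_on UNIV (maxnorm :: complex ^ 'n::finite \<Rightarrow> real)"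
  proof (rule lipschitz_onI)
    fix x y :: "complex ^ 'n::finite"
    have "maxnorm x \<le> maxnorm y + norm (x - y)" for x y :: "complex ^ 'n::finite"
      using maxnorm_triangle[of y "x - y"] maxnorm_le_norm[of "x - y"] by simp
    from this[of x y] this[of y x] show "dist (maxnorm x) (maxnorm y) \<le> 1 * dist x y"
      by (simp add: dist_norm norm_minus_commute abs_le_iff)
  qed simp
  then show "continuous_on UNIV (maxnorm :: complex ^ 'n::finite \<Rightarrow> real)"
    by (rule lipschitz_on_continuous_on)
qed

text \<open>\<open>enlarge\<close> is a closure, so the shift is extended to a continuous map that
  sends the set before closure for \<rho>/2 into the one for \<rho>; continuity then carries this
  over to the closures. The relative fibre sizes add up to 7/8 \<rho>: the part \<rho>/2 already
  spent, and \<rho>/4 of a covector of size at most 3/2 ||\<zeta>0||.\<close>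

lemma enlarge_shift:
  assumes x: "(z, \<zeta>) \<in> enlarge \<Omega> (\<rho> / 2)" and "0 < \<rho>" "\<rho> < 1"
    and z': "maxnorm z' \<le> \<rho> / 4" and \<zeta>': "maxnorm \<zeta>' \<le> \<rho> / 4 * maxnorm \<zeta>"
  shows "(z + z', \<zeta> + \<zeta>') \<in> enlarge \<Omega> \<rho>"
proof -
  define B where "B \<rho> = (\<Union>(z, \<zeta>)\<in>\<Omega>.
    {(z + z', \<zeta> + \<zeta>') | z' \<zeta>'. maxnorm z' \<le> \<rho> \<and> maxnorm \<zeta>' \<le> \<rho> * maxnorm \<zeta>})" for \<rho>
  \<comment> \<open>The fibre shift is made proportional to the size of the fibre variable at y,
    because the condition defining the enlargement is relative to that size; at y = (z, \<zeta>)
    with \<zeta> nonzero the factor is 1.\<close>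
  define g where "g y = (fst y + z', snd y + (maxnorm (snd y) / maxnorm \<zeta>) *\<^sub>R \<zeta>')" for y :: "(complex ^ 'a) \<times> (complex ^ 'a)"
  have "continuous_on UNIV g"
    unfolding g_def divide_inverse by (intro continuous_intros)
  then have cont: "continuous_on (closure (B (\<rho> / 2))) g"
    by (rule continuous_on_subset) auto
  have "g ` B (\<rho> / 2) \<subseteq> B \<rho>"
  proof
    fix y assume "y \<in> g ` B (\<rho> / 2)"
    then obtain z0 \<zeta>0 z1 \<zeta>1 where 0: "(z0, \<zeta>0) \<in> \<Omega>" and 1: "maxnorm z1 \<le> \<rho> / 2"
        "maxnorm \<zeta>1 \<le> \<rho> / 2 * maxnorm \<zeta>0" and y: "y = g (z0 + z1, \<zeta>0 + \<zeta>1)"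
      unfolding B_def by auto
    define \<kappa> where "\<kappa> = (maxnorm (\<zeta>0 + \<zeta>1) / maxnorm \<zeta>) *\<^sub>R \<zeta>'"
    have "maxnorm \<kappa> = maxnorm (\<zeta>0 + \<zeta>1) * (maxnorm \<zeta>' / maxnorm \<zeta>)"
      by (simp add: \<kappa>_def maxnorm_scaleR)
    also have "\<dots> \<le> maxnorm (\<zeta>0 + \<zeta>1) * (\<rho> / 4)"
    proof (rule mult_left_mono)
      show "maxnorm \<zeta>' / maxnorm \<zeta> \<le> \<rho> / 4"
        using \<zeta>' \<open>0 < \<rho>\<close> maxnorm_nonneg[of \<zeta>]
        by (cases "maxnorm \<zeta> = 0") (auto simp: divide_le_eq less_le)
    qed simp
    also have "\<dots> \<le> (3 / 2 * maxnorm \<zeta>0) * (\<rho> / 4)"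
    proof (rule mult_right_mono)
      have "\<rho> / 2 * maxnorm \<zeta>0 \<le> 1 / 2 * maxnorm \<zeta>0"
        using \<open>\<rho> < 1\<close> by (intro mult_right_mono) auto
      then show "maxnorm (\<zeta>0 + \<zeta>1) \<le> 3 / 2 * maxnorm \<zeta>0"
        using maxnorm_triangle[of \<zeta>0 \<zeta>1] 1(2) by simp
    qed (use \<open>0 < \<rho>\<close> in simp)
    finally have \<kappa>: "maxnorm \<kappa> \<le> 3 / 8 * \<rho> * maxnorm \<zeta>0" by (simp add: mult_ac)
    have "maxnorm (z1 + z') \<le> \<rho>"
      using maxnorm_triangle[of z1 z'] 1(1) z' \<open>0 < \<rho>\<close> by simp
    moreover have "maxnorm (\<zeta>1 + \<kappa>) \<le> \<rho> * maxnorm \<zeta>0"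
    proof -
      have "maxnorm (\<zeta>1 + \<kappa>) \<le> 7 / 8 * \<rho> * maxnorm \<zeta>0"
        using maxnorm_triangle[of \<zeta>1 \<kappa>] 1(2) \<kappa> by simp
      also have "\<dots> \<le> \<rho> * maxnorm \<zeta>0"
        using \<open>0 < \<rho>\<close> by (intro mult_right_mono) auto
      finally show ?thesis .
    qed
    moreover have "y = (z0 + (z1 + z'), \<zeta>0 + (\<zeta>1 + \<kappa>))"
      by (simp add: y g_def \<kappa>_def add.assoc)
    ultimately show "y \<in> B \<rho>"
      unfolding B_def using 0 by blast
  qed
  then have "g ` closure (B (\<rho> / 2)) \<subseteq> closure (B \<rho>)"
    using closure_subset by (intro image_closure_subset[OF cont]) auto
  moreover have "(z, \<zeta>) \<in> closure (B (\<rho> / 2))"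
    using x by (simp add: enlarge_def B_def)
  ultimately have "g (z, \<zeta>) \<in> enlarge \<Omega> \<rho>"
    unfolding enlarge_def B_def by blast
  moreover have "g (z, \<zeta>) = (z + z', \<zeta> + \<zeta>')"
  \<comment> \<open>For \<zeta> = 0 the quotient in g is 0 by convention, and the hypothesis forces
    \<zeta>' = 0 as well.\<close>
  proof (cases "maxnorm \<zeta> = 0")
    case True
    then have "maxnorm \<zeta>' \<le> 0" using \<zeta>' by simp
    then have "\<zeta>' = 0" unfolding maxnorm_le_iff by (auto simp: vec_eq_iff)
    then show ?thesis by (simp add: g_def)
  qed (simp add: g_def)
  ultimately show ?thesis by simp
qed

text \<open>A fibre shift of relative size \<rho>/4 costs at most half of ||\<zeta>||, which is why
  the bound has to be at least 2c before the shift.\<close>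

lemma cdom_shift:
  assumes "(z, \<zeta>, \<eta>) \<in> cdom \<Omega> (\<rho> / 2) Z c'" and "0 < \<rho>" "\<rho> < 1" and "2 * c \<le> c'"
    and "maxnorm z' \<le> \<rho> / 4" and "maxnorm \<zeta>' \<le> \<rho> / 4 * maxnorm \<zeta>"
  shows "(z + z', \<zeta> + \<zeta>', \<eta>) \<in> cdom \<Omega> \<rho> Z c"
proof -
  have "(z + z', \<zeta> + \<zeta>') \<in> enlarge \<Omega> \<rho>"
    by (rule enlarge_shift[OF _ assms(2,3,5,6)]) (use assms(1) in \<open>simp add: cdom_def\<close>)
  moreover have "c \<le> maxnorm (\<eta> *\<^sub>C (\<zeta> + \<zeta>'))"
  proof -
    have "\<rho> / 4 * maxnorm \<zeta> \<le> 1 / 2 * maxnorm \<zeta>"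
      using assms(3) by (intro mult_right_mono) auto
    then have "maxnorm \<zeta> / 2 \<le> maxnorm (\<zeta> + \<zeta>')"
      using maxnorm_triangle[of "\<zeta> + \<zeta>'" "- \<zeta>'"] assms(6) by simp
    then have "cmod \<eta> * (maxnorm \<zeta> / 2) \<le> cmod \<eta> * maxnorm (\<zeta> + \<zeta>')"
      by (intro mult_left_mono) auto
    moreover have "2 * c \<le> cmod \<eta> * maxnorm \<zeta>"
      using assms(1,4) by (simp add: cdom_def maxnorm_scaleC)
    ultimately show ?thesis by (simp add: maxnorm_scaleC)
  qed
  ultimately show ?thesis
    using assms(1) by (simp add: cdom_def)
qed

section \<open>Monotonicity of the domains and of the bounds\<close>

lemma enlarge_mono:
  assumes "\<rho>' \<le> \<rho>"
  shows "enlarge \<Omega> \<rho>' \<subseteq> enlarge \<Omega> \<rho>"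
  unfolding enlarge_def
proof (intro closure_mono UN_mono order_refl, clarify)
  fix z \<zeta> z' \<zeta>' :: "complex ^ 'a"
  assume "maxnorm z' \<le> \<rho>'" "maxnorm \<zeta>' \<le> \<rho>' * maxnorm \<zeta>"
  then have "maxnorm z' \<le> \<rho> \<and> maxnorm \<zeta>' \<le> \<rho> * maxnorm \<zeta>"
    using assms mult_right_mono[OF assms, of "maxnorm \<zeta>"] by auto
  then show "\<exists>z'' \<zeta>''. (z + z', \<zeta> + \<zeta>') = (z + z'', \<zeta> + \<zeta>'') \<and> maxnorm z'' \<le> \<rho> \<and>
      maxnorm \<zeta>'' \<le> \<rho> * maxnorm \<zeta>" by blast
qed

lemma cdom_mono:
  assumes "\<rho>' \<le> \<rho>" "c \<le> c'" "Z \<subseteq> S"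
  shows "cdom \<Omega> \<rho>' Z c' \<subseteq> cdom \<Omega> \<rho> S c"
  using enlarge_mono[OF assms(1)] assms(2,3) by (auto simp: cdom_def)

text \<open>Here and in \<open>N_bound\<close> the constants that have to be tracked are explicit,
  while the constant C may still depend on Z and h.\<close>

definition S_bound :: "((complex ^ 'n) \<times> (complex ^ 'n)) set \<Rightarrow> complex set \<Rightarrow> real \<Rightarrow> real \<Rightarrow> real
    \<Rightarrow> 'n::finite series \<Rightarrow> bool"
  where "S_bound \<Omega> S D \<rho> A P \<longleftrightarrow> holo_coeffs \<Omega> S D \<rho> P \<and>
    (\<forall>Z h. relcompact Z S \<and> h > 0 \<longrightarrow> (\<exists>C>0. \<forall>\<nu>. \<forall>x\<in>cdom \<Omega> \<rho> Z ((real \<nu> + 1) * D).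
      cmod (fps_nth (pt_series P x) \<nu>) \<le> C * A ^ \<nu> * exp (h * maxnorm (fst (snd x)))))"

definition N_bound :: "((complex ^ 'n) \<times> (complex ^ 'n)) set \<Rightarrow> complex set \<Rightarrow> real \<Rightarrow> real \<Rightarrow> real
    \<Rightarrow> 'n::finite series \<Rightarrow> bool"
  where "N_bound \<Omega> S D \<rho> A P \<longleftrightarrow> holo_coeffs \<Omega> S D \<rho> P \<and>
    (\<forall>Z h. relcompact Z S \<and> h > 0 \<longrightarrow> (\<exists>C>0. \<forall>m. \<forall>x\<in>cdom \<Omega> \<rho> Z (real m * D).
      cmod (\<Sum>\<nu><m. fps_nth (pt_series P x) \<nu>) \<le> C * A ^ m * exp (h * maxnorm (fst (snd x)))))"

lemma S_boundD:
  assumes "S_bound \<Omega> S D \<rho> A P" "relcompact Z S" "h > 0"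
  obtains C where "C > 0" "\<And>\<nu> x. x \<in> cdom \<Omega> \<rho> Z ((real \<nu> + 1) * D) \<Longrightarrow>
      cmod (fps_nth (pt_series P x) \<nu>) \<le> C * A ^ \<nu> * exp (h * maxnorm (fst (snd x)))"
  using assms unfolding S_bound_def by meson

lemma N_boundD:
  assumes "N_bound \<Omega> S D \<rho> A P" "relcompact Z S" "h > 0"
  obtains C where "C > 0" "\<And>m x. x \<in> cdom \<Omega> \<rho> Z (real m * D) \<Longrightarrow>
      cmod (\<Sum>\<nu><m. fps_nth (pt_series P x) \<nu>) \<le> C * A ^ m * exp (h * maxnorm (fst (snd x)))"
  using assms unfolding N_bound_def by meson

text \<open>The map from (d, \<rho>) to (d(1 - \<rho>), \<rho>) is a bijection of the admissible
  parameters.\<close>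

lemma ex_scaled_param:
  fixes R :: "real \<Rightarrow> real \<Rightarrow> bool"
  shows "(\<exists>d>0. \<exists>\<rho>\<in>{0<..<1}. R (d * (1 - \<rho>)) \<rho>) \<longleftrightarrow> (\<exists>D>0. \<exists>\<rho>\<in>{0<..<1}. R D \<rho>)"
proof
  assume "\<exists>d>0. \<exists>\<rho>\<in>{0<..<1}. R (d * (1 - \<rho>)) \<rho>"
  then obtain d \<rho> where "d > 0" "\<rho> \<in> {0<..<1}" "R (d * (1 - \<rho>)) \<rho>" by blast
  then show "\<exists>D>0. \<exists>\<rho>\<in>{0<..<1}. R D \<rho>" by (intro exI[of _ "d * (1 - \<rho>)"]) auto
next
  assume "\<exists>D>0. \<exists>\<rho>\<in>{0<..<1}. R D \<rho>"
  then obtain D \<rho> where *: "D > 0" "\<rho> \<in> {0<..<1}" "R D \<rho>" by blast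
  then have "D / (1 - \<rho>) * (1 - \<rho>) = D" "D / (1 - \<rho>) > 0" by auto
  with * show "\<exists>d>0. \<exists>\<rho>\<in>{0<..<1}. R (d * (1 - \<rho>)) \<rho>" by metis
qed

lemma N_hat_iff:
  "P \<in> N_hat \<Omega> S \<longleftrightarrow> (\<exists>D>0. \<exists>\<rho>\<in>{0<..<1}. \<exists>A\<in>{0<..<1}. N_bound \<Omega> S D \<rho> A P)"
proof -
  have "P \<in> N_hat \<Omega> S \<longleftrightarrow>
      (\<exists>d>0. \<exists>\<rho>\<in>{0<..<1}. \<exists>A\<in>{0<..<1}. N_bound \<Omega> S (d * (1 - \<rho>)) \<rho> A P)"
    unfolding N_hat_def N_bound_def holo_series_eq pt_series_def split_def mem_Collect_eq by blast
  then show ?thesis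
    unfolding ex_scaled_param[of "\<lambda>D \<rho>. \<exists>A\<in>{0<..<1}. N_bound \<Omega> S D \<rho> A P"] .
qed

lemma S_hat_iff:
  "P \<in> S_hat \<Omega> S \<longleftrightarrow> (\<exists>D>0. \<exists>\<rho>\<in>{0<..<1}. \<exists>A\<in>{0<..<1}. S_bound \<Omega> S D \<rho> A P) \<and> d_eta P \<in> N_hat \<Omega> S"
proof -
  have "P \<in> S_hat \<Omega> S \<longleftrightarrow>
      (\<exists>d>0. \<exists>\<rho>\<in>{0<..<1}. \<exists>A\<in>{0<..<1}. S_bound \<Omega> S (d * (1 - \<rho>)) \<rho> A P) \<and> d_eta P \<in> N_hat \<Omega> S"
    unfolding S_hat_def S_bound_def holo_series_eq pt_series_def split_def mem_Collect_eq by blast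
  then show ?thesis
    unfolding ex_scaled_param[of "\<lambda>D \<rho>. \<exists>A\<in>{0<..<1}. S_bound \<Omega> S D \<rho> A P"] .
qed

lemma holo_coeffs_mono:
  assumes "holo_coeffs \<Omega> S D \<rho> P" "D \<le> D'" "\<rho>' \<le> \<rho>"
  shows "holo_coeffs \<Omega> S D' \<rho>' P"
  unfolding holo_coeffs_def holo_near_def
proof
  fix \<nu> :: nat
  obtain U where "open U" "cdom \<Omega> \<rho> S ((real \<nu> + 1) * D) \<subseteq> U" "holo_on (\<lambda>x. fps_nth (pt_series P x) \<nu>) U"
    using assms(1) unfolding holo_coeffs_def holo_near_def by blast
  moreover have "cdom \<Omega> \<rho>' S ((real \<nu> + 1) * D') \<subseteq> cdom \<Omega> \<rho> S ((real \<nu> + 1) * D)"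
    using assms(2,3) by (intro cdom_mono mult_left_mono) auto
  ultimately show "\<exists>U. open U \<and> cdom \<Omega> \<rho>' S ((real \<nu> + 1) * D') \<subseteq> U \<and>
      holo_on (\<lambda>x. fps_nth (pt_series P x) \<nu>) U" by blast
qed

text \<open>Larger D and smaller \<rho> shrink the domains and larger A weakens the bound, so
  finitely many series can be given common constants.\<close>

lemma S_bound_mono:
  assumes "S_bound \<Omega> S D \<rho> A P" "D \<le> D'" "\<rho>' \<le> \<rho>" "0 < A" "A \<le> A'"
  shows "S_bound \<Omega> S D' \<rho>' A' P"
  unfolding S_bound_def
proof (intro conjI allI impI)
  show "holo_coeffs \<Omega> S D' \<rho>' P"
    using assms holo_coeffs_mono unfolding S_bound_def by blast
  fix Z and h :: real assume "relcompact Z S \<and> 0 < h"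
  then obtain C where C: "C > 0" "\<And>\<nu> x. x \<in> cdom \<Omega> \<rho> Z ((real \<nu> + 1) * D) \<Longrightarrow>
      cmod (fps_nth (pt_series P x) \<nu>) \<le> C * A ^ \<nu> * exp (h * maxnorm (fst (snd x)))"
    using S_boundD[OF assms(1)] by metis
  show "\<exists>C>0. \<forall>\<nu>. \<forall>x\<in>cdom \<Omega> \<rho>' Z ((real \<nu> + 1) * D').
      cmod (fps_nth (pt_series P x) \<nu>) \<le> C * A' ^ \<nu> * exp (h * maxnorm (fst (snd x)))"
  proof (intro exI[of _ C] conjI allI ballI C(1))
    fix \<nu> x assume "x \<in> cdom \<Omega> \<rho>' Z ((real \<nu> + 1) * D')"
    then have "x \<in> cdom \<Omega> \<rho> Z ((real \<nu> + 1) * D)"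
      using cdom_mono[of \<rho>' \<rho> "(real \<nu> + 1) * D" "(real \<nu> + 1) * D'" Z Z \<Omega>] assms(2,3)
      by (auto intro: mult_left_mono)
    then have "cmod (fps_nth (pt_series P x) \<nu>) \<le> C * A ^ \<nu> * exp (h * maxnorm (fst (snd x)))"
      by (rule C(2))
    also have "\<dots> \<le> C * A' ^ \<nu> * exp (h * maxnorm (fst (snd x)))"
      using assms(4,5) C(1) by (intro mult_right_mono mult_left_mono power_mono) auto
    finally show "cmod (fps_nth (pt_series P x) \<nu>) \<le> C * A' ^ \<nu> * exp (h * maxnorm (fst (snd x)))" .
  qed
qed

lemma N_bound_mono:
  assumes "N_bound \<Omega> S D \<rho> A P" "D \<le> D'" "\<rho>' \<le> \<rho>" "0 < A" "A \<le> A'"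
  shows "N_bound \<Omega> S D' \<rho>' A' P"
  unfolding N_bound_def
proof (intro conjI allI impI)
  show "holo_coeffs \<Omega> S D' \<rho>' P"
    using assms holo_coeffs_mono unfolding N_bound_def by blast
  fix Z and h :: real assume "relcompact Z S \<and> 0 < h"
  then obtain C where C: "C > 0" "\<And>m x. x \<in> cdom \<Omega> \<rho> Z (real m * D) \<Longrightarrow>
      cmod (\<Sum>\<nu><m. fps_nth (pt_series P x) \<nu>) \<le> C * A ^ m * exp (h * maxnorm (fst (snd x)))"
    using N_boundD[OF assms(1)] by metis
  show "\<exists>C>0. \<forall>m. \<forall>x\<in>cdom \<Omega> \<rho>' Z (real m * D').
      cmod (\<Sum>\<nu><m. fps_nth (pt_series P x) \<nu>) \<le> C * A' ^ m * exp (h * maxnorm (fst (snd x)))"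
  proof (intro exI[of _ C] conjI allI ballI C(1))
    fix m x assume "x \<in> cdom \<Omega> \<rho>' Z (real m * D')"
    then have "x \<in> cdom \<Omega> \<rho> Z (real m * D)"
      using subsetD[OF cdom_mono[OF assms(3) mult_left_mono[OF assms(2) of_nat_0_le_iff] order_refl]]
      by blast
    then have "cmod (\<Sum>\<nu><m. fps_nth (pt_series P x) \<nu>) \<le> C * A ^ m * exp (h * maxnorm (fst (snd x)))"
      by (rule C(2))
    also have "\<dots> \<le> C * A' ^ m * exp (h * maxnorm (fst (snd x)))"
      using assms(4,5) C(1) by (intro mult_right_mono mult_left_mono power_mono) auto
    finally show "cmod (\<Sum>\<nu><m. fps_nth (pt_series P x) \<nu>) \<le> C * A' ^ m * exp (h * maxnorm (fst (snd x)))" .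
  qed
qed

section \<open>Estimates of the composition\<close>

lemma fps_nth_series_comp_sum:
  assumes P: "holo_coeffs \<Omega> S D \<rho> P" and Q: "holo_coeffs \<Omega> S D \<rho> Q" and "D > 0"
    and x: "x \<in> cdom \<Omega> \<rho> S ((real \<nu> + 1) * D)"
  shows "fps_nth (pt_series (Q \<odot> P) x) \<nu> = (\<Sum>k\<le>\<nu>. \<Sum>i\<le>\<nu> - k. scalar_bidiff k
    (\<lambda>x. fps_nth (pt_series Q x) i) (\<lambda>x. fps_nth (pt_series P x) (\<nu> - k - i)) x x / fact k)"
proof -
  let ?P = "\<lambda>x. fps_cutoff (Suc \<nu>) (pt_series P x)" and ?Q = "\<lambda>x. fps_cutoff (Suc \<nu>) (pt_series Q x)"
  obtain U where U: "open U" "cdom \<Omega> \<rho> S ((real \<nu> + 1) * D) \<subseteq> U" "holo_fps U ?P" "holo_fps U ?Q"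
    using holo_coeffs_common_domain3[OF P Q Q \<open>D > 0\<close>] by blast
  have "fps_nth (pt_series (Q \<odot> P) x) \<nu> = fps_nth (star ?Q ?P x) \<nu>"
    by (rule fps_nth_series_comp[OF U(1,4,3) _ order_refl]) (use U(2) x in auto)
  also have "\<dots> = (\<Sum>k\<le>\<nu>. \<Sum>i\<le>\<nu> - k. scalar_bidiff k
      (\<lambda>x. fps_nth (?Q x) i) (\<lambda>x. fps_nth (?P x) (\<nu> - k - i)) x x / fact k)"
    by (simp add: star_def bidiff_exp_def fps_nth_bidiff sum_divide_distrib)
  also have "\<dots> = (\<Sum>k\<le>\<nu>. \<Sum>i\<le>\<nu> - k. scalar_bidiff k
      (\<lambda>x. fps_nth (pt_series Q x) i) (\<lambda>x. fps_nth (pt_series P x) (\<nu> - k - i)) x x / fact k)"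
  proof (intro sum.cong refl)
    fix k i assume "k \<in> {..\<nu>}" "i \<in> {..\<nu> - k}"
    then have "i < Suc \<nu>" "\<nu> - k - i < Suc \<nu>" by auto
    then show "scalar_bidiff k (\<lambda>x. fps_nth (?Q x) i) (\<lambda>x. fps_nth (?P x) (\<nu> - k - i)) x x / fact k =
        scalar_bidiff k (\<lambda>x. fps_nth (pt_series Q x) i) (\<lambda>x. fps_nth (pt_series P x) (\<nu> - k - i)) x x / fact k"
      by simp
  qed
  finally show ?thesis .
qed

text \<open>Since |\<eta>| \<le> 1, the lower bound on ||\<eta> \<zeta>|| is also one on
  ||\<zeta>||, as the Cauchy estimate wants. Within the polydisc ||\<zeta> + \<zeta>'|| \<le> 2
  ||\<zeta>||, so the rate h/4 of each factor becomes at most h/2, and the product has rate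
  h.\<close>

lemma scalar_bidiff_cdom_bound:
  fixes \<Omega> :: "((complex ^ 'n) \<times> (complex ^ 'n::finite)) set"
  assumes x: "(z, \<zeta>, \<eta>) \<in> cdom \<Omega> (\<rho> / 2) Z (real m * D')" and "cmod \<eta> \<le> 1"
    and \<rho>: "0 < \<rho>" "\<rho> < 1" and "0 < A" "0 < D" and "2 * D \<le> D'"
    and D': "D' \<ge> 3 * real CARD('n) / ((\<rho> / 4)\<^sup>2 * A)" and "k \<le> m" and "h > 0"
    and U: "open U" "cdom \<Omega> \<rho> Z (real m * D) \<subseteq> U" and f: "holo_on f U" and g: "holo_on g U"
    and C1: "\<And>x. x \<in> cdom \<Omega> \<rho> Z (real m * D) \<Longrightarrow> cmod (f x) \<le> C1 * A ^ i * exp (h / 4 * maxnorm (fst (snd x)))"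
    and C2: "\<And>x. x \<in> cdom \<Omega> \<rho> Z (real m * D) \<Longrightarrow> cmod (g x) \<le> C2 * A ^ j * exp (h / 4 * maxnorm (fst (snd x)))"
    and "C1 > 0" "C2 > 0"
  shows "cmod (scalar_bidiff k f g (z, \<zeta>, \<eta>) (z, \<zeta>, \<eta>) / fact k) \<le>
    A ^ (k + i + j) * (C1 * C2) * exp (h * maxnorm \<zeta>)"
proof -
  define B1 B2 where "B1 = C1 * A ^ i" and "B2 = C2 * A ^ j"
  have B: "B1 \<ge> 0" "B2 \<ge> 0" using assms(5,17,18) by (auto simp: B1_def B2_def)
  let ?L = "maxnorm \<zeta>"
  have "real m * D' \<le> cmod \<eta> * ?L"
    using x by (simp add: cdom_def maxnorm_scaleC)
  also have "\<dots> \<le> 1 * ?L"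
    using assms(2) by (intro mult_right_mono) auto
  finally have "real m * D' \<le> ?L" by simp
  moreover have "real k * D' \<le> real m * D'"
    using \<open>k \<le> m\<close> assms(6,7) by (intro mult_right_mono) auto
  ultimately have L: "real k * D' \<le> ?L" by simp
  have le: "2 * (real m * D) \<le> real m * D'"
    using mult_left_mono[OF assms(7), of "real m"] by simp
  have "cmod (scalar_bidiff k f g (z, \<zeta>, \<eta>) (z, \<zeta>, \<eta>) / fact k) \<le>
      A ^ k * ((B1 * exp (h / 2 * ?L)) * (B2 * exp (h / 2 * ?L)))"
  proof (rule scalar_bidiff_fact_bound[OF U(1,1) f g _ \<open>0 < A\<close> _ D' L])
    fix \<zeta>' :: "complex ^ 'n" assume \<zeta>': "maxnorm \<zeta>' \<le> \<rho> / 4 * ?L"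
    have in_dom: "(z, \<zeta> + \<zeta>', \<eta>) \<in> cdom \<Omega> \<rho> Z (real m * D)"
      using cdom_shift[OF x \<rho> le, of 0 \<zeta>'] \<zeta>' \<rho> by simp
    have "maxnorm (\<zeta> + \<zeta>') \<le> 2 * ?L"
      using maxnorm_triangle[of \<zeta> \<zeta>'] \<zeta>' mult_right_mono[of "\<rho> / 4" 1 ?L] \<rho> by simp
    then have "B1 * exp (h / 4 * maxnorm (\<zeta> + \<zeta>')) \<le> B1 * exp (h / 2 * ?L)"
      using \<open>h > 0\<close> B(1) by (intro mult_left_mono) auto
    then show "(z, \<zeta>, \<eta>) + (0, \<zeta>', 0) \<in> U \<and> cmod (f ((z, \<zeta>, \<eta>) + (0, \<zeta>', 0))) \<le> B1 * exp (h / 2 * ?L)"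
      using C1[OF in_dom, folded B1_def] in_dom U(2) by auto
  next
    fix z' :: "complex ^ 'n" assume z': "maxnorm z' \<le> \<rho> / 4"
    have in_dom: "(z + z', \<zeta>, \<eta>) \<in> cdom \<Omega> \<rho> Z (real m * D)"
      using cdom_shift[OF x \<rho> le, of z' 0] z' \<rho> by simp
    have "B2 * exp (h / 4 * ?L) \<le> B2 * exp (h / 2 * ?L)"
      using \<open>h > 0\<close> B(2) by (intro mult_left_mono) (auto intro: mult_right_mono)
    then show "(z, \<zeta>, \<eta>) + (z', 0, 0) \<in> U \<and> cmod (g ((z, \<zeta>, \<eta>) + (z', 0, 0))) \<le> B2 * exp (h / 2 * ?L)"
      using C2[OF in_dom, folded B2_def] in_dom U(2) by auto
  qed (use \<rho> assms(6,7) in auto)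
  also have "\<dots> = A ^ k * (B1 * B2) * (exp (h / 2 * ?L) * exp (h / 2 * ?L))"
    by (simp add: mult_ac)
  also have "exp (h / 2 * ?L) * exp (h / 2 * ?L) = exp (h * ?L)"
    by (simp flip: exp_add)
  also have "A ^ k * (B1 * B2) = A ^ (k + i + j) * (C1 * C2)"
    by (simp add: B1_def B2_def power_add mult_ac)
  finally show ?thesis .
qed

lemma triangle_sum:
  fixes g :: "nat \<Rightarrow> nat \<Rightarrow> 'a::comm_monoid_add"
  shows "(\<Sum>l<n. \<Sum>i\<le>l. g i (l - i)) = (\<Sum>i<n. \<Sum>j<n - i. g i j)"
    and "(\<Sum>l<n. \<Sum>i\<le>l. g i (l - i)) = (\<Sum>j<n. \<Sum>i<n - j. g i j)"
proof -
  have *: "(\<Sum>l<n. \<Sum>i\<le>l. g i (l - i)) = (\<Sum>i<n. \<Sum>j<n - i. g i j)" for g :: "nat \<Rightarrow> nat \<Rightarrow> 'a"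
  proof -
    have "{(i, j). i + j < n} = (SIGMA i:{..<n}. {..<n - i})" by auto
    then show ?thesis
      by (simp add: sum.triangle_reindex[symmetric] sum.Sigma)
  qed
  show "(\<Sum>l<n. \<Sum>i\<le>l. g i (l - i)) = (\<Sum>i<n. \<Sum>j<n - i. g i j)" by (rule *)
  have "(\<Sum>i\<le>l. g i (l - i)) = (\<Sum>i\<le>l. g (l - i) i)" for l
    by (rule sum.reindex_bij_witness[of _ "\<lambda>i. l - i" "\<lambda>i. l - i"]) auto
  then show "(\<Sum>l<n. \<Sum>i\<le>l. g i (l - i)) = (\<Sum>j<n. \<Sum>i<n - j. g i j)"
    using *[of "\<lambda>i j. g j i"] by simp
qed

text \<open>The two orders of summation serve the two cases of a null factor: with k and i fixed the
  inner sum is a partial sum in the index of the right factor, with k and j fixed in that of the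
  left factor.\<close>

lemma triple_triangle_sum:
  fixes T :: "nat \<Rightarrow> nat \<Rightarrow> nat \<Rightarrow> 'a::comm_monoid_add"
  shows "(\<Sum>\<nu><m. \<Sum>k\<le>\<nu>. \<Sum>i\<le>\<nu> - k. T k i (\<nu> - k - i)) = (\<Sum>k<m. \<Sum>i<m - k. \<Sum>j<m - k - i. T k i j)"
    and "(\<Sum>\<nu><m. \<Sum>k\<le>\<nu>. \<Sum>i\<le>\<nu> - k. T k i (\<nu> - k - i)) = (\<Sum>k<m. \<Sum>j<m - k. \<Sum>i<m - k - j. T k i j)"
  using triangle_sum(1)[of "\<lambda>k l. \<Sum>i\<le>l. T k i (l - i)" m]
  by (simp_all only: triangle_sum(1)[where g = "T _"], simp_all only: triangle_sum(2)[where g = "T _"])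

lemma cmod_double_sum_le:
  fixes f :: "nat \<Rightarrow> nat \<Rightarrow> complex"
  assumes "\<And>k i. k \<in> K \<Longrightarrow> i \<in> I k \<Longrightarrow> cmod (f k i) \<le> c" "card K \<le> N" "\<And>k. k \<in> K \<Longrightarrow> card (I k) \<le> N" "c \<ge> 0"
  shows "cmod (\<Sum>k\<in>K. \<Sum>i\<in>I k. f k i) \<le> (real N)\<^sup>2 * c"
proof -
  have "cmod (\<Sum>k\<in>K. \<Sum>i\<in>I k. f k i) \<le> of_nat (card K) * (real N * c)"
  proof (rule sum_norm_bound)
    fix k assume k: "k \<in> K"
    have "cmod (\<Sum>i\<in>I k. f k i) \<le> of_nat (card (I k)) * c"
      by (rule sum_norm_bound) (rule assms(1)[OF k])
    also have "\<dots> \<le> real N * c"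
      using assms(3)[OF k] assms(4) by (intro mult_right_mono) auto
    finally show "cmod (\<Sum>i\<in>I k. f k i) \<le> real N * c" .
  qed
  also have "\<dots> \<le> real N * (real N * c)"
    using assms(2,4) by (intro mult_right_mono) auto
  finally show ?thesis by (simp add: power2_eq_square mult.assoc)
qed

lemma relcompact_subset: "relcompact Z S \<Longrightarrow> Z \<subseteq> S"
  unfolding relcompact_def using closure_subset by blast

lemma bound_absorb_poly:
  assumes "(real m + 1)\<^sup>2 * A ^ m \<le> K * B ^ m" "C \<ge> 0" "E \<ge> 0"
  shows "(real (Suc m))\<^sup>2 * (A ^ m * C * E) \<le> (K * C) * B ^ m * E"
proof -
  have "(real (Suc m))\<^sup>2 * (A ^ m * C * E) = ((real m + 1)\<^sup>2 * A ^ m) * (C * E)"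
    by (simp add: mult_ac add.commute)
  also have "\<dots> \<le> (K * B ^ m) * (C * E)"
    using assms by (intro mult_right_mono) auto
  finally show ?thesis by (simp add: mult_ac)
qed

text \<open>The Cauchy estimate contributes A^k and the two coefficients A^i and A^j with k + i + j
  = \<nu>, so each of the at most (\<nu> + 1)^2 terms is of size A^\<nu>; their number is absorbed
  by A'.\<close>

lemma S_bound_comp:
  fixes \<Omega> :: "((complex ^ 'n) \<times> (complex ^ 'n::finite)) set"
  assumes Q: "S_bound \<Omega> S D \<rho> A Q" and P: "S_bound \<Omega> S D \<rho> A P" and S: "\<And>\<eta>. \<eta> \<in> S \<Longrightarrow> cmod \<eta> \<le> 1"
    and \<rho>: "0 < \<rho>" "\<rho> < 1" and A: "0 < A" "A < A'" and D: "0 < D" "2 * D \<le> D'"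
    and D': "D' \<ge> 3 * real CARD('n) / ((\<rho> / 4)\<^sup>2 * A)"
  shows "S_bound \<Omega> S D' (\<rho> / 2) A' (Q \<odot> P)"
  unfolding S_bound_def
proof (intro conjI allI impI)
  have hP: "holo_coeffs \<Omega> S D \<rho> P" and hQ: "holo_coeffs \<Omega> S D \<rho> Q"
    using P Q by (auto simp: S_bound_def)
  show "holo_coeffs \<Omega> S D' (\<rho> / 2) (Q \<odot> P)"
    by (rule holo_coeffs_mono[OF holo_coeffs_comp[OF hP hQ D(1)]]) (use D \<rho> in auto)
  fix Z and h :: real assume Zh: "relcompact Z S \<and> 0 < h"
  then have ZS: "Z \<subseteq> S" and h: "h > 0" "h / 4 > 0" using relcompact_subset by auto
  obtain CQ where CQ: "CQ > 0" "\<And>\<nu> x. x \<in> cdom \<Omega> \<rho> Z ((real \<nu> + 1) * D) \<Longrightarrow>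
      cmod (fps_nth (pt_series Q x) \<nu>) \<le> CQ * A ^ \<nu> * exp (h / 4 * maxnorm (fst (snd x)))"
    using S_boundD[OF Q _ h(2)] Zh by metis
  obtain CP where CP: "CP > 0" "\<And>\<nu> x. x \<in> cdom \<Omega> \<rho> Z ((real \<nu> + 1) * D) \<Longrightarrow>
      cmod (fps_nth (pt_series P x) \<nu>) \<le> CP * A ^ \<nu> * exp (h / 4 * maxnorm (fst (snd x)))"
    using S_boundD[OF P _ h(2)] Zh by metis
  obtain K where K: "K > 0" "\<And>m. (real m + 1)\<^sup>2 * A ^ m \<le> K * A' ^ m"
    using poly_times_power_bound[OF A] by blast
  show "\<exists>C>0. \<forall>\<nu>. \<forall>x\<in>cdom \<Omega> (\<rho> / 2) Z ((real \<nu> + 1) * D').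
      cmod (fps_nth (pt_series (Q \<odot> P) x) \<nu>) \<le> C * A' ^ \<nu> * exp (h * maxnorm (fst (snd x)))"
  proof (intro exI[of _ "K * (CQ * CP)"] conjI allI ballI)
    fix \<nu> :: nat and x assume x: "x \<in> cdom \<Omega> (\<rho> / 2) Z ((real \<nu> + 1) * D')"
    obtain z \<zeta> \<eta> where xe: "x = (z, \<zeta>, \<eta>)" using prod_cases3 by blast
    have \<eta>: "cmod \<eta> \<le> 1" using x ZS S by (auto simp: xe cdom_def)
    have "cdom \<Omega> (\<rho> / 2) Z ((real \<nu> + 1) * D') \<subseteq> cdom \<Omega> \<rho> S ((real \<nu> + 1) * D)"
      using \<rho> D ZS by (intro cdom_mono mult_left_mono) auto
    with x have xD: "x \<in> cdom \<Omega> \<rho> S ((real \<nu> + 1) * D)" by blast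
    obtain U where U: "open U" "cdom \<Omega> \<rho> S ((real \<nu> + 1) * D) \<subseteq> U"
        "\<And>j. j \<le> \<nu> \<Longrightarrow> holo_on (\<lambda>x. fps_nth (pt_series P x) j) U"
      using holo_coeffs_common_domain[OF hP D(1)] by blast
    obtain V where V: "open V" "cdom \<Omega> \<rho> S ((real \<nu> + 1) * D) \<subseteq> V"
        "\<And>j. j \<le> \<nu> \<Longrightarrow> holo_on (\<lambda>x. fps_nth (pt_series Q x) j) V"
      using holo_coeffs_common_domain[OF hQ D(1)] by blast
    have ZU: "cdom \<Omega> \<rho> Z (real (Suc \<nu>) * D) \<subseteq> U \<inter> V"
      using cdom_mono[OF order_refl order_refl ZS, of \<Omega> \<rho> "(real \<nu> + 1) * D"] U(2) V(2)
      by (auto simp: add.commute)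
    have sub: "cdom \<Omega> \<rho> Z (real (Suc \<nu>) * D) \<subseteq> cdom \<Omega> \<rho> Z ((real i + 1) * D)" if "i \<le> \<nu>" for i
      using that D by (intro cdom_mono mult_right_mono) auto
    let ?E = "exp (h * maxnorm \<zeta>)"
    have "cmod (fps_nth (pt_series (Q \<odot> P) x) \<nu>) \<le> (real (Suc \<nu>))\<^sup>2 * (A ^ \<nu> * (CQ * CP) * ?E)"
      unfolding fps_nth_series_comp_sum[OF hP hQ D(1) xD]
    proof (rule cmod_double_sum_le)
      fix k i assume ki: "k \<in> {..\<nu>}" "i \<in> {..\<nu> - k}"
      define j where "j = \<nu> - k - i"
      have kij: "k + i + j = \<nu>" using ki by (auto simp: j_def)
      have "cmod (scalar_bidiff k (\<lambda>x. fps_nth (pt_series Q x) i) (\<lambda>x. fps_nth (pt_series P x) j) (z, \<zeta>, \<eta>) (z, \<zeta>, \<eta>) / fact k)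
          \<le> A ^ (k + i + j) * (CQ * CP) * ?E"
      \<comment> \<open>The domain of order \<nu> carries the bound (\<nu> + 1) D, hence m = \<nu> +
        1; it lies in the domains of all orders up to \<nu>.\<close>
      proof (rule scalar_bidiff_cdom_bound[where m = "Suc \<nu>" and U = "U \<inter> V"])
        show "(z, \<zeta>, \<eta>) \<in> cdom \<Omega> (\<rho> / 2) Z (real (Suc \<nu>) * D')"
          using x by (simp add: xe add.commute)
        show "holo_on (\<lambda>x. fps_nth (pt_series Q x) i) (U \<inter> V)"
          by (rule holo_on_subset[OF V(3)]) (use kij in auto)
        show "holo_on (\<lambda>x. fps_nth (pt_series P x) j) (U \<inter> V)"
          by (rule holo_on_subset[OF U(3)]) (use kij in auto)
      next
        fix y assume y: "y \<in> cdom \<Omega> \<rho> Z (real (Suc \<nu>) * D)"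
        show "cmod (fps_nth (pt_series Q y) i) \<le> CQ * A ^ i * exp (h / 4 * maxnorm (fst (snd y)))"
          by (rule CQ(2)) (use sub[of i] y kij in auto)
        show "cmod (fps_nth (pt_series P y) j) \<le> CP * A ^ j * exp (h / 4 * maxnorm (fst (snd y)))"
          by (rule CP(2)) (use sub[of j] y kij in auto)
      qed (use \<eta> \<rho> A D D' kij h U(1) V(1) ZU CQ(1) CP(1) in auto)
      then show "cmod (scalar_bidiff k (\<lambda>x. fps_nth (pt_series Q x) i)
          (\<lambda>x. fps_nth (pt_series P x) (\<nu> - k - i)) x x / fact k) \<le> A ^ \<nu> * (CQ * CP) * ?E"
        by (simp add: kij) (simp add: xe j_def)
    qed (use A CQ(1) CP(1) in auto)
    also have "\<dots> \<le> (K * (CQ * CP)) * A' ^ \<nu> * ?E"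
      using CQ(1) CP(1) by (intro bound_absorb_poly K(2)) auto
    finally show "cmod (fps_nth (pt_series (Q \<odot> P) x) \<nu>) \<le>
        K * (CQ * CP) * A' ^ \<nu> * exp (h * maxnorm (fst (snd x)))"
      by (simp add: xe)
  qed (use K CQ CP in auto)
qed

text \<open>
  A partial sum of the composition is a sum of bidifferential operators applied to a coefficient of
  the symbol and a partial sum of the null symbol.
\<close>

lemma N_bound_comp:
  fixes \<Omega> :: "((complex ^ 'n) \<times> (complex ^ 'n::finite)) set"
  assumes QP: "S_bound \<Omega> S D \<rho> A Q \<and> N_bound \<Omega> S D \<rho> A P \<or> N_bound \<Omega> S D \<rho> A Q \<and> S_bound \<Omega> S D \<rho> A P"
    and S: "\<And>\<eta>. \<eta> \<in> S \<Longrightarrow> cmod \<eta> \<le> 1"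
    and \<rho>: "0 < \<rho>" "\<rho> < 1" and A: "0 < A" "A < A'" and D: "0 < D" "2 * D \<le> D'"
    and D': "D' \<ge> 3 * real CARD('n) / ((\<rho> / 4)\<^sup>2 * A)"
  shows "N_bound \<Omega> S D' (\<rho> / 2) A' (Q \<odot> P)"
  unfolding N_bound_def
proof (intro conjI allI impI)
  have hP: "holo_coeffs \<Omega> S D \<rho> P" and hQ: "holo_coeffs \<Omega> S D \<rho> Q"
    using QP by (auto simp: S_bound_def N_bound_def)
  show "holo_coeffs \<Omega> S D' (\<rho> / 2) (Q \<odot> P)"
    by (rule holo_coeffs_mono[OF holo_coeffs_comp[OF hP hQ D(1)]]) (use D \<rho> in auto)
  fix Z and h :: real assume Zh: "relcompact Z S \<and> 0 < h"
  then have ZS: "Z \<subseteq> S" and h: "h > 0" "h / 4 > 0" using relcompact_subset by auto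
  obtain K where K: "K > 0" "\<And>m. (real m + 1)\<^sup>2 * A ^ m \<le> K * A' ^ m"
    using poly_times_power_bound[OF A] by blast
  define T where "T x k i j = scalar_bidiff k (\<lambda>x. fps_nth (pt_series Q x) i)
      (\<lambda>x. fps_nth (pt_series P x) j) x x / fact k" for x k i j
  \<comment> \<open>Only m > 0 is treated: the coefficients below order m are then holomorphic near
    the domain with bound m D, while for m = 0 the partial sum is empty.\<close>
  have main: "\<exists>CQ>0. \<exists>CP>0. \<forall>m>0. \<forall>x\<in>cdom \<Omega> (\<rho> / 2) Z (real m * D').
      cmod (\<Sum>\<nu><m. \<Sum>k\<le>\<nu>. \<Sum>i\<le>\<nu> - k. T x k i (\<nu> - k - i)) \<le>
        (real (Suc m))\<^sup>2 * (A ^ m * (CQ * CP) * exp (h * maxnorm (fst (snd x))))"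
  proof -
    have dom: "\<exists>U. open U \<and> cdom \<Omega> \<rho> Z (real m * D) \<subseteq> U \<and>
        (\<forall>j<m. holo_on (\<lambda>x. fps_nth (pt_series P x) j) U) \<and> (\<forall>j<m. holo_on (\<lambda>x. fps_nth (pt_series Q x) j) U)"
      if m0: "m > 0" for m
    proof -
      obtain n where m: "m = Suc n" using m0 gr0_conv_Suc by blast
      obtain U where U: "open U" "cdom \<Omega> \<rho> S ((real n + 1) * D) \<subseteq> U"
          "\<And>j. j \<le> n \<Longrightarrow> holo_on (\<lambda>x. fps_nth (pt_series P x) j) U"
        using holo_coeffs_common_domain[OF hP D(1)] by blast
      obtain V where V: "open V" "cdom \<Omega> \<rho> S ((real n + 1) * D) \<subseteq> V"
          "\<And>j. j \<le> n \<Longrightarrow> holo_on (\<lambda>x. fps_nth (pt_series Q x) j) V"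
        using holo_coeffs_common_domain[OF hQ D(1)] by blast
      have "cdom \<Omega> \<rho> Z (real m * D) \<subseteq> cdom \<Omega> \<rho> S ((real n + 1) * D)"
        using ZS by (intro cdom_mono) (auto simp: m add.commute)
      then show ?thesis
        using U V by (intro exI[of _ "U \<inter> V"])
          (auto simp: m less_Suc_eq_le intro: holo_on_subset[of _ U "U \<inter> V"] holo_on_subset[of _ V "U \<inter> V"])
    qed
    have sub: "cdom \<Omega> \<rho> Z (real m * D) \<subseteq> cdom \<Omega> \<rho> Z (real l * D)" if "l \<le> m" for l m
      using that D by (intro cdom_mono mult_right_mono) auto
    have sub1: "cdom \<Omega> \<rho> Z (real m * D) \<subseteq> cdom \<Omega> \<rho> Z ((real i + 1) * D)" if "i < m" for i m
      using sub[of "Suc i" m] that by (auto simp: add.commute)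
    have x_in: "x \<in> cdom \<Omega> \<rho> Z (real m * D)" if "x \<in> cdom \<Omega> (\<rho> / 2) Z (real m * D')" for x m
    proof -
      have "cdom \<Omega> (\<rho> / 2) Z (real m * D') \<subseteq> cdom \<Omega> \<rho> Z (real m * D)"
        using \<rho> D by (intro cdom_mono mult_left_mono) auto
      with that show ?thesis by blast
    qed
    have \<eta>: "cmod \<eta> \<le> 1" if "(z, \<zeta>, \<eta>) \<in> cdom \<Omega> (\<rho> / 2) Z c" for z \<zeta> \<eta> c
      using that ZS S by (auto simp: cdom_def)
    from QP show ?thesis
    proof
      assume QP: "S_bound \<Omega> S D \<rho> A Q \<and> N_bound \<Omega> S D \<rho> A P"
      obtain CQ where CQ: "CQ > 0" "\<And>\<nu> x. x \<in> cdom \<Omega> \<rho> Z ((real \<nu> + 1) * D) \<Longrightarrow>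
          cmod (fps_nth (pt_series Q x) \<nu>) \<le> CQ * A ^ \<nu> * exp (h / 4 * maxnorm (fst (snd x)))"
        using S_boundD[OF conjunct1[OF QP] _ h(2)] Zh by metis
      obtain CP where CP: "CP > 0" "\<And>m x. x \<in> cdom \<Omega> \<rho> Z (real m * D) \<Longrightarrow>
          cmod (\<Sum>\<nu><m. fps_nth (pt_series P x) \<nu>) \<le> CP * A ^ m * exp (h / 4 * maxnorm (fst (snd x)))"
        using N_boundD[OF conjunct2[OF QP] _ h(2)] Zh by metis
      show ?thesis
      proof (rule exI[of _ CQ], rule conjI[OF CQ(1)], rule exI[of _ CP], rule conjI[OF CP(1)], intro allI impI ballI)
        fix m :: nat and x assume m: "m > 0" and x: "x \<in> cdom \<Omega> (\<rho> / 2) Z (real m * D')"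
        obtain z \<zeta> \<eta> where xe: "x = (z, \<zeta>, \<eta>)" using prod_cases3 by blast
        obtain U where U: "open U" "cdom \<Omega> \<rho> Z (real m * D) \<subseteq> U"
            "\<And>j. j < m \<Longrightarrow> holo_on (\<lambda>x. fps_nth (pt_series P x) j) U"
            "\<And>j. j < m \<Longrightarrow> holo_on (\<lambda>x. fps_nth (pt_series Q x) j) U"
          using dom[OF m] by blast
        have xU: "x \<in> U" using x_in[OF x] U(2) by blast
        show "cmod (\<Sum>\<nu><m. \<Sum>k\<le>\<nu>. \<Sum>i\<le>\<nu> - k. T x k i (\<nu> - k - i)) \<le>
            (real (Suc m))\<^sup>2 * (A ^ m * (CQ * CP) * exp (h * maxnorm (fst (snd x))))"
          \<comment> \<open>With k and i fixed, the inner sum runs over the coefficients of P below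
            order l = m - k - i. As a partial sum of a null symbol it is of size A^l, so the total
            power is A^m.\<close>
          unfolding triple_triangle_sum(1)[of "T x" m]
        proof (rule cmod_double_sum_le)
          fix k i assume ki: "k \<in> {..<m}" "i \<in> {..<m - k}"
          define l where "l = m - k - i"
          have kil: "k + i + l = m" "i < m" "k \<le> m" "l \<le> m" using ki by (auto simp: l_def)
          have hol: "\<And>j. j \<in> {..<l} \<Longrightarrow> holo_on (\<lambda>x. fps_nth (pt_series P x) j) U"
            using U(3) kil by auto
          have "(\<Sum>j<l. T x k i j) = scalar_bidiff k (\<lambda>x. fps_nth (pt_series Q x) i)
              (\<lambda>x. \<Sum>j<l. fps_nth (pt_series P x) j) x x / fact k"
            using scalar_bidiff_sum_right[where I = "{..<l}" and g = "\<lambda>j x. fps_nth (pt_series P x) j",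
              OF U(1) hol xU, where k = k and f = "\<lambda>x. fps_nth (pt_series Q x) i"]
            by (simp add: T_def sum_divide_distrib)
          also have "cmod \<dots> \<le> A ^ (k + i + l) * (CQ * CP) * exp (h * maxnorm \<zeta>)"
            unfolding xe
          proof (rule scalar_bidiff_cdom_bound[where m = m and U = U])
            show "holo_on (\<lambda>x. \<Sum>j<l. fps_nth (pt_series P x) j) U"
              by (rule holo_on_sum[OF hol])
          next
            fix y assume y: "y \<in> cdom \<Omega> \<rho> Z (real m * D)"
            show "cmod (fps_nth (pt_series Q y) i) \<le> CQ * A ^ i * exp (h / 4 * maxnorm (fst (snd y)))"
              by (rule CQ(2)) (use sub1[of i m] y kil in auto)
            show "cmod (\<Sum>j<l. fps_nth (pt_series P y) j) \<le> CP * A ^ l * exp (h / 4 * maxnorm (fst (snd y)))"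
              by (rule CP(2)) (use sub[of l m] y kil in auto)
          qed (use x \<eta> \<rho> A D D' kil h U CQ(1) CP(1) in \<open>auto simp: xe\<close>)
          finally show "cmod (\<Sum>j<m - k - i. T x k i j) \<le> A ^ m * (CQ * CP) * exp (h * maxnorm (fst (snd x)))"
            by (simp only: kil(1)) (simp add: xe l_def)
        qed (use A CQ(1) CP(1) in auto)
      qed
    next
      assume QP: "N_bound \<Omega> S D \<rho> A Q \<and> S_bound \<Omega> S D \<rho> A P"
      obtain CQ where CQ: "CQ > 0" "\<And>m x. x \<in> cdom \<Omega> \<rho> Z (real m * D) \<Longrightarrow>
          cmod (\<Sum>\<nu><m. fps_nth (pt_series Q x) \<nu>) \<le> CQ * A ^ m * exp (h / 4 * maxnorm (fst (snd x)))"
        using N_boundD[OF conjunct1[OF QP] _ h(2)] Zh by metis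
      obtain CP where CP: "CP > 0" "\<And>\<nu> x. x \<in> cdom \<Omega> \<rho> Z ((real \<nu> + 1) * D) \<Longrightarrow>
          cmod (fps_nth (pt_series P x) \<nu>) \<le> CP * A ^ \<nu> * exp (h / 4 * maxnorm (fst (snd x)))"
        using S_boundD[OF conjunct2[OF QP] _ h(2)] Zh by metis
      show ?thesis
      proof (rule exI[of _ CQ], rule conjI[OF CQ(1)], rule exI[of _ CP], rule conjI[OF CP(1)], intro allI impI ballI)
        fix m :: nat and x assume m: "m > 0" and x: "x \<in> cdom \<Omega> (\<rho> / 2) Z (real m * D')"
        obtain z \<zeta> \<eta> where xe: "x = (z, \<zeta>, \<eta>)" using prod_cases3 by blast
        obtain U where U: "open U" "cdom \<Omega> \<rho> Z (real m * D) \<subseteq> U"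
            "\<And>j. j < m \<Longrightarrow> holo_on (\<lambda>x. fps_nth (pt_series P x) j) U"
            "\<And>j. j < m \<Longrightarrow> holo_on (\<lambda>x. fps_nth (pt_series Q x) j) U"
          using dom[OF m] by blast
        have xU: "x \<in> U" using x_in[OF x] U(2) by blast
        show "cmod (\<Sum>\<nu><m. \<Sum>k\<le>\<nu>. \<Sum>i\<le>\<nu> - k. T x k i (\<nu> - k - i)) \<le>
            (real (Suc m))\<^sup>2 * (A ^ m * (CQ * CP) * exp (h * maxnorm (fst (snd x))))"
          \<comment> \<open>Now k and j are fixed and the partial sum is one of Q.\<close>
          unfolding triple_triangle_sum(2)[of "T x" m]
        proof (rule cmod_double_sum_le)
          fix k j assume kj: "k \<in> {..<m}" "j \<in> {..<m - k}"
          define l where "l = m - k - j"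
          have kjl: "k + l + j = m" "j < m" "k \<le> m" "l \<le> m" using kj by (auto simp: l_def)
          have hol: "\<And>i. i \<in> {..<l} \<Longrightarrow> holo_on (\<lambda>x. fps_nth (pt_series Q x) i) U"
            using U(4) kjl by auto
          have "(\<Sum>i<l. T x k i j) = scalar_bidiff k (\<lambda>x. \<Sum>i<l. fps_nth (pt_series Q x) i)
              (\<lambda>x. fps_nth (pt_series P x) j) x x / fact k"
            using scalar_bidiff_sum_left[where I = "{..<l}" and f = "\<lambda>i x. fps_nth (pt_series Q x) i",
              OF U(1) hol xU, where k = k and g = "\<lambda>x. fps_nth (pt_series P x) j"]
            by (simp add: T_def sum_divide_distrib)
          also have "cmod \<dots> \<le> A ^ (k + l + j) * (CQ * CP) * exp (h * maxnorm \<zeta>)"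
            unfolding xe
          proof (rule scalar_bidiff_cdom_bound[where m = m and U = U])
            show "holo_on (\<lambda>x. \<Sum>i<l. fps_nth (pt_series Q x) i) U"
              by (rule holo_on_sum[OF hol])
          next
            fix y assume y: "y \<in> cdom \<Omega> \<rho> Z (real m * D)"
            show "cmod (fps_nth (pt_series P y) j) \<le> CP * A ^ j * exp (h / 4 * maxnorm (fst (snd y)))"
              by (rule CP(2)) (use sub1[of j m] y kjl in auto)
            show "cmod (\<Sum>i<l. fps_nth (pt_series Q y) i) \<le> CQ * A ^ l * exp (h / 4 * maxnorm (fst (snd y)))"
              by (rule CQ(2)) (use sub[of l m] y kjl in auto)
          qed (use x \<eta> \<rho> A D D' kjl h U CQ(1) CP(1) in \<open>auto simp: xe\<close>)
          finally show "cmod (\<Sum>i<m - k - j. T x k i j) \<le> A ^ m * (CQ * CP) * exp (h * maxnorm (fst (snd x)))"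
            by (simp only: kjl(1)) (simp add: xe l_def)
        qed (use A CQ(1) CP(1) in auto)
      qed
    qed
  qed
  then obtain CQ CP where C: "CQ > 0" "CP > 0" "\<And>m x. m > 0 \<Longrightarrow> x \<in> cdom \<Omega> (\<rho> / 2) Z (real m * D') \<Longrightarrow>
      cmod (\<Sum>\<nu><m. \<Sum>k\<le>\<nu>. \<Sum>i\<le>\<nu> - k. T x k i (\<nu> - k - i)) \<le>
        (real (Suc m))\<^sup>2 * (A ^ m * (CQ * CP) * exp (h * maxnorm (fst (snd x))))"
    by blast
  show "\<exists>C>0. \<forall>m. \<forall>x\<in>cdom \<Omega> (\<rho> / 2) Z (real m * D').
      cmod (\<Sum>\<nu><m. fps_nth (pt_series (Q \<odot> P) x) \<nu>) \<le> C * A' ^ m * exp (h * maxnorm (fst (snd x)))"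
  proof (intro exI[of _ "K * (CQ * CP)"] conjI allI ballI)
    fix m :: nat and x assume x: "x \<in> cdom \<Omega> (\<rho> / 2) Z (real m * D')"
    show "cmod (\<Sum>\<nu><m. fps_nth (pt_series (Q \<odot> P) x) \<nu>) \<le>
        K * (CQ * CP) * A' ^ m * exp (h * maxnorm (fst (snd x)))"
    proof (cases "m = 0")
      case True
      then show ?thesis using K C(1,2) by simp
    next
      case False
      have "fps_nth (pt_series (Q \<odot> P) x) \<nu> = (\<Sum>k\<le>\<nu>. \<Sum>i\<le>\<nu> - k. T x k i (\<nu> - k - i))"
        if "\<nu> \<in> {..<m}" for \<nu>
        unfolding T_def
      proof (rule fps_nth_series_comp_sum[OF hP hQ D(1)])
        have "(real \<nu> + 1) * D \<le> real m * D'"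
          using that D by (intro mult_mono) auto
        then have "cdom \<Omega> (\<rho> / 2) Z (real m * D') \<subseteq> cdom \<Omega> \<rho> S ((real \<nu> + 1) * D)"
          using \<rho> ZS by (intro cdom_mono) auto
        with x show "x \<in> cdom \<Omega> \<rho> S ((real \<nu> + 1) * D)" by blast
      qed
      then have "cmod (\<Sum>\<nu><m. fps_nth (pt_series (Q \<odot> P) x) \<nu>) =
          cmod (\<Sum>\<nu><m. \<Sum>k\<le>\<nu>. \<Sum>i\<le>\<nu> - k. T x k i (\<nu> - k - i))"
        by (intro arg_cong[of _ _ cmod] sum.cong refl)
      also have "\<dots> \<le> (real (Suc m))\<^sup>2 * (A ^ m * (CQ * CP) * exp (h * maxnorm (fst (snd x))))"
        using C(3)[OF _ x] False by simp
      also have "\<dots> \<le> (K * (CQ * CP)) * A' ^ m * exp (h * maxnorm (fst (snd x)))"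
        using C(1,2) by (intro bound_absorb_poly K(2)) auto
      finally show ?thesis .
    qed
  qed (use K C in auto)
qed

section \<open>The composition of symbols\<close>

lemma cderiv_fps_star:
  assumes U: "open U" "holo_fps U F" "holo_fps U G" "x \<in> U"
  shows "cderiv_fps v (star F G) x = star (cderiv_fps v F) G x + star F (cderiv_fps v G) x"
proof (rule fps_ext)
  fix m
  have h: "holo_on (\<lambda>x. fps_nth (bidiff_exp k F G x) j) U" for k j
    by (rule holo_fpsD[OF holo_fps_bidiff_exp[OF U(1-3)]])
  have "cderiv v (\<lambda>x. fps_nth (bidiff_exp k F G x) j) x =
      fps_nth (bidiff_exp k (cderiv_fps v F) G x) j + fps_nth (bidiff_exp k F (cderiv_fps v G) x) j" for k j
    using arg_cong[OF cderiv_fps_bidiff_exp[OF U, of v k], of "\<lambda>f. fps_nth f j"] by simp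
  then show "fps_nth (cderiv_fps v (star F G) x) m =
      fps_nth (star (cderiv_fps v F) G x + star F (cderiv_fps v G) x) m"
    by (simp add: star_def cderiv_sum[OF h U(4)] sum.distrib)
qed

lemma pt_series_d_eta: "pt_series (d_eta P) x = cderiv_fps (0, 0, 1) (pt_series P) x"
proof (rule fps_ext)
  fix m
  obtain z \<zeta> \<eta> where x: "x = (z, \<zeta>, \<eta>)" using prod_cases3 by blast
  have "deriv (\<lambda>\<eta>. fps_nth (P z \<zeta> \<eta>) m) \<eta> = deriv (\<lambda>c. fps_nth (P z \<zeta> (\<eta> + c)) m) 0"
    by (subst deriv_shift_0) (simp add: o_def)
  then show "fps_nth (pt_series (d_eta P) x) m = fps_nth (cderiv_fps (0, 0, 1) (pt_series P) x) m"
    by (simp add: x d_eta_def cderiv_def scaleC_prod_def scaleC_complex_def)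
qed

text \<open>d/d\<eta> commutes with the derivatives in z and \<zeta>, and is therefore a derivation
  of the composition.\<close>

lemma d_eta_comp:
  assumes P: "holo_coeffs \<Omega> S D \<rho> P" and Q: "holo_coeffs \<Omega> S D \<rho> Q" and "D > 0"
  obtains U where "open U" "cdom \<Omega> \<rho> S ((real \<nu> + 1) * D) \<subseteq> U"
    "\<And>x. x \<in> U \<Longrightarrow> fps_nth (pt_series (d_eta (Q \<odot> P)) x) \<nu> =
      fps_nth (pt_series (d_eta Q \<odot> P) x) \<nu> + fps_nth (pt_series (Q \<odot> d_eta P) x) \<nu>"
proof -
  let ?G = "\<lambda>x. fps_cutoff (Suc \<nu>) (pt_series P x)" and ?F = "\<lambda>x. fps_cutoff (Suc \<nu>) (pt_series Q x)"
  let ?v = "(0, 0, 1) :: 'a point"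
  obtain U where U: "open U" "cdom \<Omega> \<rho> S ((real \<nu> + 1) * D) \<subseteq> U" and h: "holo_fps U ?F" "holo_fps U ?G"
    using holo_coeffs_common_domain3[OF P Q Q \<open>D > 0\<close>] by blast
  have d: "fps_nth (pt_series (d_eta X) x) j = fps_nth (cderiv_fps ?v (\<lambda>x. fps_cutoff (Suc \<nu>) (pt_series X x)) x) j"
    if "j \<le> \<nu>" for X x j
    using that by (simp add: pt_series_d_eta)
  show ?thesis
  proof (rule that[OF U])
    fix x assume x: "x \<in> U"
    have "fps_nth (pt_series (d_eta (Q \<odot> P)) x) \<nu> = cderiv ?v (\<lambda>x. fps_nth (pt_series (Q \<odot> P) x) \<nu>) x"
      by (simp add: pt_series_d_eta)
    also have "\<dots> = cderiv ?v (\<lambda>x. fps_nth (star ?F ?G x) \<nu>) x"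
      by (rule cderiv_cong_open[OF U(1) x], rule fps_nth_series_comp[OF U(1) h _ order_refl]) auto
    also have "\<dots> = fps_nth (star (cderiv_fps ?v ?F) ?G x) \<nu> + fps_nth (star ?F (cderiv_fps ?v ?G) x) \<nu>"
      using arg_cong[OF cderiv_fps_star[OF U(1) h x, of ?v], of "\<lambda>f. fps_nth f \<nu>"] by simp
    also have "fps_nth (star (cderiv_fps ?v ?F) ?G x) \<nu> = fps_nth (pt_series (d_eta Q \<odot> P) x) \<nu>"
      by (rule fps_nth_series_comp[OF U(1) holo_fps_cderiv_fps[OF U(1) h(1)] h(2) x order_refl d, symmetric])
        auto
    also have "fps_nth (star ?F (cderiv_fps ?v ?G) x) \<nu> = fps_nth (pt_series (Q \<odot> d_eta P) x) \<nu>"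
      by (rule fps_nth_series_comp[OF U(1) h(1) holo_fps_cderiv_fps[OF U(1) h(2)] x order_refl _ d, symmetric])
        auto
    finally show "fps_nth (pt_series (d_eta (Q \<odot> P)) x) \<nu> =
      fps_nth (pt_series (d_eta Q \<odot> P) x) \<nu> + fps_nth (pt_series (Q \<odot> d_eta P) x) \<nu>" .
  qed
qed

text \<open>\<open>W\<close> is tied to the sum of \<open>X\<close> and \<open>Y\<close> only near
  the domains, coefficient by coefficient, because that is how the derivation property of d/d\<eta>
  is available.\<close>

lemma N_bound_add:
  assumes X: "N_bound \<Omega> S D \<rho> A X" and Y: "N_bound \<Omega> S D \<rho> A Y" and "D > 0"
    and W: "\<And>\<nu>. \<exists>U. open U \<and> cdom \<Omega> \<rho> S ((real \<nu> + 1) * D) \<subseteq> U \<and> (\<forall>x\<in>U.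
      fps_nth (pt_series W x) \<nu> = fps_nth (pt_series X x) \<nu> + fps_nth (pt_series Y x) \<nu>)"
  shows "N_bound \<Omega> S D \<rho> A W"
  unfolding N_bound_def
proof (intro conjI allI impI)
  show "holo_coeffs \<Omega> S D \<rho> W"
    unfolding holo_coeffs_def
  proof
    fix \<nu> :: nat
    let ?c = "cdom \<Omega> \<rho> S ((real \<nu> + 1) * D)"
    obtain U where U: "open U" "?c \<subseteq> U" "\<And>x. x \<in> U \<Longrightarrow>
        fps_nth (pt_series W x) \<nu> = fps_nth (pt_series X x) \<nu> + fps_nth (pt_series Y x) \<nu>"
      using W[of \<nu>] by blast
    obtain U1 where U1: "open U1" "?c \<subseteq> U1" "holo_on (\<lambda>x. fps_nth (pt_series X x) \<nu>) U1"
      using X unfolding N_bound_def holo_coeffs_def holo_near_def by blast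
    obtain U2 where U2: "open U2" "?c \<subseteq> U2" "holo_on (\<lambda>x. fps_nth (pt_series Y x) \<nu>) U2"
      using Y unfolding N_bound_def holo_coeffs_def holo_near_def by blast
    have "holo_on (\<lambda>x. fps_nth (pt_series X x) \<nu> + fps_nth (pt_series Y x) \<nu>) (U \<inter> U1 \<inter> U2)"
      by (intro holo_on_add holo_on_subset[OF U1(3)] holo_on_subset[OF U2(3)]) auto
    then have "holo_on (\<lambda>x. fps_nth (pt_series W x) \<nu>) (U \<inter> U1 \<inter> U2)"
      by (rule holo_on_cong[rotated 2]) (use U U1 U2 in auto)
    then show "holo_near (\<lambda>x. fps_nth (pt_series W x) \<nu>) ?c"
      unfolding holo_near_def using U(1,2) U1(1,2) U2(1,2)
      by (intro exI[of _ "U \<inter> U1 \<inter> U2"]) auto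
  qed
  fix Z and h :: real assume Zh: "relcompact Z S \<and> 0 < h"
  then have ZS: "Z \<subseteq> S" using relcompact_subset by auto
  obtain CX where CX: "CX > 0" "\<And>m x. x \<in> cdom \<Omega> \<rho> Z (real m * D) \<Longrightarrow>
      cmod (\<Sum>\<nu><m. fps_nth (pt_series X x) \<nu>) \<le> CX * A ^ m * exp (h * maxnorm (fst (snd x)))"
    using N_boundD[OF X] Zh by metis
  obtain CY where CY: "CY > 0" "\<And>m x. x \<in> cdom \<Omega> \<rho> Z (real m * D) \<Longrightarrow>
      cmod (\<Sum>\<nu><m. fps_nth (pt_series Y x) \<nu>) \<le> CY * A ^ m * exp (h * maxnorm (fst (snd x)))"
    using N_boundD[OF Y] Zh by metis
  show "\<exists>C>0. \<forall>m. \<forall>x\<in>cdom \<Omega> \<rho> Z (real m * D).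
      cmod (\<Sum>\<nu><m. fps_nth (pt_series W x) \<nu>) \<le> C * A ^ m * exp (h * maxnorm (fst (snd x)))"
  proof (intro exI[of _ "CX + CY"] conjI allI ballI)
    fix m :: nat and x assume x: "x \<in> cdom \<Omega> \<rho> Z (real m * D)"
    have "fps_nth (pt_series W x) \<nu> = fps_nth (pt_series X x) \<nu> + fps_nth (pt_series Y x) \<nu>"
      if "\<nu> \<in> {..<m}" for \<nu>
    proof -
      have "cdom \<Omega> \<rho> Z (real m * D) \<subseteq> cdom \<Omega> \<rho> S ((real \<nu> + 1) * D)"
        using that \<open>D > 0\<close> ZS by (intro cdom_mono mult_right_mono) auto
      then show ?thesis using W[of \<nu>] x by blast
    qed
    then have "(\<Sum>\<nu><m. fps_nth (pt_series W x) \<nu>) =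
        (\<Sum>\<nu><m. fps_nth (pt_series X x) \<nu>) + (\<Sum>\<nu><m. fps_nth (pt_series Y x) \<nu>)"
      unfolding sum.distrib[symmetric] by (intro sum.cong refl)
    then have "cmod (\<Sum>\<nu><m. fps_nth (pt_series W x) \<nu>) \<le>
        cmod (\<Sum>\<nu><m. fps_nth (pt_series X x) \<nu>) + cmod (\<Sum>\<nu><m. fps_nth (pt_series Y x) \<nu>)"
      by (simp add: norm_triangle_ineq)
    also have "\<dots> \<le> (CX + CY) * A ^ m * exp (h * maxnorm (fst (snd x)))"
      using CX(2)[OF x] CY(2)[OF x] by (simp add: distrib_right)
    finally show "cmod (\<Sum>\<nu><m. fps_nth (pt_series W x) \<nu>) \<le>
        (CX + CY) * A ^ m * exp (h * maxnorm (fst (snd x)))" .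
  qed (use CX CY in auto)
qed

lemma S_hat_params:
  assumes "P \<in> S_hat \<Omega> S"
  obtains D \<rho> A where "D > 0" "\<rho> \<in> {0<..<1}" "A \<in> {0<..<1}" "S_bound \<Omega> S D \<rho> A P"
    "N_bound \<Omega> S D \<rho> A (d_eta P)"
proof -
  obtain D1 \<rho>1 A1 where 1: "D1 > 0" "\<rho>1 \<in> {0<..<1}" "A1 \<in> {0<..<1}" "S_bound \<Omega> S D1 \<rho>1 A1 P"
    using assms unfolding S_hat_iff by blast
  obtain D2 \<rho>2 A2 where 2: "D2 > 0" "\<rho>2 \<in> {0<..<1}" "A2 \<in> {0<..<1}" "N_bound \<Omega> S D2 \<rho>2 A2 (d_eta P)"
    using assms unfolding S_hat_iff N_hat_iff by blast
  show ?thesis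
  proof (rule that[of "max D1 D2" "min \<rho>1 \<rho>2" "max A1 A2"])
    show "S_bound \<Omega> S (max D1 D2) (min \<rho>1 \<rho>2) (max A1 A2) P"
      by (rule S_bound_mono[OF 1(4)]) (use 1 in auto)
    show "N_bound \<Omega> S (max D1 D2) (min \<rho>1 \<rho>2) (max A1 A2) (d_eta P)"
      by (rule N_bound_mono[OF 2(4)]) (use 2 in auto)
  qed (use 1 2 in auto)
qed

theorem S_hat_comp:
  fixes \<Omega> :: "((complex ^ 'n) \<times> (complex ^ 'n::finite)) set"
  assumes P: "P \<in> S_hat \<Omega> S" and Q: "Q \<in> S_hat \<Omega> S" and S: "\<And>\<eta>. \<eta> \<in> S \<Longrightarrow> cmod \<eta> \<le> 1"
  shows "Q \<odot> P \<in> S_hat \<Omega> S"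
proof -
  obtain D1 \<rho>1 A1 where 1: "D1 > 0" "\<rho>1 \<in> {0<..<1}" "A1 \<in> {0<..<1}" "S_bound \<Omega> S D1 \<rho>1 A1 P"
    "N_bound \<Omega> S D1 \<rho>1 A1 (d_eta P)" using S_hat_params[OF P] by blast
  obtain D2 \<rho>2 A2 where 2: "D2 > 0" "\<rho>2 \<in> {0<..<1}" "A2 \<in> {0<..<1}" "S_bound \<Omega> S D2 \<rho>2 A2 Q"
    "N_bound \<Omega> S D2 \<rho>2 A2 (d_eta Q)" using S_hat_params[OF Q] by blast
  define D \<rho> A where "D = max D1 D2" and "\<rho> = min \<rho>1 \<rho>2" and "A = max A1 A2"
  have pos: "0 < D" "0 < \<rho>" "\<rho> < 1" "0 < A" "A < 1"
    using 1 2 by (auto simp: D_def \<rho>_def A_def)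
  have SP: "S_bound \<Omega> S D \<rho> A P" by (rule S_bound_mono[OF 1(4)]) (use 1 in \<open>auto simp: D_def \<rho>_def A_def\<close>)
  have NP: "N_bound \<Omega> S D \<rho> A (d_eta P)"
    by (rule N_bound_mono[OF 1(5)]) (use 1 in \<open>auto simp: D_def \<rho>_def A_def\<close>)
  have SQ: "S_bound \<Omega> S D \<rho> A Q" by (rule S_bound_mono[OF 2(4)]) (use 2 in \<open>auto simp: D_def \<rho>_def A_def\<close>)
  have NQ: "N_bound \<Omega> S D \<rho> A (d_eta Q)"
    by (rule N_bound_mono[OF 2(5)]) (use 2 in \<open>auto simp: D_def \<rho>_def A_def\<close>)
  \<comment> \<open>The term 2 D compensates the loss in \<open>cdom_shift\<close>; the other one is
    the threshold at which the Cauchy estimate with radii governed by \<rho>/4 gains A^k. The value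
    A' is some number strictly between A and 1, as needed to absorb the number of terms.\<close>
  define D' where "D' = max (2 * D) (3 * real CARD('n) / ((\<rho> / 4)\<^sup>2 * A))"
  define A' where "A' = (1 + A) / 2"
  have D': "2 * D \<le> D'" "3 * real CARD('n) / ((\<rho> / 4)\<^sup>2 * A) \<le> D'" "D' > 0" and A': "A < A'" "A' \<in> {0<..<1}"
    using pos by (auto simp: D'_def A'_def)
  have "S_bound \<Omega> S D' (\<rho> / 2) A' (Q \<odot> P)"
    by (rule S_bound_comp[OF SQ SP S pos(2,3,4) A'(1) pos(1) D'(1,2)])
  moreover have "N_bound \<Omega> S D' (\<rho> / 2) A' (d_eta (Q \<odot> P))"
  proof (rule N_bound_add[OF _ _ D'(3)])
    show "N_bound \<Omega> S D' (\<rho> / 2) A' (d_eta Q \<odot> P)"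
      by (rule N_bound_comp[OF _ S pos(2,3,4) A'(1) pos(1) D'(1,2)]) (use NQ SP in auto)
    show "N_bound \<Omega> S D' (\<rho> / 2) A' (Q \<odot> d_eta P)"
      by (rule N_bound_comp[OF _ S pos(2,3,4) A'(1) pos(1) D'(1,2)]) (use NP SQ in auto)
    fix \<nu> :: nat
    have hP: "holo_coeffs \<Omega> S D' (\<rho> / 2) P" and hQ: "holo_coeffs \<Omega> S D' (\<rho> / 2) Q"
      using SP SQ holo_coeffs_mono[of \<Omega> S D \<rho> _ D' "\<rho> / 2"] pos D' by (auto simp: S_bound_def)
    show "\<exists>U. open U \<and> cdom \<Omega> (\<rho> / 2) S ((real \<nu> + 1) * D') \<subseteq> U \<and>
        (\<forall>x\<in>U. fps_nth (pt_series (d_eta (Q \<odot> P)) x) \<nu> =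
          fps_nth (pt_series (d_eta Q \<odot> P) x) \<nu> + fps_nth (pt_series (Q \<odot> d_eta P) x) \<nu>)"
      using d_eta_comp[OF hP hQ D'(3), of \<nu>] by metis
  qed
  moreover have "\<rho> / 2 \<in> {0<..<1}" using pos by auto
  ultimately show ?thesis
    unfolding S_hat_iff N_hat_iff using D'(3) A'(2) by blast
qed

theorem N_hat_comp:
  fixes \<Omega> :: "((complex ^ 'n) \<times> (complex ^ 'n::finite)) set"
  assumes P: "P \<in> S_hat \<Omega> S" and Q: "Q \<in> S_hat \<Omega> S" and N: "P \<in> N_hat \<Omega> S \<or> Q \<in> N_hat \<Omega> S"
    and S: "\<And>\<eta>. \<eta> \<in> S \<Longrightarrow> cmod \<eta> \<le> 1"
  shows "Q \<odot> P \<in> N_hat \<Omega> S"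
proof -
  obtain D1 \<rho>1 A1 where 1: "D1 > 0" "\<rho>1 \<in> {0<..<1}" "A1 \<in> {0<..<1}" "S_bound \<Omega> S D1 \<rho>1 A1 P"
    using S_hat_params[OF P] by blast
  obtain D2 \<rho>2 A2 where 2: "D2 > 0" "\<rho>2 \<in> {0<..<1}" "A2 \<in> {0<..<1}" "S_bound \<Omega> S D2 \<rho>2 A2 Q"
    using S_hat_params[OF Q] by blast
  obtain D3 \<rho>3 A3 where 3: "D3 > 0" "\<rho>3 \<in> {0<..<1}" "A3 \<in> {0<..<1}"
    "N_bound \<Omega> S D3 \<rho>3 A3 P \<or> N_bound \<Omega> S D3 \<rho>3 A3 Q"
    using N unfolding N_hat_iff by blast
  define D \<rho> A where "D = max D1 (max D2 D3)" and "\<rho> = min \<rho>1 (min \<rho>2 \<rho>3)" and "A = max A1 (max A2 A3)"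
  have pos: "0 < D" "0 < \<rho>" "\<rho> < 1" "0 < A" "A < 1"
    using 1 2 3 by (auto simp: D_def \<rho>_def A_def)
  have le: "D1 \<le> D" "D2 \<le> D" "D3 \<le> D" "\<rho> \<le> \<rho>1" "\<rho> \<le> \<rho>2" "\<rho> \<le> \<rho>3" "A1 \<le> A" "A2 \<le> A" "A3 \<le> A"
    by (auto simp: D_def \<rho>_def A_def)
  have SP: "S_bound \<Omega> S D \<rho> A P" by (rule S_bound_mono[OF 1(4)]) (use 1 le in auto)
  have SQ: "S_bound \<Omega> S D \<rho> A Q" by (rule S_bound_mono[OF 2(4)]) (use 2 le in auto)
  have NPQ: "N_bound \<Omega> S D \<rho> A P \<or> N_bound \<Omega> S D \<rho> A Q"
    using 3(4) N_bound_mono[of \<Omega> S D3 \<rho>3 A3 _ D \<rho> A] le 3(3) by auto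
  define D' where "D' = max (2 * D) (3 * real CARD('n) / ((\<rho> / 4)\<^sup>2 * A))"
  define A' where "A' = (1 + A) / 2"
  have D': "2 * D \<le> D'" "3 * real CARD('n) / ((\<rho> / 4)\<^sup>2 * A) \<le> D'" "D' > 0" and A': "A < A'" "A' \<in> {0<..<1}"
    using pos by (auto simp: D'_def A'_def)
  have "N_bound \<Omega> S D' (\<rho> / 2) A' (Q \<odot> P)"
    by (rule N_bound_comp[OF _ S pos(2,3,4) A'(1) pos(1) D'(1,2)]) (use NPQ SP SQ in auto)
  moreover have "\<rho> / 2 \<in> {0<..<1}" using pos by auto
  ultimately show ?thesis
    unfolding N_hat_iff using D'(3) A'(2) by blast
qed

theorem series_eq_assoc:
  assumes "P \<in> S_hat \<Omega> S" "Q \<in> S_hat \<Omega> S" "R \<in> S_hat \<Omega> S"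
  shows "series_eq \<Omega> S (R \<odot> (Q \<odot> P)) ((R \<odot> Q) \<odot> P)"
proof -
  have "\<exists>D \<rho>. D > 0 \<and> \<rho> \<in> {0<..<1} \<and> holo_coeffs \<Omega> S D \<rho> P" if "P \<in> S_hat \<Omega> S" for P
    using S_hat_params[OF that] unfolding S_bound_def by metis
  with assms obtain D1 \<rho>1 D2 \<rho>2 D3 \<rho>3 where
    1: "D1 > 0" "\<rho>1 \<in> {0<..<1}" "holo_coeffs \<Omega> S D1 \<rho>1 P" and
    2: "D2 > 0" "\<rho>2 \<in> {0<..<1}" "holo_coeffs \<Omega> S D2 \<rho>2 Q" and
    3: "D3 > 0" "\<rho>3 \<in> {0<..<1}" "holo_coeffs \<Omega> S D3 \<rho>3 R"
    by metis
  define D \<rho> where "D = max D1 (max D2 D3)" and "\<rho> = min \<rho>1 (min \<rho>2 \<rho>3)"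
  have pos: "D > 0" "\<rho> \<in> {0<..<1}" using 1 2 3 by (auto simp: D_def \<rho>_def)
  have hP: "holo_coeffs \<Omega> S D \<rho> P"
    by (rule holo_coeffs_mono[OF 1(3)]) (auto simp: D_def \<rho>_def)
  have hQ: "holo_coeffs \<Omega> S D \<rho> Q"
    by (rule holo_coeffs_mono[OF 2(3)]) (auto simp: D_def \<rho>_def)
  have hR: "holo_coeffs \<Omega> S D \<rho> R"
    by (rule holo_coeffs_mono[OF 3(3)]) (auto simp: D_def \<rho>_def)
  define d where "d = D / (1 - \<rho>)"
  have d: "d > 0" "d * (1 - \<rho>) = D" using pos by (auto simp: d_def)
  show ?thesis
    unfolding series_eq_def
  proof (intro exI[of _ d] conjI d(1) bexI[of _ \<rho>] pos(2) allI ballI)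
    show "holo_series \<Omega> S d \<rho> (R \<odot> Q \<odot> P)"
      unfolding holo_series_eq d(2) by (intro holo_coeffs_comp hP hQ hR pos)
    show "holo_series \<Omega> S d \<rho> ((R \<odot> Q) \<odot> P)"
      unfolding holo_series_eq d(2) by (intro holo_coeffs_comp hP hQ hR pos)
    fix \<nu> x assume x: "x \<in> cdom \<Omega> \<rho> S ((real \<nu> + 1) * (d * (1 - \<rho>)))"
    obtain U where U: "open U" "cdom \<Omega> \<rho> S ((real \<nu> + 1) * D) \<subseteq> U"
      "\<And>x. x \<in> U \<Longrightarrow> fps_nth (pt_series (R \<odot> Q \<odot> P) x) \<nu> = fps_nth (pt_series ((R \<odot> Q) \<odot> P) x) \<nu>"
      using series_comp_assoc[OF hP hQ hR pos(1)] by blast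
    have "eventually (\<lambda>y. y \<in> U) (nhds x)"
      using U x d(2) by (intro eventually_nhds_in_open) auto
    then show "\<forall>\<^sub>F (z, \<zeta>, \<eta>) in nhds x.
        fps_nth ((R \<odot> Q \<odot> P) z \<zeta> \<eta>) \<nu> = fps_nth (((R \<odot> Q) \<odot> P) z \<zeta> \<eta>) \<nu>"
      by eventually_elim (use U(3) in \<open>auto simp: pt_series_def split_def\<close>)
  qed
qed

section \<open>Hadamard's lemma\<close>

lemma scaleR_scaleC: "s *\<^sub>R c *\<^sub>C x = c *\<^sub>C s *\<^sub>R (x::'a::complex_space)"
  by (simp add: scaleC_scaleC mult.commute flip: scaleC_of_real)

text \<open>Integrates the \<zeta>-derivatives along the segment from \<zeta>0 to \<zeta> in the
  fibre. The ball is centred over \<zeta>0, so moving \<zeta> towards \<zeta>0 with z and \<eta>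
  fixed does not leave it, and the quotients are holomorphic by differentiation under the
  integral.\<close>

lemma hadamard_zeta:
  fixes f :: "'n::finite point \<Rightarrow> complex"
  assumes f: "holo_on f (ball (z0, \<zeta>0, \<eta>0) e)"
  obtains h where "\<And>i. holo_on (h i) (ball (z0, \<zeta>0, \<eta>0) e)"
    "\<And>z \<zeta> \<eta>. (z, \<zeta>, \<eta>) \<in> ball (z0, \<zeta>0, \<eta>0) e \<Longrightarrow>
      f (z, \<zeta>, \<eta>) = f (z, \<zeta>0, \<eta>) + (\<Sum>i\<in>UNIV. (\<zeta> $ i - \<zeta>0 $ i) * h i (z, \<zeta>, \<eta>))"
proof -
  define B where "B = ball (z0, \<zeta>0, \<eta>0) e"
  have B: "open B" by (simp add: B_def)
  define T where "T x s = (fst x, \<zeta>0 + s *\<^sub>R (fst (snd x) - \<zeta>0), snd (snd x))" for x :: "'n point" and s :: real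
  have T_in: "T x s \<in> B" if "x \<in> B" "s \<in> {0..1}" for x s
  proof -
    have "norm (T x s - (z0, \<zeta>0, \<eta>0)) \<le> norm (x - (z0, \<zeta>0, \<eta>0))"
    proof -
      have "(norm (s *\<^sub>R (fst (snd x) - \<zeta>0)))\<^sup>2 \<le> (norm (fst (snd x) - \<zeta>0))\<^sup>2"
        using that(2) by (intro power_mono) (auto intro: mult_left_le_one_le)
      then show ?thesis
        by (cases x) (simp add: T_def norm_prod_def)
    qed
    then show ?thesis using that(1) by (simp add: B_def dist_norm norm_minus_commute)
  qed
  have contT: "continuous_on S (\<lambda>y. T (fst y) (snd y))" for S
    unfolding T_def by (intro continuous_intros)
  define h where "h i x = integral {0..1} (\<lambda>s. cderiv (dir_zeta i) f (T x s))" for i x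
  have hf: "holo_on f B" using f by (simp add: B_def)
  have hD: "holo_on (cderiv (dir_zeta i) f) B" for i by (rule holo_on_cderiv[OF B hf])
  have holT: "holo_on (\<lambda>x. T x s) S" for s S
  proof -
    have "holo_on (\<lambda>x::'n point. \<zeta>0 + s *\<^sub>R (fst (snd x) - \<zeta>0)) S"
    proof (rule holo_on_vec)
      fix i
      have "(\<lambda>x::'n point. (\<zeta>0 + s *\<^sub>R (fst (snd x) - \<zeta>0)) $ i) =
          (\<lambda>x. \<zeta>0 $ i + of_real s * (fst (snd x) $ i - \<zeta>0 $ i))"
        by (rule ext) (simp add: scaleR_conv_of_real[symmetric])
      then show "holo_on (\<lambda>x::'n point. (\<zeta>0 + s *\<^sub>R (fst (snd x) - \<zeta>0)) $ i) S"
        by (simp only:) (intro holo_on_intros holo_on_const)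
    qed
    then show ?thesis
      unfolding T_def by (intro holo_on_Pair holo_on_fst holo_on_snd holo_on_id)
  qed
  have "holo_on (h i) B" for i
    unfolding h_def
  proof (rule holo_on_integral(1)[OF B])
    show "holo_on (\<lambda>x. cderiv (dir_zeta i) f (T x s)) B" if "s \<in> {0..1}" for s
      by (rule holo_on_compose[OF holT hD]) (rule T_in[OF _ that])
    show "continuous_on (B \<times> {0..1}) (\<lambda>(x, s). cderiv (dir_zeta i) f (T x s))"
      unfolding case_prod_beta
      by (rule continuous_on_compose2[OF holo_on_imp_continuous_on[OF hD] contT]) (auto intro!: T_in)
    fix v :: "'n point"
    \<comment> \<open>\<open>T\<close> scales the fibre part of a direction by s. Splitting
      \<open>v\<close> into the parts scaled by 1 and by s makes the continuous dependence on s
      visible.\<close>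
    let ?v1 = "(fst v, 0, snd (snd v))" and ?v2 = "(0, fst (snd v), 0)"
    have "cderiv v (\<lambda>x. cderiv (dir_zeta i) f (T x s)) x =
        cderiv ?v1 (cderiv (dir_zeta i) f) (T x s) + of_real s * cderiv ?v2 (cderiv (dir_zeta i) f) (T x s)"
      if "x \<in> B" "s \<in> {0..1}" for x s
    proof -
      have "T (x + c *\<^sub>C v) s = T x s + c *\<^sub>C (fst v, s *\<^sub>R fst (snd v), snd (snd v))" for c
        by (cases x, cases v)
          (simp add: T_def scaleC_prod_def algebra_simps scaleR_scaleC)
      then have "cderiv v (\<lambda>x. cderiv (dir_zeta i) f (T x s)) x =
          cderiv (fst v, s *\<^sub>R fst (snd v), snd (snd v)) (cderiv (dir_zeta i) f) (T x s)"
        by (simp add: cderiv_def[of v] cderiv_def[of "(fst v, s *\<^sub>R fst (snd v), snd (snd v))"])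
      also have "(fst v, s *\<^sub>R fst (snd v), snd (snd v)) = ?v1 + of_real s *\<^sub>C ?v2"
        by (simp add: scaleC_of_real)
      finally show ?thesis
        by (simp only: cderiv_add_direction[OF hD T_in[OF that]] cderiv_scaleC[OF hD T_in[OF that]])
    qed
    moreover have "continuous_on (B \<times> {0..1}) (\<lambda>(x, s). cderiv ?v1 (cderiv (dir_zeta i) f) (T x s) +
        of_real s * cderiv ?v2 (cderiv (dir_zeta i) f) (T x s))"
      unfolding case_prod_beta
      by (intro continuous_intros continuous_on_compose2[OF continuous_on_cderiv[OF B hD] contT])
        (auto intro!: T_in)
    ultimately show "continuous_on (B \<times> {0..1}) (\<lambda>(x, s). cderiv v (\<lambda>x. cderiv (dir_zeta i) f (T x s)) x)"
      by (subst continuous_on_cong[OF refl]) (auto simp: case_prod_beta)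
  qed
  moreover have "f x = f (T x 0) + (\<Sum>i\<in>UNIV. (fst (snd x) $ i - \<zeta>0 $ i) * h i x)" if x: "x \<in> B" for x
  proof -
    let ?d = "fst (snd x) - \<zeta>0"
    have der: "((\<lambda>s. f (T x s)) has_vector_derivative
        (\<Sum>i\<in>UNIV. ?d $ i * cderiv (dir_zeta i) f (T x s))) (at s within {0..1})" if "s \<in> {0..1}" for s
    proof -
      have "((\<lambda>s. T x s) has_derivative (\<lambda>t. (0, t *\<^sub>R ?d, 0))) (at s)"
        unfolding T_def by (auto intro!: derivative_eq_intros)
      from has_derivative_compose[OF this holo_on_has_derivative[OF hf T_in[OF x that]]]
      have "((\<lambda>s. f (T x s)) has_derivative (\<lambda>t. cderiv (0, t *\<^sub>R ?d, 0) f (T x s))) (at s)" .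
      moreover have "cderiv (0, t *\<^sub>R ?d, 0) f (T x s) = t *\<^sub>R (\<Sum>i\<in>UNIV. ?d $ i * cderiv (dir_zeta i) f (T x s))" for t
      proof -
        have "(0, t *\<^sub>R ?d, 0) = (\<Sum>i\<in>UNIV. (of_real t * ?d $ i) *\<^sub>C (dir_zeta i :: 'n point))"
        proof -
          have "t *\<^sub>R ?d = (\<Sum>i\<in>UNIV. axis i (of_real t * ?d $ i))"
            by (simp add: vec_eq_iff axis_def scaleR_conv_of_real[where 'a = complex] if_distrib cong: if_cong)
          then show ?thesis
            by (simp add: prod_eq_iff fst_sum snd_sum dir_zeta_def scaleC_prod_def scaleC_axis)
        qed
        then show ?thesis
          by (simp add: cderiv_sum_direction[OF hf T_in[OF x that]] cderiv_scaleC[OF hf T_in[OF x that]]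
              sum_distrib_left scaleR_conv_of_real mult.assoc)
      qed
      ultimately show ?thesis
        unfolding has_vector_derivative_def by (auto intro: has_derivative_at_withinI)
    qed
    have "((\<lambda>s. \<Sum>i\<in>UNIV. ?d $ i * cderiv (dir_zeta i) f (T x s)) has_integral (f (T x 1) - f (T x 0))) {0..1}"
      by (rule fundamental_theorem_of_calculus[OF _ der]) auto
    then have "f (T x 1) - f (T x 0) = integral {0..1} (\<lambda>s. \<Sum>i\<in>UNIV. ?d $ i * cderiv (dir_zeta i) f (T x s))"
      by (simp add: integral_unique)
    also have "\<dots> = (\<Sum>i\<in>UNIV. integral {0..1} (\<lambda>s. ?d $ i * cderiv (dir_zeta i) f (T x s)))"
    proof (rule integral_sum)
      fix i :: 'n
      have "continuous_on {0..1} (\<lambda>s. T x s)" unfolding T_def by (intro continuous_intros)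
      then have "continuous_on {0..1} (\<lambda>s. ?d $ i * cderiv (dir_zeta i) f (T x s))"
        by (intro continuous_intros continuous_on_compose2[OF holo_on_imp_continuous_on[OF hD]])
          (auto intro!: T_in[OF x])
      then show "(\<lambda>s. ?d $ i * cderiv (dir_zeta i) f (T x s)) integrable_on {0..1}"
        by (rule integrable_continuous_real)
    qed simp
    also have "\<dots> = (\<Sum>i\<in>UNIV. ?d $ i * h i x)"
      by (simp add: h_def)
    finally show ?thesis
      by (cases x) (simp add: T_def algebra_simps)
  qed
  ultimately show ?thesis
    using that[of h] by (fastforce simp: B_def T_def)
qed

section \<open>The operator \<open>exp (t \<langle>\<partial>\<^sub>\<zeta>, \<partial>\<^sub>z\<rangle>)\<close> at the origin\<close>

lemma cderiv_fps_add_direction: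
  assumes "holo_fps U F" "x \<in> U"
  shows "cderiv_fps (v + w) F x = cderiv_fps v F x + cderiv_fps w F x"
  by (rule fps_ext) (simp add: cderiv_add_direction[OF holo_fpsD[OF assms(1)] assms(2)])

lemma cderiv_fps_const_fun: "cderiv_fps v (\<lambda>x. c) = (\<lambda>x. 0)"
  by (rule ext) simp

lemma lap_const [simp]: "lap (\<lambda>y. c) = (\<lambda>y. 0)"
  by (rule ext) (simp add: lap_def cderiv_fps_const_fun)

lemma lap_funpow_const: "(lap ^^ k) (\<lambda>y. c) y = (if k = 0 then c else 0)"
proof (induction k arbitrary: c)
  case (Suc k)
  then show ?case by (simp add: funpow_Suc_right del: funpow.simps)
qed simp

abbreviation dir_z' :: "'n::finite \<Rightarrow> 'p::zero \<times> (complex ^ 'n) \<times> (complex ^ 'n)"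
  where "dir_z' i \<equiv> (0, axis i 1, 0)"

abbreviation dir_zeta' :: "'n::finite \<Rightarrow> 'p::zero \<times> (complex ^ 'n) \<times> (complex ^ 'n)"
  where "dir_zeta' i \<equiv> (0, 0, axis i 1)"

section \<open>Commutation rules for \<open>lap\<close>\<close>

context
  fixes V :: "('p::{complex_space,euclidean_space} \<times> (complex ^ 'n) \<times> (complex ^ 'n::finite)) set"
  assumes V: "open V"
begin

lemma holo_fps_lap: "holo_fps V G \<Longrightarrow> holo_fps V (lap G)"
  unfolding lap_def[abs_def] by (intro holo_fps_sum holo_fps_cderiv_fps V)

lemma holo_fps_lap_funpow: "holo_fps V G \<Longrightarrow> holo_fps V ((lap ^^ k) G)"
  by (induction k) (auto intro: holo_fps_lap)

lemma lap_funpow_cong: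
  assumes "\<And>y. y \<in> V \<Longrightarrow> G y = H y" "y \<in> V"
  shows "(lap ^^ k) G y = (lap ^^ k) H y"
  using assms(2)
proof (induction k arbitrary: y)
  case (Suc k)
  show ?case
    using lap_cong[OF V Suc.prems Suc.IH] by simp
qed (use assms(1) in simp)

lemma lap_add:
  assumes "holo_fps V G" "holo_fps V H" "y \<in> V"
  shows "lap (\<lambda>y. G y + H y) y = lap G y + lap H y"
proof -
  have "cderiv_fps (dir_zeta' i) (cderiv_fps (dir_z' i) (\<lambda>y. G y + H y)) y =
      cderiv_fps (dir_zeta' i) (cderiv_fps (dir_z' i) G) y + cderiv_fps (dir_zeta' i) (cderiv_fps (dir_z' i) H) y" for i
    by (subst cderiv_fps_add[OF holo_fps_cderiv_fps[OF V assms(1)] holo_fps_cderiv_fps[OF V assms(2)] assms(3), symmetric])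
      (rule cderiv_fps_cong[OF V assms(3)], rule cderiv_fps_add[OF assms(1,2)])
  then show ?thesis by (simp add: lap_def sum.distrib)
qed

lemma cderiv_fps_lap:
  assumes "holo_fps V G" "y \<in> V"
  shows "cderiv_fps v (lap G) y = lap (cderiv_fps v G) y"
proof -
  have "cderiv_fps v (cderiv_fps (dir_zeta' i) (cderiv_fps (dir_z' i) G)) y =
      cderiv_fps (dir_zeta' i) (cderiv_fps (dir_z' i) (cderiv_fps v G)) y" for i
    by (subst cderiv_fps_commute[OF V holo_fps_cderiv_fps[OF V assms(1)] assms(2)])
      (rule cderiv_fps_cong[OF V assms(2)], rule cderiv_fps_commute[OF V assms(1)])
  moreover have "cderiv_fps v (lap G) y =
        (\<Sum>i\<in>UNIV. cderiv_fps v (cderiv_fps (dir_zeta' i) (cderiv_fps (dir_z' i) G)) y)"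
    unfolding lap_def[abs_def]
    by (rule cderiv_fps_sum[OF _ assms(2)]) (intro holo_fps_cderiv_fps V assms(1))
  ultimately show ?thesis
    by (simp add: lap_def[of "cderiv_fps v G"])
qed

lemma cderiv_fps_lap_funpow:
  assumes "holo_fps V G" "y \<in> V"
  shows "cderiv_fps v ((lap ^^ k) G) y = (lap ^^ k) (cderiv_fps v G) y"
  using assms(2)
proof (induction k arbitrary: y)
  case (Suc k)
  have "cderiv_fps v ((lap ^^ Suc k) G) y = lap (cderiv_fps v ((lap ^^ k) G)) y"
    using cderiv_fps_lap[OF holo_fps_lap_funpow[OF assms(1)] Suc.prems] by simp
  also have "\<dots> = lap ((lap ^^ k) (cderiv_fps v G)) y"
    by (rule lap_cong[OF V Suc.prems Suc.IH])
  finally show ?case by simp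
qed simp

lemma lap_funpow_add:
  assumes "holo_fps V G" "holo_fps V H" "y \<in> V"
  shows "(lap ^^ k) (\<lambda>y. G y + H y) y = (lap ^^ k) G y + (lap ^^ k) H y"
  using assms(3)
proof (induction k arbitrary: y)
  case (Suc k)
  have "(lap ^^ Suc k) (\<lambda>y. G y + H y) y = lap (\<lambda>y. (lap ^^ k) G y + (lap ^^ k) H y) y"
    using lap_cong[OF V Suc.prems Suc.IH] by simp
  also have "\<dots> = (lap ^^ Suc k) G y + (lap ^^ Suc k) H y"
    using lap_add[OF holo_fps_lap_funpow[OF assms(1)] holo_fps_lap_funpow[OF assms(2)] Suc.prems] by simp
  finally show ?case .
qed simp

lemma lap_mult_const:
  assumes "holo_fps V K" "y \<in> V"
  shows "lap (\<lambda>y. d * K y) y = d * lap K y"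
proof -
  have "cderiv_fps (dir_zeta' i) (cderiv_fps (dir_z' i) (\<lambda>y. d * K y)) y =
      d * cderiv_fps (dir_zeta' i) (cderiv_fps (dir_z' i) K) y" for i
    by (subst cderiv_fps_mult_const[OF holo_fps_cderiv_fps[OF V assms(1)] assms(2), symmetric])
      (rule cderiv_fps_cong[OF V assms(2)], rule cderiv_fps_mult_const[OF assms(1)])
  then show ?thesis by (simp add: lap_def sum_distrib_left)
qed

text \<open>
  For \<open>c\<close> affine in \<open>(z', \<zeta>')\<close> with coefficients \<open>a\<close>, \<open>b\<close>, the commutator of \<open>lap\<close> with
  multiplication by \<open>c\<close> is the first order operator \<open>\<Sum>\<^sub>j a\<^sub>j \<partial>\<^sub>\<zeta>\<^sub>j + b\<^sub>j \<partial>\<^sub>z\<^sub>j\<close>, which commutes with \<open>lap\<close>.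
\<close>

lemma lap_funpow_mult_affine:
  assumes c: "holo_fps V c" and G: "holo_fps V G" and y: "y \<in> V"
    and a: "\<And>j y. y \<in> V \<Longrightarrow> cderiv_fps (dir_z' j) c y = a j"
    and b: "\<And>j y. y \<in> V \<Longrightarrow> cderiv_fps (dir_zeta' j) c y = b j"
  defines "H \<equiv> \<lambda>G y. \<Sum>j\<in>UNIV. a j * cderiv_fps (dir_zeta' j) G y + b j * cderiv_fps (dir_z' j) G y"
  shows "(lap ^^ k) (\<lambda>y. c y * G y) y = c y * (lap ^^ k) G y + of_nat k * (lap ^^ (k - 1)) (H G) y"
proof -
  have hH: "holo_fps V (H G)" if "holo_fps V G" for G
    unfolding H_def by (intro holo_fps_sum holo_fps_add holo_fps_mult holo_fps_const holo_fps_cderiv_fps V that)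
  have 1: "lap (\<lambda>y. c y * G y) y = c y * lap G y + H G y" if G: "holo_fps V G" and y: "y \<in> V" for G y
  proof -
    note hDG = holo_fps_cderiv_fps[OF V G]
    have "cderiv_fps (dir_zeta' i) (cderiv_fps (dir_z' i) (\<lambda>y. c y * G y)) y =
        c y * cderiv_fps (dir_zeta' i) (cderiv_fps (dir_z' i) G) y +
        (a i * cderiv_fps (dir_zeta' i) G y + b i * cderiv_fps (dir_z' i) G y)" for i
    proof -
      have "cderiv_fps (dir_zeta' i) (cderiv_fps (dir_z' i) (\<lambda>y. c y * G y)) y =
          cderiv_fps (dir_zeta' i) (\<lambda>y. a i * G y + c y * cderiv_fps (dir_z' i) G y) y"
        by (rule cderiv_fps_cong[OF V y]) (simp add: cderiv_fps_mult[OF c G] a)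
      also have "\<dots> = cderiv_fps (dir_zeta' i) (\<lambda>y. a i * G y) y +
          cderiv_fps (dir_zeta' i) (\<lambda>y. c y * cderiv_fps (dir_z' i) G y) y"
        by (rule cderiv_fps_add[OF _ _ y]) (intro holo_fps_mult holo_fps_const c G hDG)+
      finally show ?thesis
        unfolding cderiv_fps_mult_const[OF G y] cderiv_fps_mult[OF c hDG y] b[OF y]
        by (simp add: ac_simps)
    qed
    then show ?thesis
      by (simp add: lap_def H_def sum.distrib sum_distrib_left)
  qed
  have H_lap: "H (lap G) y = lap (H G) y" if G: "holo_fps V G" and y: "y \<in> V" for G y
  proof -
    have s: "lap (\<lambda>y. \<Sum>j\<in>J. K j y) y = (\<Sum>j\<in>J. lap (K j) y)" if "finite J" "\<And>j. holo_fps V (K j)" for J :: "'n set" and K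
      using that
    proof (induction J)
      case (insert i J)
      then show ?case
        using lap_add[of "K i" "\<lambda>y. \<Sum>j\<in>J. K j y" y] y by (simp add: holo_fps_sum)
    qed simp
    note hDG = holo_fps_cderiv_fps[OF V G]
    have "lap (\<lambda>y. a j * cderiv_fps (dir_zeta' j) G y + b j * cderiv_fps (dir_z' j) G y) y =
        a j * cderiv_fps (dir_zeta' j) (lap G) y + b j * cderiv_fps (dir_z' j) (lap G) y" for j
      by (subst lap_add[OF _ _ y])
        (auto intro!: holo_fps_mult hDG simp: lap_mult_const[OF hDG y] cderiv_fps_lap[OF G y])
    then show ?thesis
      unfolding H_def by (subst s) (auto intro!: holo_fps_add holo_fps_mult hDG)
  qed
  have H_funpow: "H ((lap ^^ k) G) y = (lap ^^ k) (H G) y" if y: "y \<in> V" for y k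
    using y
  proof (induction k arbitrary: y)
    case (Suc k)
    have "H ((lap ^^ Suc k) G) y = lap (H ((lap ^^ k) G)) y"
      using H_lap[OF holo_fps_lap_funpow[OF G] Suc.prems] by simp
    also have "\<dots> = lap ((lap ^^ k) (H G)) y"
      by (rule lap_cong[OF V Suc.prems Suc.IH])
    finally show ?case by simp
  qed simp
  \<comment> \<open>As H commutes with \<open>lap\<close>, the k commutators collected along the way
    add up to k times the power k - 1 of \<open>lap\<close> applied to H G; for k = 0 the truncated
    exponent is harmless because of the factor k.\<close>
  show "(lap ^^ k) (\<lambda>y. c y * G y) y = c y * (lap ^^ k) G y + of_nat k * (lap ^^ (k - 1)) (H G) y"
    using y
  proof (induction k arbitrary: y)
    case (Suc k)
    note hk = holo_fps_lap_funpow[OF G] holo_fps_lap_funpow[OF hH[OF G]]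
    have "(lap ^^ Suc k) (\<lambda>y. c y * G y) y =
        lap (\<lambda>y. c y * (lap ^^ k) G y + of_nat k * (lap ^^ (k - 1)) (H G) y) y"
      using lap_cong[OF V Suc.prems Suc.IH] by simp
    also have "\<dots> = lap (\<lambda>y. c y * (lap ^^ k) G y) y + lap (\<lambda>y. of_nat k * (lap ^^ (k - 1)) (H G) y) y"
      by (rule lap_add[OF _ _ Suc.prems]) (intro holo_fps_mult c hk holo_fps_const)+
    also have "lap (\<lambda>y. of_nat k * (lap ^^ (k - 1)) (H G) y) y = of_nat k * lap ((lap ^^ (k - 1)) (H G)) y"
      by (rule lap_mult_const[OF hk(2) Suc.prems])
    also have "of_nat k * lap ((lap ^^ (k - 1)) (H G)) y = of_nat k * (lap ^^ k) (H G) y"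
      by (cases k) auto
    also have "lap (\<lambda>y. c y * (lap ^^ k) G y) y = c y * (lap ^^ Suc k) G y + (lap ^^ k) (H G) y"
      using 1[OF hk(1) Suc.prems] H_funpow[OF Suc.prems] by simp
    finally show ?case by (simp add: algebra_simps)
  qed simp
qed

end

text \<open>exp(t lap) at z' = \<zeta>' = 0, seen as a function of the parameter \<open>p\<close>,
  so that it can be differentiated in \<open>p\<close> afterwards.\<close>

definition lap_exp :: "('p::complex_space \<times> (complex ^ 'n) \<times> (complex ^ 'n::finite) \<Rightarrow> complex fps)
    \<Rightarrow> 'p \<Rightarrow> complex fps"
  where "lap_exp G p = Abs_fps (\<lambda>m. \<Sum>k\<le>m. fps_nth ((lap ^^ k) G (p, 0, 0)) (m - k) / fact k)"

lemma exp_t_eq_lap_exp: "exp_t (\<lambda>z \<zeta>. G (p, z, \<zeta>)) 0 0 = lap_exp G p"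
  by (rule fps_ext) (simp add: fps_nth_exp_t lap_exp_def)

lemma fps_nth_lap_exp:
  assumes "m \<le> M"
  shows "fps_nth (lap_exp G p) m =
    fps_nth (\<Sum>k\<le>M. fps_X ^ k * (fps_const (1 / fact k) * (lap ^^ k) G (p, 0, 0))) m"
proof -
  have "(\<Sum>k\<le>M. if m < k then 0 else fps_nth ((lap ^^ k) G (p, 0, 0)) (m - k) / fact k) =
      (\<Sum>k\<le>m. fps_nth ((lap ^^ k) G (p, 0, 0)) (m - k) / fact k)"
    using assms by (intro sum.mono_neutral_cong_right) auto
  then show ?thesis
    by (simp add: lap_exp_def fps_sum_nth fps_X_power_mult_nth cong: if_cong)
qed

lemma lap_exp_const [simp]: "lap_exp (\<lambda>y. c) p = c"
proof (rule fps_ext)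
  fix m
  have "fps_nth (lap_exp (\<lambda>y. c) p) m =
      (\<Sum>k\<le>m. if k = 0 then fps_nth c m else 0)"
    unfolding lap_exp_def fps_nth_Abs_fps
  proof (intro sum.cong refl)
    fix k
    show "fps_nth ((lap ^^ k) (\<lambda>y. c) (p, 0, 0)) (m - k) / fact k = (if k = 0 then fps_nth c m else 0)"
      unfolding lap_funpow_const by (cases k) auto
  qed
  then show "fps_nth (lap_exp (\<lambda>y. c) p) m = fps_nth c m" by simp
qed

lemma holo_on_origin: "holo_on (\<lambda>p. (p, 0, 0)) U"
  by (intro holo_on_Pair holo_on_id holo_on_const)

context
  fixes V :: "('p::{complex_space,euclidean_space} \<times> (complex ^ 'n) \<times> (complex ^ 'n::finite)) set"
  assumes V: "open V"
begin

lemma lap_exp_cong: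
  assumes "\<And>y. y \<in> V \<Longrightarrow> G y = H y" "(p, 0, 0) \<in> V"
  shows "lap_exp G p = lap_exp H p"
  unfolding lap_exp_def using lap_funpow_cong[OF V assms(1) assms(2)] by simp

lemma lap_exp_add:
  assumes "holo_fps V G" "holo_fps V H" "(p, 0, 0) \<in> V"
  shows "lap_exp (\<lambda>y. G y + H y) p = lap_exp G p + lap_exp H p"
  by (rule fps_ext) (simp add: lap_exp_def lap_funpow_add[OF V assms] sum.distrib add_divide_distrib)

lemma lap_exp_sum:
  assumes "finite I" "\<And>i. i \<in> I \<Longrightarrow> holo_fps V (G i)" "(p, 0, 0) \<in> V"
  shows "lap_exp (\<lambda>y. \<Sum>i\<in>I. G i y) p = (\<Sum>i\<in>I. lap_exp (G i) p)"
  using assms(1,2)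
proof (induction I)
  case (insert i I)
  have "lap_exp (\<lambda>y. G i y + (\<Sum>i\<in>I. G i y)) p = lap_exp (G i) p + lap_exp (\<lambda>y. \<Sum>i\<in>I. G i y) p"
    by (rule lap_exp_add[OF _ _ assms(3)]) (use insert.prems in \<open>auto intro!: holo_fps_sum\<close>)
  with insert show ?case by simp
qed simp

text \<open>The commutator H of \<open>lap\<close> and c commutes with \<open>lap\<close>, so exp(t
  lap) c = c exp(t lap) + t exp(t lap) H: the factor k of the k-th term turns 1/k! into 1/(k-1)! and
  shifts the series by one order.\<close>

lemma lap_exp_mult_affine:
  assumes c: "holo_fps V c" and G: "holo_fps V G" and p: "(p, 0, 0) \<in> V"
    and a: "\<And>j y. y \<in> V \<Longrightarrow> cderiv_fps (dir_z' j) c y = a j"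
    and b: "\<And>j y. y \<in> V \<Longrightarrow> cderiv_fps (dir_zeta' j) c y = b j"
  shows "lap_exp (\<lambda>y. c y * G y) p = c (p, 0, 0) * lap_exp G p +
    fps_X * lap_exp (\<lambda>y. \<Sum>j\<in>UNIV. a j * cderiv_fps (dir_zeta' j) G y + b j * cderiv_fps (dir_z' j) G y) p"
    (is "_ = _ + fps_X * lap_exp ?H p")
proof (rule fps_ext)
  fix m
  define L where "L G k = fps_const (1 / fact k) * (lap ^^ k) G (p, 0, 0)"
    for G :: "'p \<times> (complex ^ 'n) \<times> (complex ^ 'n) \<Rightarrow> complex fps" and k
  have L: "L (\<lambda>y. c y * G y) k = c (p, 0, 0) * L G k + (if k = 0 then 0 else L ?H (k - 1))" for k
  proof (cases k)
    case (Suc l)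
    have "fps_const (1 / fact (Suc l)) * (of_nat (Suc l) :: complex fps) = fps_const (1 / fact l)"
      by (simp add: fps_of_nat[symmetric] field_simps del: of_nat_Suc)
    then have f: "fps_const (1 / fact (Suc l)) * (of_nat (Suc l) * x) = fps_const (1 / fact l) * x"
      for x :: "complex fps"
      by (simp only: mult.assoc[symmetric])
    have e: "(lap ^^ Suc l) (\<lambda>y. c y * G y) (p, 0, 0) =
        c (p, 0, 0) * (lap ^^ Suc l) G (p, 0, 0) + of_nat (Suc l) * (lap ^^ l) ?H (p, 0, 0)"
      using lap_funpow_mult_affine[OF V c G p a b, of "Suc l"] by (simp only: diff_Suc_1)
    show ?thesis
      unfolding L_def Suc e distrib_left f by (simp only: ac_simps nat.distinct if_False diff_Suc_1)
  qed (simp add: L_def)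
  have "fps_nth (lap_exp (\<lambda>y. c y * G y) p) m = fps_nth (\<Sum>k\<le>m. fps_X ^ k * L (\<lambda>y. c y * G y) k) m"
    unfolding L_def by (rule fps_nth_lap_exp) simp
  also have "(\<Sum>k\<le>m. fps_X ^ k * L (\<lambda>y. c y * G y) k) = c (p, 0, 0) * (\<Sum>k\<le>m. fps_X ^ k * L G k) +
      (\<Sum>k\<le>m. if k = 0 then 0 else fps_X ^ k * L ?H (k - 1))"
    unfolding L sum_distrib_left sum.distrib[symmetric]
    by (intro sum.cong refl) (simp add: distrib_left ac_simps)
  also have "(\<Sum>k\<le>m. if k = 0 then 0 else fps_X ^ k * L ?H (k - 1)) =
      fps_X * (\<Sum>k<m. fps_X ^ k * L ?H k)"
    by (cases m) (simp_all add: sum.atMost_Suc_shift sum_distrib_left mult.assoc lessThan_Suc_atMost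
      del: sum.atMost_Suc)
  \<comment> \<open>The second sum stops at order m - 1, which is enough because of its factor
    \<open>fps_X\<close>.\<close>
  also have "fps_nth (c (p, 0, 0) * (\<Sum>k\<le>m. fps_X ^ k * L G k) + fps_X * (\<Sum>k<m. fps_X ^ k * L ?H k)) m =
      fps_nth (c (p, 0, 0) * lap_exp G p + fps_X * lap_exp ?H p) m"
  proof -
    have "fps_nth (c (p, 0, 0) * (\<Sum>k\<le>m. fps_X ^ k * L G k)) m = fps_nth (c (p, 0, 0) * lap_exp G p) m"
      by (rule fps_nth_mult_cong) (simp add: fps_nth_lap_exp L_def)
    moreover have "fps_nth (fps_X * (\<Sum>k<m. fps_X ^ k * L ?H k)) m = fps_nth (fps_X * lap_exp ?H p) m"
    proof (cases m)
      case (Suc n)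
      then show ?thesis
        using fps_nth_lap_exp[of n n ?H p] by (simp add: L_def lessThan_Suc_atMost del: sum.lessThan_Suc)
    qed simp
    ultimately show ?thesis by simp
  qed
  finally show "fps_nth (lap_exp (\<lambda>y. c y * G y) p) m =
    fps_nth (c (p, 0, 0) * lap_exp G p + fps_X * lap_exp ?H p) m" .
qed

lemma lap_exp_mult_base:
  assumes "holo_fps V c" "holo_fps V G" "(p, 0, 0) \<in> V"
    and "\<And>j y. y \<in> V \<Longrightarrow> cderiv_fps (dir_z' j) c y = 0"
    and "\<And>j y. y \<in> V \<Longrightarrow> cderiv_fps (dir_zeta' j) c y = 0"
  shows "lap_exp (\<lambda>y. c y * G y) p = c (p, 0, 0) * lap_exp G p"
  using lap_exp_mult_affine[OF assms] by simp

text \<open>\<zeta>'_i vanishes at the origin, so only its commutator with \<open>lap\<close>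
  remains, which is the derivative in the conjugate variable z'_i. The next lemma is the same with
  the two sets of variables exchanged.\<close>

lemma lap_exp_zeta:
  assumes "holo_fps V G" "(p, 0, 0) \<in> V"
  shows "lap_exp (\<lambda>y. fps_const (snd (snd y) $ i) * G y) p = fps_X * lap_exp (cderiv_fps (dir_z' i) G) p"
proof -
  let ?c = "\<lambda>y::'p \<times> (complex ^ 'n) \<times> (complex ^ 'n). fps_const (snd (snd y) $ i)"
  have D: "cderiv_fps v ?c y = fps_const (snd (snd v) $ i)" for v y
    unfolding cderiv_fps_scalar
    by (subst cderiv_linear) (simp_all add: scaleC_prod_def scaleC_vec_def scaleC_complex_def
        bounded_linear_compose[OF bounded_linear_vec_nth bounded_linear_compose[OF bounded_linear_snd bounded_linear_snd]])
  have c: "holo_fps V ?c"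
    by (intro holo_fps_scalar holo_on_vec_nth holo_on_snd holo_on_id)
  have "(\<Sum>j\<in>UNIV. 0 * cderiv_fps (dir_zeta' j) G y + fps_const (axis j 1 $ i) * cderiv_fps (dir_z' j) G y) =
      (\<Sum>j\<in>UNIV. if j = i then cderiv_fps (dir_z' j) G y else 0)" for y
    by (intro sum.cong refl) (auto simp: axis_def)
  then have "(\<lambda>y. \<Sum>j\<in>UNIV. 0 * cderiv_fps (dir_zeta' j) G y + fps_const (axis j 1 $ i) * cderiv_fps (dir_z' j) G y) =
      cderiv_fps (dir_z' i) G"
    by (intro ext) simp
  then show ?thesis
    using lap_exp_mult_affine[OF c assms, of "\<lambda>j. 0" "\<lambda>j. fps_const (axis j 1 $ i)"] by (simp add: D)
qed

lemma lap_exp_z: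
  assumes "holo_fps V G" "(p, 0, 0) \<in> V"
  shows "lap_exp (\<lambda>y. fps_const (fst (snd y) $ i) * G y) p = fps_X * lap_exp (cderiv_fps (dir_zeta' i) G) p"
proof -
  let ?c = "\<lambda>y::'p \<times> (complex ^ 'n) \<times> (complex ^ 'n). fps_const (fst (snd y) $ i)"
  have D: "cderiv_fps v ?c y = fps_const (fst (snd v) $ i)" for v y
    unfolding cderiv_fps_scalar
    by (subst cderiv_linear) (simp_all add: scaleC_prod_def scaleC_vec_def scaleC_complex_def
        bounded_linear_compose[OF bounded_linear_vec_nth bounded_linear_compose[OF bounded_linear_fst bounded_linear_snd]])
  have c: "holo_fps V ?c"
    by (intro holo_fps_scalar holo_on_vec_nth holo_on_fst holo_on_snd holo_on_id)
  have "(\<Sum>j\<in>UNIV. fps_const (axis j 1 $ i) * cderiv_fps (dir_zeta' j) G y + 0 * cderiv_fps (dir_z' j) G y) =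
      (\<Sum>j\<in>UNIV. if j = i then cderiv_fps (dir_zeta' j) G y else 0)" for y
    by (intro sum.cong refl) (auto simp: axis_def)
  then have "(\<lambda>y. \<Sum>j\<in>UNIV. fps_const (axis j 1 $ i) * cderiv_fps (dir_zeta' j) G y + 0 * cderiv_fps (dir_z' j) G y) =
      cderiv_fps (dir_zeta' i) G"
    by (intro ext) simp
  then show ?thesis
    using lap_exp_mult_affine[OF c assms, of "\<lambda>j. fps_const (axis j 1 $ i)" "\<lambda>j. 0"] by (simp add: D)
qed

lemma
  assumes U: "\<And>p. p \<in> U \<Longrightarrow> (p, 0, 0) \<in> V" and G: "holo_fps V G"
  shows holo_fps_lap_exp: "holo_fps U (lap_exp G)"
    and cderiv_fps_lap_exp: "\<And>p v. p \<in> U \<Longrightarrow> cderiv_fps v (lap_exp G) p = lap_exp (cderiv_fps (v, 0, 0) G) p"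
proof -
  have h: "holo_on (\<lambda>p. (fps_nth ((lap ^^ k) G (p, 0, 0)) l) / fact k) U" for k l
  proof -
    have "holo_on (\<lambda>p. fps_nth ((lap ^^ k) G (p, 0, 0)) l * (1 / fact k)) U"
      by (intro holo_on_mult holo_on_const
          holo_on_compose[OF holo_on_origin holo_fpsD[OF holo_fps_lap_funpow[OF V G]]]) (rule U)
    then show ?thesis by simp
  qed
  show "holo_fps U (lap_exp G)"
    unfolding holo_fps_def lap_exp_def fps_nth_Abs_fps
    by (intro allI holo_on_sum h)
  fix p v assume p: "p \<in> U"
  show "cderiv_fps v (lap_exp G) p = lap_exp (cderiv_fps (v, 0, 0) G) p"
  proof (rule fps_ext)
    fix m
    have "cderiv v (\<lambda>p. fps_nth ((lap ^^ k) G (p, 0, 0)) l / fact k) p =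
        fps_nth ((lap ^^ k) (cderiv_fps (v, 0, 0) G) (p, 0, 0)) l / fact k" for k l
    proof -
      have hk: "holo_on (\<lambda>p. fps_nth ((lap ^^ k) G (p, 0, 0)) l) U"
        by (intro holo_on_compose[OF holo_on_origin holo_fpsD[OF holo_fps_lap_funpow[OF V G]]]) (rule U)
      have "cderiv v (\<lambda>p. fps_nth ((lap ^^ k) G (p, 0, 0)) l * (1 / fact k)) p =
          cderiv v (\<lambda>p. fps_nth ((lap ^^ k) G (p, 0, 0)) l) p * (1 / fact k)"
        by (subst cderiv_mult[OF hk holo_on_const p]) simp
      also have "cderiv v (\<lambda>p. fps_nth ((lap ^^ k) G (p, 0, 0)) l) p =
          fps_nth (cderiv_fps (v, 0, 0) ((lap ^^ k) G) (p, 0, 0)) l"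
        by (simp add: cderiv_def scaleC_prod_def)
      finally show ?thesis
        by (simp add: cderiv_fps_lap_funpow[OF V G U[OF p]] del: fps_nth_cderiv_fps)
    qed
    then show "fps_nth (cderiv_fps v (lap_exp G) p) m = fps_nth (lap_exp (cderiv_fps (v, 0, 0) G) p) m"
      by (simp add: lap_exp_def cderiv_sum[OF h p])
  qed
qed

end

section \<open>The chain rule\<close>

lemma point_decompose:
  "(x :: 'n::finite point) = (\<Sum>j\<in>UNIV. (fst x $ j) *\<^sub>C dir_z j) +
    (\<Sum>j\<in>UNIV. (fst (snd x) $ j) *\<^sub>C dir_zeta j) + snd (snd x) *\<^sub>C (0, 0, 1)"
proof -
  have "y = (\<Sum>j\<in>UNIV. axis j (y $ j))" for y :: "complex ^ 'n"
    by (simp add: vec_eq_iff axis_def if_distrib cong: if_cong)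
  then show ?thesis
    by (simp add: prod_eq_iff fst_sum snd_sum dir_z_def dir_zeta_def scaleC_prod_def scaleC_axis scaleC_complex_def)
qed

lemma cderiv_chain:
  fixes \<psi> :: "'a::complex_space \<Rightarrow> 'n::finite point"
  assumes \<psi>: "holo_on \<psi> U" and f: "holo_on f V" and y: "y \<in> U" "\<psi> y \<in> V"
  shows "cderiv v (\<lambda>y. f (\<psi> y)) y =
    (\<Sum>j\<in>UNIV. cderiv v (\<lambda>y. fst (\<psi> y) $ j) y * cderiv (dir_z j) f (\<psi> y)) +
    (\<Sum>j\<in>UNIV. cderiv v (\<lambda>y. fst (snd (\<psi> y)) $ j) y * cderiv (dir_zeta j) f (\<psi> y)) +
    cderiv v (\<lambda>y. snd (snd (\<psi> y))) y * cderiv (0, 0, 1) f (\<psi> y)"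
proof -
  obtain \<psi>' where \<psi>': "(\<psi> has_derivative \<psi>') (at y)" "\<forall>c v. \<psi>' (c *\<^sub>C v) = c *\<^sub>C \<psi>' v"
    using \<psi> y(1) unfolding holo_on_def by blast
  have c1: "cderiv v (\<lambda>y. fst (\<psi> y) $ j) y = fst (\<psi>' v) $ j" for j
    by (rule cderiv_eqI[OF bounded_linear.has_derivative[OF bounded_linear_compose[OF bounded_linear_vec_nth
            bounded_linear_fst] \<psi>'(1)]])
      (simp add: \<psi>'(2) scaleC_prod_def scaleC_vec_def)
  have c2: "cderiv v (\<lambda>y. fst (snd (\<psi> y)) $ j) y = fst (snd (\<psi>' v)) $ j" for j
    by (rule cderiv_eqI[OF bounded_linear.has_derivative[OF bounded_linear_compose[OF bounded_linear_vec_nth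
            bounded_linear_compose[OF bounded_linear_fst bounded_linear_snd]] \<psi>'(1)]])
      (simp add: \<psi>'(2) scaleC_prod_def scaleC_vec_def)
  have c3: "cderiv v (\<lambda>y. snd (snd (\<psi> y))) y = snd (snd (\<psi>' v))"
    by (rule cderiv_eqI[OF bounded_linear.has_derivative[OF bounded_linear_compose[OF bounded_linear_snd
            bounded_linear_snd] \<psi>'(1)]])
      (simp add: \<psi>'(2) scaleC_prod_def)
  note add = cderiv_add_direction[OF f y(2)]
  note sm = cderiv_sum_direction[OF f y(2)]
  note sc = cderiv_scaleC[OF f y(2)]
  have "cderiv v (\<lambda>y. f (\<psi> y)) y = cderiv (\<psi>' v) f (\<psi> y)"
    by (rule cderiv_compose[OF \<psi> f y \<psi>'(1)])
  also have "\<dots> = cderiv ((\<Sum>j\<in>UNIV. (fst (\<psi>' v) $ j) *\<^sub>C dir_z j) +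
    (\<Sum>j\<in>UNIV. (fst (snd (\<psi>' v)) $ j) *\<^sub>C dir_zeta j) + snd (snd (\<psi>' v)) *\<^sub>C (0, 0, 1)) f (\<psi> y)"
    using point_decompose[of "\<psi>' v"] by simp
  finally show ?thesis
    by (simp only: add sm sc c1 c2 c3)
qed

lemma cderiv_fps_chain:
  fixes \<psi> :: "'a::complex_space \<Rightarrow> 'n::finite point"
  assumes \<psi>: "holo_on \<psi> U" and F: "holo_fps V F" and y: "y \<in> U" "\<psi> y \<in> V"
  shows "cderiv_fps v (\<lambda>y. F (\<psi> y)) y =
    (\<Sum>j\<in>UNIV. fps_const (cderiv v (\<lambda>y. fst (\<psi> y) $ j) y) * cderiv_fps (dir_z j) F (\<psi> y)) +
    (\<Sum>j\<in>UNIV. fps_const (cderiv v (\<lambda>y. fst (snd (\<psi> y)) $ j) y) * cderiv_fps (dir_zeta j) F (\<psi> y)) +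
    fps_const (cderiv v (\<lambda>y. snd (snd (\<psi> y))) y) * cderiv_fps (0, 0, 1) F (\<psi> y)"
  by (rule fps_ext) (simp add: fps_sum_nth cderiv_chain[OF \<psi> holo_fpsD[OF F] y])

lemma holo_fps_compose:
  assumes "holo_on \<psi> U" "holo_fps V F" "\<And>y. y \<in> U \<Longrightarrow> \<psi> y \<in> V"
  shows "holo_fps U (\<lambda>y. F (\<psi> y))"
  unfolding holo_fps_def by (intro allI holo_on_compose[OF assms(1) holo_fpsD[OF assms(2)] assms(3)])

lemma open_vimage_holo:
  assumes "holo_on \<psi> U" "open U" "open V"
  shows "open (U \<inter> \<psi> -` V)"
  using continuous_open_preimage[OF _ assms(2,3), of \<psi>] continuous_at_imp_continuous_on[of U \<psi>]
    has_derivative_continuous assms(1) unfolding holo_on_def by blast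

section \<open>Coordinate transformations\<close>

locale coord_change =
  fixes \<Phi> g :: "complex ^ 'n \<Rightarrow> complex ^ 'n::finite" and W V :: "(complex ^ 'n) set"
    and J :: "complex ^ 'n \<Rightarrow> complex ^ 'n \<Rightarrow> complex ^ 'n ^ 'n" and N :: "((complex ^ 'n) \<times> (complex ^ 'n)) set"
  assumes W: "open W" and V: "open V" and holo_\<Phi>: "holo_on \<Phi> W" and holo_g: "holo_on g V"
    and \<Phi>_in: "\<And>w. w \<in> W \<Longrightarrow> \<Phi> w \<in> V" and g_in: "\<And>z. z \<in> V \<Longrightarrow> g z \<in> W"
    and g_\<Phi>: "\<And>w. w \<in> W \<Longrightarrow> g (\<Phi> w) = w" and \<Phi>_g: "\<And>z. z \<in> V \<Longrightarrow> \<Phi> (g z) = z"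
    and N: "open N" "N \<subseteq> V \<times> V" "\<And>z. z \<in> V \<Longrightarrow> (z, z) \<in> N"
    and holo_J: "holo_on (\<lambda>(z', z). J z' z) N"
    and J: "\<And>z' z. (z', z) \<in> N \<Longrightarrow> g z' - g z = J z' z *v (z' - z)"
begin

lemma holo_J_nth: "holo_on (\<lambda>x. J (fst x) (snd x) $ k $ j) N"
  using holo_on_vec_nth[OF holo_on_vec_nth[OF holo_J]] by (simp add: split_def)

text \<open>At z' = z the derivative of \<open>J\<close> is multiplied by z' - z = 0, so
  \<open>J z z\<close> is the Jacobian matrix of g, however \<open>J\<close> is chosen off the
  diagonal.\<close>

lemma cderiv_g:
  assumes "z \<in> V"
  shows "cderiv (axis i 1) (\<lambda>x. g x $ k) z = J z z $ k $ i"
proof -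
  define M where "M = (\<lambda>z'. (z', z)) -` N"
  have M: "open M" "z \<in> M"
    unfolding M_def by (auto intro!: open_vimage N(1) continuous_intros simp: N(3)[OF assms])
  have hP: "holo_on (\<lambda>z'. (z', z)) M" by (intro holo_on_Pair holo_on_id holo_on_const)
  have hJ: "holo_on (\<lambda>z'. J z' z $ k $ j) M" for j
    using holo_on_compose[OF hP holo_J_nth] by (auto simp: M_def)
  have hc: "holo_on (\<lambda>z'. z' $ j - z $ j) M" for j
    by (intro holo_on_intros holo_on_const)
  have dc: "cderiv (axis i 1) (\<lambda>z'. z' $ j - z $ j) z = axis i 1 $ j" for j
  proof -
    have "cderiv (axis i 1) (\<lambda>z'. z' $ j + - (z $ j)) z = cderiv (axis i 1) (\<lambda>z'. z' $ j) z"
      by (subst cderiv_add[where U = UNIV]) (auto intro!: holo_on_intros)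
    also have "\<dots> = axis i 1 $ j"
      by (rule cderiv_linear) (auto simp: scaleC_vec_def intro: bounded_linear_vec_nth)
    finally show ?thesis by simp
  qed
  have "cderiv (axis i 1) (\<lambda>x. g x $ k) z =
      cderiv (axis i 1) (\<lambda>z'. g z $ k + (\<Sum>j\<in>UNIV. J z' z $ k $ j * (z' $ j - z $ j))) z"
  proof (rule cderiv_cong_open[OF M])
    fix y assume "y \<in> M"
    then have "g y = g z + J y z *v (y - z)" using J[of y z] by (simp add: M_def algebra_simps)
    then show "g y $ k = g z $ k + (\<Sum>j\<in>UNIV. J y z $ k $ j * (y $ j - z $ j))"
      by (simp add: matrix_vector_mult_def)
  qed
  also have "\<dots> = (\<Sum>j\<in>UNIV. cderiv (axis i 1) (\<lambda>z'. J z' z $ k $ j * (z' $ j - z $ j)) z)"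
    by (subst cderiv_add[OF holo_on_const holo_on_sum[OF holo_on_mult[OF hJ hc]] M(2)])
      (simp add: cderiv_sum[OF holo_on_mult[OF hJ hc] M(2)])
  also have "\<dots> = (\<Sum>j\<in>UNIV. if j = i then J z z $ k $ j else 0)"
    unfolding cderiv_mult[OF hJ hc M(2)] dc by (intro sum.cong refl) (simp add: axis_def)
  finally show ?thesis by simp
qed

text \<open>In \<open>y = ((z, \<mu>, \<eta>), z', \<zeta>')\<close> the base point z is in the old
  coordinates, while the covector \<mu> belongs to the new ones. \<open>sig\<close> is the
  transported covector, and \<open>symbol_arg\<close> is the point at which the pullback evaluates
  the symbol.\<close>

definition sig :: "'n point \<times> (complex ^ 'n) \<times> (complex ^ 'n) \<Rightarrow> complex ^ 'n"
  where "sig y = transpose (J (fst (fst y) + fst (snd y)) (fst (fst y))) *v fst (snd (fst y))"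

definition symbol_arg :: "'n point \<times> (complex ^ 'n) \<times> (complex ^ 'n) \<Rightarrow> 'n point"
  where "symbol_arg y = (fst (fst y), snd (snd y) + sig y, snd (snd (fst y)))"

definition diag_nbhd :: "('n point \<times> (complex ^ 'n) \<times> (complex ^ 'n)) set"
  where "diag_nbhd = (\<lambda>y. (fst (fst y) + fst (snd y), fst (fst y))) -` N"

definition arg_dom :: "'n point set \<Rightarrow> ('n point \<times> (complex ^ 'n) \<times> (complex ^ 'n)) set"
  where "arg_dom U = diag_nbhd \<inter> symbol_arg -` U"

lemma sig_nth: "sig y $ j =
    (\<Sum>k\<in>UNIV. J (fst (fst y) + fst (snd y)) (fst (fst y)) $ k $ j * fst (snd (fst y)) $ k)"
  by (simp add: sig_def matrix_vector_mult_def transpose_def)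

lemma open_diag_nbhd: "open diag_nbhd"
  unfolding diag_nbhd_def by (intro open_vimage N(1) continuous_intros)

lemma diag_nbhd_in_V: "y \<in> diag_nbhd \<Longrightarrow> fst (fst y) \<in> V"
  using N(2) by (auto simp: diag_nbhd_def)

lemma diag_nbhd_origin: "y \<in> diag_nbhd \<Longrightarrow> (fst y, 0, 0) \<in> diag_nbhd"
  using N(3) diag_nbhd_in_V by (auto simp: diag_nbhd_def)

lemma holo_sig_nth: "holo_on (\<lambda>y. sig y $ j) diag_nbhd"
proof -
  have "holo_on (\<lambda>y::'n point \<times> (complex ^ 'n) \<times> (complex ^ 'n). (fst (fst y) + fst (snd y), fst (fst y))) diag_nbhd"
    by (intro holo_on_intros)
  then have hJ: "holo_on (\<lambda>y. J (fst (fst y) + fst (snd y)) (fst (fst y)) $ k $ j) diag_nbhd" for k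
    using holo_on_compose[OF _ holo_J_nth, of _ diag_nbhd] by (fastforce simp: diag_nbhd_def)
  have h\<mu>: "holo_on (\<lambda>y::'n point \<times> (complex ^ 'n) \<times> (complex ^ 'n). fst (snd (fst y)) $ k) diag_nbhd" for k
    by (intro holo_on_intros)
  show ?thesis
    unfolding sig_nth by (intro holo_on_sum holo_on_mult hJ h\<mu>)
qed

lemma holo_symbol_arg: "holo_on symbol_arg diag_nbhd"
  unfolding symbol_arg_def
  by (intro holo_on_Pair holo_on_vec_add holo_on_fst holo_on_snd holo_on_id holo_on_vec[of sig] holo_sig_nth)

lemma open_arg_dom: "open U \<Longrightarrow> open (arg_dom U)"
  unfolding arg_dom_def by (rule open_vimage_holo[OF holo_symbol_arg open_diag_nbhd])

lemma holo_fps_symbol_arg: "holo_fps U P \<Longrightarrow> holo_fps (arg_dom U) (\<lambda>y. P (symbol_arg y))"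
  by (rule holo_fps_compose[OF holo_on_subset[OF holo_symbol_arg]]) (auto simp: arg_dom_def)

text \<open>Moves the base point \<open>z\<close> while \<open>z + z'\<close> stays fixed.\<close>

definition vdir :: "'n \<Rightarrow> 'n point \<times> (complex ^ 'n) \<times> (complex ^ 'n)"
  where "vdir i = ((axis i 1, 0, 0), - axis i 1, 0)"

text \<open>Pairing the property of \<open>J\<close> with \<mu> gives: the sum of z'_j \<sigma>_j
  equals the sum of \<mu>_k (g(z + z') - g(z))_k. Along \<open>vdir i\<close> the left side yields
  -\<sigma>_i plus the sum of z'_j times the derivative of \<sigma>_j; on the right g(z + z') is
  constant, which leaves minus the value of \<sigma>_i at z' = 0.\<close>

lemma sig_expansion:
  assumes y: "y \<in> diag_nbhd"
  shows "sig y $ i = sig (fst y, 0, 0) $ i +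
    (\<Sum>j\<in>UNIV. fst (snd y) $ j * cderiv (vdir i) (\<lambda>y. sig y $ j) y)"
proof -
  let ?z = "\<lambda>y::'n point \<times> (complex ^ 'n) \<times> (complex ^ 'n). fst (fst y)"
  let ?z' = "\<lambda>y::'n point \<times> (complex ^ 'n) \<times> (complex ^ 'n). fst (snd y)"
  let ?\<mu> = "\<lambda>y::'n point \<times> (complex ^ 'n) \<times> (complex ^ 'n). fst (snd (fst y))"
  have eq: "(\<Sum>j\<in>UNIV. ?z' y $ j * sig y $ j) = (\<Sum>k\<in>UNIV. ?\<mu> y $ k * (g (?z y + ?z' y) $ k - g (?z y) $ k))"
    if "y \<in> diag_nbhd" for y
  proof -
    have "g (?z y + ?z' y) - g (?z y) = J (?z y + ?z' y) (?z y) *v ?z' y"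
      using J[of "?z y + ?z' y" "?z y"] that by (simp add: diag_nbhd_def)
    then have "g (?z y + ?z' y) $ k - g (?z y) $ k = (\<Sum>j\<in>UNIV. J (?z y + ?z' y) (?z y) $ k $ j * ?z' y $ j)" for k
      by (simp add: matrix_vector_mult_def vec_eq_iff)
    then show ?thesis
      unfolding sig_nth by (simp add: sum_distrib_left mult_ac) (rule sum.swap)
  qed
  have h': "holo_on (\<lambda>y. ?z' y $ j) diag_nbhd" for j
    by (intro holo_on_intros)
  have d': "cderiv (vdir i) (\<lambda>y. ?z' y $ j) y = - axis i 1 $ j" for j
    by (subst cderiv_linear) (simp_all add: vdir_def scaleC_prod_def scaleC_vec_def scaleC_complex_def
        bounded_linear_compose[OF bounded_linear_vec_nth bounded_linear_compose[OF bounded_linear_fst bounded_linear_snd]])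
  have "cderiv (vdir i) (\<lambda>y. \<Sum>j\<in>UNIV. ?z' y $ j * sig y $ j) y =
      (\<Sum>j\<in>UNIV. - axis i 1 $ j * sig y $ j + ?z' y $ j * cderiv (vdir i) (\<lambda>y. sig y $ j) y)"
    by (subst cderiv_sum[OF holo_on_mult[OF h' holo_sig_nth] y])
      (simp add: cderiv_mult[OF h' holo_sig_nth y] d')
  also have "\<dots> = - sig y $ i + (\<Sum>j\<in>UNIV. ?z' y $ j * cderiv (vdir i) (\<lambda>y. sig y $ j) y)"
  proof -
    have "(\<Sum>j\<in>UNIV. - axis i 1 $ j * sig y $ j) = (\<Sum>j\<in>UNIV. if j = i then - sig y $ j else 0)"
      by (intro sum.cong refl) (simp add: axis_def)
    then show ?thesis unfolding sum.distrib by simp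
  qed
  finally have l: "cderiv (vdir i) (\<lambda>y. \<Sum>j\<in>UNIV. ?z' y $ j * sig y $ j) y = \<dots>" .
  have "cderiv (vdir i) (\<lambda>y. \<Sum>k\<in>UNIV. ?\<mu> y $ k * (g (?z y + ?z' y) $ k - g (?z y) $ k)) y =
      cderiv (axis i 1) (\<lambda>x. \<Sum>k\<in>UNIV. ?\<mu> y $ k * (g (?z y + ?z' y) $ k - g x $ k)) (?z y)"
  proof -
    have "c *\<^sub>C (- axis i 1) = - (c *\<^sub>C (axis i 1 :: complex ^ 'n))" for c
      using scaleC_add_right[of c "axis i 1" "- axis i 1 :: complex ^ 'n"]
      by (simp add: eq_neg_iff_add_eq_0 add.commute)
    then have "?z (y + c *\<^sub>C vdir i) = ?z y + c *\<^sub>C axis i 1" "?\<mu> (y + c *\<^sub>C vdir i) = ?\<mu> y"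
        "?z (y + c *\<^sub>C vdir i) + ?z' (y + c *\<^sub>C vdir i) = ?z y + ?z' y" for c
      by (simp_all add: vdir_def scaleC_prod_def)
    then show ?thesis by (simp only: cderiv_def)
  qed
  also have "\<dots> = (\<Sum>k\<in>UNIV. ?\<mu> y $ k * - cderiv (axis i 1) (\<lambda>x. g x $ k) (?z y))"
  proof -
    note yV = diag_nbhd_in_V[OF y]
    have hg: "holo_on (\<lambda>x. g x $ k) V" for k by (rule holo_on_vec_nth[OF holo_g])
    have hc: "holo_on (\<lambda>x. c - g x $ k) V" for c k by (intro holo_on_diff holo_on_const hg)
    have dm: "cderiv (axis i 1) (\<lambda>x. c - g x $ k) (?z y) = - cderiv (axis i 1) (\<lambda>x. g x $ k) (?z y)" for c k
    proof -
      have "cderiv (axis i 1) (\<lambda>x. c + (-1) * g x $ k) (?z y) = - cderiv (axis i 1) (\<lambda>x. g x $ k) (?z y)"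
        by (subst cderiv_add[OF holo_on_const holo_on_mult[OF holo_on_const hg] yV])
          (simp only: cderiv_mult[OF holo_on_const hg yV], simp)
      then show ?thesis by simp
    qed
    show ?thesis
      by (subst cderiv_sum[OF holo_on_mult[OF holo_on_const hc] yV])
        (simp add: cderiv_mult[OF holo_on_const hc yV] dm)
  qed
  also have "\<dots> = - sig (fst y, 0, 0) $ i"
    using cderiv_g[OF diag_nbhd_in_V[OF y]] by (simp add: sig_nth sum_negf mult.commute)
  finally have r: "cderiv (vdir i) (\<lambda>y. \<Sum>k\<in>UNIV. ?\<mu> y $ k * (g (?z y + ?z' y) $ k - g (?z y) $ k)) y =
      - sig (fst y, 0, 0) $ i" .
  have "cderiv (vdir i) (\<lambda>y. \<Sum>j\<in>UNIV. ?z' y $ j * sig y $ j) y =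
      cderiv (vdir i) (\<lambda>y. \<Sum>k\<in>UNIV. ?\<mu> y $ k * (g (?z y + ?z' y) $ k - g (?z y) $ k)) y"
    by (rule cderiv_cong_open[OF open_diag_nbhd y eq])
  then show ?thesis unfolding l r by (simp add: algebra_simps)
qed

lemma cderiv_fps_symbol_arg_vdir:
  assumes U: "open U" "holo_fps U P" and y: "y \<in> arg_dom U"
  shows "cderiv_fps (vdir i) (\<lambda>y. P (symbol_arg y)) y = cderiv_fps (dir_z i) P (symbol_arg y) +
    (\<Sum>j\<in>UNIV. fps_const (cderiv (vdir i) (\<lambda>y. sig y $ j) y) * cderiv_fps (dir_zeta j) P (symbol_arg y))"
proof -
  have yD: "y \<in> diag_nbhd" and yU: "symbol_arg y \<in> U" using y by (auto simp: arg_dom_def)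
  have 1: "cderiv (vdir i) (\<lambda>y. fst (symbol_arg y) $ j) y = (if j = i then 1 else 0)" for j
    unfolding symbol_arg_def fst_conv
    by (subst cderiv_linear) (simp_all add: vdir_def axis_def scaleC_prod_def scaleC_vec_def scaleC_complex_def
        bounded_linear_compose[OF bounded_linear_vec_nth bounded_linear_compose[OF bounded_linear_fst bounded_linear_fst]])
  have 2: "cderiv (vdir i) (\<lambda>y. fst (snd (symbol_arg y)) $ j) y = cderiv (vdir i) (\<lambda>y. sig y $ j) y" for j
  proof -
    have "cderiv (vdir i) (\<lambda>y. snd (snd y) $ j + sig y $ j) y =
        cderiv (vdir i) (\<lambda>y. snd (snd y) $ j) y + cderiv (vdir i) (\<lambda>y. sig y $ j) y"
      by (rule cderiv_add[OF _ holo_sig_nth yD]) (intro holo_on_intros)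
    also have "cderiv (vdir i) (\<lambda>y. snd (snd y) $ j) y = 0"
      by (simp add: cderiv_def vdir_def scaleC_prod_def)
    finally show ?thesis by (simp add: symbol_arg_def)
  qed
  have 3: "cderiv (vdir i) (\<lambda>y. snd (snd (symbol_arg y))) y = 0"
    by (simp add: cderiv_def vdir_def scaleC_prod_def symbol_arg_def)
  have "(\<Sum>j\<in>UNIV. fps_const (if j = i then 1 else 0) * cderiv_fps (dir_z j) P (symbol_arg y)) =
      (\<Sum>j\<in>UNIV. if j = i then cderiv_fps (dir_z j) P (symbol_arg y) else 0)"
    by (intro sum.cong refl) auto
  then show ?thesis
    unfolding cderiv_fps_chain[OF holo_symbol_arg U(2) yD yU] 1 2 3 by simp
qed

lemma cderiv_fps_symbol_arg_zeta':
  "cderiv_fps (dir_zeta' j) (\<lambda>y. P (symbol_arg y)) y = cderiv_fps (dir_zeta j) P (symbol_arg y)"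
proof (rule fps_ext)
  fix m
  have "symbol_arg (y + c *\<^sub>C dir_zeta' j) = symbol_arg y + c *\<^sub>C dir_zeta j" for c
    by (simp add: symbol_arg_def sig_def dir_zeta_def scaleC_prod_def ac_simps)
  then show "fps_nth (cderiv_fps (dir_zeta' j) (\<lambda>y. P (symbol_arg y)) y) m = fps_nth (cderiv_fps (dir_zeta j) P (symbol_arg y)) m"
    by (simp add: cderiv_def)
qed

text \<open>By \<open>sig_expansion\<close> the i-th fibre coordinate of \<open>symbol_arg\<close>
  is \<zeta>'_i, plus \<sigma>_i at z' = 0, plus terms with a factor z'_j. Under
  \<open>lap_exp\<close> the first becomes t d/dz'_i and the factors z'_j become t d/d\<zeta>'_j;
  together with the term t d/dz_i of P they make up the full derivative in the parameter
  z_i.\<close>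

lemma lap_exp_symbol_arg_zeta:
  assumes U: "open U" "holo_fps U P" and p: "(p, 0, 0) \<in> arg_dom U"
  shows "lap_exp (\<lambda>y. fps_const (fst (snd (symbol_arg y)) $ i) * P (symbol_arg y) +
      fps_X * cderiv_fps (dir_z i) P (symbol_arg y)) p =
    fps_const (sig (p, 0, 0) $ i) * lap_exp (\<lambda>y. P (symbol_arg y)) p +
    fps_X * cderiv_fps (dir_z i) (lap_exp (\<lambda>y. P (symbol_arg y))) p"
proof -
  define F where "F y = P (symbol_arg y)" for y
  define a where "a j y = fps_const (cderiv (vdir i) (\<lambda>y. sig y $ j) y)" for j y
  let ?O = "arg_dom U"
  have O: "open ?O" by (rule open_arg_dom[OF U(1)])
  have OD: "?O \<subseteq> diag_nbhd" by (auto simp: arg_dom_def)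
  have hF: "holo_fps ?O F" unfolding F_def by (rule holo_fps_symbol_arg[OF U(2)])
  have hDP: "holo_fps ?O (\<lambda>y. cderiv_fps (dir_z i) P (symbol_arg y))"
    by (rule holo_fps_symbol_arg[OF holo_fps_cderiv_fps[OF U]])
  have ha: "holo_fps ?O (a j)" for j
    unfolding a_def by (intro holo_fps_scalar holo_on_subset[OF holo_on_cderiv[OF open_diag_nbhd holo_sig_nth] OD])
  have hz: "holo_fps ?O (\<lambda>y. fps_const (fst (snd y) $ j))" for j
    by (intro holo_fps_scalar holo_on_intros)
  have hzeta: "holo_fps ?O (\<lambda>y. fps_const (snd (snd y) $ j))" for j
    by (intro holo_fps_scalar holo_on_intros)
  define s where "s y = fps_const (sig (fst y, 0, 0) $ i)" for y :: "'n point \<times> (complex ^ 'n) \<times> (complex ^ 'n)"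
  have hs: "holo_fps ?O s"
  proof -
    have "holo_on (\<lambda>y. (fst y, 0, 0)) ?O" by (intro holo_on_Pair holo_on_fst holo_on_id holo_on_const)
    then show ?thesis
      unfolding s_def
      by (intro holo_fps_scalar) (rule holo_on_compose[OF _ holo_sig_nth], use OD diag_nbhd_origin in auto)
  qed
  have ds: "cderiv_fps (0, v) s y = 0" for v y
    unfolding s_def cderiv_fps_scalar by (simp add: cderiv_def scaleC_prod_def)
  note hD = holo_fps_cderiv_fps[OF O hF]
  have expand: "fps_const (fst (snd (symbol_arg y)) $ i) * P (symbol_arg y) + fps_X * cderiv_fps (dir_z i) P (symbol_arg y) =
      (fps_const (snd (snd y) $ i) * F y + s y * F y) +
      ((\<Sum>j\<in>UNIV. fps_const (fst (snd y) $ j) * (a j y * F y)) + fps_X * cderiv_fps (dir_z i) P (symbol_arg y))"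
    if "y \<in> ?O" for y
  proof -
    have "fst (snd (symbol_arg y)) $ i = snd (snd y) $ i + (sig (fst y, 0, 0) $ i +
        (\<Sum>j\<in>UNIV. fst (snd y) $ j * cderiv (vdir i) (\<lambda>y. sig y $ j) y))"
      using sig_expansion[of y i] that OD by (auto simp: symbol_arg_def)
    then have "fps_const (fst (snd (symbol_arg y)) $ i) = fps_const (snd (snd y) $ i) + (s y +
        (\<Sum>j\<in>UNIV. fps_const (fst (snd y) $ j) * a j y))"
      by (simp only: s_def a_def fps_const_add[symmetric] fps_const_mult fps_const_sum)
    then show ?thesis
      by (simp add: F_def distrib_right sum_distrib_right mult.assoc add.assoc)
  qed
  have ez: "lap_exp (\<lambda>y. fps_const (fst (snd y) $ j) * (a j y * F y)) p =
      fps_X * lap_exp (\<lambda>y. a j y * cderiv_fps (dir_zeta' j) F y) p" for j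
  proof -
    \<comment> \<open>The coefficients \<open>a j\<close> come from \<sigma>, which is free of
      \<zeta>', so the derivative produced by the factor z'_j falls on F alone.\<close>
    have "cderiv_fps (dir_zeta' j) (\<lambda>y. a j y * F y) y = a j y * cderiv_fps (dir_zeta' j) F y" if "y \<in> ?O" for y
    proof -
      have "cderiv (vdir i) (\<lambda>y. sig y $ k) (y + c *\<^sub>C dir_zeta' j) = cderiv (vdir i) (\<lambda>y. sig y $ k) y" for c k
        by (simp add: cderiv_def sig_def scaleC_prod_def)
      then have "cderiv_fps (dir_zeta' j) (a j) y = 0"
        unfolding a_def cderiv_fps_scalar by (simp add: cderiv_def[of "dir_zeta' j"])
      then show ?thesis by (simp add: cderiv_fps_mult[OF ha hF that])
    qed
    then show ?thesis
      unfolding lap_exp_z[OF O holo_fps_mult[OF ha hF] p]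
      by (intro arg_cong[of _ _ "(*) fps_X"] lap_exp_cong[OF O _ p])
  qed
  have eX: "lap_exp (\<lambda>y. fps_X * G y) p = fps_X * lap_exp G p" if "holo_fps ?O G" for G
    by (rule lap_exp_mult_base[OF O holo_fps_const that p]) auto
  have "lap_exp (\<lambda>y. fps_const (fst (snd (symbol_arg y)) $ i) * P (symbol_arg y) +
      fps_X * cderiv_fps (dir_z i) P (symbol_arg y)) p =
      lap_exp (\<lambda>y. (fps_const (snd (snd y) $ i) * F y + s y * F y) +
      ((\<Sum>j\<in>UNIV. fps_const (fst (snd y) $ j) * (a j y * F y)) + fps_X * cderiv_fps (dir_z i) P (symbol_arg y))) p"
    by (rule lap_exp_cong[OF O expand p])
  also have "\<dots> = (lap_exp (\<lambda>y. fps_const (snd (snd y) $ i) * F y) p + lap_exp (\<lambda>y. s y * F y) p) +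
      ((\<Sum>j\<in>UNIV. lap_exp (\<lambda>y. fps_const (fst (snd y) $ j) * (a j y * F y)) p) +
       lap_exp (\<lambda>y. fps_X * cderiv_fps (dir_z i) P (symbol_arg y)) p)"
  proof -
    note h1 = holo_fps_mult[OF hzeta hF] and h2 = holo_fps_mult[OF hs hF]
      and h3 = holo_fps_mult[OF hz holo_fps_mult[OF ha hF]] and h4 = holo_fps_mult[OF holo_fps_const hDP]
    show ?thesis
      unfolding lap_exp_add[OF O holo_fps_add[OF h1 h2] holo_fps_add[OF holo_fps_sum[OF h3] h4] p]
        lap_exp_add[OF O h1 h2 p] lap_exp_add[OF O holo_fps_sum[OF h3] h4 p] lap_exp_sum[OF O finite h3 p] ..
  qed
  also have "\<dots> = fps_const (sig (p, 0, 0) $ i) * lap_exp F p +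
      fps_X * (lap_exp (\<lambda>y. cderiv_fps (dir_z i) P (symbol_arg y)) p +
        (\<Sum>j\<in>UNIV. lap_exp (\<lambda>y. a j y * cderiv_fps (dir_zeta' j) F y) p) + lap_exp (cderiv_fps (dir_z' i) F) p)"
    unfolding lap_exp_zeta[OF O hF p] ez eX[OF hDP] lap_exp_mult_base[OF O hs hF p ds ds]
    by (simp add: s_def distrib_left sum_distrib_left ac_simps)
  also have "lap_exp (\<lambda>y. cderiv_fps (dir_z i) P (symbol_arg y)) p +
        (\<Sum>j\<in>UNIV. lap_exp (\<lambda>y. a j y * cderiv_fps (dir_zeta' j) F y) p) + lap_exp (cderiv_fps (dir_z' i) F) p =
      lap_exp (cderiv_fps (dir_z i, 0, 0) F) p"
  proof -
    note h5 = holo_fps_mult[OF ha hD]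
    have "cderiv_fps (dir_z i, 0, 0) F y = cderiv_fps (dir_z i) P (symbol_arg y) +
        (\<Sum>j\<in>UNIV. a j y * cderiv_fps (dir_zeta' j) F y) + cderiv_fps (dir_z' i) F y" if "y \<in> ?O" for y
    proof -
      \<comment> \<open>Moving z with z' fixed means moving z with z + z' fixed and then moving z'
        along.\<close>
      have "(dir_z i, 0, 0) = vdir i + (0, axis i 1, 0)"
        by (simp add: vdir_def dir_z_def)
      then have "cderiv_fps (dir_z i, 0, 0) F y = cderiv_fps (vdir i) F y + cderiv_fps (dir_z' i) F y"
        using cderiv_fps_add_direction[OF hF that] by metis
      then show ?thesis
        unfolding F_def cderiv_fps_symbol_arg_vdir[OF U that] cderiv_fps_symbol_arg_zeta' a_def by simp
    qed
    then have "lap_exp (cderiv_fps (dir_z i, 0, 0) F) p = lap_exp (\<lambda>y. cderiv_fps (dir_z i) P (symbol_arg y) +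
        (\<Sum>j\<in>UNIV. a j y * cderiv_fps (dir_zeta' j) F y) + cderiv_fps (dir_z' i) F y) p"
      by (rule lap_exp_cong[OF O _ p])
    then show ?thesis
      unfolding lap_exp_add[OF O holo_fps_add[OF hDP holo_fps_sum[OF h5]] hD p]
        lap_exp_add[OF O hDP holo_fps_sum[OF h5] p] lap_exp_sum[OF O finite h5 p] by simp
  qed
  also have "lap_exp (cderiv_fps (dir_z i, 0, 0) F) p = cderiv_fps (dir_z i) (lap_exp F) p"
    by (rule cderiv_fps_lap_exp[OF O _ hF, of "{p. (p, 0, 0) \<in> ?O}", symmetric]) (use p in auto)
  finally show ?thesis unfolding F_def .
qed

end

section \<open>The pullback as an operator on functions of a point\<close>

context coord_change
begin

text \<open>\<Phi> is inserted only after the exponential, so that the preceding computation could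
  be carried out in the old base coordinate z.\<close>

definition pull :: "('n point \<Rightarrow> complex fps) \<Rightarrow> 'n point \<Rightarrow> complex fps"
  where "pull P x = lap_exp (\<lambda>y. P (symbol_arg y)) (\<Phi> (fst x), snd x)"

definition pull_dom :: "'n point set \<Rightarrow> 'n point set"
  where "pull_dom U = (W \<times> UNIV) \<inter> (\<lambda>x. ((\<Phi> (fst x), snd x), 0, 0)) -` arg_dom U"

lemma holo_pull_base: "holo_on (\<lambda>x. (\<Phi> (fst x), snd x)) (W \<times> UNIV)"
proof (rule holo_on_Pair[OF _ holo_on_snd[OF holo_on_id]])
  show "holo_on (\<lambda>x. \<Phi> (fst x)) (W \<times> UNIV)"
    by (rule holo_on_compose[OF holo_on_fst[OF holo_on_id] holo_\<Phi>]) auto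
qed

lemma open_pull_dom:
  assumes "open U"
  shows "open (pull_dom U)"
proof -
  have "holo_on (\<lambda>x. ((\<Phi> (fst x), snd x), 0, 0)) (W \<times> UNIV)"
    by (rule holo_on_compose[OF holo_pull_base holo_on_origin]) (rule UNIV_I)
  then show ?thesis
    unfolding pull_dom_def
    by (rule open_vimage_holo) (auto intro: open_Times W open_arg_dom assms)
qed

lemma pull_domD: "x \<in> pull_dom U \<Longrightarrow> fst x \<in> W" "x \<in> pull_dom U \<Longrightarrow> ((\<Phi> (fst x), snd x), 0, 0) \<in> arg_dom U"
  by (auto simp: pull_dom_def)

lemma pull_dom_iff:
  "x \<in> pull_dom U \<longleftrightarrow> fst x \<in> W \<and> symbol_arg ((\<Phi> (fst x), snd x), 0, 0) \<in> U"
  using N(3) \<Phi>_in by (auto simp: pull_dom_def arg_dom_def diag_nbhd_def mem_Times_iff)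

lemma pull_cong:
  assumes "open U" "\<And>x. x \<in> U \<Longrightarrow> P x = Q x" "x \<in> pull_dom U"
  shows "pull P x = pull Q x"
  unfolding pull_def
  by (rule lap_exp_cong[OF open_arg_dom[OF assms(1)] _ pull_domD(2)[OF assms(3)]]) (simp add: arg_dom_def assms(2))

lemma pull_add:
  assumes "open U" "holo_fps U P" "holo_fps U Q" "x \<in> pull_dom U"
  shows "pull (\<lambda>x. P x + Q x) x = pull P x + pull Q x"
  unfolding pull_def
  by (rule lap_exp_add[OF open_arg_dom[OF assms(1)] holo_fps_symbol_arg[OF assms(2)] holo_fps_symbol_arg[OF assms(3)]
        pull_domD(2)[OF assms(4)]])

text \<open>\<open>symbol_arg\<close> does not move z and \<eta>, so a factor depending only on
  these is constant in z' and \<zeta>' and passes through the exponential.\<close>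

lemma pull_mult_base:
  assumes "open U" "holo_fps U C" "holo_fps U P" "x \<in> pull_dom U"
    and C: "\<And>z \<zeta> \<zeta>' \<eta>. (z, \<zeta>, \<eta>) \<in> U \<Longrightarrow> (z, \<zeta>', \<eta>) \<in> U \<Longrightarrow> C (z, \<zeta>, \<eta>) = C (z, \<zeta>', \<eta>)"
  shows "pull (\<lambda>x. C x * P x) x = C (symbol_arg ((\<Phi> (fst x), snd x), 0, 0)) * pull P x"
  unfolding pull_def
proof (rule lap_exp_mult_base[OF open_arg_dom[OF assms(1)] holo_fps_symbol_arg[OF assms(2)] holo_fps_symbol_arg[OF assms(3)]
      pull_domD(2)[OF assms(4)]])
  have D: "cderiv_fps (0, v) (\<lambda>y. C (symbol_arg y)) y = 0" if y: "y \<in> arg_dom U" for v y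
  proof (rule fps_ext)
    fix m
    let ?M = "(\<lambda>c. y + c *\<^sub>C (0, v)) -` arg_dom U"
    have "open ?M"
      by (intro open_vimage open_arg_dom assms(1) continuous_intros)
    then have "eventually (\<lambda>c. c \<in> ?M) (nhds 0)"
      using y by (intro eventually_nhds_in_open) auto
    then have "eventually (\<lambda>c. fps_nth (C (symbol_arg (y + c *\<^sub>C (0, v)))) m = fps_nth (C (symbol_arg y)) m) (nhds 0)"
    proof eventually_elim
      case (elim c)
      have eq: "fst (symbol_arg (y + c *\<^sub>C (0, v))) = fst (symbol_arg y)"
          "snd (snd (symbol_arg (y + c *\<^sub>C (0, v)))) = snd (snd (symbol_arg y))"
        by (simp_all add: symbol_arg_def scaleC_prod_def)
      then have 1: "(fst (symbol_arg y), fst (snd (symbol_arg (y + c *\<^sub>C (0, v)))), snd (snd (symbol_arg y))) = symbol_arg (y + c *\<^sub>C (0, v))"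
        by (simp flip: eq)
      have "C (fst (symbol_arg y), fst (snd (symbol_arg (y + c *\<^sub>C (0, v)))), snd (snd (symbol_arg y))) =
          C (fst (symbol_arg y), fst (snd (symbol_arg y)), snd (snd (symbol_arg y)))"
        by (rule C, unfold 1) (use elim y in \<open>auto simp: arg_dom_def\<close>)
      then show ?case unfolding 1 by simp
    qed
    then have "deriv (\<lambda>c. fps_nth (C (symbol_arg (y + c *\<^sub>C (0, v)))) m) 0 = deriv (\<lambda>c. fps_nth (C (symbol_arg y)) m) 0"
      by (rule deriv_cong_ev) simp
    then show "fps_nth (cderiv_fps (0, v) (\<lambda>y. C (symbol_arg y)) y) m = fps_nth 0 m"
      by (simp add: cderiv_def)
  qed
  show "cderiv_fps (dir_z' j) (\<lambda>y. C (symbol_arg y)) y = 0" "cderiv_fps (dir_zeta' j) (\<lambda>y. C (symbol_arg y)) y = 0"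
    if "y \<in> arg_dom U" for j y
    using D[OF that] by blast+
qed

lemma holo_fps_pull:
  assumes U: "open U" "holo_fps U P"
  shows "holo_fps (pull_dom U) (pull P)"
proof -
  have "holo_fps {p. (p, 0, 0) \<in> arg_dom U} (lap_exp (\<lambda>y. P (symbol_arg y)))"
    by (rule holo_fps_lap_exp[OF open_arg_dom[OF U(1)] _ holo_fps_symbol_arg[OF U(2)]]) auto
  moreover have "holo_on (\<lambda>x. (\<Phi> (fst x), snd x)) (pull_dom U)"
    by (rule holo_on_subset[OF holo_pull_base]) (auto simp: pull_dom_def)
  ultimately show ?thesis
    unfolding pull_def[abs_def] using holo_fps_compose[of "\<lambda>x. (\<Phi> (fst x), snd x)" "pull_dom U"]
      pull_domD(2) by blast
qed

text \<open>In view of \<open>star_zeta\<close>, this is the relation between the pullback of the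
  composition of \<zeta>_i with P and the compositions of \<mu>_j with the pullback of P, written
  out. The derivative in z found before becomes a combination of derivatives in w by the chain rule
  along g, whose Jacobian matrix is J(z, z).\<close>

lemma pull_zeta:
  assumes U: "open U" "holo_fps U P" and x: "x \<in> pull_dom U"
  shows "pull (\<lambda>x. fps_const (fst (snd x) $ i) * P x + fps_X * cderiv_fps (dir_z i) P x) x =
    (\<Sum>j\<in>UNIV. fps_const (J (\<Phi> (fst x)) (\<Phi> (fst x)) $ j $ i) *
      (fps_const (fst (snd x) $ j) * pull P x + fps_X * cderiv_fps (dir_z j) (pull P) x))"
proof -
  define p where "p = (\<Phi> (fst x), snd x)"
  let ?z = "\<Phi> (fst x)"
  let ?E = "lap_exp (\<lambda>y. P (symbol_arg y))"
  have p: "(p, 0, 0) \<in> arg_dom U" and w: "fst x \<in> W"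
    using pull_domD[OF x] by (auto simp: p_def)
  have gx: "(g (fst p), snd p) = x" by (simp add: p_def g_\<Phi>[OF w])
  define M where "M = {p. (p, 0, 0) \<in> arg_dom U}"
  have M: "open M" "p \<in> M"
  proof -
    have "M = (\<lambda>p. (p, 0, 0)) -` arg_dom U" by (auto simp: M_def)
    then show "open M" using open_arg_dom[OF U(1)] by (auto intro!: open_vimage continuous_intros)
  qed (use p in \<open>simp add: M_def\<close>)
  have MV: "fst q \<in> V" if "q \<in> M" for q
    using that diag_nbhd_in_V[of "(q, 0, 0)"] by (simp add: M_def arg_dom_def)
  have inv_dom: "(g (fst q), snd q) \<in> pull_dom U" if "q \<in> M" for q
    using that MV[OF that] by (auto simp: M_def pull_dom_def \<Phi>_g g_in)
  have h\<psi>: "holo_on (\<lambda>q. (g (fst q), snd q)) M"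
    by (intro holo_on_Pair holo_on_snd holo_on_id holo_on_compose[OF holo_on_fst[OF holo_on_id] holo_g]) (rule MV)
  have "cderiv_fps (dir_z i) ?E p = cderiv_fps (dir_z i) (\<lambda>q. pull P (g (fst q), snd q)) p"
    by (rule cderiv_fps_cong[OF M]) (use MV \<Phi>_g in \<open>simp add: pull_def\<close>)
  also have "\<dots> = (\<Sum>j\<in>UNIV. fps_const (cderiv (dir_z i) (\<lambda>q. g (fst q) $ j) p) * cderiv_fps (dir_z j) (pull P) x)"
  proof -
    have 2: "cderiv (dir_z i) (\<lambda>q::'n point. fst (snd q) $ j) p = 0" for j
      by (simp add: cderiv_def dir_z_def scaleC_prod_def)
    have 3: "cderiv (dir_z i) (\<lambda>q::'n point. snd (snd q)) p = 0"
      by (simp add: cderiv_def dir_z_def scaleC_prod_def)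
    show ?thesis
      using cderiv_fps_chain[OF h\<psi> holo_fps_pull[OF U] M(2) inv_dom[OF M(2)], of "dir_z i"]
      by (simp add: 2 3 gx)
  qed
  also have "\<dots> = (\<Sum>j\<in>UNIV. fps_const (J ?z ?z $ j $ i) * cderiv_fps (dir_z j) (pull P) x)"
  proof -
    have "cderiv (dir_z i) (\<lambda>q. g (fst q) $ j) p = J ?z ?z $ j $ i" for j
      using cderiv_g[OF \<Phi>_in[OF w], of i j] by (simp add: cderiv_def dir_z_def scaleC_prod_def p_def)
    then show ?thesis by simp
  qed
  finally have D: "cderiv_fps (dir_z i) ?E p = \<dots>" .
  have s: "fps_const (sig (p, 0, 0) $ i) =
      (\<Sum>j\<in>UNIV. fps_const (J ?z ?z $ j $ i) * fps_const (fst (snd x) $ j))"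
    by (simp add: sig_nth p_def fps_const_sum)
  have "pull (\<lambda>x. fps_const (fst (snd x) $ i) * P x + fps_X * cderiv_fps (dir_z i) P x) x =
      fps_const (sig (p, 0, 0) $ i) * ?E p + fps_X * cderiv_fps (dir_z i) ?E p"
    unfolding pull_def p_def[symmetric] by (rule lap_exp_symbol_arg_zeta[OF U p])
  also have "?E p = pull P x" by (simp add: pull_def p_def)
  finally show ?thesis
    unfolding D s by (simp add: sum_distrib_left sum_distrib_right distrib_left sum.distrib ac_simps)
qed

text \<open>
  An operator \<open>T\<close> with the five properties below is determined up to order \<open>m\<close> at a point by its values
  up to order \<open>m - 1\<close> near that point: at the point itself the factor \<open>\<zeta>\<^sub>i - \<zeta>0\<^sub>i\<close> contributes nothing.
\<close>

lemma hadamard_expansion: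
  assumes B: "open B" and C: "holo_fps B C" and H: "\<And>i. holo_fps B (H i)"
    and F: "\<And>x. x \<in> B \<Longrightarrow> F x = C x + (\<Sum>i\<in>UNIV. fps_const (fst (snd x) $ i - \<zeta>0 $ i) * H i x)"
    and x: "x \<in> pull_dom B" and \<zeta>0: "\<zeta>0 = sig ((\<Phi> (fst x), snd x), 0, 0)"
    and cong: "\<And>F G. (\<And>x. x \<in> B \<Longrightarrow> F x = G x) \<Longrightarrow> T F x = T G x"
    and add: "\<And>F G. holo_fps B F \<Longrightarrow> holo_fps B G \<Longrightarrow> T (\<lambda>x. F x + G x) x = T F x + T G x"
    and mult: "\<And>c F. holo_fps B F \<Longrightarrow> T (\<lambda>x. c * F x) x = c * T F x"
    and zeta: "\<And>i F. holo_fps B F \<Longrightarrow>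
      T (\<lambda>x. fps_const (fst (snd x) $ i) * F x + fps_X * cderiv_fps (dir_z i) F x) x =
      (\<Sum>j\<in>UNIV. fps_const (J (\<Phi> (fst x)) (\<Phi> (fst x)) $ j $ i) *
        (fps_const (fst (snd x) $ j) * T F x + fps_X * cderiv_fps (dir_z j) (T F) x))"
  shows "T F x = T C x + fps_X * (\<Sum>i\<in>UNIV. (\<Sum>j\<in>UNIV. fps_const (J (\<Phi> (fst x)) (\<Phi> (fst x)) $ j $ i) *
    cderiv_fps (dir_z j) (T (H i)) x) - T (cderiv_fps (dir_z i) (H i)) x)"
proof -
  let ?J = "\<lambda>j i. fps_const (J (\<Phi> (fst x)) (\<Phi> (fst x)) $ j $ i)"
  \<comment> \<open>\<open>K i\<close> is (\<zeta>_i - \<zeta>0_i) H_i, with t dH_i/dz_i added and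
    subtracted so that the first bracket is the composition of \<zeta>_i with H_i, to which
    \<open>zeta\<close> applies.\<close>
  define K where "K i x = (fps_const (fst (snd x) $ i) * H i x + fps_X * cderiv_fps (dir_z i) (H i) x) +
      (fps_const (- \<zeta>0 $ i) * H i x + (- fps_X) * cderiv_fps (dir_z i) (H i) x)" for i x
  note hD = holo_fps_cderiv_fps[OF B H]
  have hz: "holo_fps B (\<lambda>x. fps_const (fst (snd x) $ i))" for i
    by (intro holo_fps_scalar holo_on_intros)
  have h1: "holo_fps B (\<lambda>x. fps_const (fst (snd x) $ i) * H i x + fps_X * cderiv_fps (dir_z i) (H i) x)" for i
    by (intro holo_fps_add holo_fps_mult hz H hD holo_fps_const)
  have h2: "holo_fps B (\<lambda>x. fps_const (- \<zeta>0 $ i) * H i x + (- fps_X) * cderiv_fps (dir_z i) (H i) x)" for i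
    by (intro holo_fps_add holo_fps_mult H hD holo_fps_const)
  have hK: "holo_fps B (K i)" for i
    unfolding K_def by (rule holo_fps_add[OF h1 h2])
  have hsum: "holo_fps B (\<lambda>x. \<Sum>i\<in>I. K i x)" for I
    by (intro holo_fps_sum hK)
  have sum: "T (\<lambda>x. \<Sum>i\<in>I. K i x) x = (\<Sum>i\<in>I. T (K i) x)" if "finite I" for I
    using that
  proof (induction I)
    case empty
    have "T (\<lambda>x. 0 * 0) x = 0" using mult[of "\<lambda>x. 0" 0] by simp
    then show ?case by simp
  next
    case (insert i I)
    then show ?case using add[OF hK[of i] hsum[of I]] by simp
  qed
  have J\<mu>: "(\<Sum>j\<in>UNIV. ?J j i * fps_const (fst (snd x) $ j)) = fps_const (\<zeta>0 $ i)" for i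
    by (simp add: \<zeta>0 sig_nth fps_const_sum)
  \<comment> \<open>By the choice of \<zeta>0 the two multiples of \<open>T (H i) x\<close> cancel,
    and every remaining term carries a factor \<open>fps_X\<close>.\<close>
  have TK: "T (K i) x = fps_X * ((\<Sum>j\<in>UNIV. ?J j i * cderiv_fps (dir_z j) (T (H i)) x) -
      T (cderiv_fps (dir_z i) (H i)) x)" for i
  proof -
    have "T (K i) x = (\<Sum>j\<in>UNIV. ?J j i * (fps_const (fst (snd x) $ j) * T (H i) x +
        fps_X * cderiv_fps (dir_z j) (T (H i)) x)) +
        (fps_const (- \<zeta>0 $ i) * T (H i) x + (- fps_X) * T (cderiv_fps (dir_z i) (H i)) x)"
      unfolding K_def add[OF h1 h2] zeta[OF H]
      by (subst add) (intro holo_fps_mult H hD holo_fps_const, intro holo_fps_mult H hD holo_fps_const,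
          simp only: mult[OF H] mult[OF hD])
    also have "(\<Sum>j\<in>UNIV. ?J j i * (fps_const (fst (snd x) $ j) * T (H i) x +
        fps_X * cderiv_fps (dir_z j) (T (H i)) x)) =
        (\<Sum>j\<in>UNIV. ?J j i * fps_const (fst (snd x) $ j)) * T (H i) x +
        fps_X * (\<Sum>j\<in>UNIV. ?J j i * cderiv_fps (dir_z j) (T (H i)) x)"
      unfolding sum_distrib_left sum_distrib_right sum.distrib[symmetric]
      by (intro sum.cong refl) (simp add: distrib_left ac_simps)
    finally show ?thesis
      unfolding J\<mu> by (simp add: right_diff_distrib flip: fps_const_neg)
  qed
  have "T F x = T (\<lambda>x. C x + (\<Sum>i\<in>UNIV. K i x)) x"
  proof (rule cong)
    fix x assume "x \<in> B"
    have "fps_const (fst (snd x) $ i - \<zeta>0 $ i) * H i x = K i x" for i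
      by (simp add: K_def left_diff_distrib flip: fps_const_sub fps_const_neg)
    with F[OF \<open>x \<in> B\<close>] show "F x = C x + (\<Sum>i\<in>UNIV. K i x)" by simp
  qed
  also have "\<dots> = T C x + (\<Sum>i\<in>UNIV. T (K i) x)"
    using add[OF C hsum[of UNIV]] sum[of UNIV] by simp
  finally show ?thesis
    by (simp add: TK sum_distrib_left)
qed

text \<open>For fixed P, both sides as operators in Q satisfy the hypotheses of
  \<open>hadamard_expansion\<close>. The correction terms involve the Hadamard quotients of Q and
  their derivatives one order lower, whence an induction over all U, Q and x at once.\<close>

lemma fps_nth_pull_star:
  assumes "open U" "holo_fps U P" "holo_fps U Q" "x \<in> pull_dom U"
  shows "fps_nth (star (pull Q) (pull P) x) m = fps_nth (pull (star Q P) x) m"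
  using assms
proof (induction m arbitrary: U P Q x rule: less_induct)
  case (less m)
  note U = less.prems(1) and hP = less.prems(2) and hQ = less.prems(3) and x = less.prems(4)
  define q where "q = symbol_arg ((\<Phi> (fst x), snd x), 0, 0)"
  define \<zeta>0 where "\<zeta>0 = sig ((\<Phi> (fst x), snd x), 0, 0)"
  have q: "q = (\<Phi> (fst x), \<zeta>0, snd (snd x))" by (simp add: q_def symbol_arg_def \<zeta>0_def)
  have "q \<in> U" using x by (simp add: pull_dom_iff q_def)
  \<comment> \<open>A ball centred at the argument point is taken because Hadamard's lemma
    integrates along segments of the fibre ending at \<zeta>0.\<close>
  then obtain e where e: "e > 0" "ball q e \<subseteq> U" using U open_contains_ball by blast
  define B where "B = ball q e"
  have B: "open B" "B \<subseteq> U" and qB: "q \<in> B" using e by (auto simp: B_def)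
  have xB: "x \<in> pull_dom B" using x qB by (simp add: pull_dom_iff q_def)
  have hPB: "holo_fps B P" and hQB: "holo_fps B Q"
    using hP hQ B(2) by (auto intro: holo_fps_subset)
  have "\<forall>k. \<exists>h. (\<forall>i. holo_on (h i) B) \<and> (\<forall>z \<zeta> \<eta>. (z, \<zeta>, \<eta>) \<in> B \<longrightarrow>
      fps_nth (Q (z, \<zeta>, \<eta>)) k = fps_nth (Q (z, \<zeta>0, \<eta>)) k + (\<Sum>i\<in>UNIV. (\<zeta> $ i - \<zeta>0 $ i) * h i (z, \<zeta>, \<eta>)))"
  proof
    fix k
    have hk: "holo_on (\<lambda>x. fps_nth (Q x) k) (ball (\<Phi> (fst x), \<zeta>0, snd (snd x)) e)"
      using holo_fpsD[OF hQB, of k] by (simp add: B_def q)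
    show "\<exists>h. (\<forall>i. holo_on (h i) B) \<and> (\<forall>z \<zeta> \<eta>. (z, \<zeta>, \<eta>) \<in> B \<longrightarrow>
      fps_nth (Q (z, \<zeta>, \<eta>)) k = fps_nth (Q (z, \<zeta>0, \<eta>)) k + (\<Sum>i\<in>UNIV. (\<zeta> $ i - \<zeta>0 $ i) * h i (z, \<zeta>, \<eta>)))"
      unfolding B_def q by (rule hadamard_zeta[OF hk]) blast
  qed
  from choice[OF this] obtain h where h: "\<And>k i. holo_on (h k i) B"
    "\<And>k z \<zeta> \<eta>. (z, \<zeta>, \<eta>) \<in> B \<Longrightarrow> fps_nth (Q (z, \<zeta>, \<eta>)) k =
      fps_nth (Q (z, \<zeta>0, \<eta>)) k + (\<Sum>i\<in>UNIV. (\<zeta> $ i - \<zeta>0 $ i) * h k i (z, \<zeta>, \<eta>))" by blast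
  define H where "H i x = Abs_fps (\<lambda>k. h k i x)" for i x
  have hH: "holo_fps B (H i)" for i by (simp add: holo_fps_def H_def h(1))
  define C where "C x = Q (fst x, \<zeta>0, snd (snd x))" for x :: "'n point"
  have C_in: "(fst x, \<zeta>0, snd (snd x)) \<in> B" if "x \<in> B" for x
  proof -
    have "norm ((fst x, \<zeta>0, snd (snd x)) - q) \<le> norm (x - q)"
      by (cases x) (simp add: q norm_prod_def)
    then show ?thesis using that by (simp add: B_def dist_norm norm_minus_commute)
  qed
  have hC: "holo_fps B C"
    unfolding C_def
    by (rule holo_fps_compose[OF _ hQB C_in]) (intro holo_on_Pair holo_on_fst holo_on_snd holo_on_id holo_on_const)
  have Q_eq: "Q x = C x + (\<Sum>i\<in>UNIV. fps_const (fst (snd x) $ i - \<zeta>0 $ i) * H i x)" if "x \<in> B" for x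
  proof (rule fps_ext)
    fix k
    show "fps_nth (Q x) k = fps_nth (C x + (\<Sum>i\<in>UNIV. fps_const (fst (snd x) $ i - \<zeta>0 $ i) * H i x)) k"
      using h(2)[of "fst x" "fst (snd x)" "snd (snd x)" k] that
      by (simp add: fps_sum_nth H_def C_def)
  qed
  define L where "L F = star (pull F) (pull P)" for F
  define R where "R F = pull (star F P)" for F
  let ?J = "\<lambda>j i. fps_const (J (\<Phi> (fst x)) (\<Phi> (fst x)) $ j $ i)"
  define Ext where "Ext T = fps_X * (\<Sum>i\<in>UNIV. (\<Sum>j\<in>UNIV. ?J j i * cderiv_fps (dir_z j) (T (H i)) x) -
      T (cderiv_fps (dir_z i) (H i)) x)" for T :: "('n point \<Rightarrow> complex fps) \<Rightarrow> 'n point \<Rightarrow> complex fps"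
  note pB = open_pull_dom[OF B(1)]
  note hpull = holo_fps_pull[OF B(1)]
  have L_eq: "L Q x = L C x + Ext L"
    unfolding Ext_def
  proof (rule hadamard_expansion[OF B(1) hC hH Q_eq xB \<zeta>0_def])
    fix F G :: "'n point \<Rightarrow> complex fps" assume "\<And>x. x \<in> B \<Longrightarrow> F x = G x"
    then show "L F x = L G x"
      unfolding L_def by (intro star_cong[OF pB _ _ xB] pull_cong[OF B(1)] refl)
  next
    fix F G assume F: "holo_fps B F" and G: "holo_fps B G"
    have "L (\<lambda>x. F x + G x) x = star (\<lambda>x. pull F x + pull G x) (pull P) x"
      unfolding L_def by (intro star_cong[OF pB _ _ xB] pull_add[OF B(1) F G] refl)
    then show "L (\<lambda>x. F x + G x) x = L F x + L G x"
      unfolding L_def by (simp add: star_add_left[OF pB hpull[OF F] hpull[OF G] xB])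
  next
    fix c F assume F: "holo_fps B F"
    have "L (\<lambda>x. c * F x) x = star (\<lambda>x. c * pull F x) (pull P) x"
      unfolding L_def by (intro star_cong[OF pB _ _ xB] pull_mult_base[OF B(1) holo_fps_const F] refl)
    also have "\<dots> = c * L F x"
      unfolding L_def by (rule star_mult_left[OF pB holo_fps_const hpull[OF F] xB]) simp
    finally show "L (\<lambda>x. c * F x) x = c * L F x" .
  next
    fix i F assume F: "holo_fps B F"
    let ?Z = "\<lambda>j (x::'n point). fps_const (fst (snd x) $ j)"
    let ?Jf = "\<lambda>j x. fps_const (J (\<Phi> (fst x)) (\<Phi> (fst x)) $ j $ i)"
    have hZ: "holo_fps S (?Z j)" for j S
      by (intro holo_fps_scalar holo_on_intros)
    have hJ: "holo_fps (pull_dom B) (?Jf j)" for j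
    proof (intro holo_fps_scalar)
      have "holo_on (\<lambda>x. \<Phi> (fst x)) (pull_dom B)"
        by (rule holo_on_compose[OF holo_on_fst[OF holo_on_id] holo_\<Phi>]) (rule pull_domD(1))
      then have "holo_on (\<lambda>x. (\<Phi> (fst x), \<Phi> (fst x))) (pull_dom B)"
        by (intro holo_on_Pair)
      from holo_on_compose[OF this holo_J_nth[of j i]]
      show "holo_on (\<lambda>x. J (\<Phi> (fst x)) (\<Phi> (fst x)) $ j $ i) (pull_dom B)"
        using N(3)[OF \<Phi>_in[OF pull_domD(1)]] by simp
    qed
    have dJ: "cderiv_fps (dir_zeta k) (?Jf j) y = 0" for k j y
      unfolding cderiv_fps_scalar by (simp add: cderiv_def dir_zeta_def scaleC_prod_def)
    have hS: "holo_fps (pull_dom B) (star (?Z j) (pull F))" for j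
      by (rule holo_fps_star[OF pB hZ hpull[OF F]])
    have "L (\<lambda>x. fps_const (fst (snd x) $ i) * F x + fps_X * cderiv_fps (dir_z i) F x) x =
        star (\<lambda>x. \<Sum>j\<in>UNIV. ?Jf j x * star (?Z j) (pull F) x) (pull P) x"
      unfolding L_def
      by (intro star_cong[OF pB _ _ xB] refl) (simp add: pull_zeta[OF B(1) F] star_zeta[OF pB hpull[OF F]])
    also have "\<dots> = (\<Sum>j\<in>UNIV. star (\<lambda>x. ?Jf j x * star (?Z j) (pull F) x) (pull P) x)"
    proof -
      have "star (\<lambda>x. \<Sum>j\<in>I. ?Jf j x * star (?Z j) (pull F) x) (pull P) x =
          (\<Sum>j\<in>I. star (\<lambda>x. ?Jf j x * star (?Z j) (pull F) x) (pull P) x)" if "finite I" for I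
        using that
      proof (induction I)
        case empty
        show ?case using star_const_left[OF pB holo_fps_const hpull[OF hPB] xB, of 0] by simp
      next
        case (insert j I)
        have "star (\<lambda>x. ?Jf j x * star (?Z j) (pull F) x + (\<Sum>j\<in>I. ?Jf j x * star (?Z j) (pull F) x)) (pull P) x =
            star (\<lambda>x. ?Jf j x * star (?Z j) (pull F) x) (pull P) x +
            star (\<lambda>x. \<Sum>j\<in>I. ?Jf j x * star (?Z j) (pull F) x) (pull P) x"
          by (rule star_add_left[OF pB holo_fps_mult[OF hJ hS] holo_fps_sum[OF holo_fps_mult[OF hJ hS]] xB])
        with insert show ?case by simp
      qed
      then show ?thesis by simp
    qed
    \<comment> \<open>The factor J_ji at \<Phi>(w) is free of \<mu> and leaves the left factor;
      associativity then moves \<mu>_j to the outside.\<close>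
    also have "\<dots> = (\<Sum>j\<in>UNIV. ?J j i * star (star (?Z j) (pull F)) (pull P) x)"
      by (intro sum.cong refl star_mult_left[OF pB hJ hS xB] dJ)
    also have "\<dots> = (\<Sum>j\<in>UNIV. ?J j i * star (?Z j) (L F) x)"
      unfolding L_def by (simp only: star_assoc[OF pB hZ hpull[OF F] hpull[OF hPB] xB])
    also have "\<dots> = (\<Sum>j\<in>UNIV. ?J j i * (fps_const (fst (snd x) $ j) * L F x + fps_X * cderiv_fps (dir_z j) (L F) x))"
      unfolding L_def by (simp only: star_zeta[OF pB holo_fps_star[OF pB hpull[OF F] hpull[OF hPB]] xB])
    finally show "L (\<lambda>x. fps_const (fst (snd x) $ i) * F x + fps_X * cderiv_fps (dir_z i) F x) x = \<dots>" .
  qed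
  have R_eq: "R Q x = R C x + Ext R"
    unfolding Ext_def
  proof (rule hadamard_expansion[OF B(1) hC hH Q_eq xB \<zeta>0_def])
    fix F G :: "'n point \<Rightarrow> complex fps" assume "\<And>x. x \<in> B \<Longrightarrow> F x = G x"
    then show "R F x = R G x"
      unfolding R_def by (intro pull_cong[OF B(1) _ xB] star_cong[OF B(1)] refl)
  next
    fix F G assume F: "holo_fps B F" and G: "holo_fps B G"
    have "R (\<lambda>x. F x + G x) x = pull (\<lambda>x. star F P x + star G P x) x"
      unfolding R_def by (intro pull_cong[OF B(1) _ xB] star_add_left[OF B(1) F G])
    then show "R (\<lambda>x. F x + G x) x = R F x + R G x"
      unfolding R_def by (simp add: pull_add[OF B(1) holo_fps_star[OF B(1) F hPB] holo_fps_star[OF B(1) G hPB] xB])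
  next
    fix c F assume F: "holo_fps B F"
    have "R (\<lambda>x. c * F x) x = pull (\<lambda>x. c * star F P x) x"
      unfolding R_def by (intro pull_cong[OF B(1) _ xB] star_mult_left[OF B(1) holo_fps_const F]) auto
    also have "\<dots> = c * R F x"
      unfolding R_def by (rule pull_mult_base[OF B(1) holo_fps_const holo_fps_star[OF B(1) F hPB] xB]) simp
    finally show "R (\<lambda>x. c * F x) x = c * R F x" .
  next
    fix i F assume F: "holo_fps B F"
    let ?Z = "\<lambda>(x::'n point). fps_const (fst (snd x) $ i)"
    have hZ: "holo_fps B ?Z"
      by (intro holo_fps_scalar holo_on_intros)
    note hFP = holo_fps_star[OF B(1) F hPB]
    have "R (\<lambda>x. fps_const (fst (snd x) $ i) * F x + fps_X * cderiv_fps (dir_z i) F x) x =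
        pull (star (star ?Z F) P) x"
      unfolding R_def by (intro pull_cong[OF B(1) _ xB] star_cong[OF B(1)] refl star_zeta[OF B(1) F, symmetric])
    \<comment> \<open>Associativity moves \<zeta>_i to the outside, so that \<open>pull_zeta\<close>
      applies to the composition of F and P.\<close>
    also have "\<dots> = pull (\<lambda>x. fps_const (fst (snd x) $ i) * star F P x + fps_X * cderiv_fps (dir_z i) (star F P) x) x"
      by (rule pull_cong[OF B(1) _ xB])
        (simp only: star_assoc[OF B(1) hZ F hPB, symmetric] star_zeta[OF B(1) hFP])
    also have "\<dots> = (\<Sum>j\<in>UNIV. ?J j i * (fps_const (fst (snd x) $ j) * R F x + fps_X * cderiv_fps (dir_z j) (R F) x))"
      unfolding R_def by (rule pull_zeta[OF B(1) hFP xB])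
    finally show "R (\<lambda>x. fps_const (fst (snd x) $ i) * F x + fps_X * cderiv_fps (dir_z i) F x) x = \<dots>" .
  qed
  have C_indep: "C (z, \<zeta>, \<eta>) = C (z, \<zeta>', \<eta>)" for z \<zeta> \<zeta>' \<eta> by (simp add: C_def)
  have dC: "cderiv_fps (dir_zeta k) C y = 0" for k y
    by (rule fps_ext) (simp add: cderiv_def dir_zeta_def scaleC_prod_def C_def)
  \<comment> \<open>C is free of \<zeta>, so composing with it from the left is multiplication, and
    its pullback is free of \<mu>. Both sides reduce to C at the argument point times the pullback
    of P.\<close>
  have LR_C: "L C x = R C x"
  proof -
    have C1: "pull C y = C (symbol_arg ((\<Phi> (fst y), snd y), 0, 0))" if "y \<in> pull_dom B" for y
    proof -
      have "pull (\<lambda>x. C x * 1) y = C (symbol_arg ((\<Phi> (fst y), snd y), 0, 0)) * pull (\<lambda>x. 1) y"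
        by (rule pull_mult_base[OF B(1) hC holo_fps_const that]) (rule C_indep)
      then show ?thesis by (simp add: pull_def)
    qed
    have "cderiv_fps (dir_zeta k) (pull C) y = 0" if "y \<in> pull_dom B" for k y
    proof -
      have "cderiv_fps (dir_zeta k) (pull C) y = cderiv_fps (dir_zeta k) (\<lambda>y. C (symbol_arg ((\<Phi> (fst y), snd y), 0, 0))) y"
        by (rule cderiv_fps_cong[OF pB that C1])
      also have "\<dots> = 0"
        by (rule fps_ext) (simp add: cderiv_def dir_zeta_def scaleC_prod_def C_def symbol_arg_def)
      finally show ?thesis .
    qed
    then have "L C x = pull C x * pull P x"
      unfolding L_def by (intro star_const_left[OF pB hpull[OF hC] hpull[OF hPB] xB])
    also have "\<dots> = C (symbol_arg ((\<Phi> (fst x), snd x), 0, 0)) * pull P x"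
      by (simp add: C1[OF xB])
    also have "\<dots> = pull (\<lambda>x. C x * P x) x"
      by (rule pull_mult_base[OF B(1) hC hPB xB C_indep, symmetric])
    also have "\<dots> = R C x"
      unfolding R_def by (intro pull_cong[OF B(1) _ xB] star_const_left[OF B(1) hC hPB, symmetric] dC)
    finally show ?thesis .
  qed
  have "fps_nth (Ext L) m = fps_nth (Ext R) m"
  proof (cases m)
    case (Suc k)
    have IH: "fps_nth (L F y) k = fps_nth (R F y) k" if "holo_fps B F" "y \<in> pull_dom B" for F y
      unfolding L_def R_def using less.IH[OF _ B(1) hPB that] Suc by simp
    \<comment> \<open>A derivative in the base point occurs here, so the induction hypothesis is
      needed on a whole neighborhood of x and not only at x.\<close>
    have "cderiv (dir_z j) (\<lambda>y. fps_nth (L (H i) y) k) x = cderiv (dir_z j) (\<lambda>y. fps_nth (R (H i) y) k) x" for i j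
      by (rule cderiv_cong_open[OF pB xB IH[OF hH]])
    then show ?thesis
      by (simp add: Ext_def Suc fps_sum_nth IH[OF holo_fps_cderiv_fps[OF B(1) hH] xB])
  qed (simp add: Ext_def)
  then show ?case
    using L_eq R_eq LR_C by (simp add: L_def R_def)
qed

end

section \<open>Transfer of the pullback identity to truncated series\<close>

lemma fps_nth_lap:
  fixes G :: "'p::complex_space \<times> (complex ^ 'n) \<times> (complex ^ 'n::finite) \<Rightarrow> complex fps"
  shows "fps_nth (lap G y) j =
    (\<Sum>i\<in>UNIV. cderiv (dir_zeta' i) (cderiv (dir_z' i) (\<lambda>y. fps_nth (G y) j)) y)"
  by (simp add: lap_def fps_sum_nth)

lemma fps_nth_lap_funpow_cong:
  fixes G :: "'p::complex_space \<times> (complex ^ 'n) \<times> (complex ^ 'n::finite) \<Rightarrow> complex fps"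
  assumes V: "open V" and "\<And>y. y \<in> V \<Longrightarrow> fps_nth (G y) j = fps_nth (H y) j" and "y \<in> V"
  shows "fps_nth ((lap ^^ k) G y) j = fps_nth ((lap ^^ k) H y) j"
  using assms(3)
proof (induction k arbitrary: y)
  case (Suc k)
  have "cderiv (dir_zeta' i) (cderiv (dir_z' i) (\<lambda>y. fps_nth ((lap ^^ k) G y) j)) y =
      cderiv (dir_zeta' i) (cderiv (dir_z' i) (\<lambda>y. fps_nth ((lap ^^ k) H y) j)) y" for i
    by (rule cderiv_cong_open[OF V Suc.prems], rule cderiv_cong_open[OF V _ Suc.IH])
  then show ?case by (simp only: funpow.simps comp_apply fps_nth_lap)
qed (use assms(2) in simp)

context coord_change
begin

lemma fps_nth_pull_cong:
  assumes "open U" "\<And>x j. x \<in> U \<Longrightarrow> j \<le> m \<Longrightarrow> fps_nth (P x) j = fps_nth (Q x) j" "x \<in> pull_dom U"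
    and "j \<le> m"
  shows "fps_nth (pull P x) j = fps_nth (pull Q x) j"
proof -
  have "fps_nth ((lap ^^ k) (\<lambda>y. P (symbol_arg y)) ((\<Phi> (fst x), snd x), 0, 0)) (j - k) =
      fps_nth ((lap ^^ k) (\<lambda>y. Q (symbol_arg y)) ((\<Phi> (fst x), snd x), 0, 0)) (j - k)" for k
    by (rule fps_nth_lap_funpow_cong[OF open_arg_dom[OF assms(1)] _ pull_domD(2)[OF assms(3)]])
      (use assms(2,4) in \<open>auto simp: arg_dom_def\<close>)
  then show ?thesis by (simp add: pull_def lap_exp_def)
qed

lemma pt_series_pullback: "pt_series (pullback \<Phi> J P) = pull (pt_series P)"
proof
  fix x :: "'n point"
  obtain w \<mu> \<eta> where x: "x = (w, \<mu>, \<eta>)" using prod_cases3 by blast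
  have "pt_series (pullback \<Phi> J P) x =
      exp_t (\<lambda>z' \<zeta>'. pt_series P (symbol_arg ((\<Phi> w, \<mu>, \<eta>), z', \<zeta>'))) 0 0"
    by (simp add: x pullback_def symbol_arg_def sig_def)
  then show "pt_series (pullback \<Phi> J P) x = pull (pt_series P) x"
    by (simp only: exp_t_eq_lap_exp[where G = "\<lambda>y. pt_series P (symbol_arg y)"] pull_def x fst_conv snd_conv)
qed

lemma fps_nth_pullback_comp:
  assumes U: "open U" "holo_fps U (\<lambda>x. fps_cutoff (Suc \<nu>) (pt_series P x))"
      "holo_fps U (\<lambda>x. fps_cutoff (Suc \<nu>) (pt_series Q x))"
    and x: "x \<in> pull_dom U"
  shows "fps_nth (pt_series (pullback \<Phi> J Q \<odot> pullback \<Phi> J P) x) \<nu> =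
    fps_nth (pt_series (pullback \<Phi> J (Q \<odot> P)) x) \<nu>"
proof -
  let ?P = "\<lambda>x. fps_cutoff (Suc \<nu>) (pt_series P x)" and ?Q = "\<lambda>x. fps_cutoff (Suc \<nu>) (pt_series Q x)"
  have "fps_nth (pt_series (pullback \<Phi> J Q \<odot> pullback \<Phi> J P) x) \<nu> = fps_nth (star (pull ?Q) (pull ?P) x) \<nu>"
  proof (rule fps_nth_series_comp[OF open_pull_dom[OF U(1)] holo_fps_pull[OF U(1,3)] holo_fps_pull[OF U(1,2)] x order_refl])
    show "fps_nth (pt_series (pullback \<Phi> J Q) y) j = fps_nth (pull ?Q y) j" if "y \<in> pull_dom U" "j \<le> \<nu>" for y j
      unfolding pt_series_pullback by (rule fps_nth_pull_cong[OF U(1) _ that]) simp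
    show "fps_nth (pt_series (pullback \<Phi> J P) y) j = fps_nth (pull ?P y) j" if "y \<in> pull_dom U" "j \<le> \<nu>" for y j
      unfolding pt_series_pullback by (rule fps_nth_pull_cong[OF U(1) _ that]) simp
  qed
  also have "\<dots> = fps_nth (pull (star ?Q ?P) x) \<nu>"
    by (rule fps_nth_pull_star[OF U x])
  also have "\<dots> = fps_nth (pull (pt_series (Q \<odot> P)) x) \<nu>"
    by (rule fps_nth_pull_cong[OF U(1) _ x order_refl], rule fps_nth_series_comp[OF U(1,3,2), symmetric]) auto
  finally show ?thesis by (simp add: pt_series_pullback)
qed

text \<open>The Jacobian matrix of \<Phi> inverts J(z, z), so \<mu> is obtained from \<sigma> by
  multiplying with its entries, which are bounded near w0. \<open>K\<close> bounds the sum of their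
  absolute values.\<close>

lemma maxnorm_sig_bound:
  assumes "w0 \<in> W"
  obtains \<delta> K where "\<delta> > 0" "K > 0" "ball w0 \<delta> \<subseteq> W"
    "\<And>w \<mu> \<eta>. w \<in> ball w0 \<delta> \<Longrightarrow> maxnorm \<mu> \<le> K * maxnorm (sig ((\<Phi> w, \<mu>, \<eta>), 0, 0))"
proof -
  define M where "M l j w = cderiv (axis l 1) (\<lambda>w. \<Phi> w $ j) w" for l j w
  define h where "h w = (\<Sum>l\<in>UNIV. \<Sum>j\<in>UNIV. cmod (M l j w))" for w
  have h\<Phi>: "holo_on (\<lambda>w. \<Phi> w $ j) W" for j by (rule holo_on_vec_nth[OF holo_\<Phi>])
  have "continuous_on W h"
    unfolding h_def M_def by (intro continuous_intros continuous_on_cderiv W h\<Phi>)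
  then have "open (W \<inter> h -` {..<h w0 + 1})"
    by (rule continuous_open_preimage[OF _ W]) auto
  moreover have "w0 \<in> W \<inter> h -` {..<h w0 + 1}" using assms by simp
  ultimately obtain \<delta> where \<delta>: "\<delta> > 0" "ball w0 \<delta> \<subseteq> W \<inter> h -` {..<h w0 + 1}"
    using open_contains_ball by blast
  have inv: "\<mu> $ l = (\<Sum>j\<in>UNIV. M l j w * sig ((\<Phi> w, \<mu>, \<eta>), 0, 0) $ j)" if w: "w \<in> W" for w \<mu> \<eta> l
  proof -
    \<comment> \<open>The chain rule for g after \<Phi>, which is the identity on W.\<close>
    have MJ: "(\<Sum>j\<in>UNIV. M l j w * J (\<Phi> w) (\<Phi> w) $ k $ j) = (if k = l then 1 else 0)" for k
    proof -
      have h\<psi>: "holo_on (\<lambda>w. (\<Phi> w, 0, 0) :: 'n point) W"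
        by (intro holo_on_Pair holo_\<Phi> holo_on_const)
      have hf: "holo_on (\<lambda>x::'n point. g (fst x) $ k) (V \<times> UNIV)"
        by (rule holo_on_vec_nth[OF holo_on_compose[OF holo_on_fst[OF holo_on_id] holo_g]]) auto
      have dg: "cderiv (dir_z j) (\<lambda>x::'n point. g (fst x) $ k) (\<Phi> w, 0, 0) = J (\<Phi> w) (\<Phi> w) $ k $ j" for j
        using cderiv_g[OF \<Phi>_in[OF w], of j k] by (simp add: cderiv_def dir_z_def scaleC_prod_def)
      have "cderiv (axis l 1) (\<lambda>w. g (\<Phi> w) $ k) w = (\<Sum>j\<in>UNIV. M l j w * J (\<Phi> w) (\<Phi> w) $ k $ j)"
        using cderiv_chain[OF h\<psi> hf w, of "axis l 1"] \<Phi>_in[OF w] by (simp add: dg M_def)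
      moreover have "cderiv (axis l 1) (\<lambda>w. g (\<Phi> w) $ k) w = cderiv (axis l 1) (\<lambda>w. w $ k) w"
        by (rule cderiv_cong_open[OF W w]) (simp add: g_\<Phi>)
      moreover have "cderiv (axis l 1) (\<lambda>w. w $ k) w = axis l 1 $ k"
        by (rule cderiv_linear) (auto simp: scaleC_vec_def intro: bounded_linear_vec_nth)
      ultimately show ?thesis by (simp add: axis_def)
    qed
    have "(\<Sum>j\<in>UNIV. M l j w * sig ((\<Phi> w, \<mu>, \<eta>), 0, 0) $ j) =
        (\<Sum>j\<in>UNIV. \<Sum>k\<in>UNIV. M l j w * J (\<Phi> w) (\<Phi> w) $ k $ j * \<mu> $ k)"
      by (simp add: sig_nth sum_distrib_left mult.assoc)
    also have "\<dots> = (\<Sum>k\<in>UNIV. (\<Sum>j\<in>UNIV. M l j w * J (\<Phi> w) (\<Phi> w) $ k $ j) * \<mu> $ k)"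
      by (subst sum.swap) (simp add: sum_distrib_right)
    also have "\<dots> = (\<Sum>k\<in>UNIV. if k = l then \<mu> $ k else 0)"
      unfolding MJ by (intro sum.cong refl) auto
    finally show ?thesis by simp
  qed
  show ?thesis
  proof (rule that[of \<delta> "h w0 + 1"])
    have "h w0 \<ge> 0" unfolding h_def by (intro sum_nonneg) auto
    then show "h w0 + 1 > 0" by simp
    show "ball w0 \<delta> \<subseteq> W" using \<delta>(2) by blast
    fix w \<mu> \<eta> assume w: "w \<in> ball w0 \<delta>"
    then have wW: "w \<in> W" and hw: "h w \<le> h w0 + 1" using \<delta>(2) by auto
    let ?s = "sig ((\<Phi> w, \<mu>, \<eta>), 0, 0)"
    show "maxnorm \<mu> \<le> (h w0 + 1) * maxnorm ?s"
      unfolding maxnorm_le_iff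
    proof
      fix l
      have "cmod (\<mu> $ l) \<le> (\<Sum>j\<in>UNIV. cmod (M l j w) * maxnorm ?s)"
        unfolding inv[OF wW, of \<mu> l \<eta>]
        by (rule sum_norm_le) (auto simp: norm_mult intro!: mult_left_mono maxnorm_ge)
      also have "\<dots> = (\<Sum>j\<in>UNIV. cmod (M l j w)) * maxnorm ?s"
        by (simp add: sum_distrib_right)
      also have "\<dots> \<le> h w * maxnorm ?s"
        unfolding h_def
        by (intro mult_right_mono member_le_sum[where f = "\<lambda>l. \<Sum>j\<in>UNIV. cmod (M l j w)"]) (auto intro: sum_nonneg)
      also have "\<dots> \<le> (h w0 + 1) * maxnorm ?s"
        using hw by (intro mult_right_mono) auto
      finally show "cmod (\<mu> $ l) \<le> (h w0 + 1) * maxnorm ?s" .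
    qed
  qed (rule \<delta>(1))
qed

end

section \<open>Conic neighborhoods and the proof of (3)\<close>

lemma norm_le_maxnorm: "norm (z :: complex ^ 'n::finite) \<le> real CARD('n) * maxnorm z"
proof -
  have "norm z \<le> (\<Sum>i\<in>UNIV. cmod (z $ i))"
    unfolding norm_vec_def by (rule L2_set_le_sum) auto
  also have "\<dots> \<le> real CARD('n) * maxnorm z"
    by (rule sum_bounded_above) (rule maxnorm_ge)
  finally show ?thesis .
qed

text \<open>
  The neighborhood is cut out by a bound on the angle between \<open>\<mu>\<close> and \<open>\<mu>0\<close> (by no condition on \<open>\<mu>\<close> if
  \<open>\<mu>0 = 0\<close>). The closure of its enlargement may contain points of the zero section outside of \<open>T\<close>.
\<close>

lemma conic_neighborhood:
  fixes T :: "((complex ^ 'n) \<times> (complex ^ 'n::finite)) set"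
  assumes T: "open T" "fibre_conic T" "(w0, \<mu>0) \<in> T" and e: "e > 0"
  obtains \<Omega>' \<rho> where "admissible \<Omega>'" "(w0, \<mu>0) \<in> \<Omega>'" "\<rho> \<in> {0<..<1}"
    "\<And>w \<mu>. (w, \<mu>) \<in> enlarge \<Omega>' \<rho> \<Longrightarrow> w \<in> ball w0 e \<and> (\<mu> \<noteq> 0 \<longrightarrow> (w, \<mu>) \<in> T)"
proof -
  obtain e' where e': "e' > 0" "ball (w0, \<mu>0) e' \<subseteq> T"
    using T(1,3) open_contains_ball by blast
  define \<delta> where "\<delta> = min e e' / 5"
  have \<delta>: "\<delta> > 0" "2 * \<delta> < e" "4 * \<delta> < e'" using e e' by (auto simp: \<delta>_def min_def)
  define m where "m = norm \<mu>0"
  \<comment> \<open>Measures the deviation of \<mu> from the ray of \<mu>0. It is homogeneous of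
    degree 1 and involves no division, so it is continuous also at \<mu> = 0.\<close>
  define angle where "angle \<mu> = norm (m *\<^sub>R \<mu> - norm \<mu> *\<^sub>R \<mu>0)" for \<mu> :: "complex ^ 'n"
  define \<Omega>' where "\<Omega>' = {x. norm (fst x - w0) < \<delta> \<and> (\<mu>0 = 0 \<or> angle (snd x) < \<delta> * norm (snd x))}"
  \<comment> \<open>A closed set with doubled constants: it contains the shifted points and hence
    also the closure in \<open>enlarge\<close>.\<close>
  define C where "C = {x. norm (fst x - w0) \<le> 2 * \<delta> \<and> angle (snd x) \<le> 2 * \<delta> * norm (snd x)}"
  define n where "n = real CARD('n)"
  have n: "n \<ge> 1" by (simp add: n_def Suc_leI)
  \<comment> \<open>The factor n passes from the maximum norm to the Euclidean norm. With \<epsilon>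
    = n \<rho>, the denominator ensures both \<epsilon> \<le> \<delta>, for the base, and \<epsilon>
    (2 m + 2 \<delta>) \<le> \<delta>, for the change of \<open>angle\<close> and of the norm under
    a fibre shift.\<close>
  define \<rho> where "\<rho> = min (1 / 2) (\<delta> / (n * (1 + 2 * m + 2 * \<delta>)))"
  have m: "m \<ge> 0" by (simp add: m_def)
  have pos: "n * (1 + 2 * m + 2 * \<delta>) > 0" using n m \<delta> by (intro mult_pos_pos) auto
  have \<rho>: "\<rho> \<in> {0<..<1}" using pos \<delta> by (auto simp: \<rho>_def)
  have n\<rho>: "n * \<rho> * (1 + 2 * m + 2 * \<delta>) \<le> \<delta>"
  proof -
    have "\<rho> \<le> \<delta> / (n * (1 + 2 * m + 2 * \<delta>))" by (simp add: \<rho>_def)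
    then have "\<rho> * (n * (1 + 2 * m + 2 * \<delta>)) \<le> \<delta>" using pos by (simp add: pos_le_divide_eq)
    then show ?thesis by (simp add: mult_ac)
  qed
  define \<epsilon> where "\<epsilon> = n * \<rho>"
  have \<epsilon>: "\<epsilon> \<ge> 0" "\<epsilon> \<le> \<delta>" "\<epsilon> * (2 * m + 2 * \<delta>) \<le> \<delta>"
  proof -
    show "\<epsilon> \<ge> 0" using n \<rho> by (simp add: \<epsilon>_def)
    have "\<epsilon> + \<epsilon> * (2 * m + 2 * \<delta>) \<le> \<delta>" using n\<rho> by (simp add: \<epsilon>_def algebra_simps)
    moreover have "\<epsilon> * (2 * m + 2 * \<delta>) \<ge> 0" using \<open>\<epsilon> \<ge> 0\<close> m \<delta> by simp
    ultimately show "\<epsilon> \<le> \<delta>" "\<epsilon> * (2 * m + 2 * \<delta>) \<le> \<delta>" using \<open>\<epsilon> \<ge> 0\<close> by auto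
  qed
  have contA: "continuous_on S (\<lambda>x. angle (snd x))" for S :: "((complex ^ 'n) \<times> (complex ^ 'n)) set"
    unfolding angle_def by (intro continuous_intros)
  have angle_scale: "angle (c *\<^sub>R \<mu>) = c * angle \<mu>" if "c > 0" for c \<mu>
  proof -
    have "m *\<^sub>R (c *\<^sub>R \<mu>) - norm (c *\<^sub>R \<mu>) *\<^sub>R \<mu>0 = c *\<^sub>R (m *\<^sub>R \<mu> - norm \<mu> *\<^sub>R \<mu>0)"
      using that by (simp add: scaleR_diff_right mult.commute)
    then show ?thesis using that by (simp add: angle_def)
  qed
  show ?thesis
  proof (rule that[of \<Omega>' \<rho>])
    show "admissible \<Omega>'"
      unfolding admissible_def
    proof (intro conjI)
      have o1: "open {x :: (complex ^ 'n) \<times> (complex ^ 'n). norm (fst x - w0) < \<delta>}"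
        by (intro open_Collect_less continuous_intros)
      have o2: "open {x :: (complex ^ 'n) \<times> (complex ^ 'n). angle (snd x) < \<delta> * norm (snd x)}"
        by (intro open_Collect_less continuous_intros contA)
      show "open \<Omega>'"
        using o1 open_Int[OF o1 o2] by (cases "\<mu>0 = 0") (auto simp: \<Omega>'_def Collect_conj_eq)
      show "fibre_conic \<Omega>'"
        unfolding fibre_conic_def by (auto simp: \<Omega>'_def angle_scale)
      show "conically_relcompact \<Omega>' UNIV"
        unfolding conically_relcompact_def
      proof (intro exI[of _ "cball w0 \<delta> \<times> cball 0 1"] conjI subset_UNIV)
        show "compact (cball w0 \<delta> \<times> cball (0 :: complex ^ 'n) 1)" by (intro compact_Times compact_cball)
        show "\<Omega>' \<subseteq> {(z, c *\<^sub>R \<zeta>) |z \<zeta> c. c > 0 \<and> (z, \<zeta>) \<in> cball w0 \<delta> \<times> cball 0 1}"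
        proof
          fix x assume x: "x \<in> \<Omega>'"
          \<comment> \<open>Adding 1 keeps the scale positive on the zero section, while the
            rescaled covector stays in the unit ball.\<close>
          define c where "c = norm (snd x) + 1"
          have c: "c > 0" using norm_ge_zero[of "snd x"] unfolding c_def by linarith
          have "x = (fst x, c *\<^sub>R (snd x /\<^sub>R c))" using c by simp
          moreover have "norm (snd x /\<^sub>R c) \<le> 1"
            using c by (simp add: c_def divide_simps)
          moreover have "dist w0 (fst x) \<le> \<delta>" using x by (simp add: \<Omega>'_def dist_norm norm_minus_commute)
          ultimately show "x \<in> {(z, c *\<^sub>R \<zeta>) |z \<zeta> c. c > 0 \<and> (z, \<zeta>) \<in> cball w0 \<delta> \<times> cball 0 1}"
            using c by (intro CollectI exI[of _ "fst x"] exI[of _ "snd x /\<^sub>R c"] exI[of _ c]) simp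
        qed
      qed
    qed
    show "(w0, \<mu>0) \<in> \<Omega>'"
      using \<delta>(1) by (auto simp: \<Omega>'_def angle_def m_def zero_less_mult_iff)
    have "enlarge \<Omega>' \<rho> \<subseteq> C"
      unfolding enlarge_def
    proof (rule closure_minimal)
      show "closed C"
        unfolding C_def Collect_conj_eq by (intro closed_Int closed_Collect_le continuous_intros contA)
      show "(\<Union>(z, \<zeta>)\<in>\<Omega>'. {(z + z', \<zeta> + \<zeta>') | z' \<zeta>'. maxnorm z' \<le> \<rho> \<and> maxnorm \<zeta>' \<le> \<rho> * maxnorm \<zeta>}) \<subseteq> C"
      proof clarify
        fix w \<mu> w' \<mu>' :: "complex ^ 'n"
        assume x: "(w, \<mu>) \<in> \<Omega>'" and w': "maxnorm w' \<le> \<rho>" and \<mu>': "maxnorm \<mu>' \<le> \<rho> * maxnorm \<mu>"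
        have "norm w' \<le> n * \<rho>"
          using order_trans[OF norm_le_maxnorm[of w'] mult_left_mono[OF w']] by (simp add: n_def)
        then have 1: "norm (w + w' - w0) \<le> 2 * \<delta>"
          using norm_triangle_ineq[of "w - w0" w'] x \<epsilon>(2) by (simp add: \<Omega>'_def \<epsilon>_def algebra_simps)
        have n1: "n * maxnorm \<mu>' \<le> n * (\<rho> * norm \<mu>)"
          using order_trans[OF \<mu>' mult_left_mono[OF maxnorm_le_norm[of \<mu>], of \<rho>]] \<rho> n
          by (intro mult_left_mono) auto
        have 2: "norm \<mu>' \<le> \<epsilon> * norm \<mu>"
          using order_trans[OF norm_le_maxnorm[of \<mu>', folded n_def] n1] by (simp add: \<epsilon>_def mult.assoc)
        have a0: "angle \<mu> \<le> \<delta> * norm \<mu>"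
          using x \<delta>(1) by (auto simp: \<Omega>'_def angle_def m_def)
        have "m *\<^sub>R (\<mu> + \<mu>') - norm (\<mu> + \<mu>') *\<^sub>R \<mu>0 =
            (m *\<^sub>R \<mu> - norm \<mu> *\<^sub>R \<mu>0) + (m *\<^sub>R \<mu>' + (norm \<mu> - norm (\<mu> + \<mu>')) *\<^sub>R \<mu>0)"
          by (simp add: algebra_simps)
        then have "angle (\<mu> + \<mu>') \<le> angle \<mu> + norm (m *\<^sub>R \<mu>' + (norm \<mu> - norm (\<mu> + \<mu>')) *\<^sub>R \<mu>0)"
          unfolding angle_def by (simp only: norm_triangle_ineq)
        also have "\<dots> \<le> angle \<mu> + (m * norm \<mu>' + \<bar>norm \<mu> - norm (\<mu> + \<mu>')\<bar> * m)"
          using norm_triangle_ineq[of "m *\<^sub>R \<mu>'" "(norm \<mu> - norm (\<mu> + \<mu>')) *\<^sub>R \<mu>0"] m by (simp add: m_def)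
        also have "\<dots> \<le> \<delta> * norm \<mu> + (m * norm \<mu>' + norm \<mu>' * m)"
        proof -
          have "\<bar>norm \<mu> - norm (\<mu> + \<mu>')\<bar> \<le> norm \<mu>'"
            using norm_triangle_ineq3[of \<mu> "\<mu> + \<mu>'"] by simp
          then show ?thesis using a0 m by (intro add_mono mult_right_mono) auto
        qed
        also have "\<dots> = \<delta> * norm \<mu> + 2 * m * norm \<mu>'" by simp
        finally have a1: "angle (\<mu> + \<mu>') \<le> \<delta> * norm \<mu> + 2 * m * norm \<mu>'" .
        have "2 * \<delta> * norm \<mu> \<le> 2 * \<delta> * (norm (\<mu> + \<mu>') + norm \<mu>')"
          using norm_triangle_ineq4[of "\<mu> + \<mu>'" \<mu>'] \<delta>(1) by (intro mult_left_mono) auto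
        moreover have "(2 * m + 2 * \<delta>) * norm \<mu>' \<le> (2 * m + 2 * \<delta>) * (\<epsilon> * norm \<mu>)"
          using 2 m \<delta>(1) by (intro mult_left_mono) auto
        moreover have "(2 * m + 2 * \<delta>) * (\<epsilon> * norm \<mu>) \<le> \<delta> * norm \<mu>"
          using mult_right_mono[OF \<epsilon>(3), of "norm \<mu>"] by (simp add: mult_ac)
        ultimately have "angle (\<mu> + \<mu>') \<le> 2 * \<delta> * norm (\<mu> + \<mu>')"
          using a1 by (simp add: algebra_simps)
        with 1 show "(w + w', \<mu> + \<mu>') \<in> C" by (simp add: C_def)
      qed
    qed
    moreover have "w \<in> ball w0 e \<and> (\<mu> \<noteq> 0 \<longrightarrow> (w, \<mu>) \<in> T)" if "(w, \<mu>) \<in> C" for w \<mu>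
    proof (intro conjI impI)
      have w: "norm (w - w0) \<le> 2 * \<delta>" and a: "angle \<mu> \<le> 2 * \<delta> * norm \<mu>"
        using that by (auto simp: C_def)
      show "w \<in> ball w0 e" using w \<delta>(2) by (simp add: dist_norm norm_minus_commute)
      assume \<mu>: "\<mu> \<noteq> 0"
      \<comment> \<open>Rescales \<mu> to the length of \<mu>0, or to length \<delta> if \<mu>0 = 0,
        so that it can be compared with \<mu>0; T is conic, so scaling back is possible.\<close>
      define s where "s = (if \<mu>0 = 0 then \<delta> else m) / norm \<mu>"
      have s: "s > 0" using \<mu> \<delta>(1) by (simp add: s_def m_def)
      have "norm (s *\<^sub>R \<mu> - \<mu>0) \<le> 2 * \<delta>"
      proof (cases "\<mu>0 = 0")
        case True
        then show ?thesis using \<mu> \<delta>(1) by (simp add: s_def)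
      next
        case False
        have "s *\<^sub>R \<mu> - \<mu>0 = (m *\<^sub>R \<mu> - norm \<mu> *\<^sub>R \<mu>0) /\<^sub>R norm \<mu>"
          using \<mu> False by (simp add: s_def scaleR_diff_right divide_inverse mult.commute)
        then have "norm (s *\<^sub>R \<mu> - \<mu>0) = angle \<mu> / norm \<mu>"
          by (simp add: angle_def divide_inverse mult.commute)
        then show ?thesis using a \<mu> by (simp add: divide_le_eq)
      qed
      then have "dist (w0, \<mu>0) (w, s *\<^sub>R \<mu>) \<le> 2 * \<delta> + 2 * \<delta>"
        using w norm_triangle_ineq[of "(w0 - w, 0)" "(0, \<mu>0 - s *\<^sub>R \<mu>)"]
        by (simp add: dist_norm norm_minus_commute)
      then have "(w, s *\<^sub>R \<mu>) \<in> T" using \<delta>(3) e'(2) by (auto simp: subset_iff)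
      then have "(w, (1 / s) *\<^sub>R s *\<^sub>R \<mu>) \<in> T"
        using T(2) s unfolding fibre_conic_def by (meson divide_pos_pos zero_less_one)
      then show "(w, \<mu>) \<in> T" using s by simp
    qed
    ultimately show "\<And>w \<mu>. (w, \<mu>) \<in> enlarge \<Omega>' \<rho> \<Longrightarrow> w \<in> ball w0 e \<and> (\<mu> \<noteq> 0 \<longrightarrow> (w, \<mu>) \<in> T)"
      by blast
  qed (rule \<rho>)
qed

lemma N_bound_zero:
  assumes "D > 0" "A > 0"
    and U: "\<And>\<nu>. open (U \<nu>)" "\<And>\<nu>. cdom \<Omega> \<rho> S ((real \<nu> + 1) * D) \<subseteq> U \<nu>"
    and zero: "\<And>\<nu> x. x \<in> U \<nu> \<Longrightarrow> fps_nth (pt_series P x) \<nu> = 0"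
  shows "N_bound \<Omega> S D \<rho> A P"
  unfolding N_bound_def
proof (intro conjI allI impI)
  show "holo_coeffs \<Omega> S D \<rho> P"
    unfolding holo_coeffs_def holo_near_def
  proof
    fix \<nu>
    have "holo_on (\<lambda>x. fps_nth (pt_series P x) \<nu>) (U \<nu>)"
      by (rule holo_on_cong[OF U(1) _ holo_on_const[of 0]]) (simp add: zero)
    then show "\<exists>V. open V \<and> cdom \<Omega> \<rho> S ((real \<nu> + 1) * D) \<subseteq> V \<and> holo_on (\<lambda>x. fps_nth (pt_series P x) \<nu>) V"
      using U by blast
  qed
  fix Z and h :: real assume "relcompact Z S \<and> 0 < h"
  then have ZS: "Z \<subseteq> S" using relcompact_subset by blast
  have "(\<Sum>\<nu><m. fps_nth (pt_series P x) \<nu>) = 0" if x: "x \<in> cdom \<Omega> \<rho> Z (real m * D)" for x m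
  proof (rule sum.neutral, rule ballI)
    fix \<nu> assume "\<nu> \<in> {..<m}"
    then have "cdom \<Omega> \<rho> Z (real m * D) \<subseteq> cdom \<Omega> \<rho> S ((real \<nu> + 1) * D)"
      using \<open>D > 0\<close> ZS by (intro cdom_mono mult_right_mono) auto
    then show "fps_nth (pt_series P x) \<nu> = 0" using x U(2)[of \<nu>] zero by blast
  qed
  then show "\<exists>C>0. \<forall>m. \<forall>x\<in>cdom \<Omega> \<rho> Z (real m * D).
      cmod (\<Sum>\<nu><m. fps_nth (pt_series P x) \<nu>) \<le> C * A ^ m * exp (h * maxnorm (fst (snd x)))"
    using \<open>A > 0\<close> by (intro exI[of _ 1]) auto
qed

text \<open>The difference vanishes wherever both sides are built from holomorphic coefficients. It
  remains to find a conic neighborhood whose domain at every order is carried by the cotangent map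
  into the corresponding domain over \<Omega>.\<close>

theorem pullback_comp_diff:
  fixes \<Omega> :: "((complex ^ 'n) \<times> (complex ^ 'n::finite)) set"
  assumes \<Omega>: "open \<Omega>" "fibre_conic \<Omega>" and r: "r \<in> {0<..<1/2}" "\<theta> \<in> {0<..<1/2}"
    and P: "P \<in> S_hat \<Omega> (sector r \<theta>)" and Q: "Q \<in> S_hat \<Omega> (sector r \<theta>)"
    and "coordinate_transformation \<Phi> W V" and "is_Jstar \<Phi> W V J"
    and w0: "w0 \<in> W" and in_\<Omega>: "(\<Phi> w0, transpose (J (\<Phi> w0) (\<Phi> w0)) *v \<mu>0) \<in> \<Omega>"
  shows "(\<lambda>w \<mu> \<eta>. (pullback \<Phi> J Q \<odot> pullback \<Phi> J P) w \<mu> \<eta> - pullback \<Phi> J (Q \<odot> P) w \<mu> \<eta>)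
    \<in> N_hat_at (w0, \<mu>0)"
proof -
  obtain N where N: "open N" "N \<subseteq> V \<times> V" "\<forall>z\<in>V. (z, z) \<in> N" "holo_on (\<lambda>(z', z). J z' z) N"
      "\<forall>(z', z)\<in>N. inv_into W \<Phi> z' - inv_into W \<Phi> z = J z' z *v (z' - z)"
    using assms(8) unfolding is_Jstar_def by blast
  have ct: "open W" "open V" "bij_betw \<Phi> W V" "holo_on \<Phi> W" "holo_on (inv_into W \<Phi>) V"
    using assms(7) by (auto simp: coordinate_transformation_def)
  interpret coord_change \<Phi> "inv_into W \<Phi>" W V J N
  proof
    show "\<Phi> w \<in> V" if "w \<in> W" for w using ct(3) that by (auto simp: bij_betw_def)
    show "inv_into W \<Phi> z \<in> W" if "z \<in> V" for z
      using ct(3) that by (auto simp: bij_betw_def intro: inv_into_into)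
    show "inv_into W \<Phi> (\<Phi> w) = w" if "w \<in> W" for w using ct(3) that by (rule bij_betw_inv_into_left)
    show "\<Phi> (inv_into W \<Phi> z) = z" if "z \<in> V" for z using ct(3) that by (rule bij_betw_inv_into_right)
  qed (use ct N in auto)
  let ?S = "sector r \<theta>"
  obtain D1 \<rho>1 where 1: "D1 > 0" "\<rho>1 \<in> {0<..<1}" "holo_coeffs \<Omega> ?S D1 \<rho>1 P"
    using S_hat_params[OF P] unfolding S_bound_def by metis
  obtain D2 \<rho>2 where 2: "D2 > 0" "\<rho>2 \<in> {0<..<1}" "holo_coeffs \<Omega> ?S D2 \<rho>2 Q"
    using S_hat_params[OF Q] unfolding S_bound_def by metis
  define D \<rho> where "D = max D1 D2" and "\<rho> = min \<rho>1 \<rho>2"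
  have pos: "D > 0" "\<rho> > 0" using 1 2 by (auto simp: D_def \<rho>_def)
  have hP: "holo_coeffs \<Omega> ?S D \<rho> P" by (rule holo_coeffs_mono[OF 1(3)]) (auto simp: D_def \<rho>_def)
  have hQ: "holo_coeffs \<Omega> ?S D \<rho> Q" by (rule holo_coeffs_mono[OF 2(3)]) (auto simp: D_def \<rho>_def)
  \<comment> \<open>The preimage of \<Omega> under the cotangent map; the third coordinate, on which
    the transported covector does not depend, is set to 0.\<close>
  define T where "T = (\<lambda>x. (fst x, snd x, 0)) -` pull_dom {x. (fst x, fst (snd x)) \<in> \<Omega>}"
  have T_iff: "(w, \<mu>) \<in> T \<longleftrightarrow> w \<in> W \<and> (\<Phi> w, sig ((\<Phi> w, \<mu>, \<eta>), 0, 0)) \<in> \<Omega>" for w \<mu> \<eta>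
    by (simp add: T_def pull_dom_iff symbol_arg_def sig_def)
  have "open {x :: 'n point. (fst x, fst (snd x)) \<in> \<Omega>}"
  proof -
    have "continuous_on UNIV (\<lambda>x :: 'n point. (fst x, fst (snd x)))"
      by (intro continuous_intros)
    from open_vimage[OF \<Omega>(1) this] show ?thesis by (simp add: vimage_def)
  qed
  then have T: "open T"
    unfolding T_def by (intro open_vimage open_pull_dom continuous_intros)
  have T_conic: "fibre_conic T"
    unfolding fibre_conic_def
  proof (intro allI impI)
    fix w \<mu> and c :: real assume *: "(w, \<mu>) \<in> T \<and> c > 0"
    have "sig ((\<Phi> w, c *\<^sub>R \<mu>, 0), 0, 0) = c *\<^sub>R sig ((\<Phi> w, \<mu>, 0), 0, 0)"
      by (simp add: vec_eq_iff sig_nth scaleR_sum_right)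
    then show "(w, c *\<^sub>R \<mu>) \<in> T"
      using * \<Omega>(2) unfolding T_iff[of _ _ 0] fibre_conic_def by metis
  qed
  have T0: "(w0, \<mu>0) \<in> T" using w0 in_\<Omega> by (simp add: T_iff[of _ _ 0] sig_def)
  obtain \<delta> K where K: "\<delta> > 0" "K > 0"
      "\<And>w \<mu> \<eta>. w \<in> ball w0 \<delta> \<Longrightarrow> maxnorm \<mu> \<le> K * maxnorm (sig ((\<Phi> w, \<mu>, \<eta>), 0, 0))"
    using maxnorm_sig_bound[OF w0] by metis
  obtain \<Omega>' \<rho>' where \<Omega>': "admissible \<Omega>'" "(w0, \<mu>0) \<in> \<Omega>'" "\<rho>' \<in> {0<..<1}"
      "\<And>w \<mu>. (w, \<mu>) \<in> enlarge \<Omega>' \<rho>' \<Longrightarrow> w \<in> ball w0 \<delta> \<and> (\<mu> \<noteq> 0 \<longrightarrow> (w, \<mu>) \<in> T)"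
    using conic_neighborhood[OF T T_conic T0 K(1)] by metis
  have sub_enlarge: "\<Omega> \<subseteq> enlarge \<Omega> \<rho>"
  proof
    fix x assume "x \<in> \<Omega>"
    then have "x \<in> (\<Union>(z, \<zeta>)\<in>\<Omega>. {(z + z', \<zeta> + \<zeta>') | z' \<zeta>'. maxnorm z' \<le> \<rho> \<and> maxnorm \<zeta>' \<le> \<rho> * maxnorm \<zeta>})"
      using pos(2) by (intro UN_I[of x]) (auto intro!: exI[of _ 0] simp: split_def)
    then show "x \<in> enlarge \<Omega> \<rho>"
      unfolding enlarge_def by (rule subsetD[OF closure_subset])
  qed
  \<comment> \<open>\<open>D\<close> is replaced by \<open>K * D\<close> because ||\<mu>|| \<le> K
    ||\<sigma>||: a bound (\<nu> + 1) K D for ||\<eta> \<mu>|| yields the bound (\<nu> + 1) D for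
    ||\<eta> \<sigma>||.\<close>
  have dom: "\<exists>U. open U \<and> cdom \<Omega>' \<rho>' ?S ((real \<nu> + 1) * (K * D)) \<subseteq> pull_dom U \<and>
      holo_fps U (\<lambda>x. fps_cutoff (Suc \<nu>) (pt_series P x)) \<and>
      holo_fps U (\<lambda>x. fps_cutoff (Suc \<nu>) (pt_series Q x))" for \<nu> :: nat
  proof -
    obtain U where U: "open U" "cdom \<Omega> \<rho> ?S ((real \<nu> + 1) * D) \<subseteq> U"
        "holo_fps U (\<lambda>x. fps_cutoff (Suc \<nu>) (pt_series P x))"
        "holo_fps U (\<lambda>x. fps_cutoff (Suc \<nu>) (pt_series Q x))"
      using holo_coeffs_common_domain3[OF hP hQ hQ pos(1)] by blast
    have "x \<in> pull_dom U" if x: "x \<in> cdom \<Omega>' \<rho>' ?S ((real \<nu> + 1) * (K * D))" for x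
    proof -
      obtain w \<mu> \<eta> where xe: "x = (w, \<mu>, \<eta>)" using prod_cases3 by blast
      let ?s = "sig ((\<Phi> w, \<mu>, \<eta>), 0, 0)"
      have en: "(w, \<mu>) \<in> enlarge \<Omega>' \<rho>'" and \<eta>: "\<eta> \<in> ?S"
          and c: "(real \<nu> + 1) * (K * D) \<le> cmod \<eta> * maxnorm \<mu>"
        using x by (auto simp: xe cdom_def maxnorm_scaleC)
      have "(real \<nu> + 1) * (K * D) > 0" using K(2) pos(1) by (intro mult_pos_pos) auto
      \<comment> \<open>The strictly positive lower bound excludes the zero section, over which the
        enlarged neighborhood may leave T.\<close>
      then have "\<mu> \<noteq> 0" using c by auto
      then have wT: "(w, \<mu>) \<in> T" and wb: "w \<in> ball w0 \<delta>" using \<Omega>'(4)[OF en] by auto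
      have "K * ((real \<nu> + 1) * D) \<le> cmod \<eta> * (K * maxnorm ?s)"
        using c mult_left_mono[OF K(3)[OF wb, of \<mu> \<eta>], of "cmod \<eta>"] by (simp add: mult_ac)
      then have "K * ((real \<nu> + 1) * D) \<le> K * (cmod \<eta> * maxnorm ?s)" by (simp add: mult_ac)
      then have "(real \<nu> + 1) * D \<le> cmod \<eta> * maxnorm ?s" using K(2) by simp
      then have "(\<Phi> w, ?s, \<eta>) \<in> cdom \<Omega> \<rho> ?S ((real \<nu> + 1) * D)"
        using wT \<eta> sub_enlarge by (auto simp: cdom_def maxnorm_scaleC T_iff[of w \<mu> \<eta>])
      then show ?thesis
        using U(2) wT by (auto simp: pull_dom_iff xe symbol_arg_def T_iff[of w \<mu> \<eta>])
    qed
    then show ?thesis using U by blast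
  qed
  obtain U where U: "\<And>\<nu>. open (U \<nu>)" "\<And>\<nu>. cdom \<Omega>' \<rho>' ?S ((real \<nu> + 1) * (K * D)) \<subseteq> pull_dom (U \<nu>)"
      "\<And>\<nu>. holo_fps (U \<nu>) (\<lambda>x. fps_cutoff (Suc \<nu>) (pt_series P x))"
      "\<And>\<nu>. holo_fps (U \<nu>) (\<lambda>x. fps_cutoff (Suc \<nu>) (pt_series Q x))"
    using dom by metis
  let ?X = "\<lambda>w \<mu> \<eta>. (pullback \<Phi> J Q \<odot> pullback \<Phi> J P) w \<mu> \<eta> - pullback \<Phi> J (Q \<odot> P) w \<mu> \<eta>"
  have "N_bound \<Omega>' ?S (K * D) \<rho>' (1 / 2) ?X"
  proof (rule N_bound_zero[OF _ _ open_pull_dom[OF U(1)] U(2)])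
    fix \<nu> x assume "x \<in> pull_dom (U \<nu>)"
    from fps_nth_pullback_comp[OF U(1,3,4) this]
    show "fps_nth (pt_series ?X x) \<nu> = 0" by (simp add: pt_series_def)
  qed (use K pos in auto)
  then have "?X \<in> N_hat \<Omega>' ?S"
    unfolding N_hat_iff using K(2) pos(1) \<Omega>'(3)
    by (intro exI[of _ "K * D"] conjI bexI[of _ \<rho>'] bexI[of _ "1 / 2"]) auto
  then show ?thesis
    unfolding N_hat_at_def using \<Omega>'(1,2) r by blast
qed

theorem theorem7p14:
  fixes \<Omega> :: "((complex ^ 'n) \<times> (complex ^ 'n)) set" and r \<theta> :: real
  assumes "open \<Omega>" and "fibre_conic \<Omega>" and "conically_relcompact \<Omega> UNIV"
    and "r \<in> {0<..<1/2}" and "\<theta> \<in> {0<..<1/2}"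
  shows
    "(\<forall>P \<in> S_hat \<Omega> (sector r \<theta>). \<forall>Q \<in> S_hat \<Omega> (sector r \<theta>).
        Q \<odot> P \<in> S_hat \<Omega> (sector r \<theta>) \<and>
        (P \<in> N_hat \<Omega> (sector r \<theta>) \<or> Q \<in> N_hat \<Omega> (sector r \<theta>) \<longrightarrow>
          Q \<odot> P \<in> N_hat \<Omega> (sector r \<theta>)))
     \<and>
     (\<forall>P \<in> S_hat \<Omega> (sector r \<theta>). \<forall>Q \<in> S_hat \<Omega> (sector r \<theta>). \<forall>R \<in> S_hat \<Omega> (sector r \<theta>).
        series_eq \<Omega> (sector r \<theta>) (R \<odot> (Q \<odot> P)) ((R \<odot> Q) \<odot> P))
     \<and>
     (\<forall>P \<in> S_hat \<Omega> (sector r \<theta>). \<forall>Q \<in> S_hat \<Omega> (sector r \<theta>). \<forall>\<Phi> W V J.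
        coordinate_transformation \<Phi> W V \<and> fst ` closure \<Omega> \<subseteq> V \<and> is_Jstar \<Phi> W V J \<longrightarrow>
        (\<forall>w\<in>W. \<forall>\<mu>. (\<Phi> w, transpose (J (\<Phi> w) (\<Phi> w)) *v \<mu>) \<in> \<Omega> \<longrightarrow>
          (\<lambda>w \<mu> \<eta>. (pullback \<Phi> J Q \<odot> pullback \<Phi> J P) w \<mu> \<eta> - pullback \<Phi> J (Q \<odot> P) w \<mu> \<eta>)
            \<in> N_hat_at (w, \<mu>)))"
proof -
  have S: "cmod \<eta> \<le> 1" if "\<eta> \<in> sector r \<theta>" for \<eta>
    using that assms(4) by (auto simp: sector_def)
  show ?thesis
  proof (intro conjI ballI allI impI)
    fix P Q assume PQ: "P \<in> S_hat \<Omega> (sector r \<theta>)" "Q \<in> S_hat \<Omega> (sector r \<theta>)"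
    show "Q \<odot> P \<in> S_hat \<Omega> (sector r \<theta>)"
      by (rule S_hat_comp[OF PQ S])
    assume N: "P \<in> N_hat \<Omega> (sector r \<theta>) \<or> Q \<in> N_hat \<Omega> (sector r \<theta>)"
    show "Q \<odot> P \<in> N_hat \<Omega> (sector r \<theta>)"
      by (rule N_hat_comp[OF PQ N S])
  next
    fix P Q R
    assume "P \<in> S_hat \<Omega> (sector r \<theta>)" "Q \<in> S_hat \<Omega> (sector r \<theta>)" "R \<in> S_hat \<Omega> (sector r \<theta>)"
    then show "series_eq \<Omega> (sector r \<theta>) (R \<odot> (Q \<odot> P)) ((R \<odot> Q) \<odot> P)"
      by (rule series_eq_assoc)
  next
    fix P Q \<Phi> W V J w \<mu>
    assume PQ: "P \<in> S_hat \<Omega> (sector r \<theta>)" "Q \<in> S_hat \<Omega> (sector r \<theta>)"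
      and \<Phi>: "coordinate_transformation \<Phi> W V \<and> fst ` closure \<Omega> \<subseteq> V \<and> is_Jstar \<Phi> W V J"
      and w: "w \<in> W" "(\<Phi> w, transpose (J (\<Phi> w) (\<Phi> w)) *v \<mu>) \<in> \<Omega>"
    show "(\<lambda>w \<mu> \<eta>. (pullback \<Phi> J Q \<odot> pullback \<Phi> J P) w \<mu> \<eta> - pullback \<Phi> J (Q \<odot> P) w \<mu> \<eta>)
        \<in> N_hat_at (w, \<mu>)"
      by (rule pullback_comp_diff[OF assms(1,2,4,5) PQ conjunct1[OF \<Phi>] conjunct2[OF conjunct2[OF \<Phi>]] w])
  qed
qed

end
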